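(* Let $(\mathcal{W}_1,\mathcal{W}_2)$ be as in the context, so that $(\operatorname{U}(\mathcal{W}_1),\operatorname{U}(\mathcal{W}_2))$ is an irreducible reductive dual pair of type I in $\operatorname{Sp}(W)$, $W=\mathcal{W}_1\otimes_D\mathcal{W}_2$. (1) If $D=E$ or $\mathbb{H}$, then $\widehat{\operatorname{U}^\pm}(\mathcal{W}_1)$ commutes with $\widehat{\operatorname{U}^\pm}(\mathcal{W}_2)$ in $\widehat{\operatorname{Sp}}^\pm(W)$. (2) If $D=F$, assume $\epsilon_1=-1$, $\epsilon_2=1$ ($\mathcal{W}_1$ symplectic, $\mathcal{W}_2$ orthogonal). All commutation statements are in $\widehat{\operatorname{Sp}}^\pm(W)$. (a) If $2\mid\dim\mathcal{W}_2$ and $\mathcal{W}_2$ is not a hyperbolic space, then: (i) $\operatorname{O}^\pm(\mathcal{W}_2)=\operatorname{O}(\mathcal{W}_2)$; (ii) if $4\mid\dim\mathcal{W}_1$, then $\widehat{\operatorname{Sp}^\pm}(\mathcal{W}_1)$ commutes with $\operatorname{O}(\mathcal{W}_2)$; (iii) if $4\nmid\dim\mathcal{W}_1$, then $\widehat{\operatorname{Sp}^\pm}(\mathcal{W}_1)$ only commutes with $\operatorname{SO}(\mathcal{W}_2)$, and $\operatorname{O}(\mathcal{W}_2)$ only commutes with $\widehat{\operatorname{Sp}}(\mathcal{W}_1)$. (b) If $2\mid\dim\mathcal{W}_2$ and $\mathcal{W}_2$ is a hyperbolic space, then: (i) $\widehat{\operatorname{O}^\pm}(\mathcal{W}_2)\simeq\operatorname{O}^\pm(\mathcal{W}_2)\times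 T$; (ii) if $4\mid\dim\mathcal{W}_1$, then $\widehat{\operatorname{Sp}^\pm}(\mathcal{W}_1)$ commutes with $\widehat{\operatorname{O}^\pm}(\mathcal{W}_2)$; (iii) if $4\nmid\dim\mathcal{W}_1$ and $4\mid\dim\mathcal{W}_2$, then $\widehat{\operatorname{Sp}^\pm}(\mathcal{W}_1)$ only commutes with $\widehat{\operatorname{SO}^\pm}(\mathcal{W}_2)$, and $\widehat{\operatorname{O}^\pm}(\mathcal{W}_2)$ only commutes with $\widehat{\operatorname{Sp}}(\mathcal{W}_1)$; (iv) if $4\nmid\dim\mathcal{W}_1$ and $4\nmid\dim\mathcal{W}_2$, then $\widehat{\operatorname{Sp}^\pm}(\mathcal{W}_1)$ only commutes with $\widehat{\operatorname{SO}}(\mathcal{W}_2)$, and $\widehat{\operatorname{O}^\pm}(\mathcal{W}_2)$ only commutes with $\widehat{\operatorname{Sp}}(\mathcal{W}_1)$. (c) If $2\nmid\dim\mathcal{W}_2$, then: (i) $\operatorname{O}^\pm(\mathcal{W}_2)=\operatorname{O}(\mathcal{W}_2)$; (ii) if $4\mid\dim\mathcal{W}_1$, then $\widehat{\operatorname{Sp}^\pm}(\mathcal{W}_1)$ commutes with $\operatorname{O}(\mathcal{W}_2)$; (iii) if $4\nmid\dim\mathcal{W}_1$, then $\widehat{\operatorname{Sp}^\pm}(\mathcal{W}_1)$ only commutes with $\operatorname{SO}(\mathcal{W}_2)$, and $\operatorname{O}(\mathcal{W}_2)$ only commutes with $\widehat{\operatorname{Sp}}(\mathcal{W}_1)$.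
   Context: $F=\mathbb{R}$, $E=\mathbb{C}$, $\mathbb{H}$ = Hamilton quaternions, $T=\{z\in\mathbb{C}:|z|=1\}$. $(D,\tau)$ is one of $(F,\mathrm{id})$, $(E,\text{complex conjugation})$, $(\mathbb{H},\text{quaternion conjugation})$. $\mathcal{W}_1$ is a finite-dimensional nonzero right $D$-vector space with a non-degenerate $\epsilon_1$-hermitian form $\langle,\rangle_1$ (w.r.t. $\tau$), and $\mathcal{W}_2$ is a finite-dimensional nonzero left $D$-vector space with a non-degenerate $\epsilon_2$-hermitian form $\langle,\rangle_2$, where $\epsilon_i\in\{\pm1\}$, $\epsilon_1\epsilon_2=-1$; the case $D=\mathbb{H}$ with the skew-hermitian space of dimension $1$ is excluded. $W=\mathcal{W}_1\otimes_D\mathcal{W}_2$ is a symplectic $F$-space with form $\langle,\rangle=\kappa_D\,\mathrm{Trd}_{D/F}(\langle,\rangle_1\otimes\tau(\langle,\rangle_2))$, $\kappa_F=1$, $\kappa_E=\kappa_{\mathbb{H}}=\tfrac12$. Put $\dim_F W=2m$. $\operatorname{U}(\mathcal{W}_i)$ is the isometry group, $\operatorname{GU}(\mathcal{W}_i)$ the similitude group with factor $\lambda_g\in F^\times$, $\operatorname{U}^\pm(\mathcal{W}_i)=\{g\in\operatorname{GU}(\mathcal{W}_i):\lambda_g=\pm1\}$, written $\operatorname{Sp}^\pm$, $\operatorname{O}^\pm$ in the symplectic, orthogonal cases over $F$. A hyperbolic space is an orthogonal sum of hyperbolic planes. If $\mathcal{W}_2$ is orthogonal and hyperbolic with split hyperbolic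 basis $f_1,\dots,f_{n},f_1^*,\dots,f_{n}^*$, let $s_2(-1)\in\operatorname{O}^\pm(\mathcal{W}_2)$ fix each $f_k$ and send $f_k^*\mapsto-f_k^*$; $\operatorname{SO}^\pm(\mathcal{W}_2)$ is the subgroup generated by $\operatorname{SO}(\mathcal{W}_2)$ and $s_2(-1)$. $\operatorname{Sp}^\pm(W)=\{h\in\operatorname{GSp}(W):\lambda_h=\pm1\}$; $\operatorname{GSp}(W)$ acts on $W$ on the right. $\operatorname{U}^\pm(\mathcal{W}_i)$ embeds in $\operatorname{Sp}^\pm(W)$ by acting on the $i$-th tensor factor ($w_1\otimes w_2\mapsto g^{-1}w_1\otimes w_2$ for $i=1$, $w_1\otimes w_2\mapsto w_1\otimes w_2g$ for $i=2$). The cocycle. Fix a symplectic basis $\{e_1,\dots,e_m;e_1^*,\dots,e_m^*\}$ of $W$ ($\langle e_i,e_j^*\rangle=\delta_{ij}$, $\langle e_i,e_j\rangle=\langle e_i^*,e_j^*\rangle=0$), $X=\mathrm{Span}\{e_i\}$, $X^*=\mathrm{Span}\{e_i^*\}$, and $\psi(t)=e^{2\pi i e t}$ with $e\in\mathbb{R}^\times$. For $g_1,g_2\in\operatorname{Sp}(W)$, $\widetilde{c}_{X^*}(g_1,g_2)=\gamma(\psi(q(g_1,g_2)/2))$ is the Weil index attached to the Leray invariant $q(g_1,g_2)$ of the Lagrangians $X^*,X^*g_2^{-1},X^*g_1$; over $\mathbb{R}$ this equals $\exp(\tfrac{\pi i}{4}\mathrm{sgn}(e)\,\tau)$, where $\tau$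 is the signature of the quadratic form $(x_1,x_2,x_3)\mapsto\langle x_1,x_2\rangle+\langle x_2,x_3\rangle+\langle x_3,x_1\rangle$ on $X^*\oplus X^*g_2^{-1}\oplus X^*g_1$. It is a $\mu_8$-valued 2-cocycle. For $y\in F^\times$ let $s(y)\in\operatorname{GSp}(W)$ be $e_i\mapsto e_i$, $e_i^*\mapsto ye_i^*$; write $g^y=s(y)^{-1}gs(y)$. Let $\nu(y,\cdot):\operatorname{Sp}(W)\to\mu_8$ be the unique function with $\widetilde{c}_{X^*}(g_1^y,g_2^y)=\widetilde{c}_{X^*}(g_1,g_2)\nu(y,g_1)^{-1}\nu(y,g_2)^{-1}\nu(y,g_1g_2)$. Every $h\in\operatorname{Sp}^\pm(W)$ is uniquely $h=s(y)g$, $y=\lambda_h=\pm1$, $g\in\operatorname{Sp}(W)$, and for $h_i=s(y_i)g_i$ one sets $\widetilde{C}_{X^*}(h_1,h_2)=\nu(y_2,g_1)\,\widetilde{c}_{X^*}(g_1^{y_2},g_2)$, a 2-cocycle on $\operatorname{Sp}^\pm(W)$. $\widehat{\operatorname{Sp}}^\pm(W)$ is the central extension of $\operatorname{Sp}^\pm(W)$ by $T$ defined by $\widetilde{C}_{X^*}$. For a subgroup $H\subseteq\operatorname{Sp}^\pm(W)$, $\widehat{H}$ denotes its preimage; thus $\widehat{\operatorname{U}^\pm}(\mathcal{W}_i)$, $\widehat{\operatorname{Sp}^\pm}(\mathcal{W}_1)$, $\widehat{\operatorname{Sp}}(\mathcal{W}_1)$, $\widehat{\operatorname{O}^\pm}(\mathcal{W}_2)$,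 $\widehat{\operatorname{SO}}(\mathcal{W}_2)$, $\widehat{\operatorname{SO}^\pm}(\mathcal{W}_2)$ are the preimages of the indicated groups. Statements about $\operatorname{O}(\mathcal{W}_2)$ or $\operatorname{SO}(\mathcal{W}_2)$ commuting with something in $\widehat{\operatorname{Sp}}^\pm(W)$ refer to any lift, equivalently to their full preimages (as $T$ is central). "$A$ commutes with $B$" means elementwise. "$A$ only commutes with $\widehat{H}$" means: $A$ commutes with $\widehat{H}$, but does not commute with $\widehat{H'}$ for any $H'$ strictly containing $H$ among the natural groups on the other member of the pair, namely: $\operatorname{SO}(\mathcal{W}_2),\operatorname{O}(\mathcal{W}_2)$ in cases (a),(c); $\operatorname{SO}(\mathcal{W}_2),\operatorname{O}(\mathcal{W}_2),\operatorname{SO}^\pm(\mathcal{W}_2),\operatorname{O}^\pm(\mathcal{W}_2)$ in case (b); $\operatorname{Sp}(\mathcal{W}_1),\operatorname{Sp}^\pm(\mathcal{W}_1)$ on the symplectic side. *)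

theory Defs
  imports
    Complex_Main
    "HOL-Library.FuncSet"
    "HOL-Analysis.Product_Vector"
    "HOL-Algebra.Generated_Groups"
    "Jordan_Normal_Form.Determinant"
begin

section \<open>Hamilton quaternions\<close>

datatype quat = Quat (qre: real) (qi: real) (qj: real) (qk: real)

lemma quat_eq_iff: "x = y \<longleftrightarrow> qre x = qre y \<and> qi x = qi y \<and> qj x = qj y \<and> qk x = qk y"
  by (auto intro: quat.expand)

instantiation quat :: real_div_algebra
begin

definition zero_quat :: quat where "0 = Quat 0 0 0 0"

definition one_quat :: quat where "1 = Quat 1 0 0 0"

definition plus_quat :: "quat \<Rightarrow> quat \<Rightarrow> quat" where
  "x + y = Quat (qre x + qre y) (qi x + qi y) (qj x + qj y) (qk x + qk y)"

definition uminus_quat :: "quat \<Rightarrow> quat" where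
  "- x = Quat (- qre x) (- qi x) (- qj x) (- qk x)"

definition minus_quat :: "quat \<Rightarrow> quat \<Rightarrow> quat" where
  "x - y = Quat (qre x - qre y) (qi x - qi y) (qj x - qj y) (qk x - qk y)"

definition times_quat :: "quat \<Rightarrow> quat \<Rightarrow> quat" where
  "x * y = Quat
     (qre x * qre y - qi x * qi y - qj x * qj y - qk x * qk y)
     (qre x * qi y + qi x * qre y + qj x * qk y - qk x * qj y)
     (qre x * qj y - qi x * qk y + qj x * qre y + qk x * qi y)
     (qre x * qk y + qi x * qj y - qj x * qi y + qk x * qre y)"

definition scaleR_quat :: "real \<Rightarrow> quat \<Rightarrow> quat" where
  "scaleR r x = Quat (r * qre x) (r * qi x) (r * qj x) (r * qk x)"

definition inverse_quat :: "quat \<Rightarrow> quat" where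
  "inverse x =
     (let n = (qre x)\<^sup>2 + (qi x)\<^sup>2 + (qj x)\<^sup>2 + (qk x)\<^sup>2
      in Quat (qre x / n) (- qi x / n) (- qj x / n) (- qk x / n))"

definition "x div y = x * inverse y" for x y :: quat

instance
proof
  fix x :: quat
  assume "x \<noteq> 0"
  then have "(qre x)\<^sup>2 + (qi x)\<^sup>2 + (qj x)\<^sup>2 + (qk x)\<^sup>2 \<noteq> 0"
    by (auto simp: quat_eq_iff zero_quat_def add_nonneg_eq_0_iff)
  then show "inverse x * x = 1" and "x * inverse x = 1"
    by (simp_all add: quat_eq_iff one_quat_def times_quat_def inverse_quat_def Let_def
        power2_eq_square add_divide_distrib [symmetric] diff_divide_distrib [symmetric] mult.commute)
qed (simp_all add: quat_eq_iff zero_quat_def one_quat_def plus_quat_def uminus_quat_def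
    minus_quat_def times_quat_def scaleR_quat_def inverse_quat_def divide_quat_def algebra_simps)

end


section \<open>The division algebras with involution\<close>

text \<open>The class is instantiated exactly at the three pairs \<open>(D, \<tau>)\<close>; \<open>trd\<close> is the reduced
  trace of \<open>D\<close> over the reals and \<open>kappa TYPE(D)\<close> the normalising constant.\<close>

class involutive_div_algebra = real_div_algebra +
  fixes tau :: "'a \<Rightarrow> 'a"
    and trd :: "'a \<Rightarrow> real"
    and kappa :: "'a itself \<Rightarrow> real"
  assumes tau_add: "tau (x + y) = tau x + tau y"
    and tau_mult: "tau (x * y) = tau y * tau x"
    and tau_scaleR: "tau (r *\<^sub>R x) = r *\<^sub>R tau x"
    and tau_tau: "tau (tau x) = x"

instantiation real :: involutive_div_algebra
begin

definition tau_real :: "real \<Rightarrow> real" where "tau (x :: real) = x"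
definition trd_real :: "real \<Rightarrow> real" where "trd (x :: real) = x"
definition kappa_real :: "real itself \<Rightarrow> real" where "kappa (_ :: real itself) = 1"

instance
  by standard (simp_all add: tau_real_def)

end

instantiation complex :: involutive_div_algebra
begin

definition tau_complex :: "complex \<Rightarrow> complex" where "tau (z :: complex) = cnj z"
definition trd_complex :: "complex \<Rightarrow> real" where "trd (z :: complex) = Re (z + cnj z)"
definition kappa_complex :: "complex itself \<Rightarrow> real" where "kappa (_ :: complex itself) = 1 / 2"

instance
  by standard (simp_all add: tau_complex_def)

end

instantiation quat :: involutive_div_algebra
begin

definition tau_quat :: "quat \<Rightarrow> quat" where
  "tau (x :: quat) = Quat (qre x) (- qi x) (- qj x) (- qk x)"
definition trd_quat :: "quat \<Rightarrow> real" where "trd (x :: quat) = qre (x + tau x)"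
definition kappa_quat :: "quat itself \<Rightarrow> real" where "kappa (_ :: quat itself) = 1 / 2"

instance
  by standard
    (simp_all add: tau_quat_def quat_eq_iff plus_quat_def times_quat_def scaleR_quat_def)

end


section \<open>Spaces over a division algebra with a form\<close>

text \<open>The underlying additive group is the whole type \<open>'v\<close>. For a right vector space
  \<open>act V d x\<close> is \<open>x d\<close>, for a left vector space it is \<open>d x\<close>.\<close>

record ('d, 'v) form_space =
  act :: "'d \<Rightarrow> 'v \<Rightarrow> 'v"
  form :: "'v \<Rightarrow> 'v \<Rightarrow> 'd"

definition right_vector_space ::
    "('d::involutive_div_algebra, 'v::ab_group_add) form_space \<Rightarrow> bool" where
  "right_vector_space V \<longleftrightarrow>
     (\<forall>d x y. act V d (x + y) = act V d x + act V d y) \<and>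
     (\<forall>c d x. act V (c + d) x = act V c x + act V d x) \<and>
     (\<forall>c d x. act V (c * d) x = act V d (act V c x)) \<and>
     (\<forall>x. act V 1 x = x)"

definition left_vector_space ::
    "('d::involutive_div_algebra, 'v::ab_group_add) form_space \<Rightarrow> bool" where
  "left_vector_space V \<longleftrightarrow>
     (\<forall>d x y. act V d (x + y) = act V d x + act V d y) \<and>
     (\<forall>c d x. act V (c + d) x = act V c x + act V d x) \<and>
     (\<forall>c d x. act V (c * d) x = act V c (act V d x)) \<and>
     (\<forall>x. act V 1 x = x)"

definition dsubspace :: "('d, 'v::ab_group_add) form_space \<Rightarrow> 'v set \<Rightarrow> bool" where
  "dsubspace V S \<longleftrightarrow>
     0 \<in> S \<and> (\<forall>x\<in>S. \<forall>y\<in>S. x + y \<in> S) \<and> (\<forall>d. \<forall>x\<in>S. act V d x \<in> S)"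

definition dspan :: "('d, 'v::ab_group_add) form_space \<Rightarrow> 'v set \<Rightarrow> 'v set" where
  "dspan V S = dsubspace V hull S"

definition dbasis :: "('d, 'v::ab_group_add) form_space \<Rightarrow> 'v set \<Rightarrow> bool" where
  "dbasis V B \<longleftrightarrow> (\<forall>b\<in>B. b \<notin> dspan V (B - {b})) \<and> dspan V B = UNIV"

definition dfinite_dimensional :: "('d, 'v::ab_group_add) form_space \<Rightarrow> bool" where
  "dfinite_dimensional V \<longleftrightarrow> (\<exists>B. finite B \<and> dspan V B = UNIV)"

definition ddim :: "('d, 'v::ab_group_add) form_space \<Rightarrow> nat" where
  "ddim V = card (SOME B. dbasis V B)"

definition dlinear :: "('d, 'v::ab_group_add) form_space \<Rightarrow> ('v \<Rightarrow> 'v) \<Rightarrow> bool" where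
  "dlinear V g \<longleftrightarrow>
     (\<forall>x y. g (x + y) = g x + g y) \<and> (\<forall>d x. g (act V d x) = act V d (g x))"

definition form_hermitian ::
    "real \<Rightarrow> ('d::involutive_div_algebra, 'v::ab_group_add) form_space \<Rightarrow> bool" where
  "form_hermitian eps V \<longleftrightarrow>
     (\<forall>x y z. form V (x + y) z = form V x z + form V y z) \<and>
     (\<forall>x y z. form V x (y + z) = form V x y + form V x z) \<and>
     (\<forall>x y. form V y x = eps *\<^sub>R tau (form V x y))"

definition form_nondegenerate ::
    "('d::involutive_div_algebra, 'v::ab_group_add) form_space \<Rightarrow> bool" where
  "form_nondegenerate V \<longleftrightarrow> (\<forall>x. (\<forall>y. form V x y = 0) \<longrightarrow> x = 0)"

text \<open>Sesquilinearity is \<open>\<langle>x a, y b\<rangle> = \<tau>(a) \<langle>x, y\<rangle> b\<close> on a right space and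
  \<open>\<langle>a x, b y\<rangle> = a \<langle>x, y\<rangle> \<tau>(b)\<close> on a left space; with these conventions
  \<open>Trd (\<langle>,\<rangle>\<^sub>1 \<tau>(\<langle>,\<rangle>\<^sub>2))\<close> is well defined on the tensor product.\<close>

definition right_hermitian_space ::
    "real \<Rightarrow> ('d::involutive_div_algebra, 'v::ab_group_add) form_space \<Rightarrow> bool" where
  "right_hermitian_space eps V \<longleftrightarrow>
     right_vector_space V \<and> dfinite_dimensional V \<and> (\<exists>x::'v. x \<noteq> 0) \<and>
     form_hermitian eps V \<and>
     (\<forall>a b x y. form V (act V a x) (act V b y) = tau a * form V x y * b) \<and>
     form_nondegenerate V"

definition left_hermitian_space ::
    "real \<Rightarrow> ('d::involutive_div_algebra, 'v::ab_group_add) form_space \<Rightarrow> bool" where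
  "left_hermitian_space eps V \<longleftrightarrow>
     left_vector_space V \<and> dfinite_dimensional V \<and> (\<exists>x::'v. x \<noteq> 0) \<and>
     form_hermitian eps V \<and>
     (\<forall>a b x y. form V (act V a x) (act V b y) = a * form V x y * tau b) \<and>
     form_nondegenerate V"


section \<open>Similitude groups\<close>

definition similitude ::
    "('d::involutive_div_algebra, 'v::ab_group_add) form_space \<Rightarrow> real \<Rightarrow> ('v \<Rightarrow> 'v) \<Rightarrow> bool" where
  "similitude V l g \<longleftrightarrow>
     bij g \<and> dlinear V g \<and> (\<forall>x y. form V (g x) (g y) = l *\<^sub>R form V x y)"

definition GU :: "('d::involutive_div_algebra, 'v::ab_group_add) form_space \<Rightarrow> ('v \<Rightarrow> 'v) set" where
  "GU V = {g. \<exists>l. l \<noteq> 0 \<and> similitude V l g}"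

definition sim_factor ::
    "('d::involutive_div_algebra, 'v::ab_group_add) form_space \<Rightarrow> ('v \<Rightarrow> 'v) \<Rightarrow> real" where
  "sim_factor V g = (THE l. similitude V l g)"

definition U :: "('d::involutive_div_algebra, 'v::ab_group_add) form_space \<Rightarrow> ('v \<Rightarrow> 'v) set" where
  "U V = {g. similitude V 1 g}"

definition Upm :: "('d::involutive_div_algebra, 'v::ab_group_add) form_space \<Rightarrow> ('v \<Rightarrow> 'v) set" where
  "Upm V = {g \<in> GU V. sim_factor V g \<in> {1, -1}}"

text \<open>Groups acting on the right: the product of \<open>g\<close> and \<open>h\<close> applies \<open>g\<close> first.\<close>

definition rmult :: "('v \<Rightarrow> 'v) \<Rightarrow> ('v \<Rightarrow> 'v) \<Rightarrow> ('v \<Rightarrow> 'v)" where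
  "rmult g h = h \<circ> g"

definition right_Upm_group ::
    "('d::involutive_div_algebra, 'v::ab_group_add) form_space \<Rightarrow> ('v \<Rightarrow> 'v) monoid" where
  "right_Upm_group V = \<lparr>carrier = Upm V, monoid.mult = rmult, one = id\<rparr>"


section \<open>Orthogonal spaces over the reals\<close>

text \<open>The determinant of an endomorphism, computed in any ordered basis.\<close>

definition endo_det :: "(real, 'v::ab_group_add) form_space \<Rightarrow> ('v \<Rightarrow> 'v) \<Rightarrow> real" where
  "endo_det V g = (THE d. \<exists>n b A.
     inj_on b {..<n} \<and> dbasis V (b ` {..<n}) \<and> A \<in> carrier_mat n n \<and>
     (\<forall>j<n. g (b j) = (\<Sum>i<n. act V (A $$ (i, j)) (b i))) \<and> d = Determinant.det A)"

definition SO :: "(real, 'v::ab_group_add) form_space \<Rightarrow> ('v \<Rightarrow> 'v) set" where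
  "SO V = {g \<in> U V. endo_det V g = 1}"

text \<open>\<open>f 1, \<dots>, f n, f' 1, \<dots>, f' n\<close> is a split hyperbolic basis, each pair \<open>f k, f' k\<close> spanning a
  hyperbolic plane; linear independence follows from the relations.\<close>

definition hyperbolic_basis ::
    "(real, 'v::ab_group_add) form_space \<Rightarrow> nat \<Rightarrow> (nat \<Rightarrow> 'v) \<Rightarrow> (nat \<Rightarrow> 'v) \<Rightarrow> bool" where
  "hyperbolic_basis V n f f' \<longleftrightarrow>
     dspan V (f ` {1..n} \<union> f' ` {1..n}) = UNIV \<and>
     (\<forall>i\<in>{1..n}. \<forall>j\<in>{1..n}.
        form V (f i) (f j) = 0 \<and> form V (f' i) (f' j) = 0 \<and>
        form V (f i) (f' j) = (if i = j then 1 else 0))"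

definition hyperbolic_space :: "(real, 'v::ab_group_add) form_space \<Rightarrow> bool" where
  "hyperbolic_space V \<longleftrightarrow> (\<exists>n f f'. hyperbolic_basis V n f f')"

definition s2_minus1 ::
    "(real, 'v::ab_group_add) form_space \<Rightarrow> nat \<Rightarrow> (nat \<Rightarrow> 'v) \<Rightarrow> (nat \<Rightarrow> 'v) \<Rightarrow> 'v \<Rightarrow> 'v" where
  "s2_minus1 V n f f' = (THE g. dlinear V g \<and>
     (\<forall>k\<in>{1..n}. g (f k) = f k \<and> g (f' k) = - f' k))"

definition SOpm ::
    "(real, 'v::ab_group_add) form_space \<Rightarrow> nat \<Rightarrow> (nat \<Rightarrow> 'v) \<Rightarrow> (nat \<Rightarrow> 'v) \<Rightarrow> ('v \<Rightarrow> 'v) set" where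
  "SOpm V n f f' = generate (right_Upm_group V) (SO V \<union> {s2_minus1 V n f f'})"


section \<open>The tensor product and the dual pair\<close>

definition balanced ::
    "('d::involutive_div_algebra, 'a::ab_group_add) form_space \<Rightarrow>
     ('d, 'b::ab_group_add) form_space \<Rightarrow> ('a \<Rightarrow> 'b \<Rightarrow> 'c::real_vector) \<Rightarrow> bool" where
  "balanced V1 V2 f \<longleftrightarrow>
     (\<forall>x x' y. f (x + x') y = f x y + f x' y) \<and>
     (\<forall>x y y'. f x (y + y') = f x y + f x y') \<and>
     (\<forall>d x y. f (act V1 d x) y = f x (act V2 d y)) \<and>
     (\<forall>r x y. f (act V1 (of_real r) x) y = r *\<^sub>R f x y)"

text \<open>The real vector space \<open>'w\<close> with \<open>t x y = x \<otimes> y\<close> is the tensor product over \<open>D\<close>: \<open>t\<close> is the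
  universal balanced map. HOL cannot quantify over the target type, and one-dimensional targets
  suffice: real linear maps are determined by, and in finite dimension given by, their coordinates.\<close>

definition tensor_product ::
    "('d::involutive_div_algebra, 'a::ab_group_add) form_space \<Rightarrow>
     ('d, 'b::ab_group_add) form_space \<Rightarrow> ('a \<Rightarrow> 'b \<Rightarrow> 'w::real_vector) \<Rightarrow> bool" where
  "tensor_product V1 V2 t \<longleftrightarrow> balanced V1 V2 t \<and>
     (\<forall>f :: 'a \<Rightarrow> 'b \<Rightarrow> real. balanced V1 V2 f \<longrightarrow>
        (\<exists>!L. linear L \<and> (\<forall>x y. L (t x y) = f x y)))"

definition dual_pair ::
    "real \<Rightarrow> real \<Rightarrow> ('d::involutive_div_algebra, 'a::ab_group_add) form_space \<Rightarrow>
     ('d, 'b::ab_group_add) form_space \<Rightarrow> ('a \<Rightarrow> 'b \<Rightarrow> 'w::real_vector) \<Rightarrow> bool" where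
  "dual_pair eps1 eps2 V1 V2 t \<longleftrightarrow>
     eps1 \<in> {1, -1} \<and> eps2 \<in> {1, -1} \<and> eps1 * eps2 = -1 \<and>
     right_hermitian_space eps1 V1 \<and> left_hermitian_space eps2 V2 \<and> tensor_product V1 V2 t"

definition tensor_form ::
    "('d::involutive_div_algebra, 'a::ab_group_add) form_space \<Rightarrow>
     ('d, 'b::ab_group_add) form_space \<Rightarrow> ('a \<Rightarrow> 'b \<Rightarrow> 'w::real_vector) \<Rightarrow> 'w \<Rightarrow> 'w \<Rightarrow> real" where
  "tensor_form V1 V2 t = (THE B.
     (\<forall>v. linear (B v)) \<and> (\<forall>w. linear (\<lambda>v. B v w)) \<and>
     (\<forall>x y x' y'. B (t x y) (t x' y') =
        kappa TYPE('d) * trd (form V1 x x' * tau (form V2 y y'))))"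

definition emb1 :: "('a \<Rightarrow> 'b \<Rightarrow> 'w::real_vector) \<Rightarrow> ('a \<Rightarrow> 'a) \<Rightarrow> 'w \<Rightarrow> 'w" where
  "emb1 t g = (THE h. linear h \<and> (\<forall>x y. h (t x y) = t (inv_into UNIV g x) y))"

definition emb2 :: "('a \<Rightarrow> 'b \<Rightarrow> 'w::real_vector) \<Rightarrow> ('b \<Rightarrow> 'b) \<Rightarrow> 'w \<Rightarrow> 'w" where
  "emb2 t g = (THE h. linear h \<and> (\<forall>x y. h (t x y) = t x (g y)))"


section \<open>The cocycle on the symplectic similitudes of factor plus or minus one\<close>

text \<open>\<open>sbasis\<close> and \<open>sbasis'\<close> are the vectors \<open>e\<^sub>i\<close> and \<open>e\<^sub>i\<^sup>*\<close> for \<open>1 \<le> i \<le> m = half_dim\<close>;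
  \<open>psi_coeff\<close> is the \<open>e\<close> in \<open>\<psi>(t) = exp (2 \<pi> \<i> e t)\<close>.\<close>

record 'w symplectic_datum =
  sform :: "'w \<Rightarrow> 'w \<Rightarrow> real"
  half_dim :: nat
  sbasis :: "nat \<Rightarrow> 'w"
  sbasis' :: "nat \<Rightarrow> 'w"
  psi_coeff :: real

definition symplectic_frame :: "('w::real_vector) symplectic_datum \<Rightarrow> bool" where
  "symplectic_frame S \<longleftrightarrow>
     span (sbasis S ` {1..half_dim S} \<union> sbasis' S ` {1..half_dim S}) = UNIV \<and>
     (\<forall>i\<in>{1..half_dim S}. \<forall>j\<in>{1..half_dim S}.
        sform S (sbasis S i) (sbasis S j) = 0 \<and>
        sform S (sbasis' S i) (sbasis' S j) = 0 \<and>
        sform S (sbasis S i) (sbasis' S j) = (if i = j then 1 else 0)) \<and>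
     psi_coeff S \<noteq> 0"

definition symplectic_space :: "('w::real_vector) symplectic_datum \<Rightarrow> (real, 'w) form_space" where
  "symplectic_space S = \<lparr>act = scaleR, form = sform S\<rparr>"

definition Sp :: "('w::real_vector) symplectic_datum \<Rightarrow> ('w \<Rightarrow> 'w) set" where
  "Sp S = U (symplectic_space S)"

definition Sppm :: "('w::real_vector) symplectic_datum \<Rightarrow> ('w \<Rightarrow> 'w) set" where
  "Sppm S = Upm (symplectic_space S)"

definition Xstar :: "('w::real_vector) symplectic_datum \<Rightarrow> 'w set" where
  "Xstar S = span (sbasis' S ` {1..half_dim S})"

text \<open>Signature of a quadratic form \<open>Q\<close> (possibly degenerate) on a finite-dimensional subspace \<open>V\<close>:
  positive minus negative index of inertia.\<close>

definition signature :: "('v::real_vector) set \<Rightarrow> ('v \<Rightarrow> real) \<Rightarrow> int" where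
  "signature V Q =
     int (Max (dim ` {P. subspace P \<and> P \<subseteq> V \<and> (\<forall>x\<in>P - {0}. Q x > 0)})) -
     int (Max (dim ` {N. subspace N \<and> N \<subseteq> V \<and> (\<forall>x\<in>N - {0}. Q x < 0)}))"

definition leray_signature ::
    "('w::real_vector) symplectic_datum \<Rightarrow> 'w set \<Rightarrow> 'w set \<Rightarrow> 'w set \<Rightarrow> int" where
  "leray_signature S L1 L2 L3 = signature (L1 \<times> (L2 \<times> L3))
     (\<lambda>(x1, x2, x3). sform S x1 x2 + sform S x2 x3 + sform S x3 x1)"

text \<open>The Weil index of \<open>\<psi>(q(g\<^sub>1, g\<^sub>2)/2)\<close> over the reals, for the Lagrangians
  \<open>X\<^sup>*\<close>, \<open>X\<^sup>* g\<^sub>2\<^sup>-\<^sup>1\<close>, \<open>X\<^sup>* g\<^sub>1\<close>.\<close>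

definition c_tilde ::
    "('w::real_vector) symplectic_datum \<Rightarrow> ('w \<Rightarrow> 'w) \<Rightarrow> ('w \<Rightarrow> 'w) \<Rightarrow> complex" where
  "c_tilde S g1 g2 = exp (\<i> * complex_of_real (pi / 4 * sgn (psi_coeff S) *
     real_of_int (leray_signature S (Xstar S) (inv_into UNIV g2 ` Xstar S) (g1 ` Xstar S))))"

definition s_map :: "('w::real_vector) symplectic_datum \<Rightarrow> real \<Rightarrow> 'w \<Rightarrow> 'w" where
  "s_map S y = (THE h. linear h \<and>
     (\<forall>i\<in>{1..half_dim S}. h (sbasis S i) = sbasis S i \<and> h (sbasis' S i) = y *\<^sub>R sbasis' S i))"

text \<open>\<open>g\<^sup>y = s(y)\<^sup>-\<^sup>1 g s(y)\<close>.\<close>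

definition conj_s :: "('w::real_vector) symplectic_datum \<Rightarrow> real \<Rightarrow> ('w \<Rightarrow> 'w) \<Rightarrow> ('w \<Rightarrow> 'w)" where
  "conj_s S y g = rmult (rmult (inv_into UNIV (s_map S y)) g) (s_map S y)"

definition mu8 :: "complex set" where
  "mu8 = {z. z ^ 8 = 1}"

text \<open>The unique function; it is normalised outside \<open>Sp(W)\<close> by extensionality.\<close>

definition nu :: "('w::real_vector) symplectic_datum \<Rightarrow> real \<Rightarrow> ('w \<Rightarrow> 'w) \<Rightarrow> complex" where
  "nu S y = (THE n. n \<in> Sp S \<rightarrow>\<^sub>E mu8 \<and>
     (\<forall>g1\<in>Sp S. \<forall>g2\<in>Sp S.
        c_tilde S (conj_s S y g1) (conj_s S y g2) =
        c_tilde S g1 g2 * inverse (n g1) * inverse (n g2) * n (rmult g1 g2)))"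

definition lam :: "('w::real_vector) symplectic_datum \<Rightarrow> ('w \<Rightarrow> 'w) \<Rightarrow> real" where
  "lam S h = sim_factor (symplectic_space S) h"

text \<open>The component \<open>g = s(\<lambda>\<^sub>h)\<^sup>-\<^sup>1 h\<close> of \<open>h = s(\<lambda>\<^sub>h) g\<close>.\<close>

definition sp_part :: "('w::real_vector) symplectic_datum \<Rightarrow> ('w \<Rightarrow> 'w) \<Rightarrow> ('w \<Rightarrow> 'w)" where
  "sp_part S h = rmult (inv_into UNIV (s_map S (lam S h))) h"

definition C_tilde ::
    "('w::real_vector) symplectic_datum \<Rightarrow> ('w \<Rightarrow> 'w) \<Rightarrow> ('w \<Rightarrow> 'w) \<Rightarrow> complex" where
  "C_tilde S h1 h2 = nu S (lam S h2) (sp_part S h1) *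
     c_tilde S (conj_s S (lam S h2) (sp_part S h1)) (sp_part S h2)"

definition circle :: "complex set" where
  "circle = {z. cmod z = 1}"

definition circle_group :: "complex monoid" where
  "circle_group = \<lparr>carrier = circle, monoid.mult = (*), one = 1\<rparr>"

text \<open>The pair \<open>(id, 1)\<close> is the unit because \<open>C_tilde\<close> is normalised.\<close>

definition Sppm_hat :: "('w::real_vector) symplectic_datum \<Rightarrow> (('w \<Rightarrow> 'w) \<times> complex) monoid" where
  "Sppm_hat S =
     \<lparr>carrier = Sppm S \<times> circle,
      monoid.mult = (\<lambda>(h1, z1) (h2, z2). (rmult h1 h2, z1 * z2 * C_tilde S h1 h2)),
      one = (id, 1)\<rparr>"

text \<open>Preimages in the extension of a set of elements of \<open>Upm V1\<close>, respectively \<open>Upm V2\<close>.\<close>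

definition hat1 ::
    "('a \<Rightarrow> 'b \<Rightarrow> 'w::real_vector) \<Rightarrow> ('a \<Rightarrow> 'a) set \<Rightarrow> (('w \<Rightarrow> 'w) \<times> complex) set" where
  "hat1 t H = (emb1 t ` H) \<times> circle"

definition hat2 ::
    "('a \<Rightarrow> 'b \<Rightarrow> 'w::real_vector) \<Rightarrow> ('b \<Rightarrow> 'b) set \<Rightarrow> (('w \<Rightarrow> 'w) \<times> complex) set" where
  "hat2 t H = (emb2 t ` H) \<times> circle"

definition commutes_with :: "('g, 'm) monoid_scheme \<Rightarrow> 'g set \<Rightarrow> 'g set \<Rightarrow> bool" where
  "commutes_with G A B \<longleftrightarrow> (\<forall>a\<in>A. \<forall>b\<in>B. a \<otimes>\<^bsub>G\<^esub> b = b \<otimes>\<^bsub>G\<^esub> a)"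

text \<open>\<open>A\<close> commutes with \<open>hat H\<close>, but with no \<open>hat H'\<close> for \<open>H'\<close> in the family \<open>Hs\<close> of natural groups
  that strictly contains \<open>H\<close>.\<close>

definition only_commutes_with ::
    "('g, 'm) monoid_scheme \<Rightarrow> ('h set \<Rightarrow> 'g set) \<Rightarrow> 'h set set \<Rightarrow> 'g set \<Rightarrow> 'h set \<Rightarrow> bool" where
  "only_commutes_with G hat Hs A H \<longleftrightarrow>
     commutes_with G A (hat H) \<and> (\<forall>H'\<in>Hs. H \<subset> H' \<longrightarrow> \<not> commutes_with G A (hat H'))"

text \<open>The preimage of \<open>Upm V2\<close> is isomorphic to \<open>Upm V2 \<times> T\<close>, as a central extension of \<open>Upm V2\<close>
  by \<open>T\<close>: the isomorphism lies over the identity of \<open>Upm V2\<close> and is the identity on \<open>T\<close>.\<close>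

definition hat2_splits ::
    "('w::real_vector) symplectic_datum \<Rightarrow> ('a \<Rightarrow> 'b \<Rightarrow> 'w) \<Rightarrow>
     ('d::involutive_div_algebra, 'b::ab_group_add) form_space \<Rightarrow> bool" where
  "hat2_splits S t V2 \<longleftrightarrow>
     (\<exists>\<phi> \<in> iso ((Sppm_hat S)\<lparr>carrier := hat2 t (Upm V2)\<rparr>) (right_Upm_group V2 \<times>\<times> circle_group).
        (\<forall>g\<in>Upm V2. \<forall>z\<in>circle. fst (\<phi> (emb2 t g, z)) = g) \<and>
        (\<forall>z\<in>circle. \<phi> (id, z) = (id, z)))"

end

theory Submission
  imports Defs
begin

text \<open>
  Two lifts of commuting elements \<open>h\<close>, \<open>g\<close> of \<open>Sp\<^sup>\<plusminus>(W)\<close> commute up to the scalar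
  \<open>\<kappa>(h, g) = C(h, g) / C(g, h)\<close>. Because \<open>C\<close> is a cocycle, \<open>\<kappa>\<close> is multiplicative in each variable on
  commuting elements, and because \<open>C\<close> takes values in the eighth roots of unity, \<open>\<kappa>\<^sup>8 = 1\<close>. The whole
  statement is a computation of \<open>\<kappa>\<close> on the two members of the dual pair.

  To see that \<open>C\<close> is a cocycle and to evaluate it, the Leray signature is split. Relative to a
  Lagrangian transversal to three given ones it is a sum of three signatures comparing two Lagrangians
  at a time (\<open>leray_eq_mu\<close>). Modulo four such a signature is given by the sign of a Gram determinant, so
  for Lagrangians with a basis, i.e. with an orientation, the Leray signature is a coboundary modulo four:
  \<open>N(b\<^sub>1, b\<^sub>2) N(b\<^sub>2, b\<^sub>3) N(b\<^sub>3, b\<^sub>1) = i\<^bsup>-\<tau>\<^esup>\<close> with a fourth root of unity \<open>N\<close> depending on two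
  oriented Lagrangians (\<open>N_triple\<close>). Put \<open>M(h) = N(X\<^sup>*, X\<^sup>* h)\<close>. The conjugate by \<open>s(-1)\<close> of the cocycle
  \<open>c\<close> is its inverse, that is \<open>c\<close> times \<open>i\<^bsup>-\<tau>\<^esup>\<close>, and this identifies \<open>\<nu>(-1, \<cdot>)\<close> with \<open>M\<close>
  (\<open>nu_minus1\<close>); \<open>\<nu>\<close> is unique because \<open>Sp(W)\<close> is generated by eighth powers, transvections being divisible.
  The result is the closed formula \<open>K\<close> for \<open>C\<close>. On the stabiliser of a Lagrangian \<open>L\<close> the formula becomes,
  up to the coboundary of a Leray signature, a product of signs of \<open>det(h | L)\<close> (\<open>K_stab\<close>). An involution
  \<open>h\<close> of similitude factor \<open>-1\<close> has a Lagrangian fixed space, every \<open>g\<close> commuting with \<open>h\<close> preserves it, and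
  therefore \<open>\<kappa>(h, g) = sgn det(g | Fix h)\<close> (\<open>kap_involution\<close>).

  For complex and quaternionic spaces both isometry groups are generated by eighth powers: transvections
  and quasi-reflections have square roots of the same kind, since an element fixed or negated by the
  involution commutes with a square root of \<open>-1\<close>. So \<open>\<kappa>\<close> vanishes as soon as one argument is an isometry,
  and what remains is a single pair of similitudes of factor \<open>-1\<close> (\<open>kap_trivial\<close>). One of them can be chosen as an
  involution \<open>h\<close> and the other with \<open>g\<^sup>2 = -1\<close>; then \<open>g\<close> is the square of \<open>(1 + g)/\<surd>2\<close> on \<open>Fix h\<close> and
  \<open>sgn det(g | Fix h) = 1\<close>.

  For a symplectic space of dimension \<open>2k\<close> and an orthogonal space only \<open>Sp(\<W>\<^sub>1)\<close> is generated by eighth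
  powers. With the involution \<open>s\<close> fixing half of a symplectic basis and negating the other half,
  \<open>Fix s\<close> is a sum of \<open>k\<close> copies of \<open>\<W>\<^sub>2\<close>, so \<open>\<kappa>(g\<^sub>1, g\<^sub>2)\<close> is \<open>1\<close> for \<open>g\<^sub>1\<close> of factor \<open>1\<close> and
  \<open>sgn(det g\<^sub>2)\<^sup>k\<close> for \<open>g\<^sub>1\<close> of factor \<open>-1\<close> (\<open>kap_real\<close>). All the commutation statements follow by asking where the
  determinant is negative: on reflections, and on \<open>s\<^sub>2(-1)\<close>, whose determinant is \<open>(-1)\<^sup>n\<close>. A similitude of factor
  \<open>-1\<close> of \<open>\<W>\<^sub>2\<close> can be corrected to an involution that swaps positive and negative vectors of an orthogonal
  basis, which exhibits \<open>\<W>\<^sub>2\<close> as hyperbolic. Finally, the splitting over \<open>O\<^sup>\<plusminus>(\<W>\<^sub>2)\<close> is written down from \<open>K_stab\<close>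
  for \<open>Fix s\<close>; for odd \<open>k\<close> it uses the character of \<open>O(n, n)\<close> that is the sign of the determinant of the block
  acting on a maximal positive definite subspace (\<open>twisted_character\<close>).
\<close>

section \<open>Determinants of square arrays\<close>

text \<open>Square arrays as functions of two indices need no carrier conditions, and their size can vary inside an induction.\<close>

definition fdet :: "nat \<Rightarrow> (nat \<Rightarrow> nat \<Rightarrow> real) \<Rightarrow> real" where
  "fdet n a = Determinant.det (mat n n (\<lambda>(i, j). a i j))"

lemma fdet_cong:
  assumes "\<And>i j. i < n \<Longrightarrow> j < n \<Longrightarrow> a i j = b i j"
  shows "fdet n a = fdet n b"
  unfolding fdet_def by (rule arg_cong[where f = Determinant.det]) (use assms in auto)

lemma fdet_mult: "fdet n (\<lambda>i j. \<Sum>k<n. a i k * b k j) = fdet n a * fdet n b"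
proof -
  have "mat n n (\<lambda>(i, j). \<Sum>k<n. a i k * b k j) = mat n n (\<lambda>(i, j). a i j) * mat n n (\<lambda>(i, j). b i j)"
    by (rule eq_matI) (auto simp: scalar_prod_def atLeast0LessThan intro!: sum.cong)
  then show ?thesis
    by (simp add: fdet_def det_mult[of _ n])
qed

lemma fdet_transpose: "fdet n (\<lambda>i j. a j i) = fdet n a"
proof -
  have "mat n n (\<lambda>(i, j). a j i) = transpose_mat (mat n n (\<lambda>(i, j). a i j))"
    by (rule eq_matI) auto
  then show ?thesis
    by (simp add: fdet_def det_transpose[of _ n])
qed

lemma fdet_scale: "fdet n (\<lambda>i j. c * a i j) = c ^ n * fdet n a"
proof -
  have "mat n n (\<lambda>(i, j). c * a i j) = c \<cdot>\<^sub>m mat n n (\<lambda>(i, j). a i j)"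
    by (rule eq_matI) auto
  then show ?thesis
    by (simp add: fdet_def)
qed

lemma fdet_diag:
  assumes "\<And>i j. i < n \<Longrightarrow> j < n \<Longrightarrow> i \<noteq> j \<Longrightarrow> a i j = 0"
  shows "fdet n a = (\<Prod>i<n. a i i)"
proof -
  have "fdet n a = prod_list (diag_mat (mat n n (\<lambda>(i, j). a i j)))"
    unfolding fdet_def by (rule det_lower_triangular[of n]) (use assms in auto)
  also have "\<dots> = (\<Prod>i<n. a i i)"
    by (simp add: prod_list_diag_prod atLeast0LessThan)
  finally show ?thesis .
qed

lemma fdet_delta: "fdet n (\<lambda>i j. if i = j then 1 else 0) = 1"
  by (subst fdet_diag) auto

lemma fdet_eq_0_iff:
  "fdet n a = 0 \<longleftrightarrow> (\<exists>c. (\<exists>i<n. c i \<noteq> 0) \<and> (\<forall>i<n. (\<Sum>j<n. a i j * c j) = 0))"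
proof -
  let ?A = "mat n n (\<lambda>(i, j). a i j)"
  have mv: "(?A *\<^sub>v v) $ i = (\<Sum>j<n. a i j * v $ j)" if "i < n" "v \<in> carrier_vec n" for i v
    using that by (auto simp: scalar_prod_def atLeast0LessThan intro!: sum.cong)
  have "fdet n a = 0 \<longleftrightarrow> (\<exists>v. v \<in> carrier_vec n \<and> v \<noteq> 0\<^sub>v n \<and> ?A *\<^sub>v v = 0\<^sub>v n)"
    unfolding fdet_def by (rule det_0_iff_vec_prod_zero[of _ n]) simp
  also have "\<dots> \<longleftrightarrow> (\<exists>c. (\<exists>i<n. c i \<noteq> 0) \<and> (\<forall>i<n. (\<Sum>j<n. a i j * c j) = 0))"
  proof
    assume "\<exists>v. v \<in> carrier_vec n \<and> v \<noteq> 0\<^sub>v n \<and> ?A *\<^sub>v v = 0\<^sub>v n"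
    then obtain v where v: "v \<in> carrier_vec n" "v \<noteq> 0\<^sub>v n" "?A *\<^sub>v v = 0\<^sub>v n" by blast
    have "\<exists>i<n. v $ i \<noteq> 0"
    proof (rule ccontr)
      assume "\<not> (\<exists>i<n. v $ i \<noteq> 0)"
      then have "v = 0\<^sub>v n" using v(1) by (intro eq_vecI) auto
      then show False using v(2) by simp
    qed
    moreover have "\<forall>i<n. (\<Sum>j<n. a i j * v $ j) = 0"
      using mv[OF _ v(1)] v(3) by simp
    ultimately show "\<exists>c. (\<exists>i<n. c i \<noteq> 0) \<and> (\<forall>i<n. (\<Sum>j<n. a i j * c j) = 0)" by blast
  next
    assume "\<exists>c. (\<exists>i<n. c i \<noteq> 0) \<and> (\<forall>i<n. (\<Sum>j<n. a i j * c j) = 0)"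
    then obtain c where c: "\<exists>i<n. c i \<noteq> 0" "\<forall>i<n. (\<Sum>j<n. a i j * c j) = 0" by blast
    let ?v = "vec n c"
    obtain i where i: "i < n" "c i \<noteq> 0" using c(1) by blast
    then have "?v $ i \<noteq> 0\<^sub>v n $ i" by simp
    then have "?v \<noteq> 0\<^sub>v n" by metis
    moreover have "?A *\<^sub>v ?v = 0\<^sub>v n"
      by (rule eq_vecI) (use c(2) in \<open>auto simp: scalar_prod_def atLeast0LessThan\<close>)
    ultimately show "\<exists>v. v \<in> carrier_vec n \<and> v \<noteq> 0\<^sub>v n \<and> ?A *\<^sub>v v = 0\<^sub>v n"
      using vec_carrier by blast
  qed
  finally show ?thesis .
qed

lemma fdet_eq_0_iff_row:
  "fdet n a = 0 \<longleftrightarrow> (\<exists>c. (\<exists>i<n. c i \<noteq> 0) \<and> (\<forall>j<n. (\<Sum>i<n. c i * a i j) = 0))"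
proof -
  have "fdet n (\<lambda>i j. a j i) = 0 \<longleftrightarrow> fdet n a = 0"
    by (subst fdet_transpose) (rule refl)
  then show ?thesis
    by (simp add: fdet_eq_0_iff mult.commute)
qed

lemma fdet_inverse:
  assumes "fdet n a \<noteq> 0"
  obtains b where "\<And>i j. i < n \<Longrightarrow> j < n \<Longrightarrow> (\<Sum>k<n. a i k * b k j) = (if i = j then 1 else 0)"
    and "\<And>i j. i < n \<Longrightarrow> j < n \<Longrightarrow> (\<Sum>k<n. b i k * a k j) = (if i = j then 1 else 0)"
proof -
  let ?A = "mat n n (\<lambda>(i, j). a i j)"
  define B where "B = inverse (Determinant.det ?A) \<cdot>\<^sub>m adj_mat ?A"
  have A: "?A \<in> carrier_mat n n" by simp
  have nz: "Determinant.det ?A \<noteq> 0" using assms by (simp add: fdet_def)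
  have Bc: "B \<in> carrier_mat n n" using adj_mat(1)[OF A] by (simp add: B_def)
  have "?A * B = inverse (Determinant.det ?A) \<cdot>\<^sub>m (?A * adj_mat ?A)"
    unfolding B_def by (rule mult_smult_distrib[OF A adj_mat(1)[OF A]])
  then have AB1: "?A * B = 1\<^sub>m n" using nz by (auto simp: adj_mat(2)[OF A])
  have "B * ?A = inverse (Determinant.det ?A) \<cdot>\<^sub>m (adj_mat ?A * ?A)"
    unfolding B_def by (rule mult_smult_assoc_mat[OF adj_mat(1)[OF A] A])
  then have AB: "?A * B = 1\<^sub>m n" "B * ?A = 1\<^sub>m n" using nz AB1 by (auto simp: adj_mat(3)[OF A])
  have dB: "dim_col B = n" "dim_row B = n" using Bc by auto
  show thesis
  proof (rule that[of "\<lambda>i j. B $$ (i, j)"])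
    fix i j assume ij: "i < n" "j < n"
    have "(?A * B) $$ (i, j) = (\<Sum>k<n. a i k * B $$ (k, j))"
      using ij dB by (auto simp: scalar_prod_def atLeast0LessThan)
    then show "(\<Sum>k<n. a i k * B $$ (k, j)) = (if i = j then 1 else 0)"
      using AB ij by simp
    have "(B * ?A) $$ (i, j) = (\<Sum>k<n. B $$ (i, k) * a k j)"
      using ij dB by (auto simp: scalar_prod_def atLeast0LessThan)
    then show "(\<Sum>k<n. B $$ (i, k) * a k j) = (if i = j then 1 else 0)"
      using AB ij dB by simp
  qed
qed

lemma underdetermined_system:
  assumes "n < m"
  obtains c :: "nat \<Rightarrow> real" where "\<exists>i<m. c i \<noteq> 0" "\<And>j. j < n \<Longrightarrow> (\<Sum>i<m. a j i * c i) = 0"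
proof -
  have "fdet m (\<lambda>i j. if i < n then a i j else 0) = 0"
    unfolding fdet_eq_0_iff_row
    by (rule exI[of _ "\<lambda>i. if i = n then 1 else 0"])
      (use assms in \<open>auto intro!: sum.neutral\<close>)
  then obtain c where c: "\<exists>i<m. c i \<noteq> 0" "\<forall>i<m. (\<Sum>j<m. (if i < n then a i j else 0) * c j) = 0"
    unfolding fdet_eq_0_iff by blast
  show thesis
  proof (rule that[OF c(1)])
    fix j assume "j < n"
    then show "(\<Sum>i<m. a j i * c i) = 0" using c(2)[rule_format, of j] assms by simp
  qed
qed

lemma fdet_block:
  "fdet (n + p) (\<lambda>i j. if i < n \<and> j < n then a i j else if \<not> i < n \<and> \<not> j < n then d (i - n) (j - n) else 0)
     = fdet n a * fdet p d"
proof -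
  have "mat (n + p) (n + p) (\<lambda>(i, j). if i < n \<and> j < n then a i j
          else if \<not> i < n \<and> \<not> j < n then d (i - n) (j - n) else 0)
      = four_block_mat (mat n n (\<lambda>(i, j). a i j)) (0\<^sub>m n p) (0\<^sub>m p n) (mat p p (\<lambda>(i, j). d i j))"
    by (rule eq_matI) auto
  moreover have "Determinant.det \<dots> = fdet n a * fdet p d"
    unfolding fdet_def by (rule det_four_block_mat_lower_left_zero[of _ n _ p]) simp_all
  ultimately show ?thesis by (simp only: fdet_def)
qed

text \<open>The determinant cannot vanish anywhere along an invertible path, so its sign is constant.\<close>

lemma fdet_sgn_homotopy:
  assumes cont: "\<And>i j. i < n \<Longrightarrow> j < n \<Longrightarrow> continuous_on {0..1} (\<lambda>s::real. a s i j)"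
    and ne: "\<And>s. 0 \<le> s \<Longrightarrow> s \<le> 1 \<Longrightarrow> fdet n (a s) \<noteq> 0"
  shows "sgn (fdet n (a 0)) = sgn (fdet n (a 1))"
proof -
  have f: "fdet n (a s) = (\<Sum>p\<in>{p. p permutes {0..<n}}. signof p * (\<Prod>i = 0..<n. a s i (p i)))" for s
    unfolding fdet_def by (subst det_def'[of _ n]) (auto intro!: sum.cong prod.cong dest: permutes_in_image)
  have "p i < n" if "p permutes {0..<n}" "i < n" for p i
    using that permutes_in_image[of p "{0..<n}" i] by auto
  then have c: "continuous_on {0..1} (\<lambda>s. fdet n (a s))"
    unfolding f by (intro continuous_intros cont) auto
  show ?thesis
  proof (rule ccontr)
    assume H: "sgn (fdet n (a 0)) \<noteq> sgn (fdet n (a 1))"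
    consider "fdet n (a 0) < 0" "fdet n (a 1) > 0" | "fdet n (a 0) > 0" "fdet n (a 1) < 0"
      using H ne[of 0] ne[of 1] by (auto simp: sgn_if split: if_splits)
    then show False
    proof cases
      case 1
      then show False using IVT'[of "\<lambda>s. fdet n (a s)" 0 0 1] c ne by auto
    next
      case 2
      then show False using IVT2'[of "\<lambda>s. fdet n (a s)" 1 0 0] c ne by auto
    qed
  qed
qed

section \<open>Signatures of quadratic forms\<close>

lemma signature_uminus: "signature V (\<lambda>x. - Q x) = - signature V Q"
  by (simp add: signature_def)

lemma signature_scale_pos: "c > 0 \<Longrightarrow> signature V (\<lambda>x. c * Q x) = signature V Q"
  by (simp add: signature_def zero_less_mult_iff mult_less_0_iff)

lemma dim_image_inj_on:
  assumes "linear f" "subspace P" "inj_on f P"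
  shows "dim (f ` P) = dim P"
proof -
  obtain B where B: "B \<subseteq> P" "independent B" "P \<subseteq> span B" "card B = dim P"
    using basis_exists by blast
  have PB: "span B = P" using B assms(2) by (metis span_minimal subset_antisym)
  have i: "inj_on f (span B)" using assms(3) PB by simp
  have "independent (f ` B)"
    by (rule linear_independent_injective_image[OF assms(1) B(2) i])
  moreover have "span (f ` B) = f ` P"
    using linear_span_image[OF assms(1), of B] PB by simp
  moreover have "card (f ` B) = card B"
    by (rule card_image[OF inj_on_subset[OF i span_superset]])
  ultimately show ?thesis
    by (metis B(4) dim_span_eq_card_independent)
qed

lemma definite_dims_pullback:
  fixes f :: "'v::real_vector \<Rightarrow> 'u::real_vector"
  assumes f: "linear f" and V': "subspace V'" and V: "f ` V' = V"
    and R0: "\<not> R (0 :: 'u)"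
  shows "dim ` {P. subspace P \<and> P \<subseteq> V' \<and> (\<forall>x\<in>P - {0}. R (f x))}
       = dim ` {P. subspace P \<and> P \<subseteq> V \<and> (\<forall>x\<in>P - {0}. R x)}"
proof (intro equalityI subsetI)
  fix d assume "d \<in> dim ` {P. subspace P \<and> P \<subseteq> V' \<and> (\<forall>x\<in>P - {0}. R (f x))}"
  then obtain P where P: "subspace P" "P \<subseteq> V'" "\<forall>x\<in>P - {0}. R (f x)" "d = dim P" by auto
  have inj: "inj_on f P"
  proof (rule inj_onI)
    fix x y assume xy: "x \<in> P" "y \<in> P" "f x = f y"
    then have "x - y \<in> P" "f (x - y) = 0"
      using P(1) f by (auto simp: subspace_diff linear_diff)
    then have "x - y = 0" using bspec[OF P(3), of "x - y"] R0 by auto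
    then show "x = y" by simp
  qed
  have "subspace (f ` P)" by (rule linear_subspace_image[OF f P(1)])
  moreover have "f ` P \<subseteq> V" using P(2) V by auto
  moreover have "\<forall>x\<in>f ` P - {0}. R x" using P(3) f by (auto simp: linear_0)
  ultimately show "d \<in> dim ` {P. subspace P \<and> P \<subseteq> V \<and> (\<forall>x\<in>P - {0}. R x)}"
    using dim_image_inj_on[OF f P(1) inj] P(4) by (intro image_eqI[where x = "f ` P"]) auto
next
  fix d assume "d \<in> dim ` {P. subspace P \<and> P \<subseteq> V \<and> (\<forall>x\<in>P - {0}. R x)}"
  then obtain P where P: "subspace P" "P \<subseteq> V" "\<forall>x\<in>P - {0}. R x" "d = dim P" by auto
  obtain g where g: "range g \<subseteq> V'" "linear g" "\<forall>v\<in>f ` V'. f (g v) = v"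
    using linear_exists_right_inverse_on[OF f V'] by blast
  have fg: "f (g v) = v" if "v \<in> P" for v using that g(3) P(2) V by auto
  have inj: "inj_on g P" by (rule inj_on_inverseI[of _ f]) (rule fg)
  have "subspace (g ` P)" by (rule linear_subspace_image[OF g(2) P(1)])
  moreover have "g ` P \<subseteq> V'" using g(1) by auto
  moreover have "\<forall>x\<in>g ` P - {0}. R (f x)" 
  proof
    fix x assume "x \<in> g ` P - {0}"
    then obtain p where p: "p \<in> P" "x = g p" "g p \<noteq> 0" by auto
    then have "p \<noteq> 0" using linear_0[OF g(2)] by auto
    then show "R (f x)" using P(3) fg[OF p(1)] p by auto
  qed
  ultimately show "d \<in> dim ` {P. subspace P \<and> P \<subseteq> V' \<and> (\<forall>x\<in>P - {0}. R (f x))}"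
    using dim_image_inj_on[OF g(2) P(1) inj] P(4) by (intro image_eqI[where x = "g ` P"]) auto
qed

text \<open>A definite subspace upstairs maps injectively because the kernel carries the value zero, and
  a definite subspace downstairs is lifted along a linear section.\<close>

lemma signature_pullback:
  fixes f :: "'v::real_vector \<Rightarrow> 'u::real_vector"
  assumes "linear f" "subspace V'" "f ` V' = V" "Q 0 = 0"
  shows "signature V' (\<lambda>x. Q (f x)) = signature V Q"
  using definite_dims_pullback[OF assms(1-3), of "\<lambda>x. Q x > 0"]
    definite_dims_pullback[OF assms(1-3), of "\<lambda>x. Q x < 0"] assms(4)
  by (simp add: signature_def)

definition finite_dim :: "'v::real_vector itself \<Rightarrow> bool" where
  "finite_dim _ \<longleftrightarrow> (\<exists>B :: 'v set. finite B \<and> span B = UNIV)"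

lemma finite_dim_basis:
  assumes "finite_dim TYPE('v::real_vector)"
  obtains B :: "'v::real_vector set" where "finite_dimensional_vector_space scaleR B"
proof -
  obtain B0 :: "'v set" where B0: "finite B0" "span B0 = UNIV"
    using assms by (auto simp: finite_dim_def)
  obtain B where B: "B \<subseteq> B0" "independent B" "B0 \<subseteq> span B"
    by (rule maximal_independent_subset)
  have "span B = UNIV" using B(3) B0(2) by (metis span_mono span_span top.extremum_uniqueI)
  then have "finite_dimensional_vector_space scaleR B"
    using B(2) finite_subset[OF B(1) B0(1)]
    by unfold_locales (auto simp: dependent_raw_def span_raw_def)
  then show thesis by (rule that)
qed

lemma finite_dim_prod:
  assumes "finite_dim TYPE('v::real_vector)" "finite_dim TYPE('u::real_vector)"
  shows "finite_dim TYPE('v::real_vector \<times> 'u::real_vector)"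
proof -
  obtain B :: "'v set" and C :: "'u set" where B: "finite B" "span B = UNIV" and C: "finite C" "span C = UNIV"
    using assms by (auto simp: finite_dim_def)
  let ?D = "(\<lambda>b. (b, 0)) ` B \<union> (\<lambda>c. (0, c)) ` C"
  have l: "linear (\<lambda>b::'v. (b, 0::'u))" "linear (\<lambda>c::'u. (0::'v, c))"
    by (auto intro!: linearI)
  have "(x, y) \<in> span ?D" for x y
  proof -
    have "(x, 0::'u) \<in> (\<lambda>b. (b, 0::'u)) ` span B" using B by simp
    then have 1: "(x, 0::'u) \<in> span ((\<lambda>b. (b, 0::'u)) ` B)"
      unfolding linear_span_image[OF l(1), of B] .
    have "(0::'v, y) \<in> (\<lambda>c. (0::'v, c)) ` span C" using C by simp
    then have 2: "(0::'v, y) \<in> span ((\<lambda>c. (0::'v, c)) ` C)"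
      unfolding linear_span_image[OF l(2), of C] .
    have "(x, 0::'u) + (0::'v, y) \<in> span ?D"
      using 1 2 span_mono[of _ ?D] by (intro span_add) blast+
    then show ?thesis by simp
  qed
  then have "span ?D = UNIV" by auto
  then show ?thesis unfolding finite_dim_def using B(1) C(1) by (intro exI[of _ ?D]) auto
qed

text \<open>The dimension count behind Sylvester's law: a positive definite subspace meets a complement of
  \<open>P\<close> on which the form is nonpositive only in zero.\<close>

lemma Max_definite_dim:
  fixes P K :: "'v::real_vector set"
  assumes fd: "finite_dim TYPE('v)" and P: "subspace P" and K: "subspace K"
    and PK: "\<And>x. \<exists>p\<in>P. \<exists>k\<in>K. x = p + k"
    and RP: "\<And>x. x \<in> P - {0} \<Longrightarrow> R x" and RK: "\<And>x. x \<in> K \<Longrightarrow> \<not> R x"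
  shows "Max (dim ` {P. subspace P \<and> P \<subseteq> UNIV \<and> (\<forall>x\<in>P - {0}. R x)}) = dim P"
proof (rule Max_eqI)
  obtain B :: "'v set" where B: "finite_dimensional_vector_space scaleR B"
    by (rule finite_dim_basis[OF fd])
  interpret fd: finite_dimensional_vector_space scaleR B
    rewrites "module.dependent (*\<^sub>R) = dependent"
    and "module.representation (*\<^sub>R) = representation"
    and "module.subspace (*\<^sub>R) = subspace"
    and "module.span (*\<^sub>R) = span"
    and "vector_space.extend_basis (*\<^sub>R) = extend_basis"
    and "vector_space.dim (*\<^sub>R) = dim"
    by (rule B, simp_all add: dependent_raw_def representation_raw_def
      subspace_raw_def span_raw_def extend_basis_raw_def dim_raw_def)
  show "finite (dim ` {P. subspace P \<and> P \<subseteq> UNIV \<and> (\<forall>x\<in>P - {0}. R x)})"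
    by (rule finite_subset[of _ "{..card B}"]) (use fd.dim_subset_UNIV fd.dimension_def in auto)
  show "dim P \<in> dim ` {P. subspace P \<and> P \<subseteq> UNIV \<and> (\<forall>x\<in>P - {0}. R x)}"
    using P RP by auto
  fix d assume "d \<in> dim ` {P. subspace P \<and> P \<subseteq> UNIV \<and> (\<forall>x\<in>P - {0}. R x)}"
  then obtain P' where P': "subspace P'" "\<forall>x\<in>P' - {0}. R x" "d = dim P'" by auto
  have "P' \<inter> K = {0}" using P' RK K by (auto simp: subspace_0)
  then have "dim {x + y |x y. x \<in> P' \<and> y \<in> K} = dim P' + dim K"
    using fd.dim_sums_Int[OF P'(1) K] by simp
  moreover have "dim {x + y |x y. x \<in> P' \<and> y \<in> K} \<le> dim (UNIV :: 'v set)"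
    by (rule fd.dim_subset) simp
  moreover have "{x + y |x y. x \<in> P \<and> y \<in> K} = UNIV" using PK by fastforce
  then have "dim (UNIV :: 'v set) + dim (P \<inter> K) = dim P + dim K"
    using fd.dim_sums_Int[OF P K] by simp
  ultimately show "d \<le> dim P" using P'(3) by simp
qed

definition bilinear_form :: "('v::real_vector \<Rightarrow> 'v \<Rightarrow> real) \<Rightarrow> bool" where
  "bilinear_form k \<longleftrightarrow> (\<forall>x. linear (k x)) \<and> (\<forall>y. linear (\<lambda>x. k x y))"

definition symmetric_form :: "('v::real_vector \<Rightarrow> 'v \<Rightarrow> real) \<Rightarrow> bool" where
  "symmetric_form k \<longleftrightarrow> bilinear_form k \<and> (\<forall>x y. k x y = k y x)"

lemma bilinear_formD:
  assumes "bilinear_form k"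
  shows "k (x + x') y = k x y + k x' y" "k x (y + y') = k x y + k x y'"
    "k (r *\<^sub>R x) y = r * k x y" "k x (r *\<^sub>R y) = r * k x y"
    "k 0 y = 0" "k x 0 = 0" "k (- x) y = - k x y" "k x (- y) = - k x y"
    "k (x - x') y = k x y - k x' y" "k x (y - y') = k x y - k x y'"
    "k (\<Sum>i\<in>A. f i) y = (\<Sum>i\<in>A. k (f i) y)" "k x (\<Sum>i\<in>A. f i) = (\<Sum>i\<in>A. k x (f i))"
proof -
  have 1: "linear (k x)" for x using assms by (simp add: bilinear_form_def)
  have 2: "linear (\<lambda>x. k x y)" for y using assms by (simp add: bilinear_form_def)
  show "k (x + x') y = k x y + k x' y" "k (r *\<^sub>R x) y = r * k x y" "k 0 y = 0" "k (- x) y = - k x y"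
    "k (x - x') y = k x y - k x' y" "k (\<Sum>i\<in>A. f i) y = (\<Sum>i\<in>A. k (f i) y)"
    using linear_add[OF 2] linear_scale[OF 2] linear_0[OF 2] linear_neg[OF 2] linear_diff[OF 2]
      linear_sum[OF 2] by auto
  show "k x (y + y') = k x y + k x y'" "k x (r *\<^sub>R y) = r * k x y" "k x 0 = 0" "k x (- y) = - k x y"
    "k x (y - y') = k x y - k x y'" "k x (\<Sum>i\<in>A. f i) = (\<Sum>i\<in>A. k x (f i))"
    using linear_add[OF 1] linear_scale[OF 1] linear_0[OF 1] linear_neg[OF 1] linear_diff[OF 1]
      linear_sum[OF 1] by auto
qed

text \<open>Vectors with a biorthogonal system of functionals are linearly independent, which bounds their
  number.\<close>

lemma biorthogonal_finite:
  fixes y :: "'i \<Rightarrow> 'v::real_vector"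
  assumes fd: "finite_dim TYPE('v)"
    and lin: "\<And>s. s \<in> A \<Longrightarrow> linear (f s :: 'v \<Rightarrow> real)"
    and d: "\<And>s. s \<in> A \<Longrightarrow> f s (y s) \<noteq> 0"
    and o: "\<And>s s'. s \<in> A \<Longrightarrow> s' \<in> A \<Longrightarrow> s \<noteq> s' \<Longrightarrow> f s (y s') = 0"
  shows "finite A"
proof -
  obtain B0 :: "'v set" where B0: "finite B0" "span B0 = UNIV"
    using fd by (auto simp: finite_dim_def)
  have inj: "inj_on y A" by (rule inj_onI) (metis d o)
  have "independent (y ` A)"
  proof (rule ccontr)
    assume "\<not> independent (y ` A)"
    then obtain T u v where T: "finite T" "T \<subseteq> y ` A" "v \<in> T" "u v \<noteq> 0" "(\<Sum>v\<in>T. u v *\<^sub>R v) = 0"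
      unfolding real_vector.dependent_explicit by blast
    obtain s where s: "s \<in> A" "v = y s" using T by auto
    have 0: "f s w = 0" if "w \<in> T" "w \<noteq> v" for w
      using that T(2) o s by (force simp: subset_iff image_iff)
    have "0 = f s (\<Sum>v\<in>T. u v *\<^sub>R v)" using T(5) linear_0[OF lin[OF s(1)]] by simp
    also have "\<dots> = (\<Sum>w\<in>T. u w * f s w)"
      by (simp add: linear_sum[OF lin[OF s(1)]] linear_scale[OF lin[OF s(1)]])
    also have "\<dots> = (\<Sum>w\<in>T. if w = v then u v * f s v else 0)"
      by (rule sum.cong) (use 0 in auto)
    also have "\<dots> = u v * f s v" using T(1,3) by simp
    finally show False using T(4) d s by simp
  qed
  then have "finite (y ` A)"
    using real_vector.independent_span_bound[OF B0(1), of "y ` A"] B0(2) by auto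
  then show ?thesis using inj finite_imageD by blast
qed

text \<open>A finite set of pairwise orthogonal anisotropic vectors that captures the rank of the form.\<close>

definition orthogonal_frame :: "('v::real_vector \<Rightarrow> 'v \<Rightarrow> real) \<Rightarrow> 'v set \<Rightarrow> bool" where
  "orthogonal_frame k C \<longleftrightarrow> finite C \<and> (\<forall>c\<in>C. k c c \<noteq> 0) \<and> (\<forall>c\<in>C. \<forall>d\<in>C. c \<noteq> d \<longrightarrow> k c d = 0) \<and>
     (\<forall>x. (\<forall>c\<in>C. k c x = 0) \<longrightarrow> (\<forall>y. k x y = 0))"

lemma finite_maximal_set:
  assumes "X {}" and bound: "\<And>C. X C \<Longrightarrow> finite C \<and> card C \<le> (K::nat)"
  obtains C where "X C" "\<And>c. c \<notin> C \<Longrightarrow> \<not> X (insert c C)"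
proof -
  obtain C where C: "X C" "\<And>D. X D \<Longrightarrow> card D \<le> card C"
    using ex_has_greatest_nat[of X "{}" card "Suc K"] assms(1) bound by (auto simp: less_Suc_eq_le)
  show thesis
  proof (rule that[OF C(1)])
    fix c assume "c \<notin> C"
    then show "\<not> X (insert c C)" using C(2)[of "insert c C"] bound[OF C(1)] by auto
  qed
qed

lemma biorthogonal_card:
  fixes C :: "'v::real_vector set"
  assumes B0: "finite B0" "span B0 = (UNIV :: 'v set)" and C: "finite C"
    and lin: "\<And>s. s \<in> C \<Longrightarrow> linear (f s :: 'v \<Rightarrow> real)"
    and d: "\<And>s. s \<in> C \<Longrightarrow> f s s \<noteq> 0"
    and o: "\<And>s s'. s \<in> C \<Longrightarrow> s' \<in> C \<Longrightarrow> s \<noteq> s' \<Longrightarrow> f s s' = 0"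
  shows "card C \<le> card B0"
proof -
  have "independent C"
  proof (rule real_vector.independent_if_scalars_zero[OF C])
    fix u x assume H: "(\<Sum>x\<in>C. u x *\<^sub>R x) = 0" "x \<in> C"
    have "0 = f x (\<Sum>x\<in>C. u x *\<^sub>R x)" using H linear_0[OF lin] by simp
    also have "\<dots> = (\<Sum>w\<in>C. u w * f x w)"
      by (simp add: linear_sum[OF lin[OF H(2)]] linear_scale[OF lin[OF H(2)]])
    also have "\<dots> = (\<Sum>w\<in>C. if w = x then u x * f x x else 0)"
      by (rule sum.cong) (use o H in auto)
    also have "\<dots> = u x * f x x" using H(2) C by simp
    finally show "u x = 0" using d[OF H(2)] by simp
  qed
  then show ?thesis using real_vector.independent_span_bound[OF B0(1), of C] B0(2) by auto
qed

lemma orthogonal_frame_exists: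
  fixes k :: "'v::real_vector \<Rightarrow> 'v \<Rightarrow> real"
  assumes fd: "finite_dim TYPE('v)" and k: "symmetric_form k"
  obtains C where "orthogonal_frame k C"
proof -
  note kb = bilinear_formD[OF k[unfolded symmetric_form_def, THEN conjunct1]]
  have sym: "k x y = k y x" for x y using k by (simp add: symmetric_form_def)
  obtain B0 :: "'v set" where B0: "finite B0" "span B0 = UNIV"
    using fd by (auto simp: finite_dim_def)
  define X where "X C \<longleftrightarrow> finite C \<and> (\<forall>c\<in>C. k c c \<noteq> 0) \<and> (\<forall>c\<in>C. \<forall>d\<in>C. c \<noteq> d \<longrightarrow> k c d = 0)" for C
  have lin: "linear (k x)" for x using k by (simp add: symmetric_form_def bilinear_form_def)
  have "X {}" by (simp add: X_def)
  moreover have "finite C \<and> card C \<le> card B0" if "X C" for C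
    using that biorthogonal_card[OF B0, of C k] lin by (auto simp: X_def)
  ultimately obtain C where C: "X C" "\<And>c. c \<notin> C \<Longrightarrow> \<not> X (insert c C)"
    using finite_maximal_set[of X "card B0"] by metis
  \<comment> \<open>A maximal orthogonal set leaves a totally isotropic complement, and polarisation then makes the
    form vanish on it.\<close>
  have iso: "k x x = 0" if "\<forall>c\<in>C. k c x = 0" for x
  proof (rule ccontr)
    assume "k x x \<noteq> 0"
    then have "x \<notin> C" "X (insert x C)" using that C(1) sym by (auto simp: X_def)
    then show False using C(2) by blast
  qed
  have "k x y = 0" if x: "\<forall>c\<in>C. k c x = 0" for x y
  proof -
    define z where "z = y - (\<Sum>c\<in>C. (k c y / k c c) *\<^sub>R c)"
    have z: "\<forall>c\<in>C. k c z = 0"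
    proof
      fix c assume c: "c \<in> C"
      have "(\<Sum>d\<in>C. (k d y / k d d) * k c d) = (\<Sum>d\<in>C. if d = c then k c y else 0)"
        by (rule sum.cong) (use C(1) c in \<open>auto simp: X_def\<close>)
      also have "\<dots> = k c y" using C(1) c by (simp add: X_def)
      finally show "k c z = 0" by (simp add: z_def kb)
    qed
    have "k (x + z) (x + z) = 0" using x z by (intro iso) (simp add: kb)
    then have "k x z = 0" using iso[OF x] iso[OF z] sym[of x z] by (simp add: kb)
    moreover have "k x (\<Sum>c\<in>C. (k c y / k c c) *\<^sub>R c) = 0"
      using x sym[of x] by (simp add: kb)
    ultimately show "k x y = 0" by (simp add: z_def kb)
  qed
  then show thesis using that[of C] C(1) by (auto simp: orthogonal_frame_def X_def)
qed

lemma Max_definite_dim_orthogonal: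
  fixes k :: "'v::real_vector \<Rightarrow> 'v \<Rightarrow> real"
  assumes fd: "finite_dim TYPE('v)" and k: "symmetric_form k" and C: "orthogonal_frame k C"
  shows "Max (dim ` {P. subspace P \<and> P \<subseteq> UNIV \<and> (\<forall>x\<in>P - {0}. k x x > 0)}) = card {c\<in>C. k c c > 0}"
proof -
  note kb = bilinear_formD[OF k[unfolded symmetric_form_def, THEN conjunct1]]
  have sym: "k x y = k y x" for x y using k by (simp add: symmetric_form_def)
  have lin: "linear (k x)" for x using k by (simp add: symmetric_form_def bilinear_form_def)
  have fC: "finite C" and dC: "\<And>c. c \<in> C \<Longrightarrow> k c c \<noteq> 0"
    and oC: "\<And>c d. c \<in> C \<Longrightarrow> d \<in> C \<Longrightarrow> c \<noteq> d \<Longrightarrow> k c d = 0"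
    and rC: "\<And>x y. (\<forall>c\<in>C. k c x = 0) \<Longrightarrow> k x y = 0"
    using C unfolding orthogonal_frame_def by blast+
  define C1 where "C1 = {c\<in>C. k c c > 0}"
  define K where "K = {x. \<forall>c\<in>C1. k c x = 0}"
  have f1: "finite C1" using fC by (simp add: C1_def)
  have ind: "independent C1"
  proof (rule real_vector.independent_if_scalars_zero[OF f1])
    fix u x assume H: "(\<Sum>x\<in>C1. u x *\<^sub>R x) = 0" "x \<in> C1"
    have "0 = k x (\<Sum>x\<in>C1. u x *\<^sub>R x)" using H by (simp add: kb)
    also have "\<dots> = (\<Sum>w\<in>C1. if w = x then u x * k x x else 0)"
      unfolding kb by (rule sum.cong) (use oC H in \<open>auto simp: C1_def\<close>)
    also have "\<dots> = u x * k x x" using H(2) f1 by simp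
    finally show "u x = 0" using H(2) by (auto simp: C1_def)
  qed
  \<comment> \<open>Expanding a vector along the frame makes the form a weighted sum of squares.\<close>
  have sq: "k x x = (\<Sum>c\<in>C. (k c x)\<^sup>2 / k c c)" for x
  proof -
    define z where "z = x - (\<Sum>c\<in>C. (k c x / k c c) *\<^sub>R c)"
    have z: "\<forall>c\<in>C. k c z = 0"
    proof
      fix c assume c: "c \<in> C"
      have "(\<Sum>d\<in>C. (k d x / k d d) * k c d) = (\<Sum>d\<in>C. if d = c then k c x else 0)"
        by (rule sum.cong) (use dC oC c in auto)
      also have "\<dots> = k c x" using fC c by simp
      finally show "k c z = 0" by (simp add: z_def kb)
    qed
    have "k x z = 0" using rC[OF z] sym by metis
    then have "k x x = k x (\<Sum>c\<in>C. (k c x / k c c) *\<^sub>R c)" by (simp add: z_def kb)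
    also have "\<dots> = (\<Sum>c\<in>C. (k c x)\<^sup>2 / k c c)"
      by (simp add: kb sym[of x] power2_eq_square)
    finally show ?thesis .
  qed
  have "Max (dim ` {P. subspace P \<and> P \<subseteq> UNIV \<and> (\<forall>x\<in>P - {0}. k x x > 0)}) = dim (span C1)"
  proof (rule Max_definite_dim[OF fd, of _ K])
    show "subspace (span C1)" by simp
    show "subspace K" unfolding K_def by (auto simp: subspace_def kb)
    show "\<exists>p\<in>span C1. \<exists>q\<in>K. x = p + q" for x
    proof (intro bexI)
      let ?p = "\<Sum>c\<in>C1. (k c x / k c c) *\<^sub>R c"
      show "?p \<in> span C1" by (intro span_sum span_scale span_base)
      have "k c (x - ?p) = 0" if c: "c \<in> C1" for c
      proof -
        have "(\<Sum>d\<in>C1. (k d x / k d d) * k c d) = (\<Sum>d\<in>C1. if d = c then k c x else 0)"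
          by (rule sum.cong) (use oC c in \<open>auto simp: C1_def\<close>)
        also have "\<dots> = k c x" using f1 c by simp
        finally show ?thesis by (simp add: kb)
      qed
      then show "x - ?p \<in> K" by (simp add: K_def)
      show "x = ?p + (x - ?p)" by simp
    qed
    show "k x x > 0" if x: "x \<in> span C1 - {0}" for x
    proof -
      obtain u where u: "x = (\<Sum>c\<in>C1. u c *\<^sub>R c)"
        using x span_finite[OF f1] by auto
      have kcx: "k c x = (if c \<in> C1 then u c * k c c else 0)" if c: "c \<in> C" for c
      proof -
        have "k c x = (\<Sum>d\<in>C1. if d = c then u c * k c c else 0)"
          unfolding u kb by (rule sum.cong) (use oC c in \<open>auto simp: C1_def\<close>)
        then show ?thesis using f1 by simp
      qed
      have "\<exists>c\<in>C1. u c \<noteq> 0"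
      proof (rule ccontr)
        assume "\<not> (\<exists>c\<in>C1. u c \<noteq> 0)"
        then have "x = 0" unfolding u by (intro sum.neutral) auto
        then show False using x by simp
      qed
      then obtain c where c: "c \<in> C1" "u c \<noteq> 0" by blast
      show "k x x > 0" unfolding sq[of x]
      proof (rule sum_pos2[OF fC])
        show "c \<in> C" using c by (simp add: C1_def)
        show "0 < (k c x)\<^sup>2 / k c c" using c kcx[of c] by (auto simp: C1_def)
        show "0 \<le> (k d x)\<^sup>2 / k d d" if "d \<in> C" for d
          using kcx[OF that] by (auto simp: C1_def)
      qed
    qed
    show "\<not> k x x > 0" if x: "x \<in> K" for x
    proof -
      have "(k c x)\<^sup>2 / k c c \<le> 0" if "c \<in> C" for c
        using x that dC[OF that] by (cases "k c c > 0") (auto simp: K_def C1_def divide_nonneg_neg)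
      then have "k x x \<le> 0" unfolding sq[of x] by (intro sum_nonpos) auto
      then show ?thesis by simp
    qed
  qed
  then show ?thesis using dim_span_eq_card_independent[OF ind] by (simp add: C1_def)
qed

lemma signature_orthogonal:
  fixes k :: "'v::real_vector \<Rightarrow> 'v \<Rightarrow> real"
  assumes fd: "finite_dim TYPE('v)" and k: "symmetric_form k" and C: "orthogonal_frame k C"
  shows "signature UNIV (\<lambda>x. k x x) = int (card {c\<in>C. k c c > 0}) - int (card {c\<in>C. k c c < 0})"
proof -
  have k': "symmetric_form (\<lambda>x y. - k x y)"
    using k unfolding symmetric_form_def bilinear_form_def by (auto intro: linear_compose_neg)
  have C': "orthogonal_frame (\<lambda>x y. - k x y) C" using C by (auto simp: orthogonal_frame_def)
  show ?thesis
    unfolding signature_def Max_definite_dim_orthogonal[OF fd k C]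
    using Max_definite_dim_orthogonal[OF fd k' C'] by simp
qed

lemma signature_prod:
  fixes k :: "'v::real_vector \<Rightarrow> 'v \<Rightarrow> real" and l :: "'u::real_vector \<Rightarrow> 'u \<Rightarrow> real"
  assumes fd: "finite_dim TYPE('v)" "finite_dim TYPE('u)" and k: "symmetric_form k" and l: "symmetric_form l"
  shows "signature UNIV (\<lambda>x. k (fst x) (fst x) + l (snd x) (snd x))
       = signature UNIV (\<lambda>x. k x x) + signature UNIV (\<lambda>x. l x x)"
proof -
  obtain C D where C: "orthogonal_frame k C" and D: "orthogonal_frame l D"
    using orthogonal_frame_exists[OF fd(1) k] orthogonal_frame_exists[OF fd(2) l] by metis
  note kb = bilinear_formD[OF k[unfolded symmetric_form_def, THEN conjunct1]]
  note lb = bilinear_formD[OF l[unfolded symmetric_form_def, THEN conjunct1]]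
  let ?h = "\<lambda>x y. k (fst x) (fst y) + l (snd x) (snd y)"
  let ?E = "(\<lambda>c. (c, 0)) ` C \<union> (\<lambda>d. (0, d)) ` D"
  have h: "symmetric_form ?h"
    using k l unfolding symmetric_form_def bilinear_form_def
    by (auto intro!: linearI simp: kb lb algebra_simps)
  have E: "orthogonal_frame ?h ?E"
    using C D unfolding orthogonal_frame_def by (auto simp: kb lb ball_Un)
  have k0: "k 0 0 = 0" "l 0 0 = 0" by (simp_all add: kb lb)
  have fC: "finite C" "finite D" using C D by (auto simp: orthogonal_frame_def)
  have n0: "0 \<notin> C" "0 \<notin> D" using C D k0 by (auto simp: orthogonal_frame_def)
  have cards: "card {c\<in>?E. R (?h c c)} = card {c\<in>C. R (k c c)} + card {d\<in>D. R (l d d)}" for R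
  proof -
    have "{c\<in>?E. R (?h c c)} = (\<lambda>c. (c, 0)) ` {c\<in>C. R (k c c)} \<union> (\<lambda>d. (0, d)) ` {d\<in>D. R (l d d)}"
      using k0 by auto
    moreover have "card \<dots> = card ((\<lambda>c. (c, 0::'u)) ` {c\<in>C. R (k c c)}) + card ((\<lambda>d. (0::'v, d)) ` {d\<in>D. R (l d d)})"
      by (rule card_Un_disjoint) (use fC n0 in auto)
    ultimately show ?thesis by (simp add: card_image inj_on_def)
  qed
  show ?thesis
    using signature_orthogonal[OF finite_dim_prod[OF fd] h E] cards[of "\<lambda>r. r > 0"] cards[of "\<lambda>r. r < 0"]
      signature_orthogonal[OF fd(1) k C] signature_orthogonal[OF fd(2) l D]
    by simp
qed

section \<open>Lagrangian frames and the Leray signature\<close>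

locale symplectic =
  fixes S :: "('w::real_vector) symplectic_datum"
  assumes bil: "bilinear_form (sform S)"
    and alt: "sform S x y = - sform S y x"
    and frame: "symplectic_frame S"
    and nontrivial: "half_dim S > 0"
begin

abbreviation om :: "'w \<Rightarrow> 'w \<Rightarrow> real" where "om \<equiv> sform S"
abbreviation m :: nat where "m \<equiv> half_dim S"
abbreviation ee :: "nat \<Rightarrow> 'w" where "ee j \<equiv> sbasis S (Suc j)"
abbreviation ff :: "nat \<Rightarrow> 'w" where "ff j \<equiv> sbasis' S (Suc j)"

lemmas omb = bilinear_formD[OF bil]

lemma lin_om: "linear (om x)" "linear (\<lambda>x. om x y)"
  using bil by (auto simp: bilinear_form_def)

lemma om_self [simp]: "om x x = 0"
  using alt[of x x] by simp

lemma om_basis: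
  assumes "i < m" "j < m"
  shows "om (ee i) (ee j) = 0" "om (ff i) (ff j) = 0"
    "om (ee i) (ff j) = (if i = j then 1 else 0)" "om (ff i) (ee j) = (if i = j then -1 else 0)"
proof -
  have "Suc i \<in> {1..m}" "Suc j \<in> {1..m}" using assms by auto
  then show "om (ee i) (ee j) = 0" "om (ff i) (ff j) = 0" and 1: "om (ee i) (ff j) = (if i = j then 1 else 0)"
    using frame by (auto simp: symplectic_frame_def)
  show "om (ff i) (ee j) = (if i = j then -1 else 0)"
    using \<open>Suc i \<in> {1..m}\<close> \<open>Suc j \<in> {1..m}\<close> frame alt[of "ff i" "ee j"]
    by (auto simp: symplectic_frame_def)
qed

lemma frame_image: "sbasis S ` {1..m} = ee ` {..<m}" "sbasis' S ` {1..m} = ff ` {..<m}"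
proof -
  have "{1..m} = Suc ` {..<m}" by (simp add: lessThan_atLeast0 image_Suc_atLeastLessThan atLeastLessThanSuc_atLeastAtMost)
  then show "sbasis S ` {1..m} = ee ` {..<m}" "sbasis' S ` {1..m} = ff ` {..<m}"
    by (auto simp: image_image)
qed

lemma span_frame: "span (ee ` {..<m} \<union> ff ` {..<m}) = UNIV"
  using frame unfolding symplectic_frame_def frame_image by blast

lemma finite_dim_W: "finite_dim TYPE('w)"
  unfolding finite_dim_def using span_frame by (intro exI[of _ "ee ` {..<m} \<union> ff ` {..<m}"]) simp

lemma expand: "x = (\<Sum>j<m. om x (ff j) *\<^sub>R ee j) - (\<Sum>j<m. om x (ee j) *\<^sub>R ff j)"
proof -
  let ?g = "\<lambda>x. (\<Sum>j<m. om x (ff j) *\<^sub>R ee j) - (\<Sum>j<m. om x (ee j) *\<^sub>R ff j)"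
  have lin: "linear ?g"
    by (rule linearI) (simp_all add: omb algebra_simps sum.distrib scaleR_sum_right)
  have "id x = ?g x"
  proof (rule linear_eq_on_span[OF linear_id lin])
    show "x \<in> span (ee ` {..<m} \<union> ff ` {..<m})" by (simp add: span_frame)
    fix y assume "y \<in> ee ` {..<m} \<union> ff ` {..<m}"
    then consider i where "i < m" "y = ee i" | i where "i < m" "y = ff i" by auto
    then show "id y = ?g y"
    proof cases
      case 1
      have "(\<Sum>j<m. om y (ff j) *\<^sub>R ee j) = (\<Sum>j<m. if j = i then ee i else 0)"
        by (rule sum.cong) (use 1 in \<open>auto simp: om_basis\<close>)
      moreover have "(\<Sum>j<m. om y (ee j) *\<^sub>R ff j) = 0"
        by (rule sum.neutral) (use 1 in \<open>auto simp: om_basis\<close>)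
      ultimately show ?thesis using 1 by simp
    next
      case 2
      have "(\<Sum>j<m. om y (ee j) *\<^sub>R ff j) = (\<Sum>j<m. if j = i then - ff i else 0)"
        by (rule sum.cong) (use 2 in \<open>auto simp: om_basis\<close>)
      moreover have "(\<Sum>j<m. om y (ff j) *\<^sub>R ee j) = 0"
        by (rule sum.neutral) (use 2 in \<open>auto simp: om_basis\<close>)
      ultimately show ?thesis using 2 by simp
    qed
  qed
  then show ?thesis by simp
qed

lemma nondegenerate: "(\<And>y. om x y = 0) \<Longrightarrow> x = 0"
  by (subst expand) simp

definition lspan :: "(nat \<Rightarrow> 'w) \<Rightarrow> 'w set" where
  "lspan b = {\<Sum>i<m. c i *\<^sub>R b i | c. True}"

lemma lspanI: "x = (\<Sum>i<m. c i *\<^sub>R b i) \<Longrightarrow> x \<in> lspan b"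
  unfolding lspan_def by (rule CollectI, rule exI[of _ c]) simp

lemma subspace_lspan: "subspace (lspan b)"
  unfolding subspace_def
proof (intro conjI ballI allI)
  show "0 \<in> lspan b" unfolding lspan_def by (rule CollectI, rule exI[of _ "\<lambda>_. 0"]) simp
  fix x y assume "x \<in> lspan b" "y \<in> lspan b"
  then obtain c d where "x = (\<Sum>i<m. c i *\<^sub>R b i)" "y = (\<Sum>i<m. d i *\<^sub>R b i)"
    by (auto simp: lspan_def)
  then have "x + y = (\<Sum>i<m. (c i + d i) *\<^sub>R b i)" by (simp add: sum.distrib scaleR_add_left)
  then show "x + y \<in> lspan b" by (rule lspanI)
next
  fix r x assume "x \<in> lspan b"
  then obtain c where "x = (\<Sum>i<m. c i *\<^sub>R b i)" by (auto simp: lspan_def)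
  then have "r *\<^sub>R x = (\<Sum>i<m. (r * c i) *\<^sub>R b i)" by (simp add: scaleR_sum_right)
  then show "r *\<^sub>R x \<in> lspan b" by (rule lspanI)
qed

lemma lspan_base: "i < m \<Longrightarrow> b i \<in> lspan b"
  unfolding lspan_def by (rule CollectI, rule exI[of _ "\<lambda>j. if j = i then 1 else 0"])
    (simp add: if_distrib[of "\<lambda>r. r *\<^sub>R _"] cong: if_cong)

lemma lspan_eq_span: "lspan b = span (b ` {..<m})"
proof
  show "lspan b \<subseteq> span (b ` {..<m})"
    unfolding lspan_def by (auto intro!: span_sum span_scale intro: span_base)
  show "span (b ` {..<m}) \<subseteq> lspan b"
    by (rule span_minimal[OF _ subspace_lspan]) (auto intro: lspan_base)
qed

lemma lspan_image:
  assumes "linear h"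
  shows "lspan (\<lambda>i. h (b i)) = h ` lspan b"
proof -
  have h: "h (\<Sum>i<m. c i *\<^sub>R b i) = (\<Sum>i<m. c i *\<^sub>R h (b i))" for c
    using assms by (simp add: linear_sum linear_scale)
  show ?thesis
  proof (intro equalityI subsetI)
    fix x assume "x \<in> lspan (\<lambda>i. h (b i))"
    then obtain c where "x = h (\<Sum>i<m. c i *\<^sub>R b i)" by (auto simp: lspan_def h)
    then show "x \<in> h ` lspan b" using lspanI[OF refl] by blast
  next
    fix x assume "x \<in> h ` lspan b"
    then obtain c where "x = h (\<Sum>i<m. c i *\<^sub>R b i)" by (auto simp: lspan_def)
    then show "x \<in> lspan (\<lambda>i. h (b i))" unfolding h by (rule lspanI)
  qed
qed

definition lframe :: "(nat \<Rightarrow> 'w) \<Rightarrow> bool" where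
  "lframe b \<longleftrightarrow> (\<forall>i<m. \<forall>j<m. om (b i) (b j) = 0) \<and>
     (\<forall>c. (\<Sum>i<m. c i *\<^sub>R b i) = 0 \<longrightarrow> (\<forall>i<m. c i = 0))"

lemma lframe_isotropic:
  assumes "lframe b" "x \<in> lspan b" "y \<in> lspan b"
  shows "om x y = 0"
  using assms by (auto simp: lspan_def lframe_def omb intro!: sum.neutral)

definition gdet :: "(nat \<Rightarrow> 'w) \<Rightarrow> (nat \<Rightarrow> 'w) \<Rightarrow> real" where
  "gdet b b' = fdet m (\<lambda>i j. om (b i) (b' j))"

lemma gdet_swap: "gdet b' b = (-1) ^ m * gdet b b'"
proof -
  have "gdet b' b = fdet m (\<lambda>i j. - 1 * om (b j) (b' i))"
    unfolding gdet_def by (rule fdet_cong) (simp add: alt[of "b' _"])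
  also have "\<dots> = (-1) ^ m * fdet m (\<lambda>i j. om (b j) (b' i))" by (rule fdet_scale)
  also have "fdet m (\<lambda>i j. om (b j) (b' i)) = gdet b b'"
    unfolding gdet_def by (rule fdet_transpose)
  finally show ?thesis .
qed

lemma gdet_change:
  assumes "\<And>j. j < m \<Longrightarrow> c j = (\<Sum>i<m. a i j *\<^sub>R b i)"
  shows "gdet c b' = fdet m a * gdet b b'" "gdet b' c = gdet b' b * fdet m a"
proof -
  have "gdet c b' = fdet m (\<lambda>i j. \<Sum>k<m. a k i * om (b k) (b' j))"
    unfolding gdet_def by (rule fdet_cong) (simp add: assms omb)
  also have "\<dots> = fdet m (\<lambda>i j. a j i) * fdet m (\<lambda>k j. om (b k) (b' j))"
    by (rule fdet_mult)
  finally show "gdet c b' = fdet m a * gdet b b'"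
    by (simp add: gdet_def fdet_transpose[of m a])
  have "gdet b' c = fdet m (\<lambda>i j. \<Sum>k<m. om (b' i) (b k) * a k j)"
    unfolding gdet_def by (rule fdet_cong) (simp add: assms omb mult.commute)
  also have "\<dots> = gdet b' b * fdet m a" unfolding gdet_def by (rule fdet_mult)
  finally show "gdet b' c = gdet b' b * fdet m a" .
qed

text \<open>A pencil of Lagrangians, pairwise transversal; almost every member is transversal to a given Lagrangian.\<close>

definition tt :: "real \<Rightarrow> nat \<Rightarrow> 'w" where
  "tt s j = ff j + s *\<^sub>R ee j"

lemma om_tt: "i < m \<Longrightarrow> j < m \<Longrightarrow> om (tt s i) (tt s' j) = (if i = j then s - s' else 0)"
  by (simp add: tt_def omb om_basis)

lemma lframe_tt: "lframe (tt s)"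
proof -
  have "c j = 0" if c: "(\<Sum>i<m. c i *\<^sub>R tt s i) = 0" and j: "j < m" for c j
  proof -
    have "0 = om (ee j) (\<Sum>i<m. c i *\<^sub>R tt s i)" using c by (simp add: omb)
    also have "\<dots> = (\<Sum>i<m. if i = j then c j else 0)"
      unfolding omb by (rule sum.cong) (use j in \<open>auto simp: tt_def omb om_basis\<close>)
    finally show ?thesis using j by simp
  qed
  then show ?thesis by (simp add: lframe_def om_tt)
qed

lemma orthogonal_tt:
  assumes "\<And>j. j < m \<Longrightarrow> om x (tt s j) = 0"
  shows "x = (\<Sum>j<m. (- om x (ee j)) *\<^sub>R tt s j)"
proof -
  have "om x (ff j) = - s * om x (ee j)" if "j < m" for j
    using assms[OF that] by (simp add: tt_def omb)
  then have 1: "(\<Sum>j<m. om x (ff j) *\<^sub>R ee j) = (\<Sum>j<m. (- om x (ee j)) *\<^sub>R (s *\<^sub>R ee j))"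
    by (intro sum.cong) auto
  have "x = (\<Sum>j<m. (- om x (ee j)) *\<^sub>R (s *\<^sub>R ee j)) - (\<Sum>j<m. om x (ee j) *\<^sub>R ff j)"
    using expand[of x] unfolding 1 .
  also have "\<dots> = (\<Sum>j<m. (- om x (ee j)) *\<^sub>R tt s j)"
    by (simp add: tt_def scaleR_add_right sum.distrib sum_negf sum_subtractf)
  finally show ?thesis .
qed

lemma orthogonal_tt_lspan: "(\<And>j. j < m \<Longrightarrow> om x (tt s j) = 0) \<Longrightarrow> x \<in> lspan (tt s)"
  by (rule lspanI[OF orthogonal_tt])

text \<open>For two values of \<open>s\<close> at which \<open>b\<close> fails to be transversal to \<open>tt s\<close>, isotropy of \<open>b\<close> forces the
  coefficient vectors of the common elements to be orthogonal; so only finitely many \<open>s\<close> fail.\<close>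

lemma finite_nontransversal:
  assumes b: "lframe b"
  shows "finite {s. gdet b (tt s) = 0}"
proof -
  let ?A = "{s. gdet b (tt s) = 0}"
  have "\<exists>x. x \<in> lspan b \<and> x \<noteq> 0 \<and> (\<forall>j<m. om x (tt s j) = 0)" if "s \<in> ?A" for s
  proof -
    have "\<exists>c. (\<exists>i<m. c i \<noteq> 0) \<and> (\<forall>j<m. (\<Sum>i<m. c i * om (b i) (tt s j)) = 0)"
      using that by (simp only: gdet_def mem_Collect_eq fdet_eq_0_iff_row)
    then obtain c where c0: "(\<exists>i<m. c i \<noteq> 0) \<and> (\<forall>j<m. (\<Sum>i<m. c i * om (b i) (tt s j)) = 0)"
      by (rule exE)
    note c = c0[THEN conjunct1] c0[THEN conjunct2]
    have "(\<Sum>i<m. c i *\<^sub>R b i) \<noteq> 0" using c(1) b by (auto simp: lframe_def)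
    then show ?thesis using c(2)
      by (intro exI[of _ "\<Sum>i<m. c i *\<^sub>R b i"]) (auto simp: lspan_def omb)
  qed
  then obtain x where x: "\<And>s. s \<in> ?A \<Longrightarrow> x s \<in> lspan b"
    "\<And>s. s \<in> ?A \<Longrightarrow> x s \<noteq> 0" "\<And>s j. s \<in> ?A \<Longrightarrow> j < m \<Longrightarrow> om (x s) (tt s j) = 0" by metis
  define \<beta> where "\<beta> s j = - om (x s) (ee j)" for s j
  have xb: "x s = (\<Sum>j<m. \<beta> s j *\<^sub>R tt s j)" if "s \<in> ?A" for s
    unfolding \<beta>_def using orthogonal_tt[OF x(3)[OF that]] by simp
  have ip: "om (\<Sum>j<m. \<beta> s j *\<^sub>R ee j) (\<Sum>j<m. \<beta> s' j *\<^sub>R ff j) = (\<Sum>j<m. \<beta> s j * \<beta> s' j)" for s s'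
    unfolding omb
    by (intro sum.cong refl) (simp add: om_basis if_distrib[of "\<lambda>r. _ * r"] mult.commute cong: if_cong)
  show ?thesis
  proof (rule biorthogonal_finite[OF finite_dim_W, where f = "\<lambda>s. om (\<Sum>j<m. \<beta> s j *\<^sub>R ee j)"
        and y = "\<lambda>s. \<Sum>j<m. \<beta> s j *\<^sub>R ff j"])
    show "linear (om (\<Sum>j<m. \<beta> s j *\<^sub>R ee j))" for s by (rule lin_om)
    show "om (\<Sum>j<m. \<beta> s j *\<^sub>R ee j) (\<Sum>j<m. \<beta> s j *\<^sub>R ff j) \<noteq> 0" if "s \<in> ?A" for s
    proof
      assume "om (\<Sum>j<m. \<beta> s j *\<^sub>R ee j) (\<Sum>j<m. \<beta> s j *\<^sub>R ff j) = 0"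
      then have "\<forall>j<m. \<beta> s j = 0" unfolding ip by (subst (asm) sum_nonneg_eq_0_iff) auto
      then have "x s = 0" using xb[OF that] by simp
      then show False using x(2)[OF that] by simp
    qed
    show "om (\<Sum>j<m. \<beta> s j *\<^sub>R ee j) (\<Sum>j<m. \<beta> s' j *\<^sub>R ff j) = 0"
      if "s \<in> ?A" "s' \<in> ?A" "s \<noteq> s'" for s s'
    proof -
      have "0 = om (x s) (x s')" using lframe_isotropic[OF b x(1) x(1)] that by simp
      also have "\<dots> = om (\<Sum>j<m. \<beta> s j *\<^sub>R tt s j) (\<Sum>j<m. \<beta> s' j *\<^sub>R tt s' j)"
        using xb that by simp
      also have "\<dots> = (\<Sum>j<m. (s - s') * (\<beta> s j * \<beta> s' j))"
        unfolding omb
        by (intro sum.cong refl) (simp add: om_tt if_distrib[of "\<lambda>r. _ * r"] mult.commute mult.left_commute cong: if_cong)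
      finally have "(s - s') * (\<Sum>j<m. \<beta> s j * \<beta> s' j) = 0" by (simp add: sum_distrib_left)
      then show ?thesis unfolding ip using that by simp
    qed
  qed
qed

lemma transversal_exists:
  assumes "finite F" "\<And>b. b \<in> F \<Longrightarrow> lframe b"
  obtains s where "\<And>b. b \<in> F \<Longrightarrow> gdet b (tt s) \<noteq> 0"
proof -
  have "finite (\<Union>b\<in>F. {s. gdet b (tt s) = 0})"
    using assms finite_nontransversal by auto
  then obtain s where "s \<notin> (\<Union>b\<in>F. {s. gdet b (tt s) = 0})"
    using ex_new_if_finite[OF infinite_UNIV_char_0] by blast
  then show thesis using that by auto
qed

text \<open>The point of the Lagrangian \<open>b\<close> that differs from \<open>w\<close> by an element of the transversal Lagrangian \<open>tt s\<close>.\<close>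

definition prj :: "real \<Rightarrow> (nat \<Rightarrow> 'w) \<Rightarrow> 'w \<Rightarrow> 'w" where
  "prj s b w = (THE x. x \<in> lspan b \<and> (\<forall>j<m. om x (tt s j) = om w (tt s j)))"

context
  fixes s b
  assumes b: "lframe b" and ts: "gdet b (tt s) \<noteq> 0"
begin

lemma transversal_zero:
  assumes "x \<in> lspan b" "\<And>j. j < m \<Longrightarrow> om x (tt s j) = 0"
  shows "x = 0"
proof -
  obtain c where c: "x = (\<Sum>i<m. c i *\<^sub>R b i)" using assms(1) by (auto simp: lspan_def)
  have "\<forall>j<m. (\<Sum>i<m. c i * om (b i) (tt s j)) = 0" using assms(2) by (simp add: c omb)
  then have "\<forall>i<m. c i = 0" using ts unfolding gdet_def fdet_eq_0_iff_row by blast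
  then show ?thesis by (simp add: c)
qed

lemma prj_props: "prj s b w \<in> lspan b" "j < m \<Longrightarrow> om (prj s b w) (tt s j) = om w (tt s j)"
proof -
  obtain g where g: "\<And>i j. i < m \<Longrightarrow> j < m \<Longrightarrow> (\<Sum>k<m. g i k * om (b k) (tt s j)) = (if i = j then 1 else 0)"
    using fdet_inverse[OF ts[unfolded gdet_def]] by metis
  let ?x = "\<Sum>i<m. (\<Sum>l<m. om w (tt s l) * g l i) *\<^sub>R b i"
  have x: "om ?x (tt s j) = om w (tt s j)" if j: "j < m" for j
  proof -
    have "om ?x (tt s j) = (\<Sum>i<m. \<Sum>l<m. om w (tt s l) * (g l i * om (b i) (tt s j)))"
      by (simp add: omb sum_distrib_right mult.assoc)
    also have "\<dots> = (\<Sum>l<m. om w (tt s l) * (\<Sum>i<m. g l i * om (b i) (tt s j)))"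
      by (subst sum.swap) (simp add: sum_distrib_left)
    also have "\<dots> = (\<Sum>l<m. if l = j then om w (tt s j) else 0)"
      by (rule sum.cong) (use j g in auto)
    finally show ?thesis using j by simp
  qed
  have xl: "?x \<in> lspan b" by (auto simp: lspan_def)
  have "prj s b w \<in> lspan b \<and> (\<forall>j<m. om (prj s b w) (tt s j) = om w (tt s j))"
    unfolding prj_def
  proof (rule theI)
    show "?x \<in> lspan b \<and> (\<forall>j<m. om ?x (tt s j) = om w (tt s j))" using x xl by blast
    fix y assume y: "y \<in> lspan b \<and> (\<forall>j<m. om y (tt s j) = om w (tt s j))"
    then have "y - ?x = 0"
      using x xl by (intro transversal_zero) (auto simp: omb intro: subspace_diff[OF subspace_lspan])
    then show "y = ?x" by simp
  qed
  then show "prj s b w \<in> lspan b" "j < m \<Longrightarrow> om (prj s b w) (tt s j) = om w (tt s j)" by auto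
qed

lemma prj_unique:
  assumes "x \<in> lspan b" "\<And>j. j < m \<Longrightarrow> om x (tt s j) = om w (tt s j)"
  shows "prj s b w = x"
proof -
  have "prj s b w - x = 0"
    using assms prj_props
    by (intro transversal_zero) (auto simp: omb intro: subspace_diff[OF subspace_lspan])
  then show ?thesis by simp
qed

lemma prj_id: "x \<in> lspan b \<Longrightarrow> prj s b x = x"
  by (rule prj_unique) auto

lemma range_prj: "range (prj s b) = lspan b"
  using prj_props(1) prj_id by (metis (no_types, lifting) UNIV_I image_iff subset_antisym subsetI)

lemma linear_prj: "linear (prj s b)"
proof (rule linearI)
  show "prj s b (x + y) = prj s b x + prj s b y" for x y
    by (rule prj_unique) (auto simp: omb prj_props intro: subspace_add[OF subspace_lspan])
  show "prj s b (r *\<^sub>R x) = r *\<^sub>R prj s b x" for r x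
    by (rule prj_unique) (auto simp: omb prj_props intro: subspace_scale[OF subspace_lspan])
qed

lemma prj_om: "x \<in> lspan (tt s) \<Longrightarrow> om (prj s b w) x = om w x"
  by (auto simp: lspan_def omb prj_props intro!: sum.cong)

lemma prj_diff: "prj s b w - w \<in> lspan (tt s)"
  by (rule orthogonal_tt_lspan) (simp add: omb prj_props)

end

definition kform :: "real \<Rightarrow> (nat \<Rightarrow> 'w) \<Rightarrow> (nat \<Rightarrow> 'w) \<Rightarrow> 'w \<Rightarrow> 'w \<Rightarrow> real" where
  "kform s b b' w w' = om (prj s b w) (prj s b' w')"

definition mu :: "real \<Rightarrow> (nat \<Rightarrow> 'w) \<Rightarrow> (nat \<Rightarrow> 'w) \<Rightarrow> int" where
  "mu s b b' = signature UNIV (\<lambda>w. kform s b b' w w)"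

text \<open>Relative to the transversal \<open>tt s\<close> every Lagrangian is the graph of a form; \<open>kform\<close> is the
  difference of the two forms, hence symmetric and additive along a chain.\<close>

lemma kform_diff:
  assumes "lframe b" "gdet b (tt s) \<noteq> 0" "lframe b'" "gdet b' (tt s) \<noteq> 0"
  shows "kform s b b' w w' = om w (prj s b' w') - om w (prj s b w')"
proof -
  have 1: "om (prj s b w - w) (prj s c w') = om (prj s b w - w) w'"
    if c: "lframe c" "gdet c (tt s) \<noteq> 0" for c
    using prj_om[OF c prj_diff[OF assms(1,2), of w], of w'] alt by metis
  have 2: "om (prj s b w) (prj s c w') = om w (prj s c w') + om (prj s b w - w) w'"
    if c: "lframe c" "gdet c (tt s) \<noteq> 0" for c
    using 1[OF c] by (simp add: omb)
  have "om (prj s b w) (prj s b w') = 0"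
    using lframe_isotropic[OF assms(1)] prj_props(1)[OF assms(1,2)] by blast
  then show ?thesis using 2[OF assms(1,2)] 2[OF assms(3,4)] by (simp add: kform_def)
qed

lemma kform_symmetric:
  assumes "lframe b" "gdet b (tt s) \<noteq> 0" "lframe b'" "gdet b' (tt s) \<noteq> 0"
  shows "symmetric_form (kform s b b')"
proof -
  have sw: "om w (prj s c w') - om w' (prj s c w) = om w w'"
    if c: "lframe c" "gdet c (tt s) \<noteq> 0" for c w w'
  proof -
    have "om (prj s c w - w) (prj s c w') = om (prj s c w - w) w'"
      using prj_om[OF c prj_diff[OF c, of w], of w'] alt by metis
    moreover have "om (prj s c w) (prj s c w') = 0"
      using lframe_isotropic[OF c(1)] prj_props(1)[OF c] by blast
    ultimately show ?thesis using alt[of w' "prj s c w"] by (simp add: omb)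
  qed
  have "kform s b b' w w' = kform s b b' w' w" for w w'
    using sw[OF assms(1,2), of w w'] sw[OF assms(3,4), of w w'] by (simp add: kform_diff[OF assms])
  moreover have "bilinear_form (kform s b b')"
    unfolding bilinear_form_def kform_def
    using linear_compose[OF linear_prj[OF assms(3,4)] lin_om(1)]
      linear_compose[OF linear_prj[OF assms(1,2)] lin_om(2)] by (simp add: o_def)
  ultimately show ?thesis by (simp add: symmetric_form_def)
qed

lemma mu_swap:
  assumes "lframe b" "gdet b (tt s) \<noteq> 0" "lframe b'" "gdet b' (tt s) \<noteq> 0"
  shows "mu s b' b = - mu s b b'"
proof -
  have "kform s b' b w w = - kform s b b' w w" for w
    by (simp add: kform_diff assms)
  then show ?thesis unfolding mu_def by (simp add: signature_uminus)
qed

definition leray :: "(nat \<Rightarrow> 'w) \<Rightarrow> (nat \<Rightarrow> 'w) \<Rightarrow> (nat \<Rightarrow> 'w) \<Rightarrow> int" where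
  "leray b1 b2 b3 = leray_signature S (lspan b1) (lspan b2) (lspan b3)"

text \<open>On \<open>(w\<^sub>1, w\<^sub>2, w\<^sub>3)\<close>, each \<open>w\<^sub>i\<close> in the \<open>i\<close>-th Lagrangian, pass to three independent combinations such as
  \<open>w\<^sub>1 + w\<^sub>2 - w\<^sub>3\<close>: the quadratic form of the Leray signature becomes an orthogonal sum of the three
  comparison forms.\<close>

lemma leray_eq_mu:
  assumes 1: "lframe b1" "gdet b1 (tt s) \<noteq> 0" and 2: "lframe b2" "gdet b2 (tt s) \<noteq> 0"
    and 3: "lframe b3" "gdet b3 (tt s) \<noteq> 0"
  shows "leray b1 b2 b3 = mu s b1 b2 + mu s b2 b3 + mu s b3 b1"
proof -
  let ?Q = "\<lambda>(x1, x2, x3). om x1 x2 + om x2 x3 + om x3 x1"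
  let ?f = "\<lambda>(x1, x2, x3). (prj s b1 x1, prj s b2 x2, prj s b3 x3)"
  let ?g = "\<lambda>(x1::'w, x2, x3). (x1 + x2 - x3, x2 + x3 - x1, x3 + x1 - x2)"
  let ?k = "kform s b1 b2" and ?l = "kform s b2 b3" and ?n = "kform s b3 b1"
  let ?R = "\<lambda>p. ?k (fst p) (fst p) + (\<lambda>q. ?l (fst q) (fst q) + ?n (snd q) (snd q)) (snd p)"
  note k = kform_symmetric[OF 1 2] and l = kform_symmetric[OF 2 3] and n = kform_symmetric[OF 3 1]
  note kb = bilinear_formD[OF k[unfolded symmetric_form_def, THEN conjunct1]]
  note lb = bilinear_formD[OF l[unfolded symmetric_form_def, THEN conjunct1]]
  note nb = bilinear_formD[OF n[unfolded symmetric_form_def, THEN conjunct1]]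
  have lf: "linear ?f"
    using linear_prj[OF 1] linear_prj[OF 2] linear_prj[OF 3]
    by (auto intro!: linearI simp: linear_add linear_scale)
  have lg: "linear ?g" by (auto intro!: linearI simp: algebra_simps)
  have "range ?f = range (prj s b1) \<times> range (prj s b2) \<times> range (prj s b3)" by (auto simp: image_iff)
  then have rf: "range ?f = lspan b1 \<times> lspan b2 \<times> lspan b3"
    using range_prj[OF 1] range_prj[OF 2] range_prj[OF 3] by simp
  have rg: "range ?g = UNIV"
  proof -
    have "(u, v, z) = ?g ((1/2) *\<^sub>R (u + z), (1/2) *\<^sub>R (u + v), (1/2) *\<^sub>R (v + z))" for u v z :: 'w
      by (simp add: algebra_simps flip: scaleR_add_left)
    then show ?thesis by (metis (no_types, lifting) UNIV_eq_I prod_cases3 rangeI)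
  qed
  have id: "?Q (?f p) = 1/4 * ?R (?g p)" for p
  proof -
    obtain x1 x2 x3 where p: "p = (x1, x2, x3)" by (rule prod_cases3)
    have s0: "?k x y + ?l x y + ?n x y = 0" for x y
      by (simp add: kform_diff 1 2 3)
    have c: "?k x y = ?k y x" "?l x y = ?l y x" "?n x y = ?n y x" for x y
      using k l n by (simp_all add: symmetric_form_def)
    have "4 * (?k x1 x2 + ?l x2 x3 + ?n x3 x1) = ?R (?g p)"
      using s0[of x1 x1] s0[of x2 x2] s0[of x3 x3] s0[of x1 x2] s0[of x2 x3] s0[of x3 x1]
        c[of x1 x2] c[of x2 x3] c[of x3 x1]
      by (simp add: p kb lb nb)
    then show ?thesis by (simp add: p kform_def)
  qed
  have "leray b1 b2 b3 = signature UNIV (\<lambda>p. ?Q (?f p))"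
    unfolding leray_def leray_signature_def
    by (rule signature_pullback[symmetric, OF lf _ rf]) (auto simp: zero_prod_def omb)
  also have "\<dots> = signature UNIV (\<lambda>p. 1/4 * ?R (?g p))" by (simp only: id)
  also have "\<dots> = signature UNIV (\<lambda>p. ?R (?g p))" by (rule signature_scale_pos) simp
  also have "\<dots> = signature UNIV ?R"
    by (rule signature_pullback[OF lg _ rg]) (auto simp: kb lb nb)
  also have "\<dots> = mu s b1 b2 + (signature UNIV (\<lambda>q. ?l (fst q) (fst q) + ?n (snd q) (snd q)))"
  proof -
    let ?h = "\<lambda>p q. ?l (fst p) (fst q) + ?n (snd p) (snd q)"
    have h: "symmetric_form ?h"
      using l n unfolding symmetric_form_def bilinear_form_def
      by (auto intro!: linearI simp: lb nb algebra_simps)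
    show ?thesis
      using signature_prod[OF finite_dim_W finite_dim_prod[OF finite_dim_W finite_dim_W] k h]
      by (simp add: mu_def)
  qed
  also have "\<dots> = mu s b1 b2 + (mu s b2 b3 + mu s b3 b1)"
    using signature_prod[OF finite_dim_W finite_dim_W l n] by (simp add: mu_def)
  finally show ?thesis by simp
qed

lemma leray_cyclic:
  assumes "lframe b1" "lframe b2" "lframe b3"
  shows "leray b2 b3 b1 = leray b1 b2 b3"
proof -
  obtain s where s: "\<And>b. b \<in> {b1, b2, b3} \<Longrightarrow> gdet b (tt s) \<noteq> 0"
    by (rule transversal_exists[of "{b1, b2, b3}"]) (use assms in auto)
  show ?thesis using s[of b1] s[of b2] s[of b3] by (simp add: leray_eq_mu[where s = s] assms)
qed

lemma leray_swap:
  assumes "lframe b1" "lframe b2" "lframe b3"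
  shows "leray b2 b1 b3 = - leray b1 b2 b3"
proof -
  obtain s where s: "\<And>b. b \<in> {b1, b2, b3} \<Longrightarrow> gdet b (tt s) \<noteq> 0"
    by (rule transversal_exists[of "{b1, b2, b3}"]) (use assms in auto)
  show ?thesis using s[of b1] s[of b2] s[of b3] mu_swap[of b1 s b2] mu_swap[of b2 s b3] mu_swap[of b1 s b3]
    by (simp add: leray_eq_mu[where s = s] assms)
qed

lemma leray_cocycle:
  assumes "lframe b1" "lframe b2" "lframe b3" "lframe b4"
  shows "leray b1 b2 b3 = leray b1 b2 b4 + leray b2 b3 b4 + leray b3 b1 b4"
proof -
  obtain s where s: "\<And>b. b \<in> {b1, b2, b3, b4} \<Longrightarrow> gdet b (tt s) \<noteq> 0"
    by (rule transversal_exists[of "{b1, b2, b3, b4}"]) (use assms in auto)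
  show ?thesis using s[of b1] s[of b2] s[of b3] s[of b4]
      mu_swap[of b1 s b4] mu_swap[of b2 s b4] mu_swap[of b3 s b4]
    by (simp add: leray_eq_mu[where s = s] assms)
qed

lemma leray_lspan_cong:
  "lspan b1 = lspan c1 \<Longrightarrow> lspan b2 = lspan c2 \<Longrightarrow> lspan b3 = lspan c3 \<Longrightarrow> leray b1 b2 b3 = leray c1 c2 c3"
  by (simp add: leray_def)

lemma leray_degenerate:
  assumes "lframe b1" "lframe b2" "lframe b3" "lspan b1 = lspan b2"
  shows "leray b1 b2 b3 = 0"
  using leray_swap[OF assms(1-3)] assms(4) by (simp add: leray_def)

end

section \<open>The signature modulo four and oriented Lagrangians\<close>

definition ipow :: "int \<Rightarrow> complex" where
  "ipow k = cis (pi / 2 * real_of_int k)"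

lemma ipow_add: "ipow (a + b) = ipow a * ipow b"
  by (simp add: ipow_def cis_mult distrib_left)

lemma ipow_0 [simp]: "ipow 0 = 1"
  by (simp add: ipow_def)

lemma ipow_nonzero [simp]: "ipow k \<noteq> 0"
  by (simp add: ipow_def)

lemma ipow_minus: "ipow (- k) = inverse (ipow k)"
  by (simp add: ipow_def)

lemma ipow_cnj: "cnj (ipow k) = ipow (- k)"
  by (simp add: ipow_def cis_cnj)

lemma ipow_two: "ipow (2 * int n) = (-1) ^ n"
proof -
  have "ipow (2 * int n) = cis (real n * pi)" by (simp add: ipow_def mult.commute)
  also have "\<dots> = (-1) ^ n" by (simp only: flip: DeMoivre) simp
  finally show ?thesis .
qed

lemma ipow_pow4: "ipow k ^ 4 = 1"
proof -
  have "ipow k ^ 4 = cis (2 * pi * real_of_int k)"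
    unfolding ipow_def by (simp only: DeMoivre) (simp add: mult.commute mult.left_commute)
  then show ?thesis by (simp add: cis_multiple_2pi)
qed

definition sg :: "real \<Rightarrow> complex" where
  "sg r = complex_of_real (sgn r)"

lemma sg_mult: "sg (a * b) = sg a * sg b"
  by (simp add: sg_def sgn_mult)

lemma sg_sq: "r \<noteq> 0 \<Longrightarrow> sg r * sg r = 1"
  by (simp add: sg_def sgn_if)

lemma sg_neg1_pow: "sg ((-1) ^ n) = (-1) ^ n"
  by (induction n) (simp_all add: sg_def)

lemma sg_cases: "r \<noteq> 0 \<Longrightarrow> sg r = 1 \<or> sg r = -1"
  by (simp add: sg_def sgn_if)

lemma sgn_prod_real: "finite A \<Longrightarrow> sgn (\<Prod>i\<in>A. g i :: real) = (\<Prod>i\<in>A. sgn (g i))"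
  by (induction rule: finite_induct) (simp_all add: sgn_mult)

lemma prod_sgn_card:
  assumes "finite C" "\<And>c. c \<in> C \<Longrightarrow> g c \<noteq> (0::real)"
  shows "(\<Prod>c\<in>C. sgn (g c)) = (-1) ^ card {c\<in>C. g c < 0}"
  using assms
proof (induction C)
  case (insert x C)
  have "{c \<in> insert x C. g c < 0} = (if g x < 0 then insert x {c\<in>C. g c < 0} else {c\<in>C. g c < 0})"
    by auto
  then show ?case using insert by (auto simp: sgn_if)
qed simp

context symplectic
begin

lemma gdet_nonzero_swap: "gdet b b' \<noteq> 0 \<Longrightarrow> gdet b' b \<noteq> 0"
  by (simp add: gdet_swap[of b' b])

text \<open>Diagonalise the form comparing two Lagrangians. Transversality makes it nondegenerate of rank
  \<open>m\<close>, so its signature modulo four records \<open>m\<close> and the sign of its determinant; the same diagonalising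
  vectors, projected to either Lagrangian, have equal pairings with \<open>tt s\<close>.\<close>

lemma ipow_mu:
  assumes b: "lframe b" "gdet b (tt s) \<noteq> 0" and b': "lframe b'" "gdet b' (tt s) \<noteq> 0"
    and bb': "gdet b b' \<noteq> 0"
  shows "ipow (mu s b b') = ipow (int m) * sg (gdet b b' * gdet b (tt s) * gdet b' (tt s))"
proof -
  let ?k = "kform s b b'"
  let ?A = "prj s b" and ?A' = "prj s b'"
  note k = kform_symmetric[OF b b']
  have ksym: "?k x y = ?k y x" for x y using k by (simp add: symmetric_form_def)
  obtain C where C: "orthogonal_frame ?k C"
    by (rule orthogonal_frame_exists[OF finite_dim_W k])
  have fC: "finite C" and dC: "\<And>c. c \<in> C \<Longrightarrow> ?k c c \<noteq> 0"
    and oC: "\<And>c d. c \<in> C \<Longrightarrow> d \<in> C \<Longrightarrow> c \<noteq> d \<Longrightarrow> ?k c d = 0"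
    and rC: "\<And>x y. (\<forall>c\<in>C. ?k c x = 0) \<Longrightarrow> ?k x y = 0"
    using C unfolding orthogonal_frame_def by blast+
  define n where "n = card C"
  obtain c where c: "bij_betw c {0..<n} C"
    using ex_bij_betw_nat_finite[OF fC] n_def by blast
  have cC: "c i \<in> C" if "i < n" for i using c that by (auto simp: bij_betw_def)
  have cinj: "c i \<noteq> c j" if "i < n" "j < n" "i \<noteq> j" for i j
    using c that by (auto simp: bij_betw_def inj_on_def)
  have kc: "om (?A (c i)) (?A' (c j)) = (if i = j then ?k (c i) (c i) else 0)" if "i < n" "j < n" for i j
    using oC[OF cC cC] cinj that by (auto simp: kform_def)
  have "\<exists>q. ?A (c i) = (\<Sum>l<m. q l *\<^sub>R b l)" for i
    using prj_props(1)[OF b, of "c i"] by (auto simp: lspan_def)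
  then obtain q0 where q0: "\<And>i. ?A (c i) = (\<Sum>l<m. q0 i l *\<^sub>R b l)" by metis
  have "\<exists>q. ?A' (c i) = (\<Sum>l<m. q l *\<^sub>R b' l)" for i
    using prj_props(1)[OF b', of "c i"] by (auto simp: lspan_def)
  then obtain p0 where p0: "\<And>i. ?A' (c i) = (\<Sum>l<m. p0 i l *\<^sub>R b' l)" by metis
  have nm: "n = m"
  proof (rule ccontr)
    assume "n \<noteq> m"
    then consider "n < m" | "m < n" by linarith
    then show False
    proof cases
      case 1
      then obtain a where a: "\<exists>i<m. a i \<noteq> 0" "\<And>j. j < n \<Longrightarrow> (\<Sum>i<m. om (b i) (?A' (c j)) * a i) = 0"
        using underdetermined_system[of n m "\<lambda>j i. om (b i) (?A' (c j))"] by metis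
      let ?x = "\<Sum>i<m. a i *\<^sub>R b i"
      have xl: "?x \<in> lspan b" by (rule lspanI[OF refl])
      have "?k d ?x = 0" if d: "d \<in> C" for d
      proof -
        obtain j where j: "j < n" "d = c j" using c d by (auto simp: bij_betw_def)
        have "?k d ?x = om ?x (?A' d)" using ksym[of d ?x] prj_id[OF b xl] by (simp add: kform_def)
        also have "\<dots> = (\<Sum>i<m. om (b i) (?A' (c j)) * a i)" by (simp add: omb j mult.commute)
        finally show ?thesis using a(2)[OF j(1)] by simp
      qed
      then have kx: "?k ?x y = 0" for y using rC by blast
      have "(\<Sum>i<m. a i * om (b i) (b' j)) = 0" if "j < m" for j
        using kx[of "b' j"] prj_id[OF b xl] prj_id[OF b' lspan_base[OF that]] by (simp add: kform_def omb)
      then have "gdet b b' = 0" unfolding gdet_def fdet_eq_0_iff_row using a(1) by blast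
      then show False using bb' by simp
    next
      case 2
      then obtain a where a: "\<exists>i<n. a i \<noteq> 0" "\<And>j. j < m \<Longrightarrow> (\<Sum>i<n. q0 i j * a i) = 0"
        using underdetermined_system[of m n "\<lambda>j i. q0 i j"] by metis
      have "(\<Sum>i<n. a i *\<^sub>R ?A (c i)) = (\<Sum>i<n. \<Sum>l<m. (q0 i l * a i) *\<^sub>R b l)"
        by (simp add: q0 scaleR_sum_right mult.commute)
      also have "\<dots> = (\<Sum>l<m. (\<Sum>i<n. q0 i l * a i) *\<^sub>R b l)"
        by (subst sum.swap) (simp add: scaleR_sum_left)
      also have "\<dots> = 0" using a(2) by simp
      finally have z: "(\<Sum>i<n. a i *\<^sub>R ?A (c i)) = 0" .
      have "a j = 0" if j: "j < n" for j
      proof -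
        have "0 = om (\<Sum>i<n. a i *\<^sub>R ?A (c i)) (?A' (c j))" by (simp add: z omb)
        also have "\<dots> = (\<Sum>i<n. if i = j then a j * ?k (c j) (c j) else 0)"
          unfolding omb by (rule sum.cong) (use kc j in auto)
        also have "\<dots> = a j * ?k (c j) (c j)" using j by simp
        finally show ?thesis using dC[OF cC[OF j]] by simp
      qed
      then show False using a(1) by blast
    qed
  qed
  let ?c1 = "\<lambda>i. ?A (c i)" and ?c2 = "\<lambda>i. ?A' (c i)"
  let ?q = "fdet m (\<lambda>l i. q0 i l)" and ?p = "fdet m (\<lambda>l i. p0 i l)"
  have g12: "gdet ?c1 ?c2 = ?q * gdet b b' * ?p"
    using gdet_change(1)[of ?c1 "\<lambda>l i. q0 i l" b ?c2] gdet_change(2)[of ?c2 "\<lambda>l i. p0 i l" b' b] q0 p0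
    by (simp add: mult.assoc)
  have g1t: "gdet ?c1 (tt s) = ?q * gdet b (tt s)"
    by (rule gdet_change(1)) (rule q0)
  have g2t: "gdet ?c2 (tt s) = ?p * gdet b' (tt s)"
    by (rule gdet_change(1)) (rule p0)
  have gt: "gdet ?c1 (tt s) = gdet ?c2 (tt s)"
    unfolding gdet_def by (rule fdet_cong) (simp add: prj_props(2)[OF b] prj_props(2)[OF b'])
  have g12': "gdet ?c1 ?c2 = (\<Prod>i<m. ?k (c i) (c i))"
    unfolding gdet_def by (subst fdet_diag) (use kc nm in auto)
  have cb: "bij_betw c {..<m} C" using c nm by (simp add: lessThan_atLeast0)
  have "sgn (gdet ?c1 ?c2) = (\<Prod>i<m. sgn (?k (c i) (c i)))"
    unfolding g12' by (simp add: sgn_prod_real)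
  also have "\<dots> = (\<Prod>d\<in>C. sgn (?k d d))" by (rule prod.reindex_bij_betw[OF cb])
  also have "\<dots> = (-1) ^ card {d\<in>C. ?k d d < 0}" by (rule prod_sgn_card[OF fC dC])
  finally have sD: "sgn (gdet ?c1 ?c2) = (-1) ^ card {d\<in>C. ?k d d < 0}" .
  have gn: "gdet ?c1 ?c2 \<noteq> 0" using sD by auto
  then have qp: "?q \<noteq> 0" "?p \<noteq> 0" using g12 by auto
  have "gdet ?c1 ?c2 * (gdet ?c1 (tt s) * gdet ?c2 (tt s)) = (?q * ?p)\<^sup>2 * (gdet b b' * gdet b (tt s) * gdet b' (tt s))"
    unfolding g12 unfolding g1t g2t by (simp add: power2_eq_square)
  then have "sgn (gdet ?c1 ?c2) * (sgn (gdet ?c1 (tt s)) * sgn (gdet ?c1 (tt s))) =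
      sgn ((?q * ?p)\<^sup>2) * sgn (gdet b b' * gdet b (tt s) * gdet b' (tt s))"
    unfolding gt by (simp only: flip: sgn_mult)
  moreover have "gdet ?c1 (tt s) \<noteq> 0" using g1t qp b(2) by simp
  ultimately have sX: "sgn (gdet b b' * gdet b (tt s) * gdet b' (tt s)) = sgn (gdet ?c1 ?c2)"
    using qp by (simp add: sgn_if split: if_splits)
  have "card {d\<in>C. ?k d d > 0} + card {d\<in>C. ?k d d < 0} = card ({d\<in>C. ?k d d > 0} \<union> {d\<in>C. ?k d d < 0})"
    by (rule card_Un_disjoint[symmetric]) (use fC in auto)
  also have "{d\<in>C. ?k d d > 0} \<union> {d\<in>C. ?k d d < 0} = C" using dC by (auto simp: neq_iff)
  finally have "mu s b b' = int m - 2 * int (card {d\<in>C. ?k d d < 0})"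
    unfolding mu_def signature_orthogonal[OF finite_dim_W k C] using nm n_def by simp
  then have "ipow (mu s b b') = ipow (int m + - (2 * int (card {d\<in>C. ?k d d < 0})))" by simp
  also have "\<dots> = ipow (int m) * inverse ((-1) ^ card {d\<in>C. ?k d d < 0})"
    by (simp only: ipow_add ipow_minus ipow_two)
  also have "inverse ((-1) ^ card {d\<in>C. ?k d d < 0}) = (of_real ((-1) ^ card {d\<in>C. ?k d d < 0}) :: complex)"
    by (cases "even (card {d\<in>C. ?k d d < 0})") simp_all
  finally show ?thesis by (simp only: sg_def sX sD)
qed

definition n0 :: "(nat \<Rightarrow> 'w) \<Rightarrow> (nat \<Rightarrow> 'w) \<Rightarrow> complex" where
  "n0 b b' = ipow (- int m) * sg (gdet b b')"

lemma n0_inverse: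
  assumes "gdet b b' \<noteq> 0"
  shows "n0 b b' * n0 b' b = 1"
proof -
  have "n0 b b' * n0 b' b = ipow (- int m) * ipow (- int m) * (-1) ^ m * (sg (gdet b b') * sg (gdet b b'))"
    by (simp add: n0_def gdet_swap[of b' b] sg_mult sg_neg1_pow)
  also have "\<dots> = ipow (- int m) * ipow (- int m) * ipow (2 * int m)"
    by (simp only: sg_sq[OF assms] ipow_two mult_1_right)
  also have "\<dots> = ipow (- int m + - int m + 2 * int m)" by (simp only: ipow_add)
  finally show ?thesis by simp
qed

text \<open>The Leray signature of three pairwise transversal Lagrangians is, modulo four, a coboundary once
  each of them carries an orientation.\<close>

lemma n0_triple:
  assumes "lframe b1" "lframe b2" "lframe b3"
    and d: "gdet b1 b2 \<noteq> 0" "gdet b2 b3 \<noteq> 0" "gdet b3 b1 \<noteq> 0"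
  shows "n0 b1 b2 * n0 b2 b3 * n0 b3 b1 = ipow (- leray b1 b2 b3)"
proof -
  obtain s where s: "\<And>b. b \<in> {b1, b2, b3} \<Longrightarrow> gdet b (tt s) \<noteq> 0"
    by (rule transversal_exists[of "{b1, b2, b3}"]) (use assms in auto)
  let ?g1 = "gdet b1 (tt s)" and ?g2 = "gdet b2 (tt s)" and ?g3 = "gdet b3 (tt s)"
  have n: "?g1 \<noteq> 0" "?g2 \<noteq> 0" "?g3 \<noteq> 0" using s by auto
  have "ipow (leray b1 b2 b3) = ipow (mu s b1 b2) * ipow (mu s b2 b3) * ipow (mu s b3 b1)"
    using n by (simp add: leray_eq_mu[where s = s] assms ipow_add)
  also have "\<dots> = (ipow (int m) * ipow (int m) * ipow (int m)) * (sg (gdet b1 b2) * sg (gdet b2 b3) * sg (gdet b3 b1))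
      * ((sg ?g1 * sg ?g1) * (sg ?g2 * sg ?g2) * (sg ?g3 * sg ?g3))"
    by (simp add: ipow_mu assms n sg_mult)
  also have "\<dots> = (ipow (int m) * ipow (int m) * ipow (int m)) * (sg (gdet b1 b2) * sg (gdet b2 b3) * sg (gdet b3 b1))"
    using n by (simp add: sg_sq)
  finally have t: "ipow (leray b1 b2 b3) = \<dots>" .
  have "(n0 b1 b2 * n0 b2 b3 * n0 b3 b1) * ipow (leray b1 b2 b3)
      = (ipow (- int m) * ipow (int m)) ^ 3 * ((sg (gdet b1 b2) * sg (gdet b1 b2)) * (sg (gdet b2 b3) * sg (gdet b2 b3))
        * (sg (gdet b3 b1) * sg (gdet b3 b1)))"
    unfolding t n0_def by (simp add: power3_eq_cube)
  also have "\<dots> = 1" using d by (simp add: sg_sq flip: ipow_add)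
  finally show ?thesis by (simp add: ipow_minus field_simps)
qed

text \<open>For transversal oriented Lagrangians this is \<open>n0\<close>; in general an auxiliary Lagrangian transversal to both
  is inserted, and the Leray signature makes the value independent of it.\<close>

definition N :: "(nat \<Rightarrow> 'w) \<Rightarrow> (nat \<Rightarrow> 'w) \<Rightarrow> complex" where
  "N b1 b2 = (let b3 = SOME b3. lframe b3 \<and> gdet b1 b3 \<noteq> 0 \<and> gdet b3 b2 \<noteq> 0
     in ipow (- leray b1 b2 b3) * n0 b1 b3 * n0 b3 b2)"

lemma N_aux:
  assumes "lframe b1" "lframe b2" "lframe b3" "lframe b5"
    and d: "gdet b1 b3 \<noteq> 0" "gdet b3 b2 \<noteq> 0" "gdet b1 b5 \<noteq> 0" "gdet b5 b2 \<noteq> 0" "gdet b3 b5 \<noteq> 0"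
  shows "ipow (- leray b1 b2 b3) * n0 b1 b3 * n0 b3 b2 = ipow (- leray b1 b2 b5) * n0 b1 b5 * n0 b5 b2"
proof -
  note d' = d[THEN gdet_nonzero_swap]
  note i = n0_inverse[OF d(1)] n0_inverse[OF d(2)] n0_inverse[OF d(3)] n0_inverse[OF d(4)] n0_inverse[OF d(5)]
  have 1: "n0 b1 b3 * n0 b3 b5 * n0 b5 b1 = ipow (- leray b1 b3 b5)"
    by (rule n0_triple) (use assms d' in auto)
  have 2: "n0 b3 b2 * n0 b2 b5 * n0 b5 b3 = ipow (- leray b3 b2 b5)"
    by (rule n0_triple) (use assms d' in auto)
  have "(n0 b1 b3 * n0 b3 b5 * n0 b5 b1) * n0 b5 b3 * n0 b1 b5
      = n0 b1 b3 * (n0 b3 b5 * n0 b5 b3) * (n0 b1 b5 * n0 b5 b1)" by (simp only: mult_ac)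
  then have e1: "n0 b1 b3 = ipow (- leray b1 b3 b5) * n0 b5 b3 * n0 b1 b5"
    by (simp only: 1 i mult_1_right)
  have "(n0 b3 b2 * n0 b2 b5 * n0 b5 b3) * n0 b3 b5 * n0 b5 b2
      = n0 b3 b2 * (n0 b3 b5 * n0 b5 b3) * (n0 b5 b2 * n0 b2 b5)" by (simp only: mult_ac)
  then have e2: "n0 b3 b2 = ipow (- leray b3 b2 b5) * n0 b3 b5 * n0 b5 b2"
    by (simp only: 2 i mult_1_right)
  have e: "- leray b1 b2 b3 + - leray b1 b3 b5 + - leray b3 b2 b5 = - leray b1 b2 b5"
    using leray_cocycle[of b1 b2 b3 b5] leray_swap[of b3 b1 b5] leray_swap[of b3 b2 b5] assms by simp
  have "ipow (- leray b1 b2 b3) * n0 b1 b3 * n0 b3 b2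
      = (ipow (- leray b1 b2 b3) * ipow (- leray b1 b3 b5) * ipow (- leray b3 b2 b5)) * (n0 b3 b5 * n0 b5 b3) * n0 b1 b5 * n0 b5 b2"
    unfolding e1 e2 by (simp only: mult_ac)
  also have "\<dots> = ipow (- leray b1 b2 b3 + - leray b1 b3 b5 + - leray b3 b2 b5) * n0 b1 b5 * n0 b5 b2"
    by (simp only: i ipow_add mult_1_right)
  finally show ?thesis unfolding e .
qed

lemma N_eq:
  assumes "lframe b1" "lframe b2" "lframe b3" and d: "gdet b1 b3 \<noteq> 0" "gdet b3 b2 \<noteq> 0"
  shows "N b1 b2 = ipow (- leray b1 b2 b3) * n0 b1 b3 * n0 b3 b2"
proof -
  let ?P = "\<lambda>b3. lframe b3 \<and> gdet b1 b3 \<noteq> 0 \<and> gdet b3 b2 \<noteq> 0"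
  define b4 where "b4 = (SOME b3. ?P b3)"
  have b4: "?P b4" unfolding b4_def by (rule someI[of ?P b3]) (use assms in auto)
  obtain s where s: "\<And>b. b \<in> {b1, b2, b3, b4} \<Longrightarrow> gdet b (tt s) \<noteq> 0"
    by (rule transversal_exists[of "{b1, b2, b3, b4}"]) (use assms b4 in auto)
  have s2: "gdet (tt s) b2 \<noteq> 0" by (rule gdet_nonzero_swap) (use s in auto)
  have "N b1 b2 = ipow (- leray b1 b2 b4) * n0 b1 b4 * n0 b4 b2"
    unfolding N_def b4_def Let_def ..
  also have "\<dots> = ipow (- leray b1 b2 (tt s)) * n0 b1 (tt s) * n0 (tt s) b2"
    by (rule N_aux) (use assms b4 s s2 lframe_tt in auto)
  also have "\<dots> = ipow (- leray b1 b2 b3) * n0 b1 b3 * n0 b3 b2"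
    by (rule N_aux[symmetric]) (use assms b4 s s2 lframe_tt in auto)
  finally show ?thesis .
qed

lemma N_triple:
  assumes "lframe b1" "lframe b2" "lframe b3"
  shows "N b1 b2 * N b2 b3 * N b3 b1 = ipow (- leray b1 b2 b3)"
proof -
  obtain s where s: "\<And>b. b \<in> {b1, b2, b3} \<Longrightarrow> gdet b (tt s) \<noteq> 0"
    by (rule transversal_exists[of "{b1, b2, b3}"]) (use assms in auto)
  then have n: "gdet b1 (tt s) \<noteq> 0" "gdet b2 (tt s) \<noteq> 0" "gdet b3 (tt s) \<noteq> 0" by auto
  note n' = n[THEN gdet_nonzero_swap]
  have "N b1 b2 * N b2 b3 * N b3 b1 = ipow (- leray b1 b2 (tt s)) * ipow (- leray b2 b3 (tt s)) * ipow (- leray b3 b1 (tt s))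
     * ((n0 b1 (tt s) * n0 (tt s) b1) * (n0 b2 (tt s) * n0 (tt s) b2) * (n0 b3 (tt s) * n0 (tt s) b3))"
    unfolding N_eq[OF assms(1,2) lframe_tt n(1) n'(2)] N_eq[OF assms(2,3) lframe_tt n(2) n'(3)]
      N_eq[OF assms(3,1) lframe_tt n(3) n'(1)]
    by (simp only: mult_ac)
  also have "\<dots> = ipow (- leray b1 b2 (tt s) + - leray b2 b3 (tt s) + - leray b3 b1 (tt s))"
    by (simp only: n0_inverse[OF n(1)] n0_inverse[OF n(2)] n0_inverse[OF n(3)] ipow_add mult_1_right)
  also have "- leray b1 b2 (tt s) + - leray b2 b3 (tt s) + - leray b3 b1 (tt s) = - leray b1 b2 b3"
    using leray_cocycle[OF assms lframe_tt, of s] by simp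
  finally show ?thesis .
qed

lemma N_pow4:
  assumes "lframe b1" "lframe b2"
  shows "N b1 b2 ^ 4 = 1"
proof -
  obtain s where s: "\<And>b. b \<in> {b1, b2} \<Longrightarrow> gdet b (tt s) \<noteq> 0"
    by (rule transversal_exists[of "{b1, b2}"]) (use assms in auto)
  then have n: "gdet b1 (tt s) \<noteq> 0" "gdet (tt s) b2 \<noteq> 0" using gdet_nonzero_swap by auto
  have "sg r ^ 4 = 1" if "r \<noteq> 0" for r using sg_cases[OF that] by auto
  then show ?thesis
    using n by (simp add: N_eq[OF assms lframe_tt n] n0_def power_mult_distrib ipow_pow4)
qed

lemma N_self:
  assumes "lframe b"
  shows "N b b = 1"
proof -
  have "N b b * N b b * N b b = 1" using N_triple[OF assms assms assms] leray_degenerate[OF assms assms assms] by simp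
  then have 3: "N b b ^ 3 = 1" by (simp add: power3_eq_cube)
  have "N b b ^ 4 = N b b ^ 3 * N b b" by (simp add: power_Suc2[symmetric] del: power_Suc)
  then show ?thesis using N_pow4[OF assms assms] 3 by simp
qed

lemma N_swap:
  assumes "lframe b1" "lframe b2"
  shows "N b1 b2 * N b2 b1 = 1"
  using N_triple[OF assms assms(1)] leray_degenerate[OF assms(1,1,2)] leray_cyclic[OF assms(1,1,2)] N_self[OF assms(1)]
  by simp

lemma N_change:
  assumes b: "lframe b" and c: "lframe c" and b2: "lframe b2"
    and a: "\<And>j. j < m \<Longrightarrow> c j = (\<Sum>i<m. a i j *\<^sub>R b i)" and l: "lspan c = lspan b"
  shows "N c b2 = sg (fdet m a) * N b b2"
proof -
  obtain s where s: "\<And>b'. b' \<in> {b, c, b2} \<Longrightarrow> gdet b' (tt s) \<noteq> 0"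
    by (rule transversal_exists[of "{b, c, b2}"]) (use assms in auto)
  then have n: "gdet b (tt s) \<noteq> 0" "gdet c (tt s) \<noteq> 0" "gdet (tt s) b2 \<noteq> 0"
    using gdet_nonzero_swap by auto
  show ?thesis
    using leray_lspan_cong[OF l refl refl, of b2 "tt s"]
    by (simp add: N_eq[OF c b2 lframe_tt n(2,3)] N_eq[OF b b2 lframe_tt n(1,3)] n0_def gdet_change(1)[OF a] sg_mult)
qed

section \<open>Symplectic similitudes\<close>

definition sim :: "real \<Rightarrow> ('w \<Rightarrow> 'w) \<Rightarrow> bool" where
  "sim l h \<longleftrightarrow> linear h \<and> bij h \<and> (\<forall>x y. om (h x) (h y) = l * om x y)"

lemma simD:
  assumes "sim l h"
  shows "linear h" "bij h" "om (h x) (h y) = l * om x y"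
  using assms by (auto simp: sim_def)

lemma sim_id: "sim 1 id"
  by (simp add: sim_def linear_id)

lemma sim_comp: "sim l h \<Longrightarrow> sim l' h' \<Longrightarrow> sim (l * l') (h \<circ> h')"
  by (auto simp: sim_def linear_compose bij_comp)

lemma sim_inv:
  assumes "sim l h" "l = 1 \<or> l = -1"
  shows "sim l (inv_into UNIV h)"
proof -
  have b: "bij h" and li: "linear h" and o: "om (h x) (h y) = l * om x y" for x y
    using assms(1) by (auto simp: sim_def)
  have hi: "h (inv_into UNIV h x) = x" for x using b by (simp add: bij_is_surj surj_f_inv_f)
  have ih: "inv_into UNIV h (h x) = x" for x using b by (simp add: bij_is_inj)
  have "linear (inv_into UNIV h)"
  proof (rule linearI)
    show "inv_into UNIV h (x + y) = inv_into UNIV h x + inv_into UNIV h y" for x y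
      using ih[of "inv_into UNIV h x + inv_into UNIV h y"] by (simp add: linear_add[OF li] hi)
    show "inv_into UNIV h (r *\<^sub>R x) = r *\<^sub>R inv_into UNIV h x" for r x
      using ih[of "r *\<^sub>R inv_into UNIV h x"] by (simp add: linear_scale[OF li] hi)
  qed
  moreover have "om (inv_into UNIV h x) (inv_into UNIV h y) = l * om x y" for x y
    using o[of "inv_into UNIV h x" "inv_into UNIV h y"] assms(2) by (auto simp: hi)
  ultimately show ?thesis using bij_imp_bij_inv[OF b] by (simp add: sim_def)
qed

lemma lframe_sim:
  assumes "sim l h" "lframe b"
  shows "lframe (\<lambda>i. h (b i))"
proof -
  note h = simD[OF assms(1)]
  have "(\<Sum>i<m. c i *\<^sub>R h (b i)) = h (\<Sum>i<m. c i *\<^sub>R b i)" for c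
    using h(1) by (simp add: linear_sum linear_scale)
  moreover have "h x = 0 \<Longrightarrow> x = 0" for x
    using h(1,2) linear_0[OF h(1)] by (metis bij_pointE)
  ultimately show ?thesis using assms(2) h(3) by (auto simp: lframe_def)
qed

lemma gdet_sim: "sim l h \<Longrightarrow> gdet (\<lambda>i. h (b i)) (\<lambda>i. h (b' i)) = l ^ m * gdet b b'"
  by (simp add: gdet_def simD(3) fdet_scale)

lemma leray_sim:
  assumes h: "sim l h" and l: "l = 1 \<or> l = -1"
  shows "leray (\<lambda>i. h (b1 i)) (\<lambda>i. h (b2 i)) (\<lambda>i. h (b3 i)) = (if l = 1 then 1 else -1) * leray b1 b2 b3"
proof -
  note h' = simD[OF h]
  let ?Q = "\<lambda>(x1, x2, x3). om x1 x2 + om x2 x3 + om x3 x1"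
  let ?f = "\<lambda>(x1, x2, x3). (h x1, h x2, h x3)"
  let ?V = "lspan b1 \<times> lspan b2 \<times> lspan b3"
  have lf: "linear ?f" using h'(1) by (auto intro!: linearI simp: linear_add linear_scale)
  have sv: "subspace ?V"
    using subspace_lspan[of b1] subspace_lspan[of b2] subspace_lspan[of b3]
    by (auto simp: subspace_def zero_prod_def)
  have fv: "?f ` ?V = h ` lspan b1 \<times> h ` lspan b2 \<times> h ` lspan b3" by (force simp: image_iff)
  have "leray (\<lambda>i. h (b1 i)) (\<lambda>i. h (b2 i)) (\<lambda>i. h (b3 i)) = signature ?V (\<lambda>p. ?Q (?f p))"
    unfolding leray_def leray_signature_def lspan_image[OF h'(1)]
    by (rule signature_pullback[symmetric, OF lf sv fv]) (auto simp: zero_prod_def omb)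
  also have "(\<lambda>p. ?Q (?f p)) = (\<lambda>p. l * ?Q p)" by (auto simp: h'(3) algebra_simps)
  also have "signature ?V \<dots> = (if l = 1 then 1 else -1) * leray b1 b2 b3"
    using l signature_uminus[of ?V ?Q] by (auto simp: leray_def leray_signature_def)
  finally show ?thesis .
qed

lemma N_sim:
  assumes h: "sim l h" and l: "l = 1 \<or> l = -1" and b: "lframe b1" "lframe b2"
  shows "N (\<lambda>i. h (b1 i)) (\<lambda>i. h (b2 i)) = (if l = 1 then N b1 b2 else cnj (N b1 b2))"
proof -
  obtain s where s: "\<And>b'. b' \<in> {b1, b2} \<Longrightarrow> gdet b' (tt s) \<noteq> 0"
    by (rule transversal_exists[of "{b1, b2}"]) (use assms in auto)
  then have n: "gdet b1 (tt s) \<noteq> 0" "gdet (tt s) b2 \<noteq> 0"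
    using gdet_nonzero_swap by auto
  have n': "gdet (\<lambda>i. h (b1 i)) (\<lambda>i. h (tt s i)) \<noteq> 0" "gdet (\<lambda>i. h (tt s i)) (\<lambda>i. h (b2 i)) \<noteq> 0"
    using n l by (auto simp: gdet_sim[OF h])
  have "sg (l ^ m) * sg (l ^ m) = 1" using l by (intro sg_sq) auto
  then have e: "N (\<lambda>i. h (b1 i)) (\<lambda>i. h (b2 i)) = ipow (- (if l = 1 then 1 else -1) * leray b1 b2 (tt s)) * n0 b1 (tt s) * n0 (tt s) b2"
    using leray_sim[OF h l, of b1 b2 "tt s"]
    by (simp add: N_eq[OF lframe_sim[OF h b(1)] lframe_sim[OF h b(2)] lframe_sim[OF h lframe_tt] n'] n0_def
        gdet_sim[OF h] sg_mult)
  have r: "cnj (n0 b1 (tt s) * n0 (tt s) b2) = n0 b1 (tt s) * n0 (tt s) b2"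
  proof -
    have "ipow (- int m) * ipow (- int m) = inverse (ipow (2 * int m))"
      by (simp flip: ipow_add ipow_minus)
    then have "n0 b1 (tt s) * n0 (tt s) b2 = inverse ((-1) ^ m) * (sg (gdet b1 (tt s)) * sg (gdet (tt s) b2))"
      by (simp add: n0_def ipow_two)
    then show ?thesis by (simp add: sg_def)
  qed
  show ?thesis
    using e r l by (auto simp: N_eq[OF b lframe_tt n] ipow_cnj mult.assoc)
qed

end

section \<open>Hermitian spaces and their isometry groups\<close>

text \<open>What the three pairs \<open>(D, \<tau>)\<close> have in common: the norm \<open>\<tau>(x) x\<close> is real and definite, and \<open>trd\<close> is a
  trace form. The last property is finite dimensionality over the reals, phrased as induction over linear
  combinations of a finite set.\<close>

class normed_involution = involutive_div_algebra +
  assumes ex_norm_scaleR: "\<exists>r. tau x * x = r *\<^sub>R 1 \<and> (x \<noteq> 0 \<longrightarrow> r > 0)"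
    and trd_add: "trd (x + y) = trd x + trd y"
    and trd_scaleR: "trd (r *\<^sub>R x) = r * trd x"
    and trd_commute: "trd (x * y) = trd (y * x)"
    and trd_tau: "trd (tau x) = trd x"
    and kappa_trd_1: "kappa TYPE('a) * trd 1 \<noteq> 0"
    and ex_finite_induct: "\<exists>E. finite E \<and> (\<forall>P. P 0 \<longrightarrow> (\<forall>r. \<forall>e\<in>E. \<forall>y. P y \<longrightarrow> P (r *\<^sub>R e + y)) \<longrightarrow> (\<forall>d. P d))"

lemma ex_norm: "\<exists>r. tau x * x = (of_real r :: 'a::normed_involution) \<and> (x \<noteq> 0 \<longrightarrow> r > 0)"
  using ex_norm_scaleR[of x] by (simp add: of_real_def)

lemma ex_finite_inductI:
  assumes "span E = (UNIV :: 'a::real_vector set)"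
  shows "\<forall>P. P 0 \<longrightarrow> (\<forall>r. \<forall>e\<in>E. \<forall>y. P y \<longrightarrow> P (r *\<^sub>R e + y)) \<longrightarrow> (\<forall>d::'a. P d)"
proof (intro allI impI)
  fix P and d :: 'a assume "P 0" "\<forall>r. \<forall>e\<in>E. \<forall>y. P y \<longrightarrow> P (r *\<^sub>R e + y)"
  moreover have "d \<in> span E" using assms by simp
  ultimately show "P d" by (intro span_induct_alt[of d E P]) auto
qed

text \<open>In the complex numbers and the quaternions every element fixed or negated by the involution
  commutes with a unit square root of minus one; this is what makes their quasi-reflections squares.\<close>

class rotating_involution = normed_involution +
  assumes ex_root: "tau q = q \<or> tau q = - q \<Longrightarrow> \<exists>J. J * J = -1 \<and> tau J * J = 1 \<and> J * q = q * J"

lemma qre_sum4: "a\<^sup>2 + b\<^sup>2 + c\<^sup>2 + d\<^sup>2 > (0::real)" if "\<not> (a = 0 \<and> b = 0 \<and> c = 0 \<and> d = 0)"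
proof -
  have "a\<^sup>2 + b\<^sup>2 + c\<^sup>2 + d\<^sup>2 \<ge> 0" by simp
  moreover have "a\<^sup>2 + b\<^sup>2 + c\<^sup>2 + d\<^sup>2 \<noteq> 0" using that by (auto simp: add_nonneg_eq_0_iff)
  ultimately show ?thesis by linarith
qed

instance real :: normed_involution
proof
  fix x y :: real and r :: real
  show "\<exists>r. tau x * x = r *\<^sub>R 1 \<and> (x \<noteq> 0 \<longrightarrow> r > 0)"
    by (rule exI[of _ "x * x"]) (auto simp: tau_real_def zero_less_mult_iff)
  have "x \<in> span {1}" for x :: real
    using span_scale[OF span_base[of 1 "{1::real}"], of x] by simp
  then have "span {1::real} = UNIV" by blast
  then show "\<exists>E. finite E \<and> (\<forall>P. P 0 \<longrightarrow> (\<forall>r. \<forall>e\<in>E. \<forall>y. P y \<longrightarrow> P (r *\<^sub>R e + y)) \<longrightarrow> (\<forall>d::real. P d))"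
    by (intro exI[of _ "{1::real}"] conjI ex_finite_inductI) simp
qed (simp_all add: trd_real_def tau_real_def kappa_real_def)

instance complex :: rotating_involution
proof
  fix x y q :: complex and r :: real
  show "\<exists>r. tau x * x = r *\<^sub>R 1 \<and> (x \<noteq> 0 \<longrightarrow> r > 0)"
    by (rule exI[of _ "(cmod x)\<^sup>2"])
      (auto simp: tau_complex_def scaleR_conv_of_real complex_norm_square[symmetric] mult.commute[of "cnj x"])
    have "x \<in> span {1, \<i>}" for x :: complex
    proof -
      have "Re x *\<^sub>R 1 + Im x *\<^sub>R \<i> \<in> span {1, \<i>}"
        by (intro span_add span_scale span_base) auto
      moreover have "Re x *\<^sub>R 1 + Im x *\<^sub>R \<i> = x" by (simp add: complex_eq_iff)
      ultimately show ?thesis by simp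
    qed
  then have "span {1, \<i>} = UNIV" by blast
  then show "\<exists>E. finite E \<and> (\<forall>P. P 0 \<longrightarrow> (\<forall>r. \<forall>e\<in>E. \<forall>y. P y \<longrightarrow> P (r *\<^sub>R e + y)) \<longrightarrow> (\<forall>d::complex. P d))"
    by (intro exI[of _ "{1, \<i>}"] conjI ex_finite_inductI) simp
  show "\<exists>J. J * J = -1 \<and> tau J * J = 1 \<and> J * q = q * J"
    by (rule exI[of _ \<i>]) (simp add: tau_complex_def)
qed (simp_all add: trd_complex_def tau_complex_def kappa_complex_def distrib_left)

instance quat :: rotating_involution
proof
  fix x y q :: quat and r :: real
  show "\<exists>r. tau x * x = r *\<^sub>R 1 \<and> (x \<noteq> 0 \<longrightarrow> r > 0)"
  proof (intro exI conjI)
    let ?r = "(qre x)\<^sup>2 + (qi x)\<^sup>2 + (qj x)\<^sup>2 + (qk x)\<^sup>2"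
    show "tau x * x = ?r *\<^sub>R 1"
      by (simp add: one_quat_def scaleR_quat_def tau_quat_def times_quat_def power2_eq_square algebra_simps)
    show "x \<noteq> 0 \<longrightarrow> ?r > 0"
      using qre_sum4 by (auto simp: quat_eq_iff zero_quat_def)
  qed
    let ?E = "{Quat 1 0 0 0, Quat 0 1 0 0, Quat 0 0 1 0, Quat 0 0 0 1}"
    have "x \<in> span ?E" for x :: quat
    proof -
      have "qre x *\<^sub>R Quat 1 0 0 0 + qi x *\<^sub>R Quat 0 1 0 0 + qj x *\<^sub>R Quat 0 0 1 0 + qk x *\<^sub>R Quat 0 0 0 1 \<in> span ?E"
        by (intro span_add span_scale span_base) auto
      moreover have "qre x *\<^sub>R Quat 1 0 0 0 + qi x *\<^sub>R Quat 0 1 0 0 + qj x *\<^sub>R Quat 0 0 1 0 + qk x *\<^sub>R Quat 0 0 0 1 = x"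
        by (simp add: quat_eq_iff scaleR_quat_def plus_quat_def)
      ultimately show ?thesis by simp
    qed
    then have "span ?E = UNIV" by blast
    then show "\<exists>E. finite E \<and> (\<forall>P. P 0 \<longrightarrow> (\<forall>r. \<forall>e\<in>E. \<forall>y. P y \<longrightarrow> P (r *\<^sub>R e + y)) \<longrightarrow> (\<forall>d::quat. P d))"
      by (intro exI[of _ ?E] conjI ex_finite_inductI) simp
  assume q: "tau q = q \<or> tau q = - q"
  show "\<exists>J. J * J = -1 \<and> tau J * J = 1 \<and> J * q = q * J"
  proof (cases "qi q = 0 \<and> qj q = 0 \<and> qk q = 0")
    case True
    then show ?thesis
      by (intro exI[of _ "Quat 0 1 0 0"])
        (simp add: tau_quat_def times_quat_def uminus_quat_def one_quat_def)
  next
    case False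
    then have re: "qre q = 0" using q by (auto simp: tau_quat_def uminus_quat_def quat_eq_iff)
    let ?n = "(qi q)\<^sup>2 + (qj q)\<^sup>2 + (qk q)\<^sup>2"
    have n: "?n > 0" using qre_sum4[of 0 "qi q" "qj q" "qk q"] False by simp
    define t where "t = 1 / sqrt ?n"
    have t: "t * t * ?n = 1" using n by (simp add: t_def)
    let ?J = "Quat 0 (t * qi q) (t * qj q) (t * qk q)"
    have "t * qi q * (t * qi q) + t * qj q * (t * qj q) + t * qk q * (t * qk q) = 1"
      using t by (simp add: power2_eq_square algebra_simps)
    then show ?thesis
      by (intro exI[of _ ?J])
        (simp add: tau_quat_def times_quat_def uminus_quat_def one_quat_def re algebra_simps)
  qed
qed (simp_all add: trd_quat_def tau_quat_def kappa_quat_def times_quat_def plus_quat_def scaleR_quat_def one_quat_def algebra_simps)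

context involutive_div_algebra
begin

lemma tau_0 [simp]: "tau 0 = 0"
  using tau_add[of 0 0] by simp

lemma tau_minus: "tau (- x) = - tau x"
  using tau_add[of x "- x"] by (simp add: minus_unique)

lemma tau_diff: "tau (x - y) = tau x - tau y"
  using tau_add[of x "- y"] by (simp add: tau_minus)

lemma tau_eq_0_iff [simp]: "tau x = 0 \<longleftrightarrow> x = 0"
  using tau_tau[of x] tau_0 by metis

lemma tau_1 [simp]: "tau 1 = 1"
proof -
  have "tau 1 * tau 1 = tau 1 * 1" using tau_mult[of 1 1] by simp
  then show ?thesis by (subst (asm) mult_cancel_left) auto
qed

lemma tau_inverse: "tau (inverse x) = inverse (tau x)"
proof (cases "x = 0")
  case False
  have "tau (inverse x) * tau x = 1" using tau_mult[of x "inverse x"] False by simp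
  then show ?thesis by (metis inverse_unique inverse_inverse_eq)
qed simp

end

lemma tau_of_real [simp]: "tau (of_real r :: 'a::involutive_div_algebra) = of_real r"
  using tau_scaleR[of r "1::'a"] by (simp add: of_real_def)

lemma of_real_central: "of_real r * x = x * (of_real r :: 'a::real_div_algebra)"
  by (simp add: of_real_def)

definition nrm :: "'a::normed_involution \<Rightarrow> real" where
  "nrm x = (SOME r. tau x * x = of_real r)"

lemma tau_mult_self: "tau x * x = of_real (nrm x)"
  unfolding nrm_def by (rule someI_ex) (use ex_norm[of x] in blast)

lemma nrm_pos: "x \<noteq> 0 \<Longrightarrow> nrm x > 0"
  using ex_norm[of x] tau_mult_self[of x] by auto

lemma self_mult_tau: "x * tau x = of_real (nrm x)"
proof (cases "x = 0")
  case False
  have "(x * tau x) * x = x * of_real (nrm x)" by (simp add: mult.assoc tau_mult_self)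
  also have "\<dots> = of_real (nrm x) * x" by (simp only: of_real_central)
  finally show ?thesis using False by simp
qed (use tau_mult_self[of 0] in simp)

lemma nrm_mult: "nrm (x * y) = nrm x * nrm (y :: 'a::normed_involution)"
proof -
  have "of_real (nrm (x * y)) = tau y * (tau x * x) * y"
    by (simp only: tau_mult mult.assoc flip: tau_mult_self)
  also have "\<dots> = of_real (nrm x) * (tau y * y)"
    by (simp only: tau_mult_self of_real_central[of "nrm x" "tau y", symmetric] mult.assoc)
  finally have "(of_real (nrm (x * y)) :: 'a) = of_real (nrm x * nrm y)"
    by (simp add: tau_mult_self)
  then show ?thesis by (simp only: of_real_eq_iff)
qed

lemma nrm_tau: "nrm (tau x) = nrm (x :: 'a::normed_involution)"
proof -
  have "(of_real (nrm (tau x)) :: 'a) = of_real (nrm x)"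
    using tau_mult_self[of "tau x"] self_mult_tau[of x] by (simp add: tau_tau)
  then show ?thesis by (simp only: of_real_eq_iff)
qed

lemma quasi_reflection_identity:
  fixes b t :: "'a::real_div_algebra"
  assumes "b \<noteq> 0" "t \<noteq> 0"
  shows "(- inverse t) * (b + e *\<^sub>R t) * (- inverse b) = inverse t + e *\<^sub>R inverse b"
proof -
  have "(- inverse t) * (b + e *\<^sub>R t) * (- inverse b) = inverse t * (b + e *\<^sub>R t) * inverse b" by simp
  also have "\<dots> = inverse t * (b * inverse b) + e *\<^sub>R ((inverse t * t) * inverse b)"
    by (simp only: distrib_left distrib_right mult.assoc mult_scaleR_left mult_scaleR_right)
  finally show ?thesis using assms by simp
qed

locale hermitian =
  fixes V :: "('d::normed_involution, 'v::ab_group_add) form_space" and eps :: real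
  assumes H: "right_hermitian_space eps V" and eps: "eps = 1 \<or> eps = -1"
begin

abbreviation h :: "'v \<Rightarrow> 'v \<Rightarrow> 'd" where "h \<equiv> form V"
abbreviation ac :: "'d \<Rightarrow> 'v \<Rightarrow> 'v" where "ac \<equiv> act V"

lemma eps_sq [simp]: "eps * eps = 1"
  using eps by auto

lemma ac_add: "ac d (x + y) = ac d x + ac d y"
  and ac_plus: "ac (c + d) x = ac c x + ac d x"
  and ac_mult: "ac (c * d) x = ac d (ac c x)"
  and ac_1 [simp]: "ac 1 x = x"
  using H by (auto simp: right_hermitian_space_def right_vector_space_def)

lemma ac_0 [simp]: "ac 0 x = 0" "ac d 0 = 0"
  using ac_plus[of 0 0 x] ac_add[of d 0 0] by auto

lemma ac_minus: "ac (- d) x = - ac d x" "ac d (- x) = - ac d x"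
  using ac_plus[of d "- d" x] ac_add[of d x "- x"] by (simp_all add: eq_neg_iff_add_eq_0 add.commute)

lemma ac_diff: "ac (c - d) x = ac c x - ac d x" "ac d (x - y) = ac d x - ac d y"
  using ac_plus[of c "- d" x] ac_add[of d x "- y"] by (simp_all add: ac_minus)

lemma ac_sum: "ac d (\<Sum>i\<in>A. f i) = (\<Sum>i\<in>A. ac d (f i))"
  by (induction A rule: infinite_finite_induct) (simp_all add: ac_add)

lemma h_add: "h (x + y) z = h x z + h y z" "h x (y + z) = h x y + h x z"
  and h_sym: "h y x = eps *\<^sub>R tau (h x y)"
  and h_ac2: "h (ac a x) (ac b y) = tau a * h x y * b"
  and h_nondeg: "(\<And>y. h x y = 0) \<Longrightarrow> x = 0"
  using H unfolding right_hermitian_space_def form_hermitian_def form_nondegenerate_def by blast+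

lemma h_ac: "h (ac a x) y = tau a * h x y" "h x (ac b y) = h x y * b"
  using h_ac2[of a x 1 y] h_ac2[of 1 x b y] by simp_all

lemma h_0 [simp]: "h 0 y = 0" "h x 0 = 0"
  using h_add(1)[of 0 0 y] h_add(2)[of x 0 0] by auto

lemma h_minus: "h (- x) y = - h x y" "h x (- y) = - h x y"
  using h_add(1)[of x "- x" y] h_add(2)[of x y "- y"] by (simp_all add: eq_neg_iff_add_eq_0 add.commute)

lemma h_diff: "h (x - y) z = h x z - h y z" "h x (y - z) = h x y - h x z"
  using h_add(1)[of x "- y" z] h_add(2)[of x y "- z"] by (simp_all add: h_minus)

lemma h_sum: "h (\<Sum>i\<in>A. f i) y = (\<Sum>i\<in>A. h (f i) y)" "h x (\<Sum>i\<in>A. f i) = (\<Sum>i\<in>A. h x (f i))"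
  by (induction A rule: infinite_finite_induct) (simp_all add: h_add)

lemma h_eq_0_sym: "h x y = 0 \<longleftrightarrow> h y x = 0"
proof -
  have "h y x = 0" if "h x y = 0" for x y using h_sym[of y x] that by simp
  then show ?thesis by blast
qed

lemma tau_h: "tau (h x y) = eps *\<^sub>R h y x"
  using eps by (auto simp: h_sym[of x y] tau_tau tau_minus)

lemma real_space: "vector_space (\<lambda>r. ac (of_real r))"
proof -
  have "ac (of_real (a * b)) x = ac (of_real a) (ac (of_real b) x)" for a b x
    by (simp only: mult.commute[of a b] of_real_mult ac_mult)
  then show ?thesis by unfold_locales (simp_all add: ac_add ac_plus)
qed

text \<open>Over the reals the space is finite-dimensional, so biorthogonal systems have bounded size.\<close>

lemma biorthogonal_bound:
  obtains K :: nat where "\<And>C y. finite C \<Longrightarrow> (\<And>x. x \<in> C \<Longrightarrow> h (y x) x \<noteq> 0) \<Longrightarrow>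
     (\<And>x x'. x \<in> C \<Longrightarrow> x' \<in> C \<Longrightarrow> x \<noteq> x' \<Longrightarrow> h (y x) x' = 0) \<Longrightarrow> card C \<le> K"
proof -
  interpret r: vector_space "\<lambda>r. ac (of_real r)" by (rule real_space)
  obtain B where B: "finite B" "dspan V B = UNIV"
    using H by (auto simp: right_hermitian_space_def dfinite_dimensional_def)
  obtain E :: "'d set" where E: "finite E"
    "\<And>P d. P 0 \<Longrightarrow> (\<And>r e y. e \<in> E \<Longrightarrow> P y \<Longrightarrow> P (r *\<^sub>R e + y)) \<Longrightarrow> P d"
    using ex_finite_induct by metis
  let ?T = "(\<lambda>(e, b). ac e b) ` (E \<times> B)"
  have fT: "finite ?T" using E B by simp
  have gen: "ac c b \<in> r.span ?T" if b: "b \<in> B" for c b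
  proof -
    show ?thesis
    proof (rule E(2)[of "\<lambda>c. ac c b \<in> r.span ?T"])
      show "ac 0 b \<in> r.span ?T" by (simp add: r.span_zero)
      fix k e y assume step: "e \<in> E" "ac y b \<in> r.span ?T"
      have "ac e b \<in> r.span ?T" using step(1) b by (intro r.span_base) auto
      then have "ac (of_real k) (ac e b) + ac y b \<in> r.span ?T"
        using step(2) by (intro r.span_add r.span_scale)
      moreover have "k *\<^sub>R e = e * of_real k" by (simp add: of_real_def)
      ultimately show "ac (k *\<^sub>R e + y) b \<in> r.span ?T" by (simp add: ac_plus ac_mult)
    qed
  qed
  have "ac d x \<in> r.span ?T" if "x \<in> r.span ?T" for d x
    using that
  proof (induction rule: r.span_induct_alt)
    case base
    then show ?case by (simp add: r.span_zero)
  next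
    case (step k t y)
    then obtain e b where eb: "b \<in> B" "t = ac e b" by auto
    have "ac d (ac (of_real k) t) = ac (e * of_real k * d) b" by (simp add: eb ac_mult)
    then show ?case using step gen[OF eb(1)] by (simp add: ac_add r.span_add)
  qed
  then have ds: "dsubspace V (r.span ?T)"
    by (auto simp: dsubspace_def r.span_zero r.span_add)
  have "B \<subseteq> r.span ?T" using gen[of _ 1] by auto
  then have "dspan V B \<subseteq> r.span ?T" unfolding dspan_def by (rule hull_minimal[where S = "dsubspace V", OF _ ds])
  then have sT: "r.span ?T = UNIV" using B by auto
  show thesis
  proof (rule that[of "card ?T"])
    fix C :: "'v set" and y
    assume C: "finite C" and d: "\<And>x. x \<in> C \<Longrightarrow> h (y x) x \<noteq> 0"
      and o: "\<And>x x'. x \<in> C \<Longrightarrow> x' \<in> C \<Longrightarrow> x \<noteq> x' \<Longrightarrow> h (y x) x' = 0"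
    have "r.independent C"
    proof (rule r.independent_if_scalars_zero[OF C])
      fix u x assume u: "(\<Sum>x\<in>C. ac (of_real (u x)) x) = 0" "x \<in> C"
      have "0 = h (y x) (\<Sum>x\<in>C. ac (of_real (u x)) x)" using u by simp
      also have "\<dots> = (\<Sum>z\<in>C. if z = x then h (y x) x * of_real (u x) else 0)"
        unfolding h_sum by (rule sum.cong) (use o u(2) in \<open>auto simp: h_ac\<close>)
      also have "\<dots> = h (y x) x * of_real (u x)" using C u(2) by simp
      finally show "u x = 0" using d[OF u(2)] by simp
    qed
    then show "card C \<le> card ?T" using r.independent_span_bound[OF fT] sT by auto
  qed
qed

lemma similitudeD:
  assumes "similitude V l g"
  shows "bij g" "g (x + y) = g x + g y" "g (ac d x) = ac d (g x)" "h (g x) (g y) = l *\<^sub>R h x y"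
    "g 0 = 0" "g (- x) = - g x" "g (x - y) = g x - g y"
proof -
  show "bij g" and a: "g (x + y) = g x + g y" and "g (ac d x) = ac d (g x)" "h (g x) (g y) = l *\<^sub>R h x y" for x y
    using assms by (auto simp: similitude_def dlinear_def)
  show z: "g 0 = 0" using assms by (metis add_cancel_left_left similitude_def dlinear_def)
  have a': "g (x + y) = g x + g y" for x y using assms by (auto simp: similitude_def dlinear_def)
  show n: "g (- x) = - g x" using a'[of x "- x"] z by (simp add: eq_neg_iff_add_eq_0 add.commute)
  show "g (x - y) = g x - g y" using a'[of "x - y" y] by simp
qed

lemma similitude_sum: "similitude V l g \<Longrightarrow> g (\<Sum>i\<in>A. f i) = (\<Sum>i\<in>A. g (f i))"
  by (induction A rule: infinite_finite_induct) (simp_all add: similitudeD)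

lemma similitude_comp: "similitude V l g \<Longrightarrow> similitude V l' g' \<Longrightarrow> similitude V (l * l') (g \<circ> g')"
  by (auto simp: similitude_def dlinear_def intro: bij_comp)

lemma similitude_inv:
  assumes g: "similitude V l g" and l: "l \<noteq> 0"
  shows "similitude V (inverse l) (inv_into UNIV g)"
proof -
  note g' = similitudeD[OF g]
  have gi: "g (inv_into UNIV g x) = x" for x using g'(1) by (simp add: bij_is_surj surj_f_inv_f)
  have ig: "inv_into UNIV g (g x) = x" for x using g'(1) by (simp add: bij_is_inj)
  have "inv_into UNIV g (x + y) = inv_into UNIV g x + inv_into UNIV g y" for x y
    using ig[of "inv_into UNIV g x + inv_into UNIV g y"] by (simp add: g'(2) gi)
  moreover have "inv_into UNIV g (ac d x) = ac d (inv_into UNIV g x)" for d x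
    using ig[of "ac d (inv_into UNIV g x)"] by (simp add: g'(3) gi)
  moreover have "h (inv_into UNIV g x) (inv_into UNIV g y) = inverse l *\<^sub>R h x y" for x y
    using g'(4)[of "inv_into UNIV g x" "inv_into UNIV g y"] l by (simp add: gi)
  ultimately show ?thesis
    using bij_imp_bij_inv[OF g'(1)] by (auto simp: similitude_def dlinear_def)
qed

lemma U_iff: "g \<in> U V \<longleftrightarrow> similitude V 1 g"
  by (simp add: U_def)

lemma U_comp: "g \<in> U V \<Longrightarrow> g' \<in> U V \<Longrightarrow> g \<circ> g' \<in> U V"
  using similitude_comp[of 1 g 1 g'] by (simp add: U_iff)

lemma U_inv: "g \<in> U V \<Longrightarrow> inv_into UNIV g \<in> U V"
  using similitude_inv[of 1 g] by (simp add: U_iff)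

lemma U_id: "id \<in> U V"
  by (simp add: U_iff similitude_def dlinear_def)

subsection \<open>Transvections and quasi-reflections\<close>

text \<open>For \<open>h u u = 0\<close> these are the transvections, for \<open>h u u \<noteq> 0\<close> the maps that multiply \<open>u\<close> by a scalar and
  fix its orthogonal complement; \<open>cond\<close> says that the map is an isometry.\<close>

definition R :: "'v \<Rightarrow> 'd \<Rightarrow> 'v \<Rightarrow> 'v" where
  "R u a x = x + ac (a * h u x) u"

definition cond :: "'v \<Rightarrow> 'd \<Rightarrow> bool" where
  "cond u a \<longleftrightarrow> a + eps *\<^sub>R tau a + eps *\<^sub>R (tau a * h u u * a) = 0"

lemma R_comp: "R u a (R u a' x) = R u (a + a' + a * h u u * a') x"
  by (simp add: R_def h_add h_ac ac_plus ac_mult[symmetric] algebra_simps flip: ac_plus)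

lemma R_0: "R u 0 = id"
  by (auto simp: R_def)

lemma R_fix: "h u x = 0 \<Longrightarrow> R u a x = x"
  by (simp add: R_def)

lemma R_in_U:
  assumes c: "cond u a"
  shows "R u a \<in> U V"
proof -
  let ?q = "h u u" and ?a' = "eps *\<^sub>R tau a"
  have 1: "?a' + a + ?a' * ?q * a = 0" using c by (simp add: cond_def algebra_simps)
  have 2: "a + ?a' + a * ?q * ?a' = 0"
  proof (cases "?q = 0")
    case True
    then show ?thesis using 1 by (simp add: add.commute)
  next
    case False
    have "(1 + ?a' * ?q) * (1 + a * ?q) = 1 + (?a' + a + ?a' * ?q * a) * ?q"
      by (simp add: algebra_simps)
    then have "(1 + ?a' * ?q) * (1 + a * ?q) = 1" by (simp only: 1 mult_zero_left add_0_right)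
    then have "(1 + a * ?q) * (1 + ?a' * ?q) = 1"
      by (metis inverse_unique inverse_inverse_eq left_inverse zero_neq_one mult_zero_left)
    moreover have "(1 + a * ?q) * (1 + ?a' * ?q) = 1 + (a + ?a' + a * ?q * ?a') * ?q"
      by (simp add: algebra_simps)
    ultimately have "(a + ?a' + a * ?q * ?a') * ?q = 0" by (metis add_cancel_left_right)
    then show ?thesis using False mult_eq_0_iff by blast
  qed
  have "bij (R u a)"
  proof (rule o_bij[where g = "R u ?a'"])
    show "R u ?a' \<circ> R u a = id" by (rule ext) (simp only: o_apply R_comp 1 R_0)
    show "R u a \<circ> R u ?a' = id" by (rule ext) (simp only: o_apply R_comp 2 R_0)
  qed
  moreover have "dlinear V (R u a)"
    by (simp add: dlinear_def R_def h_add h_ac ac_plus ac_add ac_mult algebra_simps)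
  moreover have "h (R u a x) (R u a y) = h x y" for x y
  proof -
    have "tau (h u x) = eps *\<^sub>R h x u" by (rule tau_h)
    then have "h (R u a x) (R u a y) - h x y = h x u * (a + eps *\<^sub>R tau a + eps *\<^sub>R (tau a * h u u * a)) * h u y"
      by (simp add: R_def h_add h_ac tau_mult algebra_simps)
    then show ?thesis using c by (simp add: cond_def)
  qed
  ultimately show ?thesis by (simp add: U_iff similitude_def)
qed

inductive_set tgroup :: "('v \<Rightarrow> 'v) set" where
  tgroup_id: "id \<in> tgroup"
| tgroup_R: "cond u a \<Longrightarrow> g \<in> tgroup \<Longrightarrow> R u a \<circ> g \<in> tgroup"

lemma tgroup_single: "cond u a \<Longrightarrow> R u a \<in> tgroup"
  using tgroup_R[OF _ tgroup_id] by simp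

lemma tgroup_comp: "g \<in> tgroup \<Longrightarrow> g' \<in> tgroup \<Longrightarrow> g \<circ> g' \<in> tgroup"
  by (induction rule: tgroup.induct) (simp_all add: tgroup_R comp_assoc)

lemma tgroup_U: "g \<in> tgroup \<Longrightarrow> g \<in> U V"
  by (induction rule: tgroup.induct) (rule U_id, rule U_comp[OF R_in_U])

lemma move_generic:
  assumes n: "h v v = h w w" and b: "h (v - w) v \<noteq> 0"
  obtains r where "r \<in> tgroup" "r v = w" "\<And>x. h v x = 0 \<Longrightarrow> h w x = 0 \<Longrightarrow> r x = x"
proof -
  let ?b = "h (v - w) v"
  let ?a = "- inverse ?b"
  have tb: "tau ?b = eps *\<^sub>R (h v v - h v w)"
    by (simp add: h_diff tau_diff tau_h algebra_simps)
  have etb: "eps *\<^sub>R tau ?b = h v v - h v w" unfolding tb by simp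
  have uu: "h (v - w) (v - w) = ?b + eps *\<^sub>R tau ?b"
    unfolding etb by (simp add: n h_diff)
  have tn: "tau ?b \<noteq> 0" using b by simp
  have "tau ?a * (?b + eps *\<^sub>R tau ?b) * ?a = inverse (tau ?b) + eps *\<^sub>R inverse ?b"
    unfolding tau_minus tau_inverse by (rule quasi_reflection_identity[OF b tn])
  then have c: "cond (v - w) ?a"
    unfolding cond_def uu by (simp add: tau_minus tau_inverse scaleR_add_right)
  show thesis
  proof (rule that)
    show "R (v - w) ?a \<in> tgroup" by (rule tgroup_single[OF c])
    show "R (v - w) ?a v = w" using b by (simp add: R_def ac_minus)
    show "R (v - w) ?a x = x" if "h v x = 0" "h w x = 0" for x
      by (rule R_fix) (simp add: h_diff that)
  qed
qed

text \<open>When the direct quasi-reflection degenerates, first reverse the sign of the vector.\<close>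

lemma move:
  assumes n: "h v v = h w w" and q: "h v v \<noteq> 0"
  obtains r where "r \<in> tgroup" "r v = w" "\<And>x. h v x = 0 \<Longrightarrow> h w x = 0 \<Longrightarrow> r x = x"
proof (cases "h (v - w) v = 0")
  case False
  show thesis using move_generic[OF n False] that by blast
next
  case True
  have dbl: "x + x \<noteq> 0" if "x \<noteq> 0" for x :: 'd
    using that by (metis scaleR_2 scaleR_eq_0_iff zero_neq_numeral)
  have wv: "h w v = h v v" using True by (simp add: h_diff)
  have "h (v - - v) v \<noteq> 0" using dbl[OF q] by (simp add: h_add)
  then obtain r where r: "r \<in> tgroup" "r v = - v" "\<And>x. h v x = 0 \<Longrightarrow> h (- v) x = 0 \<Longrightarrow> r x = x"
    using move_generic[of v "- v"] by (auto simp: h_minus)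
  have "h (- v - w) (- v) \<noteq> 0" using dbl[OF q] by (simp add: h_diff h_minus wv)
  then obtain r' where r': "r' \<in> tgroup" "r' (- v) = w" "\<And>x. h (- v) x = 0 \<Longrightarrow> h w x = 0 \<Longrightarrow> r' x = x"
    using move_generic[of "- v" w] n by (auto simp: h_minus)
  show thesis
    by (rule that[of "r' \<circ> r"]) (use r r' in \<open>auto simp: tgroup_comp h_minus\<close>)
qed

subsection \<open>Orthogonal sets\<close>

definition orth_set :: "'v set \<Rightarrow> bool" where
  "orth_set Q \<longleftrightarrow> finite Q \<and> (\<forall>x\<in>Q. h x x \<noteq> 0) \<and> (\<forall>x\<in>Q. \<forall>y\<in>Q. x \<noteq> y \<longrightarrow> h x y = 0)"

definition perp :: "'v set \<Rightarrow> 'v set" where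
  "perp Q = {x. \<forall>y\<in>Q. h y x = 0}"

lemma orth_set_bound: obtains K where "\<And>Q. orth_set Q \<Longrightarrow> card Q \<le> K"
proof -
  obtain K :: nat where K: "\<And>C y. finite C \<Longrightarrow> (\<And>x. x \<in> C \<Longrightarrow> h (y x) x \<noteq> 0) \<Longrightarrow>
     (\<And>x x'. x \<in> C \<Longrightarrow> x' \<in> C \<Longrightarrow> x \<noteq> x' \<Longrightarrow> h (y x) x' = 0) \<Longrightarrow> card C \<le> K"
    by (rule biorthogonal_bound) blast
  show thesis by (rule that[of K], rule K[where y = id]) (auto simp: orth_set_def)
qed

lemma orth_expand:
  assumes Q: "orth_set Q"
  shows "x - (\<Sum>v\<in>Q. ac (inverse (h v v) * h v x) v) \<in> perp Q"
proof -
  have "h y (\<Sum>v\<in>Q. ac (inverse (h v v) * h v x) v) = h y x" if y: "y \<in> Q" for y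
  proof -
    have "h y (\<Sum>v\<in>Q. ac (inverse (h v v) * h v x) v) = (\<Sum>v\<in>Q. if v = y then h y x else 0)"
      unfolding h_sum
      by (rule sum.cong) (use Q y in \<open>auto simp: orth_set_def h_ac mult.assoc[symmetric]\<close>)
    then show ?thesis using Q y by (simp add: orth_set_def)
  qed
  then show ?thesis by (simp add: perp_def h_diff)
qed

lemma orth_expand_full:
  assumes "orth_set Q" "perp Q = {0}"
  shows "x = (\<Sum>v\<in>Q. ac (inverse (h v v) * h v x) v)"
  using orth_expand[OF assms(1), of x] assms(2) by simp

lemma orth_set_insert:
  assumes "orth_set Q" "v \<in> perp Q" "h v v \<noteq> 0"
  shows "orth_set (insert v Q)" "v \<notin> Q"
proof -
  show "v \<notin> Q" using assms by (auto simp: perp_def)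
  show "orth_set (insert v Q)"
    using assms h_eq_0_sym by (auto simp: orth_set_def perp_def)
qed

text \<open>If all vectors of the complement were isotropic, polarisation and rescaling would give
  \<open>d = - eps \<tau>(d)\<close> for every \<open>d\<close>.\<close>

lemma anisotropic_exists:
  assumes e: "eps = 1 \<or> (\<exists>d::'d. tau d \<noteq> d)" and Q: "orth_set Q" and p: "perp Q \<noteq> {0}"
  obtains v where "v \<in> perp Q" "h v v \<noteq> 0"
proof (rule ccontr)
  assume "\<not> thesis"
  then have iso: "\<And>v. v \<in> perp Q \<Longrightarrow> h v v = 0" using that by blast
  have pa: "x + y \<in> perp Q" "ac d x \<in> perp Q" if "x \<in> perp Q" "y \<in> perp Q" for x y d
    using that by (auto simp: perp_def h_add h_ac)
  have "0 \<in> perp Q" by (simp add: perp_def)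
  then obtain x where x: "x \<in> perp Q" "x \<noteq> 0" using p by blast
  then obtain y0 where y0: "h x y0 \<noteq> 0" using h_nondeg by blast
  let ?z = "\<Sum>v\<in>Q. ac (inverse (h v v) * h v y0) v"
  let ?y = "y0 - ?z"
  have y: "?y \<in> perp Q" by (rule orth_expand[OF Q])
  have "h x ?z = 0" unfolding h_sum
    by (rule sum.neutral) (use x h_eq_0_sym in \<open>auto simp: perp_def h_ac\<close>)
  then have xy: "h x ?y \<noteq> 0" using y0 by (simp add: h_diff)
  have pol: "h x z + h z x = 0" if "z \<in> perp Q" for z
    using iso[OF pa(1)[OF x(1) that]] iso[OF x(1)] iso[OF that] by (simp add: h_add add.commute)
  \<comment> \<open>Rescaling the second vector makes the value of the form arbitrary.\<close>
  have all: "d = - eps *\<^sub>R tau d" for d :: 'd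
  proof -
    let ?w = "ac (inverse (h x ?y) * d) ?y"
    have hw: "h x ?w = d" using xy by (simp add: h_ac mult.assoc[symmetric])
    have "h x ?w + h ?w x = 0" by (rule pol[OF pa(2)[OF y y]])
    then show ?thesis unfolding h_sym[of ?w x] hw by (simp add: eq_neg_iff_add_eq_0)
  qed
  have "eps = -1" using all[of 1] eps by auto
  then show False using all e by auto
qed

lemma fixes_orth_imp_id:
  assumes g: "similitude V l g" and Q: "orth_set Q" "perp Q = {0}" and f: "\<And>x. x \<in> Q \<Longrightarrow> g x = x"
  shows "g = id"
proof
  fix x
  have "g x = g (\<Sum>v\<in>Q. ac (inverse (h v v) * h v x) v)" using orth_expand_full[OF Q, of x] by simp
  also have "\<dots> = (\<Sum>v\<in>Q. ac (inverse (h v v) * h v x) v)"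
    by (simp add: similitude_sum[OF g] similitudeD(3)[OF g] f)
  also have "\<dots> = x" using orth_expand_full[OF Q, of x] by simp
  finally show "g x = id x" by simp
qed

text \<open>Witt's argument: move an anisotropic vector back with quasi-reflections that fix the orthogonal set
  already treated.\<close>

lemma U_generated_aux:
  assumes e: "eps = 1 \<or> (\<exists>d::'d. tau d \<noteq> d)" and K: "\<And>Q. orth_set Q \<Longrightarrow> card Q \<le> K"
  shows "orth_set Q \<Longrightarrow> g \<in> U V \<Longrightarrow> (\<And>x. x \<in> Q \<Longrightarrow> g x = x) \<Longrightarrow> g \<in> tgroup"
proof (induction "K - card Q" arbitrary: Q g rule: less_induct)
  case less
  have gs: "similitude V 1 g" using less.prems(2) by (simp add: U_iff)
  show ?case
  proof (cases "perp Q = {0}")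
    case True
    then have "g = id" using fixes_orth_imp_id[OF gs less.prems(1)] less.prems(3) by blast
    then show ?thesis by (simp add: tgroup_id)
  next
    case False
    obtain v where v: "v \<in> perp Q" "h v v \<noteq> 0" by (rule anisotropic_exists[OF e less.prems(1) False])
    have gv: "h (g v) (g v) = h v v" by (simp add: similitudeD[OF gs])
    have gp: "h y (g v) = 0" if "y \<in> Q" for y
      using similitudeD(4)[OF gs, of y v] less.prems(3)[OF that] v(1) that by (simp add: perp_def)
    obtain r where r: "r \<in> tgroup" "r v = g v" "\<And>x. h v x = 0 \<Longrightarrow> h (g v) x = 0 \<Longrightarrow> r x = x"
      by (rule move[of v "g v"]) (use gv v in auto)
    have rU: "r \<in> U V" by (rule tgroup_U[OF r(1)])
    then have br: "bij r" by (simp add: U_iff similitude_def)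
    let ?g' = "inv_into UNIV r \<circ> g"
    have ir: "inv_into UNIV r (r x) = x" for x using br by (simp add: bij_is_inj)
    have "?g' x = x" if x: "x \<in> insert v Q" for x
    proof (cases "x = v")
      case True
      then show ?thesis using ir[of v] r(2) by simp
    next
      case False
      then have x: "x \<in> Q" using x by simp
      have "r x = x" using r(3)[of x] v(1) x gp[OF x] h_eq_0_sym by (auto simp: perp_def)
      then show ?thesis using ir[of x] less.prems(3)[OF x] by simp
    qed
    moreover have "?g' \<in> U V" by (rule U_comp[OF U_inv[OF rU] less.prems(2)])
    moreover note os = orth_set_insert[OF less.prems(1) v]
    moreover have "K - card (insert v Q) < K - card Q"
      using K[OF os(1)] os(2) less.prems(1) by (simp add: orth_set_def)
    ultimately have "?g' \<in> tgroup" using less.hyps by blast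
    then have "r \<circ> ?g' \<in> tgroup" by (rule tgroup_comp[OF r(1)])
    moreover have "r \<circ> ?g' = g" using br by (auto simp: fun_eq_iff bij_is_surj surj_f_inv_f)
    ultimately show ?thesis by simp
  qed
qed

lemma U_generated:
  assumes "eps = 1 \<or> (\<exists>d::'d. tau d \<noteq> d)" "g \<in> U V"
  shows "g \<in> tgroup"
proof -
  obtain K where "\<And>Q. orth_set Q \<Longrightarrow> card Q \<le> K" by (rule orth_set_bound) blast
  then show ?thesis using U_generated_aux[OF assms(1), of K "{}" g] assms(2) by (auto simp: orth_set_def)
qed

subsection \<open>Square roots of transvections and quasi-reflections\<close>

lemma sqrt_isotropic:
  assumes "cond u a" "h u u = 0"
  obtains a' where "cond u a'" "R u a' \<circ> R u a' = R u a"
proof (rule that[of "(1/2) *\<^sub>R a"])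
  have "(1/2) *\<^sub>R (a + eps *\<^sub>R tau a) = 0" using assms by (simp add: cond_def)
  then show "cond u ((1/2) *\<^sub>R a)" using assms(2)
    by (simp add: cond_def tau_scaleR scaleR_add_right mult.commute)
  show "R u ((1/2) *\<^sub>R a) \<circ> R u ((1/2) *\<^sub>R a) = R u a"
    by (rule ext) (simp add: R_comp assms flip: scaleR_add_left)
qed

lemma cond_iff:
  assumes "h u u \<noteq> 0"
  shows "cond u a \<longleftrightarrow> tau (1 + a * h u u) * h u u * (1 + a * h u u) = h u u"
proof -
  let ?q = "h u u"
  have tq: "tau ?q = eps *\<^sub>R ?q" by (rule tau_h)
  have "tau (1 + a * ?q) * ?q * (1 + a * ?q) = ?q + ?q * (a + eps *\<^sub>R tau a + eps *\<^sub>R (tau a * ?q * a)) * ?q"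
    by (simp add: tau_add tau_mult tq algebra_simps)
  then show ?thesis using assms by (simp add: cond_def)
qed

definition dbl :: "('v \<Rightarrow> 'v) \<Rightarrow> 'v \<Rightarrow> 'v" where
  "dbl g = g \<circ> g"

text \<open>A generator with a square root of the same kind has an eighth root of the same kind.\<close>

lemma tgroup_eighth_powers:
  assumes sqrt: "\<And>u a. cond u a \<Longrightarrow> \<exists>a'. cond u a' \<and> R u a' \<circ> R u a' = R u a"
    and id: "P id"
    and comp: "\<And>g g'. g \<in> U V \<Longrightarrow> g' \<in> U V \<Longrightarrow> P g \<Longrightarrow> P g' \<Longrightarrow> P (g \<circ> g')"
    and pow: "\<And>g. g \<in> U V \<Longrightarrow> P (dbl (dbl (dbl g)))"
  shows "g \<in> tgroup \<Longrightarrow> P g"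
proof (induction rule: tgroup.induct)
  case (tgroup_R u a g)
  obtain a1 where a1: "cond u a1" "R u a = dbl (R u a1)" using sqrt[OF tgroup_R(1)] by (auto simp: dbl_def)
  obtain a2 where a2: "cond u a2" "R u a1 = dbl (R u a2)" using sqrt[OF a1(1)] by (auto simp: dbl_def)
  obtain a3 where a3: "cond u a3" "R u a2 = dbl (R u a3)" using sqrt[OF a2(1)] by (auto simp: dbl_def)
  have "P (R u a)" using pow[OF R_in_U[OF a3(1)]] a1 a2 a3 by simp
  then show ?case using comp tgroup_R R_in_U tgroup_U by blast
qed (rule id)

subsection \<open>Anti-isometries\<close>

text \<open>A similitude of factor \<open>-1\<close> can be corrected by isometries until it swaps the members of
  orthogonal pairs \<open>v, w\<close> with \<open>h w w = - h v v\<close> spanning the space; then it is an involution.\<close>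

lemma anti_involution_aux:
  assumes e: "eps = 1 \<or> (\<exists>d::'d. tau d \<noteq> d)" and cen: "\<And>v d. h v v * d = d * h v v"
    and K: "\<And>Q. orth_set Q \<Longrightarrow> card Q \<le> K"
  shows "orth_set Q \<Longrightarrow> similitude V (-1) g \<Longrightarrow> (\<And>x. x \<in> Q \<Longrightarrow> g x \<in> Q \<and> g (g x) = x) \<Longrightarrow>
    \<exists>g' Q'. similitude V (-1) g' \<and> g' \<circ> g' = id \<and> orth_set Q' \<and> perp Q' = {0} \<and> g' ` Q' \<subseteq> Q'"
proof (induction "K - card Q" arbitrary: Q g rule: less_induct)
  case less
  note g = similitudeD[OF less.prems(2)]
  show ?case
  proof (cases "perp Q = {0}")
    case True
    have "similitude V (-1 * -1) (g \<circ> g)" by (rule similitude_comp[OF less.prems(2,2)])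
    then have "g \<circ> g = id"
      by (rule fixes_orth_imp_id[OF _ less.prems(1) True]) (use less.prems(3) in auto)
    then show ?thesis using less.prems True by (intro exI[of _ g] exI[of _ Q]) auto
  next
    case False
    obtain v where v: "v \<in> perp Q" "h v v \<noteq> 0" by (rule anisotropic_exists[OF e less.prems(1) False])
    define q where "q = h v v"
    define b where "b = h v (g v)"
    define w0 where "w0 = g v - ac (inverse q * b) v"
    define t where "t = 1 + nrm b / nrm q"
    have q0: "q \<noteq> 0" using v by (simp add: q_def)
    have nq: "nrm q > 0" by (rule nrm_pos[OF q0])
    have t: "t > 0"
    proof (cases "b = 0")
      case True
      then show ?thesis using tau_mult_self[of "0::'d"] by (simp add: t_def)
    next
      case False
      then show ?thesis using nrm_pos[OF False] nq by (simp add: t_def add_pos_pos)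
    qed
    have vw0: "h v w0 = 0"
      using q0 by (simp add: w0_def h_diff h_ac b_def q_def mult.assoc[symmetric])
    have tq: "tau q = eps *\<^sub>R q" unfolding q_def by (rule tau_h)
    have qq: "(eps / nrm q) *\<^sub>R (q * q) = 1"
    proof -
      have "(1 / nrm q) *\<^sub>R (eps *\<^sub>R (q * q)) = (1 / nrm q) *\<^sub>R (nrm q *\<^sub>R 1)"
        using tau_mult_self[of q] tq by (simp add: of_real_def)
      then show ?thesis using nq by simp
    qed
    have iq: "inverse q = (eps / nrm q) *\<^sub>R q"
      using qq by (intro inverse_unique) simp
    have "h w0 w0 = h (g v) w0 - tau (inverse q * b) * h v w0"
      by (subst (1) w0_def) (simp add: h_diff h_ac)
    also have "\<dots> = - q - h (g v) v * (inverse q * b)"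
    proof -
      have "h (g v) w0 = - q - h (g v) v * (inverse q * b)"
        by (simp add: w0_def h_diff h_ac g(4) q_def)
      then show ?thesis by (simp add: vw0)
    qed
    also have "h (g v) v = eps *\<^sub>R tau b" unfolding b_def by (rule h_sym)
    also have "eps *\<^sub>R tau b * (inverse q * b) = (1 / nrm q) *\<^sub>R (q * (tau b * b))"
    proof -
      have "eps *\<^sub>R tau b * (inverse q * b) = (1 / nrm q) *\<^sub>R ((tau b * q) * b)"
        unfolding iq by (simp add: mult.assoc)
      also have "tau b * q = q * tau b" using cen[of v "tau b"] by (simp add: q_def)
      finally show ?thesis by (simp add: mult.assoc)
    qed
    also have "\<dots> = (nrm b / nrm q) *\<^sub>R q"
      unfolding tau_mult_self by (simp add: of_real_def)
    finally have w0: "h w0 w0 = - (t *\<^sub>R q)" by (simp add: t_def scaleR_add_left)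
    define w where "w = ac (of_real (1 / sqrt t)) w0"
    have ww: "h w w = - q"
    proof -
      have "h w w = (1 / sqrt t * (1 / sqrt t)) *\<^sub>R h w0 w0"
        by (simp only: w_def h_ac tau_of_real) (simp add: of_real_def)
      also have "1 / sqrt t * (1 / sqrt t) = 1 / t" using t by simp
      finally show ?thesis using t by (simp add: w0)
    qed
    have vw: "h v w = 0" by (simp add: w_def h_ac vw0)
    have gvp: "h y (g v) = 0" if y: "y \<in> Q" for y
    proof -
      have "h y (g v) = h (g (g y)) (g v)" using less.prems(3)[OF y] by simp
      also have "\<dots> = - h (g y) v" by (simp add: g(4))
      also have "\<dots> = 0" using v(1) less.prems(3)[OF y] by (simp add: perp_def)
      finally show ?thesis .
    qed
    have wp: "h y w = 0" if "y \<in> Q" for y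
      using gvp[OF that] v(1) that by (simp add: w_def w0_def h_ac h_diff perp_def)
    have gvn: "h (g v) (g v) = - q" by (simp add: g(4) q_def)
    obtain r1 where r1: "r1 \<in> tgroup" "r1 (g v) = w" "\<And>x. h (g v) x = 0 \<Longrightarrow> h w x = 0 \<Longrightarrow> r1 x = x"
      by (rule move[of "g v" w]) (use gvn ww q0 in auto)
    have r1Q: "r1 y = y" if "y \<in> Q" for y
      by (rule r1(3)) (use gvp[OF that] wp[OF that] h_eq_0_sym in blast)+
    define g1 where "g1 = r1 \<circ> g"
    have g1s: "similitude V (-1) g1"
      using similitude_comp[of 1 r1 "-1" g] tgroup_U[OF r1(1)] less.prems(2) by (simp add: g1_def U_iff)
    note g1 = similitudeD[OF g1s]
    have g1v: "g1 v = w" by (simp add: g1_def r1)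
    have g1Q: "g1 y = g y" if "y \<in> Q" for y
      using less.prems(3)[OF that] r1Q by (simp add: g1_def)
    have g1w: "h (g1 w) (g1 w) = q" "h (g1 w) w = 0"
      using g1(4)[of w w] g1(4)[of w v] ww vw h_eq_0_sym by (auto simp: g1v)
    have g1wp: "h y (g1 w) = 0" if y: "y \<in> Q" for y
    proof -
      have gy: "g y \<in> Q" "g1 (g y) = y" using less.prems(3)[OF y] g1Q by auto
      have "h y (g1 w) = h (g1 (g y)) (g1 w)" by (simp add: gy)
      also have "\<dots> = - h (g y) w" by (simp add: g1(4))
      finally show ?thesis using wp gy by simp
    qed
    obtain r2 where r2: "r2 \<in> tgroup" "r2 (g1 w) = v" "\<And>x. h (g1 w) x = 0 \<Longrightarrow> h v x = 0 \<Longrightarrow> r2 x = x"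
      by (rule move[of "g1 w" v]) (use g1w q0 in \<open>auto simp: q_def\<close>)
    have r2w: "r2 w = w" by (rule r2(3)) (use g1w vw in auto)
    have r2Q: "r2 y = y" if "y \<in> Q" for y
      by (rule r2(3)) (use g1wp[OF that] v(1) that h_eq_0_sym in \<open>auto simp: perp_def\<close>)
    define g2 where "g2 = r2 \<circ> g1"
    have g2s: "similitude V (-1) g2"
      using similitude_comp[of 1 r2 "-1" g1] tgroup_U[OF r2(1)] g1s by (simp add: g2_def U_iff)
    have g2: "g2 v = w" "g2 w = v" "\<And>y. y \<in> Q \<Longrightarrow> g2 y = g y"
      using g1Q less.prems(3) r2Q by (auto simp: g2_def g1v r2w r2(2))
    have os: "orth_set (insert v Q)" "v \<notin> Q" by (rule orth_set_insert[OF less.prems(1) v])+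
    have wp': "w \<in> perp (insert v Q)" using wp vw by (simp add: perp_def)
    have os': "orth_set (insert w (insert v Q))" "w \<notin> insert v Q"
      by (rule orth_set_insert[OF os(1) wp'], use ww q0 in simp)+
    have "K - card (insert w (insert v Q)) < K - card Q"
      using K[OF os'(1)] os os' less.prems(1) by (simp add: orth_set_def)
    then show ?thesis
    proof (rule less.hyps[OF _ os'(1) g2s])
      fix x assume "x \<in> insert w (insert v Q)"
      then show "g2 x \<in> insert w (insert v Q) \<and> g2 (g2 x) = x"
        using g2 less.prems(3) by auto
    qed
  qed
qed

lemma anti_involution:
  assumes "eps = 1 \<or> (\<exists>d::'d. tau d \<noteq> d)" "\<And>v d. h v v * d = d * h v v" "similitude V (-1) g"
  obtains g' Q' where "similitude V (-1) g'" "g' \<circ> g' = id" "orth_set Q'" "perp Q' = {0}" "g' ` Q' \<subseteq> Q'"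
proof -
  obtain K where K: "\<And>Q. orth_set Q \<Longrightarrow> card Q \<le> K" by (rule orth_set_bound) blast
  have "\<exists>g' Q'. similitude V (-1) g' \<and> g' \<circ> g' = id \<and> orth_set Q' \<and> perp Q' = {0} \<and> g' ` Q' \<subseteq> Q'"
    by (rule anti_involution_aux[OF assms(1,2) K, of "{}" g]) (use assms(3) in \<open>auto simp: orth_set_def\<close>)
  then show thesis using that by blast
qed

lemma full_orth_set_exists:
  assumes "eps = 1 \<or> (\<exists>d::'d. tau d \<noteq> d)"
  obtains Q where "orth_set Q" "perp Q = {0}"
proof -
  obtain K where K: "\<And>Q. orth_set Q \<Longrightarrow> card Q \<le> K" by (rule orth_set_bound) blast
  have 0: "orth_set {}" by (simp add: orth_set_def)
  have b: "finite Q \<and> card Q \<le> K" if "orth_set Q" for Q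
    using K[OF that] that by (simp add: orth_set_def)
  obtain Q where Q: "orth_set Q" "\<And>c. c \<notin> Q \<Longrightarrow> \<not> orth_set (insert c Q)"
    using finite_maximal_set[of orth_set K, OF 0 b] by metis
  have "perp Q = {0}"
  proof (rule ccontr)
    assume "perp Q \<noteq> {0}"
    then obtain v where "v \<in> perp Q" "h v v \<noteq> 0" using anisotropic_exists[OF assms Q(1)] by blast
    then show False using orth_set_insert[OF Q(1)] Q(2) by blast
  qed
  then show thesis using Q(1) that by blast
qed

text \<open>Multiplying the members of an orthogonal basis by units that anticommute with their norms gives a
  complex structure of similitude factor \<open>-1\<close>.\<close>

lemma anti_complex_structure:
  assumes e: "eps = 1 \<or> (\<exists>d::'d. tau d \<noteq> d)"
    and J: "\<And>q::'d. q \<noteq> 0 \<Longrightarrow> tau q = eps *\<^sub>R q \<Longrightarrow> \<exists>j. j * j = -1 \<and> tau j * q * j = - q"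
  obtains g where "similitude V (-1) g" "g \<circ> g = uminus"
proof -
  obtain Q where Q: "orth_set Q" "perp Q = {0}" by (rule full_orth_set_exists[OF e])
  have "\<exists>j. j * j = -1 \<and> tau j * h v v * j = - h v v" if "v \<in> Q" for v
    using J[of "h v v"] tau_h[of v v] Q(1) that by (auto simp: orth_set_def)
  then obtain j where j: "\<And>v. v \<in> Q \<Longrightarrow> j v * j v = -1" "\<And>v. v \<in> Q \<Longrightarrow> tau (j v) * h v v * j v = - h v v"
    by metis
  define c where "c v x = inverse (h v v) * h v x" for v x
  define g where "g x = (\<Sum>v\<in>Q. ac (j v * c v x) v)" for x
  have ex: "x = (\<Sum>v\<in>Q. ac (c v x) v)" for x
    unfolding c_def by (rule orth_expand_full[OF Q])
  have hv: "h v (g x) = h v v * (j v * c v x)" if v: "v \<in> Q" for v x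
  proof -
    have "h v (g x) = (\<Sum>w\<in>Q. if w = v then h v v * (j v * c v x) else 0)"
      unfolding g_def h_sum by (rule sum.cong) (use Q v in \<open>auto simp: orth_set_def h_ac\<close>)
    then show ?thesis using Q v by (simp add: orth_set_def)
  qed
  have cg: "c v (g x) = j v * c v x" if "v \<in> Q" for v x
    using hv[OF that] Q(1) that unfolding c_def[of v "g x"] by (simp add: orth_set_def mult.assoc[symmetric])
  have gg: "g (g x) = - x" for x
  proof -
    have "g (g x) = (\<Sum>v\<in>Q. ac (j v * j v * c v x) v)"
      unfolding g_def[of "g x"] by (rule sum.cong) (simp_all add: cg mult.assoc)
    also have "\<dots> = (\<Sum>v\<in>Q. - ac (c v x) v)" by (rule sum.cong) (simp_all add: j ac_minus)
    also have "\<dots> = - x" using ex[of x] by (simp add: sum_negf)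
    finally show ?thesis .
  qed
  have form: "h x y = (\<Sum>v\<in>Q. tau (c v x) * h v v * c v y)" for x y
  proof -
    have "h x y = h x (\<Sum>v\<in>Q. ac (c v y) v)" using ex[of y] by simp
    also have "\<dots> = (\<Sum>v\<in>Q. h x v * c v y)" by (simp add: h_sum h_ac)
    also have "\<dots> = (\<Sum>v\<in>Q. tau (c v x) * h v v * c v y)"
    proof (rule sum.cong[OF refl])
      fix v assume v: "v \<in> Q"
      have "tau (h v v) = eps *\<^sub>R h v v" "h v v \<noteq> 0" using v Q(1) tau_h by (auto simp: orth_set_def)
      then have "inverse (tau (h v v)) * h v v = eps *\<^sub>R 1"
        using eps by auto
      then have "tau (c v x) * h v v = h x v"
        by (simp add: c_def tau_mult tau_inverse tau_h mult.assoc)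
      then show "h x v * c v y = tau (c v x) * h v v * c v y" by simp
    qed
    finally show ?thesis .
  qed
  have "bij g"
  proof (rule o_bij[where g = "\<lambda>x. - g x"])
    show "(\<lambda>x. - g x) \<circ> g = id" by (simp add: fun_eq_iff gg)
    have "g (- x) = - g x" for x using gg[of "g x"] by (simp add: gg)
    then show "g \<circ> (\<lambda>x. - g x) = id" by (simp add: fun_eq_iff gg)
  qed
  moreover have cadd: "c v (x + y) = c v x + c v y" "c v (ac d x) = c v x * d" for v x y d
    by (simp_all add: c_def h_add h_ac distrib_left mult.assoc)
  have "dlinear V g"
    unfolding dlinear_def g_def cadd
    by (auto simp: distrib_left ac_plus sum.distrib ac_sum mult.assoc[symmetric] ac_mult[symmetric])
  moreover have "h (g x) (g y) = - h x y" for x y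
  proof -
    have "h (g x) (g y) = (\<Sum>v\<in>Q. tau (c v x) * (tau (j v) * h v v * j v) * c v y)"
      unfolding form[of "g x"] by (rule sum.cong) (simp_all add: cg tau_mult mult.assoc)
    also have "\<dots> = (\<Sum>v\<in>Q. - (tau (c v x) * h v v * c v y))"
      by (rule sum.cong) (simp_all add: j)
    finally show ?thesis by (simp add: form[of x y] sum_negf)
  qed
  ultimately have "similitude V (-1) g" by (simp add: similitude_def)
  then show thesis using that gg by (auto simp: fun_eq_iff)
qed

end

locale rotating_hermitian = hermitian V eps
  for V :: "('d::rotating_involution, 'v::ab_group_add) form_space" and eps
begin

lemma ex_tau_neq: "\<exists>d::'d. tau d \<noteq> d"
proof -
  obtain J :: 'd where J: "J * J = -1" "tau J * J = 1" using ex_root[of "1::'d"] by auto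
  have "tau J \<noteq> J"
  proof
    assume "tau J = J"
    then have "(1::'d) = -1" using J by simp
    then have "(2::real) *\<^sub>R (1::'d) = 0" by (simp add: scaleR_2 eq_neg_iff_add_eq_0)
    then show False by simp
  qed
  then show ?thesis by blast
qed

text \<open>A unit \<open>c\<close> other than \<open>-1\<close> has the square root \<open>(1 + c) / \<bar>1 + c\<bar>\<close>.\<close>

lemma unit_sqrt:
  fixes c q :: 'd
  assumes c: "tau c * c = 1" "c * q = q * c" and q: "tau q = q \<or> tau q = - q"
  obtains c' where "c' * c' = c" "tau c' * c' = 1" "c' * q = q * c'"
proof (cases "c = -1")
  case True
  then show thesis using ex_root[OF q] that by blast
next
  case False
  define d where "d = 1 + c"
  define n where "n = nrm d"
  define r :: 'd where "r = of_real (1 / sqrt n)"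
  have d0: "d \<noteq> 0" using False by (auto simp: d_def add_eq_0_iff)
  have n: "n > 0" unfolding n_def by (rule nrm_pos[OF d0])
  have td: "tau d * d = of_real n" unfolding n_def by (rule tau_mult_self)
  have c0: "c \<noteq> 0" using c(1) by auto
  have "c * (tau c * c) = c" using c by simp
  then have ct: "c * tau c = 1" using c0 by (simp add: mult.assoc[symmetric])
  have "c * of_real n = (c + c * tau c) * d" unfolding td[symmetric] by (simp add: d_def tau_add distrib_left distrib_right mult.assoc)
  then have dd: "d * d = c * of_real n" by (simp add: ct d_def add.commute)
  have "1 / sqrt n * (1 / sqrt n) * n = 1" using n by simp
  then have rr: "r * r * of_real n = 1" by (simp only: r_def of_real_mult[symmetric] of_real_1)
  have rc: "r * x = x * r" for x unfolding r_def by (rule of_real_central)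
  have tr: "tau r = r" unfolding r_def by (rule tau_of_real)
  show thesis
  proof (rule that)
    have "(r * d) * (r * d) = (r * r) * (d * d)" by (metis rc mult.assoc)
    also have "\<dots> = c * (r * r * of_real n)" unfolding dd by (metis rc mult.assoc)
    finally show "(r * d) * (r * d) = c" by (simp add: rr)
    have "tau (r * d) * (r * d) = (r * r) * (tau d * d)" unfolding tau_mult tr by (metis rc mult.assoc)
    then show "tau (r * d) * (r * d) = 1" by (simp add: td rr)
    have "d * q = q * d" using c(2) by (simp add: d_def distrib_left distrib_right)
    then show "(r * d) * q = q * (r * d)" by (metis rc mult.assoc)
  qed
qed

text \<open>On the line spanned by \<open>u\<close> the map is multiplication by a unit commuting with the norm of \<open>u\<close>; take a square
  root of that unit.\<close>

lemma quasi_reflection_sqrt: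
  assumes c: "cond u a"
  shows "\<exists>a'. cond u a' \<and> R u a' \<circ> R u a' = R u a"
proof (cases "h u u = 0")
  case True
  then show ?thesis using sqrt_isotropic[OF c] by metis
next
  case False
  let ?q = "h u u"
  define w where "w = 1 + a * ?q"
  have wq: "tau w * ?q * w = ?q" using c cond_iff[OF False] by (simp add: w_def)
  have "nrm (tau w * ?q * w) = nrm w * nrm ?q * nrm w" by (simp add: nrm_mult nrm_tau)
  then have "nrm w * nrm w = 1" using wq nrm_pos[OF False] by simp
  moreover have "w \<noteq> 0" using wq False by auto
  ultimately have "nrm w = 1" using nrm_pos[of w] by (metis abs_of_pos abs_1 square_eq_1_iff less_asym less_minus_one_simps(1))
  then have tw: "tau w * w = 1" "w * tau w = 1" by (simp_all add: tau_mult_self self_mult_tau)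
  have "w * ?q = w * (tau w * ?q * w)" by (simp add: wq)
  also have "\<dots> = ?q * w" by (simp add: tw mult.assoc[symmetric])
  finally have wc: "w * ?q = ?q * w" .
  have tq: "tau ?q = ?q \<or> tau ?q = - ?q" using tau_h[of u u] eps by auto
  obtain w' where w': "w' * w' = w" "tau w' * w' = 1" "w' * ?q = ?q * w'"
    by (rule unit_sqrt[OF tw(1) wc tq])
  define a' where "a' = (w' - 1) * inverse ?q"
  have a'q: "a' * ?q = w' - 1" using False by (simp add: a'_def mult.assoc)
  have "tau w' * ?q * w' = tau w' * w' * ?q" by (simp add: mult.assoc w'(3))
  then have "cond u a'" unfolding cond_iff[OF False] by (simp add: a'q w'(2))
  moreover have "(a' + a' + a' * ?q * a') * ?q = a * ?q"
  proof -
    have "(a' + a' + a' * ?q * a') * ?q = a' * ?q + a' * ?q + (a' * ?q) * (a' * ?q)"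
      by (simp add: distrib_right mult.assoc)
    also have "\<dots> = w' * w' - 1" unfolding a'q by (simp add: algebra_simps)
    also have "\<dots> = a * ?q" by (simp add: w' w_def)
    finally show ?thesis .
  qed
  then have "a' + a' + a' * ?q * a' = a" using False by simp
  then have "R u a' \<circ> R u a' = R u a" by (auto simp: fun_eq_iff R_comp)
  ultimately show ?thesis by blast
qed

lemma U_eighth_powers:
  assumes "P id" "\<And>g g'. g \<in> U V \<Longrightarrow> g' \<in> U V \<Longrightarrow> P g \<Longrightarrow> P g' \<Longrightarrow> P (g \<circ> g')"
    and "\<And>g. g \<in> U V \<Longrightarrow> P (dbl (dbl (dbl g)))" and "g \<in> U V"
  shows "P g"
  by (rule tgroup_eighth_powers[of P, OF quasi_reflection_sqrt assms(1-3) U_generated[OF disjI2[OF ex_tau_neq] assms(4)]])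

end

section \<open>Real symplectic spaces\<close>

locale real_symplectic = hermitian V "-1"
  for V :: "(real, 'v::ab_group_add) form_space"
begin

lemma h_swap: "h y x = - h x y"
  using h_sym[of y x] by (simp add: tau_real_def)

lemma h_self [simp]: "h x x = 0"
  using h_swap[of x x] by simp

lemma cond_all: "cond u a"
  by (simp add: cond_def tau_real_def)

definition spairs :: "('v \<times> 'v) set \<Rightarrow> bool" where
  "spairs P \<longleftrightarrow> finite P \<and> (\<forall>p\<in>P. \<forall>q\<in>P. h (fst p) (fst q) = 0 \<and> h (snd p) (snd q) = 0 \<and>
     h (fst p) (snd q) = (if p = q then 1 else 0))"

definition sperp :: "('v \<times> 'v) set \<Rightarrow> 'v set" where
  "sperp P = {x. \<forall>p\<in>P. h (fst p) x = 0 \<and> h (snd p) x = 0}"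

definition spart :: "('v \<times> 'v) set \<Rightarrow> 'v \<Rightarrow> 'v" where
  "spart P x = (\<Sum>p\<in>P. ac (- h (snd p) x) (fst p) + ac (h (fst p) x) (snd p))"

lemma spairsD:
  assumes "spairs P" "p \<in> P" "q \<in> P"
  shows "h (fst p) (fst q) = 0" "h (snd p) (snd q) = 0" "h (fst p) (snd q) = (if p = q then 1 else 0)"
    "h (snd p) (fst q) = (if p = q then -1 else 0)"
  using assms h_swap[of "snd p" "fst q"] by (auto simp: spairs_def)

lemma spairs_bound: obtains K where "\<And>P. spairs P \<Longrightarrow> card P \<le> K"
proof -
  obtain K :: nat where K: "\<And>C y. finite C \<Longrightarrow> (\<And>x. x \<in> C \<Longrightarrow> h (y x) x \<noteq> 0) \<Longrightarrow>
     (\<And>x x'. x \<in> C \<Longrightarrow> x' \<in> C \<Longrightarrow> x \<noteq> x' \<Longrightarrow> h (y x) x' = 0) \<Longrightarrow> card C \<le> K"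
    by (rule biorthogonal_bound) blast
  show thesis
  proof (rule that)
    fix P assume P: "spairs P"
    have inj: "inj_on fst P"
      by (rule inj_onI) (metis P spairsD(3) zero_neq_one)
    have "card (fst ` P) \<le> K"
    proof (rule K[where y = "\<lambda>x. snd (inv_into P fst x)"])
      show "finite (fst ` P)" using P by (simp add: spairs_def)
      show "h (snd (inv_into P fst x)) x \<noteq> 0" if x: "x \<in> fst ` P" for x
        using spairsD(4)[OF P inv_into_into[OF x] inv_into_into[OF x]] f_inv_into_f[OF x] by simp
      show "h (snd (inv_into P fst x)) x' = 0" if x: "x \<in> fst ` P" "x' \<in> fst ` P" "x \<noteq> x'" for x x'
        using spairsD(4)[OF P inv_into_into[OF x(1)] inv_into_into[OF x(2)]]
          f_inv_into_f[OF x(1)] f_inv_into_f[OF x(2)] x(3) by auto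
    qed
    then show "card P \<le> K" using card_image[OF inj] by simp
  qed
qed

lemma spart_pair:
  assumes P: "spairs P" "q \<in> P"
  shows "h (fst q) (spart P x) = h (fst q) x" "h (snd q) (spart P x) = h (snd q) x"
proof -
  have fP: "finite P" using P by (simp add: spairs_def)
  have "h (fst q) (spart P x) = (\<Sum>p\<in>P. if p = q then h (fst q) x else 0)"
    unfolding spart_def h_sum by (rule sum.cong) (use spairsD[OF P(1) P(2)] in \<open>auto simp: h_add h_ac\<close>)
  then show "h (fst q) (spart P x) = h (fst q) x" using P fP by simp
  have "h (snd q) (spart P x) = (\<Sum>p\<in>P. if p = q then h (snd q) x else 0)"
    unfolding spart_def h_sum by (rule sum.cong) (use spairsD[OF P(1) P(2)] in \<open>auto simp: h_add h_ac\<close>)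
  then show "h (snd q) (spart P x) = h (snd q) x" using P fP by simp
qed

lemma spart_perp: "spairs P \<Longrightarrow> x - spart P x \<in> sperp P"
  by (simp add: sperp_def h_diff spart_pair)

lemma spart_full: "spairs P \<Longrightarrow> sperp P = {0} \<Longrightarrow> spart P x = x"
  using spart_perp[of P x] by simp

lemma sperp_add: "x \<in> sperp P \<Longrightarrow> y \<in> sperp P \<Longrightarrow> x + y \<in> sperp P"
  and sperp_ac: "x \<in> sperp P \<Longrightarrow> ac d x \<in> sperp P"
  by (auto simp: sperp_def h_add h_ac)

lemma spartner:
  assumes P: "spairs P" and v: "v \<in> sperp P" "v \<noteq> 0"
  obtains w where "w \<in> sperp P" "h v w = 1"
proof -
  obtain y where y: "h v y \<noteq> 0" using h_nondeg[of v] v(2) by blast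
  let ?z = "y - spart P y"
  have z: "?z \<in> sperp P" by (rule spart_perp[OF P])
  have "h v (fst p) = 0 \<and> h v (snd p) = 0" if "p \<in> P" for p
    using v(1) that h_swap[of v "fst p"] h_swap[of v "snd p"] by (simp add: sperp_def)
  then have "h v (spart P y) = 0"
    unfolding spart_def h_sum by (intro sum.neutral) (simp add: h_add h_ac)
  then have "h v ?z = h v y" by (simp add: h_diff)
  then have "h v (ac (1 / h v y) ?z) = 1" using y by (simp add: h_ac)
  then show thesis using that sperp_ac[OF z] by blast
qed

text \<open>When \<open>h v' v \<noteq> 0\<close> a single transvection along \<open>v' - v\<close> carries \<open>v\<close> to \<open>v'\<close>.\<close>

lemma smove:
  assumes "h v' v \<noteq> 0"
  obtains r where "r \<in> tgroup" "r v = v'" "\<And>x. h v x = h v' x \<Longrightarrow> r x = x"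
proof (rule that)
  show "R (v' - v) (1 / h v' v) \<in> tgroup" by (rule tgroup_single[OF cond_all])
  show "R (v' - v) (1 / h v' v) v = v'" using assms by (simp add: R_def h_diff)
  show "R (v' - v) (1 / h v' v) x = x" if "h v x = h v' x" for x
    by (rule R_fix) (simp add: h_diff that)
qed

lemma smove_first:
  assumes P: "spairs P" and v: "v \<in> sperp P" "v \<noteq> 0" and v': "v' \<in> sperp P" "v' \<noteq> 0"
  obtains r where "r \<in> tgroup" "r v = v'" "\<And>p. p \<in> P \<Longrightarrow> r (fst p) = fst p \<and> r (snd p) = snd p"
proof -
  have fix1: "h x (fst p) = 0 \<and> h x (snd p) = 0" if "x \<in> sperp P" "p \<in> P" for x p
    using that h_swap[of x "fst p"] h_swap[of x "snd p"] by (simp add: sperp_def)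
  have step: "\<exists>r\<in>tgroup. r x = y \<and> (\<forall>p\<in>P. r (fst p) = fst p \<and> r (snd p) = snd p)"
    if xy: "x \<in> sperp P" "y \<in> sperp P" "h y x \<noteq> 0" for x y
  proof -
    obtain r where "r \<in> tgroup" "r x = y" "\<And>z. h x z = h y z \<Longrightarrow> r z = z"
      by (rule smove[OF xy(3)]) blast
    then show ?thesis using fix1[OF xy(1)] fix1[OF xy(2)] by (intro bexI[of _ r]) auto
  qed
  obtain w where w: "w \<in> sperp P" "h v w = 1" by (rule spartner[OF P v])
  obtain w' where w': "w' \<in> sperp P" "h v' w' = 1" by (rule spartner[OF P v'])
  have "\<exists>z\<in>sperp P. h v z \<noteq> 0 \<and> h v' z \<noteq> 0"
  proof (cases "h v' w = 0")
    case False
    then show ?thesis using w by (intro bexI[of _ w]) auto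
  next
    case True
    show ?thesis
    proof (cases "h v w' = 0")
      case False
      then show ?thesis using w' by (intro bexI[of _ w']) auto
    next
      case vw: True
      then show ?thesis using w w' True sperp_add[OF w(1) w'(1)] by (intro bexI[of _ "w + w'"]) (auto simp: h_add)
    qed
  qed
  then obtain z where z: "z \<in> sperp P" "h v z \<noteq> 0" "h v' z \<noteq> 0" by blast
  have "h z v \<noteq> 0" using z(2) h_swap[of z v] by simp
  then obtain r1 where r1: "r1 \<in> tgroup" "r1 v = z" "\<And>p. p \<in> P \<Longrightarrow> r1 (fst p) = fst p \<and> r1 (snd p) = snd p"
    using step[OF v(1) z(1)] by blast
  obtain r2 where r2: "r2 \<in> tgroup" "r2 z = v'" "\<And>p. p \<in> P \<Longrightarrow> r2 (fst p) = fst p \<and> r2 (snd p) = snd p"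
    using step[OF z(1) v'(1) z(3)] by blast
  show thesis
    by (rule that[of "r2 \<circ> r1"]) (use r1 r2 in \<open>auto simp: tgroup_comp\<close>)
qed

lemma smove_second:
  assumes P: "spairs P" and v: "v \<in> sperp P"
    and w: "w \<in> sperp P" "h v w = 1" and w': "w' \<in> sperp P" "h v w' = 1"
  obtains r where "r \<in> tgroup" "r w = w'" "r v = v"
    "\<And>p. p \<in> P \<Longrightarrow> r (fst p) = fst p \<and> r (snd p) = snd p"
proof -
  have fix1: "h x (fst p) = 0 \<and> h x (snd p) = 0" if "x \<in> sperp P" "p \<in> P" for x p
    using that h_swap[of x "fst p"] h_swap[of x "snd p"] by (simp add: sperp_def)
  have step: "\<exists>r\<in>tgroup. r x = y \<and> r v = v \<and> (\<forall>p\<in>P. r (fst p) = fst p \<and> r (snd p) = snd p)"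
    if xy: "x \<in> sperp P" "y \<in> sperp P" "h y x \<noteq> 0" "h v x = 1" "h v y = 1" for x y
  proof -
    obtain r where "r \<in> tgroup" "r x = y" "\<And>z. h x z = h y z \<Longrightarrow> r z = z"
      by (rule smove[OF xy(3)]) blast
    then show ?thesis using fix1[OF xy(1)] fix1[OF xy(2)] xy h_swap[of x v] h_swap[of y v]
      by (intro bexI[of _ r]) auto
  qed
  show thesis
  proof (cases "h w' w = 0")
    case False
    then show ?thesis using step[OF w(1) w'(1)] w w' that by blast
  next
    case True
    have z: "w + v \<in> sperp P" "h (w + v) w \<noteq> 0" "h w' (w + v) \<noteq> 0" "h v (w + v) = 1"
      using sperp_add[OF w(1) v] w w' True h_swap[of w' v] by (auto simp: h_add)
    obtain r1 where r1: "r1 \<in> tgroup" "r1 w = w + v" "r1 v = v"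
      "\<And>p. p \<in> P \<Longrightarrow> r1 (fst p) = fst p \<and> r1 (snd p) = snd p"
      using step[OF w(1) z(1,2) w(2) z(4)] by blast
    obtain r2 where r2: "r2 \<in> tgroup" "r2 (w + v) = w'" "r2 v = v"
      "\<And>p. p \<in> P \<Longrightarrow> r2 (fst p) = fst p \<and> r2 (snd p) = snd p"
      using step[OF z(1) w'(1) z(3,4) w'(2)] by blast
    show ?thesis
      by (rule that[of "r2 \<circ> r1"]) (use r1 r2 in \<open>auto simp: tgroup_comp\<close>)
  qed
qed

lemma spairs_insert:
  assumes P: "spairs P" and v: "v \<in> sperp P" and w: "w \<in> sperp P" "h v w = 1"
  shows "spairs (insert (v, w) P)" "(v, w) \<notin> P"
proof -
  show n: "(v, w) \<notin> P"
  proof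
    assume "(v, w) \<in> P"
    then have "h w v = 0" using v by (force simp: sperp_def)
    then show False using w(2) h_swap[of v w] by simp
  qed
  have f: "h x (fst p) = 0 \<and> h x (snd p) = 0" if "x \<in> sperp P" "p \<in> P" for x p
    using that h_swap[of x "fst p"] h_swap[of x "snd p"] by (simp add: sperp_def)
  show "spairs (insert (v, w) P)"
    using P n f[OF v] f[OF w(1)] v w unfolding spairs_def sperp_def by auto
qed

lemma fixes_spairs_imp_id:
  assumes g: "similitude V l g" and P: "spairs P" "sperp P = {0}"
    and f: "\<And>p. p \<in> P \<Longrightarrow> g (fst p) = fst p \<and> g (snd p) = snd p"
  shows "g = id"
proof
  fix x
  have "g (spart P x) = spart P x"
    unfolding spart_def by (simp add: similitude_sum[OF g] similitudeD[OF g] f)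
  then show "g x = id x" by (simp add: spart_full[OF P])
qed

lemma Sp_generated_aux:
  assumes K: "\<And>P. spairs P \<Longrightarrow> card P \<le> K"
  shows "spairs P \<Longrightarrow> g \<in> U V \<Longrightarrow> (\<And>p. p \<in> P \<Longrightarrow> g (fst p) = fst p \<and> g (snd p) = snd p) \<Longrightarrow> g \<in> tgroup"
proof (induction "K - card P" arbitrary: P g rule: less_induct)
  case less
  have gs: "similitude V 1 g" using less.prems(2) by (simp add: U_iff)
  show ?case
  proof (cases "sperp P = {0}")
    case True
    then have "g = id" using fixes_spairs_imp_id[OF gs less.prems(1)] less.prems(3) by blast
    then show ?thesis by (simp add: tgroup_id)
  next
    case False
    have "0 \<in> sperp P" by (simp add: sperp_def)
    then obtain v where v: "v \<in> sperp P" "v \<noteq> 0" using False by blast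
    obtain w where w: "w \<in> sperp P" "h v w = 1" by (rule spartner[OF less.prems(1) v])
    have inv: "inv_into UNIV r (r x) = x" "r (inv_into UNIV r x) = x" if "r \<in> tgroup" for r x
      using tgroup_U[OF that] by (simp_all add: U_iff similitude_def bij_is_inj bij_is_surj surj_f_inv_f)
    have gp: "f x \<in> sperp P" if x: "x \<in> sperp P" and f: "f \<in> U V"
      and fp: "\<And>p. p \<in> P \<Longrightarrow> f (fst p) = fst p \<and> f (snd p) = snd p" for x f
    proof -
      have fs: "similitude V 1 f" using f by (simp add: U_iff)
      have "h (fst p) (f x) = 0 \<and> h (snd p) (f x) = 0" if "p \<in> P" for p
        using similitudeD(4)[OF fs, of "fst p" x] similitudeD(4)[OF fs, of "snd p" x] fp[OF that] x that
        by (simp add: sperp_def)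
      then show ?thesis by (simp add: sperp_def)
    qed
    have "g v \<noteq> 0" using similitudeD(4)[OF gs, of v w] w(2) by auto
    then obtain r where r: "r \<in> tgroup" "r v = g v" "\<And>p. p \<in> P \<Longrightarrow> r (fst p) = fst p \<and> r (snd p) = snd p"
      using smove_first[OF less.prems(1) v gp[OF v(1) less.prems(2,3)]] by blast
    define g1 where "g1 = inv_into UNIV r \<circ> g"
    have g1U: "g1 \<in> U V" unfolding g1_def by (rule U_comp[OF U_inv[OF tgroup_U[OF r(1)]] less.prems(2)])
    have g1s: "similitude V 1 g1" using g1U by (simp add: U_iff)
    have g1v: "g1 v = v" using inv(1)[OF r(1), of v] r(2) by (simp add: g1_def)
    have g1p: "g1 (fst p) = fst p \<and> g1 (snd p) = snd p" if "p \<in> P" for p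
      using inv(1)[OF r(1), of "fst p"] inv(1)[OF r(1), of "snd p"] r(3)[OF that] less.prems(3)[OF that]
      by (simp add: g1_def)
    have "h v (g1 w) = 1" using similitudeD(4)[OF g1s, of v w] w(2) g1v by simp
    then obtain r' where r': "r' \<in> tgroup" "r' w = g1 w" "r' v = v"
        "\<And>p. p \<in> P \<Longrightarrow> r' (fst p) = fst p \<and> r' (snd p) = snd p"
      using smove_second[OF less.prems(1) v(1) w gp[OF w(1) g1U g1p]] by blast
    define g2 where "g2 = inv_into UNIV r' \<circ> g1"
    have g2U: "g2 \<in> U V" unfolding g2_def by (rule U_comp[OF U_inv[OF tgroup_U[OF r'(1)]] g1U])
    have g2: "g2 (fst p) = fst p \<and> g2 (snd p) = snd p" if "p \<in> insert (v, w) P" for p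
    proof (cases "p = (v, w)")
      case True
      then show ?thesis using inv(1)[OF r'(1), of v] inv(1)[OF r'(1), of w] r'(2,3) g1v by (simp add: g2_def)
    next
      case False
      then have p: "p \<in> P" using that by simp
      show ?thesis
        using inv(1)[OF r'(1), of "fst p"] inv(1)[OF r'(1), of "snd p"] r'(4)[OF p] g1p[OF p] by (simp add: g2_def)
    qed
    note si = spairs_insert[OF less.prems(1) v(1) w]
    have "K - card (insert (v, w) P) < K - card P"
      using K[OF si(1)] si(2) less.prems(1) by (simp add: spairs_def)
    then have "g2 \<in> tgroup" using less.hyps si(1) g2U g2 by blast
    then have "r \<circ> (r' \<circ> g2) \<in> tgroup" using tgroup_comp r(1) r'(1) by blast
    moreover have "r \<circ> (r' \<circ> g2) = g" by (auto simp: fun_eq_iff g1_def g2_def inv[OF r(1)] inv[OF r'(1)])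
    ultimately show ?thesis by simp
  qed
qed

lemma Sp_generated: "g \<in> U V \<Longrightarrow> g \<in> tgroup"
proof -
  assume g: "g \<in> U V"
  obtain K where "\<And>P. spairs P \<Longrightarrow> card P \<le> K" by (rule spairs_bound) blast
  then show "g \<in> tgroup" using Sp_generated_aux[of K "{}" g] g by (auto simp: spairs_def)
qed

lemma Sp_eighth_powers:
  assumes "P id" "\<And>g g'. g \<in> U V \<Longrightarrow> g' \<in> U V \<Longrightarrow> P g \<Longrightarrow> P g' \<Longrightarrow> P (g \<circ> g')"
    and "\<And>g. g \<in> U V \<Longrightarrow> P (dbl (dbl (dbl g)))" and "g \<in> U V"
  shows "P g"
proof (rule tgroup_eighth_powers[of P, OF _ assms(1-3) Sp_generated[OF assms(4)]])
  fix u a assume "cond u a"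
  then show "\<exists>a'. cond u a' \<and> R u a' \<circ> R u a' = R u a" using sqrt_isotropic[of u a] by (metis h_self)
qed

lemma full_spairs_exists: obtains P where "spairs P" "sperp P = {0}"
proof -
  obtain K where K: "\<And>P. spairs P \<Longrightarrow> card P \<le> K" by (rule spairs_bound) blast
  have 0: "spairs {}" by (simp add: spairs_def)
  have b: "finite P \<and> card P \<le> K" if "spairs P" for P
    using K[OF that] that by (simp add: spairs_def)
  obtain P where P: "spairs P" "\<And>c. c \<notin> P \<Longrightarrow> \<not> spairs (insert c P)"
    using finite_maximal_set[of spairs K, OF 0 b] by metis
  have "sperp P = {0}"
  proof (rule ccontr)
    assume n: "sperp P \<noteq> {0}"
    have "0 \<in> sperp P" by (simp add: sperp_def)
    then obtain v where v: "v \<in> sperp P" "v \<noteq> 0" using n by blast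
    obtain w where w: "w \<in> sperp P" "h v w = 1" by (rule spartner[OF P(1) v])
    show False using spairs_insert[OF P(1) v(1) w] P(2) by blast
  qed
  then show thesis using P(1) that by blast
qed

definition sflip :: "('v \<times> 'v) set \<Rightarrow> 'v \<Rightarrow> 'v" where
  "sflip P x = (\<Sum>p\<in>P. ac (- h (snd p) x) (fst p) - ac (h (fst p) x) (snd p))"

lemma sflip:
  assumes P: "spairs P" "sperp P = {0}"
  shows "similitude V (-1) (sflip P)" "sflip P \<circ> sflip P = id"
    "p \<in> P \<Longrightarrow> sflip P (fst p) = fst p" "p \<in> P \<Longrightarrow> sflip P (snd p) = - snd p"
proof -
  have fP: "finite P" using P by (simp add: spairs_def)
  show 1: "sflip P (fst q) = fst q" if q: "q \<in> P" for q
  proof -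
    have "sflip P (fst q) = (\<Sum>p\<in>P. if p = q then fst q else 0)"
      unfolding sflip_def by (rule sum.cong) (use spairsD[OF P(1) _ q] in auto)
    then show ?thesis using fP q by simp
  qed
  show 2: "sflip P (snd q) = - snd q" if q: "q \<in> P" for q
  proof -
    have "sflip P (snd q) = (\<Sum>p\<in>P. if p = q then - snd q else 0)"
      unfolding sflip_def by (rule sum.cong) (use spairsD[OF P(1) _ q] in \<open>auto simp: ac_minus\<close>)
    then show ?thesis using fP q by simp
  qed
  have add: "sflip P (x + y) = sflip P x + sflip P y" for x y
    by (simp add: sflip_def h_add ac_plus ac_diff ac_minus algebra_simps sum.distrib sum_subtractf sum_negf)
  have sc: "sflip P (ac d x) = ac d (sflip P x)" for d x
    by (simp add: sflip_def h_ac ac_sum ac_diff ac_minus mult.commute flip: ac_mult)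
  have 0: "sflip P 0 = 0" by (simp add: sflip_def)
  have min: "sflip P (- x) = - sflip P x" for x
    using add[of x "- x"] 0 by (simp add: eq_neg_iff_add_eq_0 add.commute)
  have sub: "sflip P (x - y) = sflip P x - sflip P y" for x y
    using add[of "x - y" y] by simp
  have sm: "sflip P (\<Sum>i\<in>A. f i) = (\<Sum>i\<in>A. sflip P (f i))" for A and f :: "'v \<times> 'v \<Rightarrow> 'v"
    by (induction A rule: infinite_finite_induct) (simp_all add: 0 add)
  have ss: "sflip P (sflip P x) = x" for x
  proof -
    have "sflip P (sflip P x) = (\<Sum>p\<in>P. ac (- h (snd p) x) (fst p) + ac (h (fst p) x) (snd p))"
      unfolding sflip_def[of P x] sm
      by (rule sum.cong) (simp_all add: sub sc min 1 2 ac_minus)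
    also have "\<dots> = x" using spart_full[OF P, of x] by (simp add: spart_def)
    finally show ?thesis .
  qed
  then show "sflip P \<circ> sflip P = id" by (simp add: fun_eq_iff)
  have hp: "h (fst q) (sflip P x) = - h (fst q) x" "h (snd q) (sflip P x) = h (snd q) x" if q: "q \<in> P" for q x
  proof -
    have "h (fst q) (sflip P x) = (\<Sum>p\<in>P. if p = q then - h (fst q) x else 0)"
      unfolding sflip_def h_sum by (rule sum.cong) (use spairsD[OF P(1) q] in \<open>auto simp: h_diff h_ac\<close>)
    then show "h (fst q) (sflip P x) = - h (fst q) x" using q fP by simp
    have "h (snd q) (sflip P x) = (\<Sum>p\<in>P. if p = q then h (snd q) x else 0)"
      unfolding sflip_def h_sum by (rule sum.cong) (use spairsD[OF P(1) q] in \<open>auto simp: h_diff h_ac\<close>)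
    then show "h (snd q) (sflip P x) = h (snd q) x" using q fP by simp
  qed
  have fm: "h x y = (\<Sum>p\<in>P. h (snd p) y * h (fst p) x - h (fst p) y * h (snd p) x)" for x y
  proof -
    have "h x y = h x (spart P y)" by (simp add: spart_full[OF P])
    also have "\<dots> = (\<Sum>p\<in>P. h (snd p) y * h (fst p) x - h (fst p) y * h (snd p) x)"
      unfolding spart_def h_sum
    proof (rule sum.cong[OF refl])
      fix p
      show "h x (ac (- h (snd p) y) (fst p) + ac (h (fst p) y) (snd p))
          = h (snd p) y * h (fst p) x - h (fst p) y * h (snd p) x"
        using h_swap[of x "fst p"] h_swap[of x "snd p"] by (simp add: h_add h_ac)
    qed
    finally show ?thesis .
  qed
  have "h (sflip P x) (sflip P y) = - h x y" for x y
    unfolding fm[of "sflip P x"] fm[of x] sum_negf[symmetric]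
    by (rule sum.cong) (simp_all add: hp)
  moreover have "bij (sflip P)" by (rule o_bij[where g = "sflip P"]) (simp_all add: fun_eq_iff ss)
  ultimately show "similitude V (-1) (sflip P)"
    using add sc by (simp add: similitude_def dlinear_def)
qed

end

section \<open>The extension of the similitude group\<close>

lemma regroup_1:
  fixes a :: "'a::comm_monoid_mult"
  assumes "a * b = c * d * i" "i * u = p * q"
  shows "a * (u * b) = (p * c) * (q * d)"
proof -
  have "a * (u * b) = (a * b) * u" by (simp only: mult_ac)
  also have "\<dots> = c * d * (i * u)" by (simp only: assms(1) mult.assoc)
  finally show ?thesis by (simp only: assms(2) mult_ac)
qed

lemma regroup_2:
  fixes a :: "'a::comm_monoid_mult"
  assumes "a * b = c * d * i" "p * (i * u) = q"
  shows "(p * a) * (u * b) = c * (q * d)"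
proof -
  have "(p * a) * (u * b) = (a * b) * (p * u)" by (simp only: mult_ac)
  also have "\<dots> = (c * d * i) * (p * u)" by (simp only: assms(1))
  also have "\<dots> = c * d * (p * (i * u))" by (simp only: mult_ac)
  also have "\<dots> = c * d * q" by (simp only: assms(2))
  finally show ?thesis by (simp only: mult.assoc mult.commute[of d q])
qed

context symplectic
begin

lemma similitude_sim: "similitude (symplectic_space S) l h \<longleftrightarrow> sim l h"
  by (auto simp: similitude_def sim_def dlinear_def symplectic_space_def linear_iff)

lemma real_symplectic_space: "real_symplectic (symplectic_space S)"
proof
  let ?V = "symplectic_space S"
  have sp: "span X \<subseteq> dspan ?V X" for X
  proof -
    have "subspace T" if "dsubspace ?V T" for T
      using that by (auto simp: dsubspace_def subspace_def symplectic_space_def)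
    then show ?thesis unfolding dspan_def hull_def by (auto intro: span_minimal[THEN subsetD])
  qed
  have "finite (ee ` {..<m} \<union> ff ` {..<m})" "dspan ?V (ee ` {..<m} \<union> ff ` {..<m}) = UNIV"
    using sp[of "ee ` {..<m} \<union> ff ` {..<m}"] span_frame by auto
  then have 1: "dfinite_dimensional ?V" unfolding dfinite_dimensional_def by blast
  have 2: "\<exists>x::'w. x \<noteq> 0"
    using om_basis(3)[of 0 0] nontrivial by (intro exI[of _ "ee 0"]) (auto simp: omb)
  have 3: "form_hermitian (-1) ?V"
    unfolding form_hermitian_def symplectic_space_def
    by (auto simp: omb tau_real_def intro: alt)
  show "right_hermitian_space (-1) ?V"
    unfolding right_hermitian_space_def
    using 1 2 3 nondegenerate
    by (auto simp: right_vector_space_def symplectic_space_def scaleR_add_right scaleR_add_left omb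
        tau_real_def form_nondegenerate_def mult.commute)
  show "(-1::real) = 1 \<or> (-1::real) = -1" by simp
qed

lemma sim_unique: "sim l h \<Longrightarrow> sim l' h \<Longrightarrow> l = l'"
  using om_basis(3)[of 0 0] nontrivial simD(3)[of l h "ee 0" "ff 0"] simD(3)[of l' h "ee 0" "ff 0"] by simp

lemma lam_eq: "sim l h \<Longrightarrow> lam S h = l"
  unfolding lam_def sim_factor_def similitude_sim by (rule the_equality) (auto dest: sim_unique)

lemma Sp_iff: "g \<in> Sp S \<longleftrightarrow> sim 1 g"
  by (simp add: Sp_def U_def similitude_sim)

lemma Sppm_iff: "h \<in> Sppm S \<longleftrightarrow> sim 1 h \<or> sim (-1) h"
proof
  assume "h \<in> Sppm S"
  then obtain l where l: "sim l h" "lam S h \<in> {1, -1}"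
    by (auto simp: Sppm_def Upm_def GU_def similitude_sim lam_def)
  then show "sim 1 h \<or> sim (-1) h" using lam_eq[OF l(1)] by auto
next
  assume h: "sim 1 h \<or> sim (-1) h"
  then have "lam S h \<in> {1, -1}" using lam_eq by auto
  moreover have "h \<in> GU (symplectic_space S)"
    using h unfolding GU_def similitude_sim by (intro CollectI) (metis neg_equal_0_iff_equal zero_neq_one)
  ultimately show "h \<in> Sppm S" by (simp add: Sppm_def Upm_def lam_def)
qed

lemma Sppm_sim: "h \<in> Sppm S \<Longrightarrow> sim (lam S h) h" "h \<in> Sppm S \<Longrightarrow> lam S h = 1 \<or> lam S h = -1"
  using lam_eq by (auto simp: Sppm_iff)

lemma Sppm_comp: "h \<in> Sppm S \<Longrightarrow> h' \<in> Sppm S \<Longrightarrow> h \<circ> h' \<in> Sppm S"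
  using sim_comp by (fastforce simp: Sppm_iff)

lemma lam_comp: "h \<in> Sppm S \<Longrightarrow> h' \<in> Sppm S \<Longrightarrow> lam S (h \<circ> h') = lam S h * lam S h'"
  using sim_comp[OF Sppm_sim(1) Sppm_sim(1)] lam_eq by blast

lemma Sppm_id: "id \<in> Sppm S"
  using sim_id by (simp add: Sppm_iff)

lemma linear_eq_on_frame:
  assumes "linear f" "linear g" "\<And>j. j < m \<Longrightarrow> f (ee j) = g (ee j)" "\<And>j. j < m \<Longrightarrow> f (ff j) = g (ff j)"
  shows "f = g"
proof
  fix x
  show "f x = g x"
    by (rule linear_eq_on_span[OF assms(1,2), of "ee ` {..<m} \<union> ff ` {..<m}"])
      (use assms(3,4) span_frame in auto)
qed

lemma ball_frame: "(\<forall>i\<in>{1..m}. Q i) \<longleftrightarrow> (\<forall>j<m. Q (Suc j))"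
proof -
  have "{1..m} = Suc ` {..<m}"
    by (simp add: lessThan_atLeast0 image_Suc_atLeastLessThan atLeastLessThanSuc_atLeastAtMost)
  then show ?thesis by (simp only: ball_simps lessThan_iff Ball_def image_iff) auto
qed

lemma s_map_props: "linear (s_map S y)" "j < m \<Longrightarrow> s_map S y (ee j) = ee j" "j < m \<Longrightarrow> s_map S y (ff j) = y *\<^sub>R ff j"
proof -
  let ?P = "\<lambda>h. linear h \<and> (\<forall>i\<in>{1..m}. h (sbasis S i) = sbasis S i \<and> h (sbasis' S i) = y *\<^sub>R sbasis' S i)"
  let ?g = "\<lambda>x. (\<Sum>j<m. om x (ff j) *\<^sub>R ee j) - y *\<^sub>R (\<Sum>j<m. om x (ee j) *\<^sub>R ff j)"
  have gl: "linear ?g" by (rule linearI) (simp_all add: omb algebra_simps sum.distrib scaleR_sum_right)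
  have ge: "?g (ee i) = ee i" if i: "i < m" for i
  proof -
    have "(\<Sum>j<m. om (ee i) (ff j) *\<^sub>R ee j) = (\<Sum>j<m. if j = i then ee i else 0)"
      by (rule sum.cong) (use i in \<open>auto simp: om_basis\<close>)
    moreover have "(\<Sum>j<m. om (ee i) (ee j) *\<^sub>R ff j) = 0"
      by (rule sum.neutral) (use i in \<open>auto simp: om_basis\<close>)
    ultimately show ?thesis using i by simp
  qed
  have gf: "?g (ff i) = y *\<^sub>R ff i" if i: "i < m" for i
  proof -
    have "(\<Sum>j<m. om (ff i) (ee j) *\<^sub>R ff j) = (\<Sum>j<m. if j = i then - ff i else 0)"
      by (rule sum.cong) (use i in \<open>auto simp: om_basis\<close>)
    moreover have "(\<Sum>j<m. om (ff i) (ff j) *\<^sub>R ee j) = 0"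
      by (rule sum.neutral) (use i in \<open>auto simp: om_basis\<close>)
    ultimately show ?thesis using i by simp
  qed
  have P: "?P (s_map S y)" unfolding s_map_def
  proof (rule theI[where P = ?P])
    show "?P ?g" using gl ge gf unfolding ball_frame by blast
    fix h assume h: "?P h"
    then have h': "linear h" "\<And>j. j < m \<Longrightarrow> h (ee j) = ee j" "\<And>j. j < m \<Longrightarrow> h (ff j) = y *\<^sub>R ff j"
      unfolding ball_frame by blast+
    show "h = ?g" by (rule linear_eq_on_frame[OF h'(1) gl]) (use h' ge gf in auto)
  qed
  show "linear (s_map S y)" using P by blast
  show "s_map S y (ee j) = ee j" "s_map S y (ff j) = y *\<^sub>R ff j" if "j < m"
    using P that unfolding ball_frame by blast+
qed

lemma s_map_1: "s_map S 1 = id"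
  by (rule linear_eq_on_frame) (use s_map_props[where y = 1] in \<open>auto simp: linear_id\<close>)

abbreviation sm :: "'w \<Rightarrow> 'w" where "sm \<equiv> s_map S (-1)"

lemma sm_sm: "sm (sm x) = x"
proof -
  have "sm \<circ> sm = id"
    by (rule linear_eq_on_frame)
      (use s_map_props[where y = "-1"] linear_compose in \<open>auto simp: linear_id linear_neg\<close>)
  then show ?thesis by (simp add: fun_eq_iff)
qed

lemma sm_inv: "inv_into UNIV sm = sm"
  by (rule inv_equality) (simp_all add: sm_sm)

lemma sim_sm: "sim (-1) sm"
proof -
  note sp = s_map_props[where y = "-1"]
  have b: "bij sm" by (rule o_bij[where g = sm]) (auto simp: sm_sm)
  have "om (sm x) (sm y) = - om x y" for x y
  proof -
    have 1: "om (sm (ee i)) (sm y) = - om (ee i) y" if i: "i < m" for i y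
    proof -
      have "(\<lambda>y. om (sm (ee i)) (sm y)) = (\<lambda>y. - om (ee i) y)"
        by (rule linear_eq_on_frame)
          (use linear_compose[OF sp(1) lin_om(1)[of "sm (ee i)"]] linear_compose_neg[OF lin_om(1)[of "ee i"]] i
            in \<open>auto simp: o_def sp omb om_basis\<close>)
      then show ?thesis by (simp add: fun_eq_iff)
    qed
    have 2: "om (sm (ff i)) (sm y) = - om (ff i) y" if i: "i < m" for i y
    proof -
      have "(\<lambda>y. om (sm (ff i)) (sm y)) = (\<lambda>y. - om (ff i) y)"
        by (rule linear_eq_on_frame)
          (use linear_compose[OF sp(1) lin_om(1)[of "sm (ff i)"]] linear_compose_neg[OF lin_om(1)[of "ff i"]] i
            in \<open>auto simp: o_def sp omb om_basis\<close>)
      then show ?thesis by (simp add: fun_eq_iff)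
    qed
    have "(\<lambda>x. om (sm x) (sm y)) = (\<lambda>x. - om x y)"
      by (rule linear_eq_on_frame)
        (use linear_compose[OF sp(1) lin_om(2)[of "sm y"]] linear_compose_neg[OF lin_om(2)[of y]] 1 2
          in \<open>auto simp: o_def\<close>)
    then show ?thesis by (simp add: fun_eq_iff)
  qed
  then show ?thesis using b sp(1) by (simp add: sim_def)
qed

lemma lframe_ff: "lframe ff"
proof -
  have "tt 0 = ff" by (simp add: fun_eq_iff tt_def)
  then show ?thesis using lframe_tt[of 0] by simp
qed

lemma Xstar_eq: "Xstar S = lspan ff"
  unfolding Xstar_def frame_image lspan_eq_span ..

lemma sm_lspan_ff: "sm ` lspan ff = lspan ff"
proof -
  note sp = s_map_props[where y = "-1"]
  have "sm x \<in> lspan ff" if x: "x \<in> lspan ff" for x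
  proof -
    obtain c where c: "x = (\<Sum>i<m. c i *\<^sub>R ff i)" using x by (auto simp: lspan_def)
    have "sm x = (\<Sum>i<m. (- c i) *\<^sub>R ff i)"
      unfolding c linear_sum[OF sp(1)] by (rule sum.cong) (simp_all add: linear_scale[OF sp(1)] sp)
    then show ?thesis by (rule lspanI)
  qed
  then show ?thesis using sm_sm by (metis image_eqI image_subset_iff subsetI subset_antisym)
qed

subsection \<open>The cocycle in terms of Leray signatures\<close>

text \<open>The Leray signature entering the cocycle, moved by \<open>h2\<close>; in this form it makes sense for all similitudes.\<close>

definition tw :: "('w \<Rightarrow> 'w) \<Rightarrow> ('w \<Rightarrow> 'w) \<Rightarrow> int" where
  "tw h1 h2 = leray ff (\<lambda>i. h2 (h1 (ff i))) (\<lambda>i. h2 (ff i))"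

lemma lframe_sim_ff: "h \<in> Sppm S \<Longrightarrow> lframe (\<lambda>i. h (ff i))"
  using lframe_sim[OF Sppm_sim(1) lframe_ff] .

lemma lframe_sim_ff2: "h \<in> Sppm S \<Longrightarrow> h' \<in> Sppm S \<Longrightarrow> lframe (\<lambda>i. h' (h (ff i)))"
  using lframe_sim_ff[OF Sppm_comp[of h' h]] by simp

text \<open>The cocycle identity of the Leray signature for four Lagrangians, after moving one triple by \<open>h3\<close>; an anti-symplectic
  \<open>h3\<close> negates the form and hence the signature of that triple.\<close>

lemma tw_cocycle:
  assumes h: "h1 \<in> Sppm S" "h2 \<in> Sppm S" "h3 \<in> Sppm S"
  shows "(if lam S h3 = 1 then 1 else -1) * tw h1 h2 + tw (h2 \<circ> h1) h3 = tw h1 (h3 \<circ> h2) + tw h2 h3"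
proof -
  let ?p1 = "\<lambda>i. h3 (h2 (h1 (ff i)))" and ?p2 = "\<lambda>i. h3 (h2 (ff i))" and ?p3 = "\<lambda>i. h3 (ff i)"
  have l: "lframe ?p1" "lframe ?p2" "lframe ?p3"
    using lframe_sim_ff[OF Sppm_comp[OF h(3) Sppm_comp[OF h(2,1)]]] lframe_sim_ff2[OF h(2,3)] lframe_sim_ff[OF h(3)]
    by auto
  have "leray ?p3 ?p1 ?p2 = (if lam S h3 = 1 then 1 else -1) * tw h1 h2"
    unfolding tw_def by (rule leray_sim[OF Sppm_sim[OF h(3)]])
  moreover have "leray ?p1 ?p2 ?p3 = leray ?p1 ?p2 ff + leray ?p2 ?p3 ff + leray ?p3 ?p1 ff"
    by (rule leray_cocycle) (use l lframe_ff in auto)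
  moreover have "leray ?p1 ?p2 ?p3 = leray ?p3 ?p1 ?p2" using leray_cyclic l by metis
  moreover have "leray ?p1 ?p2 ff = leray ff ?p1 ?p2" "leray ?p2 ?p3 ff = leray ff ?p2 ?p3"
    using leray_cyclic l lframe_ff by metis+
  moreover have "leray ?p3 ?p1 ff = - leray ff ?p1 ?p3"
    using leray_cyclic[OF lframe_ff l(3) l(1)] leray_swap[OF lframe_ff l(1) l(3)] leray_cyclic[OF l(1) lframe_ff l(3)] by simp
  ultimately show ?thesis by (simp add: tw_def)
qed

lemma leray_swap23: "lframe b1 \<Longrightarrow> lframe b2 \<Longrightarrow> lframe b3 \<Longrightarrow> leray b1 b3 b2 = - leray b1 b2 b3"
  using leray_swap[of b1 b2 b3] leray_cyclic[of b2 b1 b3] by simp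

text \<open>The Lagrangian spanned by the \<open>ff i\<close>, oriented by this basis, is compared with its image.\<close>

definition M :: "('w \<Rightarrow> 'w) \<Rightarrow> complex" where
  "M h = N ff (\<lambda>i. h (ff i))"

lemma M_pow4: "h \<in> Sppm S \<Longrightarrow> M h ^ 4 = 1"
  unfolding M_def by (rule N_pow4[OF lframe_ff lframe_sim_ff])

lemma M_nonzero: "h \<in> Sppm S \<Longrightarrow> M h \<noteq> 0"
  using M_pow4[of h] by auto

text \<open>Apply the triple formula for \<open>N\<close> to the Lagrangian \<open>X\<^sup>*\<close> and its images under \<open>h2\<close> and the product. A
  similitude of factor \<open>-1\<close> negates the form and hence conjugates \<open>N\<close>.\<close>

lemma M_comp:
  assumes h: "h1 \<in> Sppm S" "h2 \<in> Sppm S"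
  shows "(if lam S h2 = 1 then M h1 else cnj (M h1)) * M h2 = ipow (tw h1 h2) * M (h2 \<circ> h1)"
proof -
  let ?a = "\<lambda>i. h2 (ff i)" and ?b = "\<lambda>i. h2 (h1 (ff i))"
  have l: "lframe ?a" "lframe ?b" using h lframe_sim_ff lframe_sim_ff2 by auto
  let ?L = "if lam S h2 = 1 then M h1 else cnj (M h1)"
  have 1: "N ?a ?b = ?L"
    unfolding M_def by (rule N_sim[OF Sppm_sim[OF h(2)] lframe_ff lframe_sim_ff[OF h(1)]])
  have 2: "N ff ?a * N ?a ?b * N ?b ff = ipow (- leray ff ?a ?b)"
    by (rule N_triple[OF lframe_ff l])
  have 3: "- leray ff ?a ?b = tw h1 h2"
    using leray_swap23[OF lframe_ff l] by (simp add: tw_def)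
  have 4: "N ff ?a = M h2" "N ff ?b = M (h2 \<circ> h1)" by (simp_all add: M_def)
  have 5: "M (h2 \<circ> h1) * N ?b ff = 1" using N_swap[OF lframe_ff l(2)] unfolding 4 .
  have "ipow (tw h1 h2) * M (h2 \<circ> h1) = (M h2 * ?L * N ?b ff) * M (h2 \<circ> h1)"
    using 2 unfolding 1 3 4 by (simp only:)
  also have "\<dots> = ?L * M h2 * (M (h2 \<circ> h1) * N ?b ff)" by (simp only: mult_ac)
  finally show ?thesis by (simp only: 5 mult_1_right)
qed

definition et :: complex where "et = M sm"

lemma sm_Sppm: "sm \<in> Sppm S" "lam S sm = -1"
  using sim_sm lam_eq by (auto simp: Sppm_iff)

lemma et_cases: "et = 1 \<or> et = -1"
proof -
  let ?a = "\<lambda>i j. if i = j then (-1::real) else 0"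
  have l: "lframe (\<lambda>i. sm (ff i))" by (rule lframe_sim_ff[OF sm_Sppm(1)])
  have "sm (ff j) = (\<Sum>i<m. ?a i j *\<^sub>R ff i)" if "j < m" for j
    using that s_map_props(3)[of j "-1"] by (simp add: if_distrib[of "\<lambda>r. r *\<^sub>R _"] cong: if_cong)
  moreover have "lspan (\<lambda>i. sm (ff i)) = lspan ff"
    using lspan_image[OF s_map_props(1)] sm_lspan_ff by simp
  ultimately have "N (\<lambda>i. sm (ff i)) ff = sg (fdet m ?a) * N ff ff"
    by (rule N_change[OF lframe_ff l lframe_ff])
  moreover have "fdet m ?a = (-1) ^ m" by (subst fdet_diag) auto
  ultimately have "N (\<lambda>i. sm (ff i)) ff = (-1) ^ m" using N_self[OF lframe_ff] by (simp add: sg_neg1_pow)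
  then have "et * (-1) ^ m = 1" using N_swap[OF lframe_ff l] by (simp add: et_def M_def)
  then show ?thesis by (cases "even m") (auto simp: minus_equation_iff)
qed

lemma sm_ff_lspan:
  assumes "h \<in> Sppm S"
  shows "lspan (\<lambda>i. h (sm (ff i))) = lspan (\<lambda>i. h (ff i))"
proof -
  have lh: "linear h" by (rule simD(1)[OF Sppm_sim(1)[OF assms]])
  have "lspan (\<lambda>i. h (sm (ff i))) = h ` lspan (\<lambda>i. sm (ff i))" by (rule lspan_image[OF lh])
  also have "\<dots> = h ` lspan ff" using lspan_image[OF s_map_props(1)] sm_lspan_ff by simp
  also have "\<dots> = lspan (\<lambda>i. h (ff i))" by (rule lspan_image[OF lh, symmetric])
  finally show ?thesis .
qed

lemma M_sm:
  assumes h: "h \<in> Sppm S"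
  shows "M (h \<circ> sm) = et * M h"
proof -
  have "tw sm h = leray ff (\<lambda>i. h (ff i)) (\<lambda>i. h (ff i))"
    unfolding tw_def by (rule leray_lspan_cong[OF refl sm_ff_lspan[OF h] refl])
  also have "\<dots> = 0"
    using leray_swap23[OF lframe_ff lframe_sim_ff[OF h] lframe_sim_ff[OF h]] by simp
  finally have "tw sm h = 0" .
  moreover have "cnj et = et" using et_cases by auto
  ultimately show ?thesis using M_comp[OF sm_Sppm(1) h] by (simp add: et_def split: if_splits)
qed

subsection \<open>The function \<open>\<nu>\<close>\<close>

definition pz :: "complex \<Rightarrow> complex" where
  "pz z = (if psi_coeff S > 0 then z else cnj z)"

definition es :: "int \<Rightarrow> complex" where
  "es k = cis (pi / 4 * real_of_int k)"

lemma psi_nonzero: "psi_coeff S \<noteq> 0"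
  using frame by (simp add: symplectic_frame_def)

lemma pz_simps: "pz (a * b) = pz a * pz b" "pz 1 = 1" "pz (inverse a) = inverse (pz a)" "pz a = pz b \<longleftrightarrow> a = b"
  "pz a ^ n = pz (a ^ n)" "pz a = 0 \<longleftrightarrow> a = 0"
  by (auto simp: pz_def)

lemma es_add: "es (a + b) = es a * es b"
  by (simp add: es_def cis_mult distrib_left)

lemma es_0 [simp]: "es 0 = 1" and es_nonzero [simp]: "es k \<noteq> 0" and cmod_es [simp]: "cmod (es k) = 1"
  by (simp_all add: es_def)

lemma es_minus: "es (- k) = inverse (es k)"
  by (simp add: es_def)

lemma es_two: "es k * es k = ipow k"
  by (simp add: es_def ipow_def cis_mult field_simps)

lemma es_pow8: "es k ^ 8 = 1"
proof -
  have "es k ^ 8 = (es k * es k) ^ 4" by (simp flip: power2_eq_square power_mult)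
  then show ?thesis by (simp add: es_two ipow_pow4)
qed

lemma c_tilde_eq:
  assumes g: "g1 \<in> Sp S" "g2 \<in> Sp S"
  shows "c_tilde S g1 g2 = pz (es (tw g1 g2))"
proof -
  have s1: "sim 1 g1" and s2: "sim 1 g2" using g by (simp_all add: Sp_iff)
  note i2 = sim_inv[OF s2, simplified]
  let ?a = "\<lambda>i. inv_into UNIV g2 (ff i)" and ?b = "\<lambda>i. g1 (ff i)"
  have gi: "g2 (inv_into UNIV g2 x) = x" for x using simD(2)[OF s2] by (simp add: bij_is_surj surj_f_inv_f)
  have "leray_signature S (Xstar S) (inv_into UNIV g2 ` Xstar S) (g1 ` Xstar S) = leray ff ?a ?b"
    unfolding leray_def Xstar_eq lspan_image[OF simD(1)[OF s1]] lspan_image[OF simD(1)[OF i2]] ..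
  also have "\<dots> = leray (\<lambda>i. g2 (ff i)) (\<lambda>i. g2 (?a i)) (\<lambda>i. g2 (?b i))"
    using leray_sim[OF s2, of ff ?a ?b] by simp
  also have "\<dots> = leray (\<lambda>i. g2 (ff i)) ff (\<lambda>i. g2 (g1 (ff i)))" by (simp add: gi)
  also have "\<dots> = leray ff (\<lambda>i. g2 (g1 (ff i))) (\<lambda>i. g2 (ff i))"
    by (rule leray_cyclic[symmetric, OF _ lframe_ff])
      (use lframe_sim[OF s2 lframe_ff] lframe_sim[OF s2 lframe_sim[OF s1 lframe_ff]] in auto)
  finally have "leray_signature S (Xstar S) (inv_into UNIV g2 ` Xstar S) (g1 ` Xstar S) = tw g1 g2"
    by (simp add: tw_def)
  then have "c_tilde S g1 g2 = cis (pi / 4 * sgn (psi_coeff S) * real_of_int (tw g1 g2))"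
    by (simp add: c_tilde_def cis_conv_exp)
  also have "\<dots> = pz (es (tw g1 g2))"
    using psi_nonzero by (auto simp: pz_def es_def cis_cnj sgn_if)
  finally show ?thesis .
qed

lemma Sp_Sppm: "g \<in> Sp S \<Longrightarrow> g \<in> Sppm S" and Sp_lam: "g \<in> Sp S \<Longrightarrow> lam S g = 1"
  using lam_eq by (auto simp: Sp_iff Sppm_iff)

lemma Sp_comp: "g \<in> Sp S \<Longrightarrow> g' \<in> Sp S \<Longrightarrow> g \<circ> g' \<in> Sp S"
  using sim_comp[of 1 g 1 g'] by (simp add: Sp_iff)

text \<open>Transvections are eighth powers, so the symplectic group has no characters of order eight.\<close>

lemma Sp_character_trivial:
  fixes \<chi> :: "('w \<Rightarrow> 'w) \<Rightarrow> complex"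
  assumes hom: "\<And>g g'. g \<in> Sp S \<Longrightarrow> g' \<in> Sp S \<Longrightarrow> \<chi> (g \<circ> g') = \<chi> g * \<chi> g'"
    and fin: "\<And>g. g \<in> Sp S \<Longrightarrow> \<chi> g ^ 8 = 1" and g: "g \<in> Sp S"
  shows "\<chi> g = 1"
proof -
  interpret rs: real_symplectic "symplectic_space S" by (rule real_symplectic_space)
  have U: "U (symplectic_space S) = Sp S" by (simp add: Sp_def)
  show ?thesis
  proof (rule rs.Sp_eighth_powers[of "\<lambda>g. \<chi> g = 1", unfolded U, OF _ _ _ g])
    have i: "id \<in> Sp S" using sim_id by (simp add: Sp_iff)
    have "\<chi> id = \<chi> id * \<chi> id" using hom[OF i i] by simp
    moreover have "\<chi> id \<noteq> 0" using fin[OF i] by auto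
    ultimately show "\<chi> id = 1" by simp
    show "\<chi> (g \<circ> g') = 1" if "g \<in> Sp S" "g' \<in> Sp S" "\<chi> g = 1" "\<chi> g' = 1" for g g'
      using hom that by simp
    show "\<chi> (rs.dbl (rs.dbl (rs.dbl g))) = 1" if g: "g \<in> Sp S" for g
    proof -
      have d: "rs.dbl f \<in> Sp S \<and> \<chi> (rs.dbl f) = \<chi> f ^ 2" if "f \<in> Sp S" for f
        using Sp_comp[OF that that] hom[OF that that] by (simp add: rs.dbl_def power2_eq_square)
      have "\<chi> (rs.dbl (rs.dbl (rs.dbl g))) = ((\<chi> g ^ 2) ^ 2) ^ 2"
        using d[OF g] d[of "rs.dbl g"] d[of "rs.dbl (rs.dbl g)"] by simp
      then show ?thesis using fin[OF g] by (simp flip: power_mult)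
    qed
  qed
qed

lemma nu_eqI:
  assumes n: "\<And>g. g \<in> Sp S \<Longrightarrow> n g ^ 8 = 1"
    and eq: "\<And>g1 g2. g1 \<in> Sp S \<Longrightarrow> g2 \<in> Sp S \<Longrightarrow>
      c_tilde S (conj_s S y g1) (conj_s S y g2) = c_tilde S g1 g2 * inverse (n g1) * inverse (n g2) * n (rmult g1 g2)"
    and g: "g \<in> Sp S"
  shows "nu S y g = n g"
proof -
  let ?E = "\<lambda>n. \<forall>g1\<in>Sp S. \<forall>g2\<in>Sp S. c_tilde S (conj_s S y g1) (conj_s S y g2) =
        c_tilde S g1 g2 * inverse (n g1) * inverse (n g2) * n (rmult g1 g2)"
  let ?n = "restrict n (Sp S)"
  have rm: "rmult g1 g2 \<in> Sp S" if "g1 \<in> Sp S" "g2 \<in> Sp S" for g1 g2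
    using Sp_comp that by (simp add: rmult_def)
  have "nu S y = ?n"
    unfolding nu_def
  proof (rule the_equality)
    show "?n \<in> Sp S \<rightarrow>\<^sub>E mu8 \<and> ?E ?n"
      using n eq rm by (auto simp: mu8_def)
    fix k assume k: "k \<in> Sp S \<rightarrow>\<^sub>E mu8 \<and> ?E k"
    have k8: "k g ^ 8 = 1" if "g \<in> Sp S" for g using k that by (auto simp: mu8_def PiE_iff)
    have nz: "k g \<noteq> 0" "n g \<noteq> 0" if "g \<in> Sp S" for g using k8[OF that] n[OF that] by auto
    have "k g / n g = 1" if g: "g \<in> Sp S" for g
    proof (rule Sp_character_trivial[OF _ _ g, where \<chi> = "\<lambda>g. k g / n g"])
      show "(k g / n g) ^ 8 = 1" if "g \<in> Sp S" for g using k8[OF that] n[OF that] by (simp add: power_divide)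
      show "k (g \<circ> g') / n (g \<circ> g') = k g / n g * (k g' / n g')" if gg: "g \<in> Sp S" "g' \<in> Sp S" for g g'
      proof -
        have "c_tilde S g' g * inverse (k g') * inverse (k g) * k (g \<circ> g') =
            c_tilde S g' g * inverse (n g') * inverse (n g) * n (g \<circ> g')"
          using k eq[OF gg(2,1)] gg by (auto simp: rmult_def)
        moreover have "c_tilde S g' g \<noteq> 0" by (simp add: c_tilde_def)
        ultimately show ?thesis using nz[OF gg(1)] nz[OF gg(2)] nz[OF Sp_comp[OF gg]]
          by (simp add: field_simps)
      qed
    qed
    then have "k g = n g" if "g \<in> Sp S" for g using that nz by fastforce
    then show "k = ?n" using k by (auto simp: PiE_iff extensional_def fun_eq_iff)
  qed
  then show ?thesis using g by simp
qed

lemma nu_1: "g \<in> Sp S \<Longrightarrow> nu S 1 g = 1"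
  by (rule nu_eqI[of "\<lambda>_. 1"]) (simp_all add: conj_s_def s_map_1 rmult_def)

lemma conj_sm: "conj_s S (-1) g = sm \<circ> g \<circ> sm"
  by (simp add: conj_s_def sm_inv rmult_def comp_assoc)

lemma conj_Sp: "g \<in> Sp S \<Longrightarrow> sm \<circ> g \<circ> sm \<in> Sp S"
  using sim_comp[OF sim_comp[OF sim_sm] sim_sm, of 1 g] by (simp add: Sp_iff)

lemma tw_conj:
  assumes g: "g1 \<in> Sp S" "g2 \<in> Sp S"
  shows "tw (sm \<circ> g1 \<circ> sm) (sm \<circ> g2 \<circ> sm) = - tw g1 g2"
proof -
  have S2: "sm \<circ> (g2 \<circ> g1) \<in> Sppm S" "sm \<circ> g2 \<in> Sppm S" using g Sp_Sppm Sppm_comp sm_Sppm by blast+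
  have "tw (sm \<circ> g1 \<circ> sm) (sm \<circ> g2 \<circ> sm) = leray ff (\<lambda>i. sm (g2 (g1 (sm (ff i))))) (\<lambda>i. sm (g2 (sm (ff i))))"
    by (simp add: tw_def sm_sm)
  also have "\<dots> = leray (\<lambda>i. sm (ff i)) (\<lambda>i. sm (g2 (g1 (ff i)))) (\<lambda>i. sm (g2 (ff i)))"
    by (rule leray_lspan_cong) (use sm_ff_lspan[OF S2(1)] sm_ff_lspan[OF S2(2)] sm_ff_lspan[OF Sppm_id] in auto)
  also have "\<dots> = - tw g1 g2"
    using leray_sim[OF sim_sm, of ff "\<lambda>i. g2 (g1 (ff i))" "\<lambda>i. g2 (ff i)"] by (simp add: tw_def)
  finally show ?thesis .
qed

text \<open>Conjugation by \<open>s(-1)\<close> negates the Leray signature, so the quotient of the two cocycles is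
  \<open>es (- 2 tw) = ipow (- tw)\<close>, which is the coboundary of \<open>M\<close>.\<close>

lemma nu_minus1:
  assumes g: "g \<in> Sp S"
  shows "nu S (-1) g = pz (M g)"
proof (rule nu_eqI[OF _ _ g])
  show "pz (M g) ^ 8 = 1" if "g \<in> Sp S" for g
  proof -
    have "M g ^ 8 = (M g ^ 4) ^ 2" by (simp flip: power_mult)
    then show ?thesis using M_pow4[OF Sp_Sppm[OF that]] by (simp add: pz_simps)
  qed
  fix g1 g2 assume gg: "g1 \<in> Sp S" "g2 \<in> Sp S"
  have "M g1 * M g2 = ipow (tw g1 g2) * M (g2 \<circ> g1)"
    using M_comp[OF Sp_Sppm[OF gg(1)] Sp_Sppm[OF gg(2)]] Sp_lam[OF gg(2)] by simp
  moreover have "M g1 \<noteq> 0" "M g2 \<noteq> 0" "M (g2 \<circ> g1) \<noteq> 0"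
    using gg M_nonzero Sp_Sppm Sp_comp by blast+
  ultimately have "inverse (ipow (tw g1 g2)) = inverse (M g1) * inverse (M g2) * M (g2 \<circ> g1)"
    by (simp add: field_simps)
  then have "es (- tw g1 g2) = es (tw g1 g2) * inverse (M g1) * inverse (M g2) * M (g2 \<circ> g1)"
    unfolding es_two[symmetric] by (simp add: es_minus field_simps)
  moreover have "c_tilde S (conj_s S (-1) g1) (conj_s S (-1) g2) = pz (es (- tw g1 g2))"
    by (simp add: conj_sm c_tilde_eq gg conj_Sp tw_conj)
  ultimately show "c_tilde S (conj_s S (-1) g1) (conj_s S (-1) g2) =
      c_tilde S g1 g2 * inverse (pz (M g1)) * inverse (pz (M g2)) * pz (M (rmult g1 g2))"
    by (simp add: c_tilde_eq gg rmult_def pz_simps)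
qed

subsection \<open>The cocycle and its commutators\<close>

text \<open>The cocycle for a positive additive character; a negative one replaces it by its complex conjugate.\<close>

definition K :: "('w \<Rightarrow> 'w) \<Rightarrow> ('w \<Rightarrow> 'w) \<Rightarrow> complex" where
  "K h1 h2 = (if lam S h2 = -1 then (if lam S h1 = -1 then et else 1) * M h1 else 1) * es (tw h1 h2)"

lemma C_tilde_eq:
  assumes h: "h1 \<in> Sppm S" "h2 \<in> Sppm S"
  shows "C_tilde S h1 h2 = pz (K h1 h2)"
proof -
  define s where "s h = (if lam S h = -1 then sm else id)" for h
  have sS: "s h \<in> Sppm S" for h using sm_Sppm Sppm_id by (simp add: s_def)
  have ss: "s h (s h x) = x" for h x by (simp add: s_def sm_sm)
  have sp: "sp_part S h = h \<circ> s h" if "h \<in> Sppm S" for h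
    using Sppm_sim(2)[OF that] by (auto simp: sp_part_def s_def rmult_def sm_inv s_map_1)
  have spS: "sp_part S h \<in> Sp S" if hS: "h \<in> Sppm S" for h
  proof -
    have "sim 1 (h \<circ> s h)"
      using Sppm_sim[OF hS] sim_comp[OF Sppm_sim(1)[OF hS] sim_sm] by (auto simp: s_def)
    then show ?thesis by (simp add: sp[OF hS] Sp_iff)
  qed
  have cj: "conj_s S (lam S h2) (sp_part S h1) = s h2 \<circ> (h1 \<circ> s h1) \<circ> s h2"
    using Sppm_sim(2)[OF h(2)] sp[OF h(1)] conj_sm by (auto simp: s_def conj_s_def s_map_1 rmult_def)
  have cjS: "conj_s S (lam S h2) (sp_part S h1) \<in> Sp S"
    using Sppm_sim(2)[OF h(2)] spS[OF h(1)] conj_sm conj_Sp by (auto simp: conj_s_def s_map_1 rmult_def)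
  have lsp: "lspan (\<lambda>i. f (s h (ff i))) = lspan (\<lambda>i. f (ff i))" if "f \<in> Sppm S" for f h
    using sm_ff_lspan[OF that] by (simp add: s_def)
  have h21: "h2 \<circ> h1 \<in> Sppm S" "h2 \<circ> h1 \<circ> s h1 \<in> Sppm S"
    using Sppm_comp[OF h(2,1)] Sppm_comp[OF Sppm_comp[OF h(2,1)] sS] by auto
  have "tw (conj_s S (lam S h2) (sp_part S h1)) (sp_part S h2)
      = leray ff (\<lambda>i. (h2 \<circ> h1 \<circ> s h1) (s h2 (ff i))) (\<lambda>i. h2 (s h2 (ff i)))"
    by (simp add: tw_def cj sp[OF h(2)] ss)
  also have "\<dots> = leray ff (\<lambda>i. (h2 \<circ> h1) (s h1 (ff i))) (\<lambda>i. h2 (ff i))"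
    by (rule leray_lspan_cong[OF refl]) (use lsp[OF h21(2)] lsp[OF h(2)] in auto)
  also have "\<dots> = leray ff (\<lambda>i. (h2 \<circ> h1) (ff i)) (\<lambda>i. h2 (ff i))"
    by (rule leray_lspan_cong[OF refl lsp[OF h21(1)] refl])
  also have "\<dots> = tw h1 h2" by (simp add: tw_def)
  finally have t: "tw (conj_s S (lam S h2) (sp_part S h1)) (sp_part S h2) = tw h1 h2" .
  have n: "nu S (lam S h2) (sp_part S h1) = pz (if lam S h2 = -1 then (if lam S h1 = -1 then et else 1) * M h1 else 1)"
    using Sppm_sim(2)[OF h(2)] nu_minus1[OF spS[OF h(1)]] nu_1[OF spS[OF h(1)]] M_sm[OF h(1)]
    by (auto simp: sp[OF h(1)] s_def pz_simps)
  show ?thesis unfolding C_tilde_def n c_tilde_eq[OF cjS spS[OF h(2)]] t K_def by (simp add: pz_simps)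
qed

lemma cnj_M: "h \<in> Sppm S \<Longrightarrow> cnj (M h) * M h = 1"
proof -
  assume h: "h \<in> Sppm S"
  have "cmod (M h) ^ 4 = cmod (M h ^ 4)" by (simp only: norm_power)
  then have "cmod (M h) ^ 4 = 1" by (simp only: M_pow4[OF h] norm_one)
  then have "cmod (M h) = 1" using power_eq_imp_eq_base[of "cmod (M h)" 4 1] by simp
  then have "M h * cnj (M h) = 1" unfolding complex_norm_square[symmetric] by simp
  then show "cnj (M h) * M h = 1" by (simp only: mult.commute)
qed

lemma K_cocycle:
  assumes h: "h1 \<in> Sppm S" "h2 \<in> Sppm S" "h3 \<in> Sppm S"
  shows "K h1 h2 * K (h2 \<circ> h1) h3 = K h1 (h3 \<circ> h2) * K h2 h3"
proof -
  have l: "lam S h1 = 1 \<or> lam S h1 = -1" "lam S h2 = 1 \<or> lam S h2 = -1" "lam S h3 = 1 \<or> lam S h3 = -1"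
    using Sppm_sim(2) h by auto
  have lc: "lam S (h2 \<circ> h1) = lam S h2 * lam S h1" "lam S (h3 \<circ> h2) = lam S h3 * lam S h2"
    using lam_comp h by auto
  have ee: "et * et = 1" using et_cases by auto
  show ?thesis
  proof (cases "lam S h3 = 1")
    case True
    then have "tw h1 h2 + tw (h2 \<circ> h1) h3 = tw h1 (h3 \<circ> h2) + tw h2 h3" using tw_cocycle[OF h] by simp
    then have "es (tw h1 h2) * es (tw (h2 \<circ> h1) h3) = es (tw h1 (h3 \<circ> h2)) * es (tw h2 h3)"
      by (simp flip: es_add)
    then show ?thesis using True lc by (simp add: K_def)
  next
    case False
    then have l3: "lam S h3 = -1" using l by simp
    have "tw h1 h2 + tw (h2 \<circ> h1) h3 = tw h1 (h3 \<circ> h2) + tw h2 h3 + (tw h1 h2 + tw h1 h2)"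
      using tw_cocycle[OF h] l3 by simp
    then have e: "es (tw h1 h2) * es (tw (h2 \<circ> h1) h3) = es (tw h1 (h3 \<circ> h2)) * es (tw h2 h3) * ipow (tw h1 h2)"
      by (simp only: es_add[symmetric] es_two[symmetric])
    note mc = M_comp[OF h(1,2)]
    show ?thesis
    proof (cases "lam S h2 = 1")
      case True
      have "ipow (tw h1 h2) * M (h2 \<circ> h1) = M h1 * M h2" using mc True by simp
      then have "es (tw h1 h2) * (M (h2 \<circ> h1) * es (tw (h2 \<circ> h1) h3)) = (M h1 * es (tw h1 (h3 \<circ> h2))) * (M h2 * es (tw h2 h3))"
        by (rule regroup_1[OF e])
      then show ?thesis using l3 True lc l(1) by (auto simp: K_def)
    next
      case False
      then have l2: "lam S h2 = -1" using l by simp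
      have "ipow (tw h1 h2) * M (h2 \<circ> h1) = cnj (M h1) * M h2" using mc l2 by simp
      then have "M h1 * (ipow (tw h1 h2) * M (h2 \<circ> h1)) = (cnj (M h1) * M h1) * M h2" by simp
      then have "M h1 * (ipow (tw h1 h2) * M (h2 \<circ> h1)) = M h2" by (simp only: cnj_M[OF h(1)] mult_1)
      then have "(M h1 * es (tw h1 h2)) * (M (h2 \<circ> h1) * es (tw (h2 \<circ> h1) h3)) = es (tw h1 (h3 \<circ> h2)) * (M h2 * es (tw h2 h3))"
        by (rule regroup_2[OF e])
      then show ?thesis using l3 l2 lc l(1) ee by (auto simp: K_def mult.assoc)
    qed
  qed
qed

lemma K_nonzero: "h1 \<in> Sppm S \<Longrightarrow> K h1 h2 \<noteq> 0"
  using M_nonzero[of h1] et_cases by (auto simp: K_def)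

lemma K_pow8: "h1 \<in> Sppm S \<Longrightarrow> K h1 h2 ^ 8 = 1"
proof -
  assume h: "h1 \<in> Sppm S"
  have "M h1 ^ 8 = (M h1 ^ 4) ^ 2" by (simp flip: power_mult)
  then have "M h1 ^ 8 = 1" using M_pow4[OF h] by simp
  moreover have "et ^ 8 = 1" using et_cases by auto
  ultimately show ?thesis by (simp add: K_def power_mult_distrib es_pow8)
qed

definition kap :: "('w \<Rightarrow> 'w) \<Rightarrow> ('w \<Rightarrow> 'w) \<Rightarrow> complex" where
  "kap h g = K h g / K g h"

lemma C_tilde_commute_iff:
  "h \<in> Sppm S \<Longrightarrow> g \<in> Sppm S \<Longrightarrow> C_tilde S h g = C_tilde S g h \<longleftrightarrow> kap h g = 1"
  using K_nonzero[of g h] by (simp add: C_tilde_eq pz_simps kap_def)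

lemma kap_swap: "kap g h = inverse (kap h g)"
  by (simp add: kap_def)

lemma kap_pow8: "h \<in> Sppm S \<Longrightarrow> g \<in> Sppm S \<Longrightarrow> kap h g ^ 8 = 1"
  by (simp add: kap_def power_divide K_pow8)

text \<open>For commuting elements \<open>kap h g\<close> is the commutator of two lifts, and the commutator with a fixed lift is multiplicative
  because commutators are central.\<close>

lemma kap_mult:
  assumes S: "h \<in> Sppm S" "g \<in> Sppm S" "g' \<in> Sppm S"
    and c: "h \<circ> g = g \<circ> h" "h \<circ> g' = g' \<circ> h"
  shows "kap h (g' \<circ> g) = kap h g * kap h g'"
proof -
  have 1: "K h g * K (g \<circ> h) g' = K h (g' \<circ> g) * K g g'" by (rule K_cocycle[OF S(1,2,3)])
  have 2: "K g h * K (g \<circ> h) g' = K g (g' \<circ> h) * K h g'" using K_cocycle[OF S(2,1,3)] c by simp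
  have 3: "K g g' * K (g' \<circ> g) h = K g (g' \<circ> h) * K g' h" using K_cocycle[OF S(2,3,1)] c by simp
  have nz: "K h g \<noteq> 0" "K (g \<circ> h) g' \<noteq> 0" "K h (g' \<circ> g) \<noteq> 0" "K g g' \<noteq> 0" "K g h \<noteq> 0"
      "K g (g' \<circ> h) \<noteq> 0" "K h g' \<noteq> 0" "K (g' \<circ> g) h \<noteq> 0" "K g' h \<noteq> 0"
    using K_nonzero Sppm_comp S by auto
  have "(K h (g' \<circ> g) * (K g h * K g' h)) * K g g' = (K h (g' \<circ> g) * K g g') * K g h * K g' h"
    by (simp only: mult_ac)
  also have "\<dots> = (K h g * K (g \<circ> h) g') * K g h * K g' h" by (simp only: 1)
  also have "\<dots> = (K g h * K (g \<circ> h) g') * K h g * K g' h" by (simp only: mult_ac)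
  also have "\<dots> = (K g (g' \<circ> h) * K h g') * K h g * K g' h" by (simp only: 2)
  also have "\<dots> = (K g (g' \<circ> h) * K g' h) * K h g * K h g'" by (simp only: mult_ac)
  also have "\<dots> = (K g g' * K (g' \<circ> g) h) * K h g * K h g'" by (simp only: 3)
  also have "\<dots> = (K (g' \<circ> g) h * (K h g * K h g')) * K g g'" by (simp only: mult_ac)
  finally have "K h (g' \<circ> g) * (K g h * K g' h) = K (g' \<circ> g) h * (K h g * K h g')" using nz by simp
  then show ?thesis using nz by (simp add: kap_def frac_eq_eq mult_ac)
qed

end

section \<open>Stabilisers of Lagrangians\<close>

context symplectic
begin

definition frame_mat :: "(nat \<Rightarrow> 'w) \<Rightarrow> ('w \<Rightarrow> 'w) \<Rightarrow> (nat \<Rightarrow> nat \<Rightarrow> real) \<Rightarrow> bool" where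
  "frame_mat b h a \<longleftrightarrow> (\<forall>j<m. h (b j) = (\<Sum>i<m. a i j *\<^sub>R b i))"

text \<open>The determinant of \<open>h\<close> on the Lagrangian with basis \<open>b\<close>; it is meaningful when \<open>h\<close> preserves that Lagrangian.\<close>

definition fdt :: "(nat \<Rightarrow> 'w) \<Rightarrow> ('w \<Rightarrow> 'w) \<Rightarrow> real" where
  "fdt b h = fdet m (SOME a. frame_mat b h a)"

lemma fdt_eq:
  assumes b: "lframe b" and a: "frame_mat b h a"
  shows "fdt b h = fdet m a"
proof -
  define a' where "a' = (SOME a. frame_mat b h a)"
  have a': "frame_mat b h a'" unfolding a'_def by (rule someI[of _ a]) (rule a)
  have "a' i j = a i j" if ij: "i < m" "j < m" for i j
  proof -
    have "(\<Sum>i<m. (a' i j - a i j) *\<^sub>R b i) = 0"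
      using a a' ij by (simp add: frame_mat_def scaleR_diff_left sum_subtractf)
    then have "a' i j - a i j = 0"
      using b[unfolded lframe_def, THEN conjunct2, THEN spec, of "\<lambda>i. a' i j - a i j"] ij by blast
    then show ?thesis by simp
  qed
  then show ?thesis unfolding fdt_def a'_def[symmetric] by (rule fdet_cong)
qed

lemma frame_mat_exists:
  assumes "\<And>x. x \<in> lspan b \<Longrightarrow> h x \<in> lspan b"
  obtains a where "frame_mat b h a"
proof -
  have "\<forall>j. \<exists>c. j < m \<longrightarrow> h (b j) = (\<Sum>i<m. c i *\<^sub>R b i)"
    using assms lspan_base[of _ b] by (fastforce simp: lspan_def)
  then obtain c where "\<And>j. j < m \<Longrightarrow> h (b j) = (\<Sum>i<m. c j i *\<^sub>R b i)" by metis
  then show thesis by (intro that[of "\<lambda>i j. c j i"]) (simp add: frame_mat_def)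
qed

lemma fdt_comp:
  assumes b: "lframe b" and l: "linear h2"
    and i: "\<And>x. x \<in> lspan b \<Longrightarrow> h1 x \<in> lspan b" "\<And>x. x \<in> lspan b \<Longrightarrow> h2 x \<in> lspan b"
  shows "fdt b (h2 \<circ> h1) = fdt b h2 * fdt b h1"
proof -
  obtain a1 where a1: "frame_mat b h1 a1" by (rule frame_mat_exists[OF i(1)])
  obtain a2 where a2: "frame_mat b h2 a2" by (rule frame_mat_exists[OF i(2)])
  have "frame_mat b (h2 \<circ> h1) (\<lambda>i j. \<Sum>k<m. a2 i k * a1 k j)"
    unfolding frame_mat_def
  proof (intro allI impI)
    fix j assume j: "j < m"
    have "(h2 \<circ> h1) (b j) = (\<Sum>k<m. a1 k j *\<^sub>R h2 (b k))"
      using a1 j by (simp add: frame_mat_def linear_sum[OF l] linear_scale[OF l])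
    also have "\<dots> = (\<Sum>k<m. \<Sum>i<m. (a2 i k * a1 k j) *\<^sub>R b i)"
      using a2 by (simp add: frame_mat_def scaleR_sum_right mult.commute)
    also have "\<dots> = (\<Sum>i<m. (\<Sum>k<m. a2 i k * a1 k j) *\<^sub>R b i)"
      by (subst sum.swap) (simp add: scaleR_sum_left)
    finally show "(h2 \<circ> h1) (b j) = \<dots>" .
  qed
  then show ?thesis using fdt_eq[OF b] a1 a2 by (simp add: fdet_mult)
qed

lemma fdt_fixed:
  assumes b: "lframe b" and f: "\<And>x. x \<in> lspan b \<Longrightarrow> h x = x"
  shows "fdt b h = 1"
proof -
  have "frame_mat b h (\<lambda>i j. if i = j then 1 else 0)"
    unfolding frame_mat_def using f[OF lspan_base]
    by (simp add: if_distrib[of "\<lambda>r. r *\<^sub>R _"] cong: if_cong)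
  then show ?thesis using fdt_eq[OF b] by (simp add: fdet_delta)
qed

lemma fdt_nonzero:
  assumes b: "lframe b" and l: "linear h" "inj h" and i: "\<And>x. x \<in> lspan b \<Longrightarrow> h x \<in> lspan b"
  shows "fdt b h \<noteq> 0"
proof
  obtain a where a: "frame_mat b h a" by (rule frame_mat_exists[OF i])
  assume "fdt b h = 0"
  then have "\<exists>c. (\<exists>i<m. c i \<noteq> 0) \<and> (\<forall>i<m. (\<Sum>j<m. a i j * c j) = 0)"
    unfolding fdt_eq[OF b a] fdet_eq_0_iff .
  then obtain c where c0: "(\<exists>i<m. c i \<noteq> 0) \<and> (\<forall>i<m. (\<Sum>j<m. a i j * c j) = 0)" by (rule exE)
  note c = c0[THEN conjunct1] c0[THEN conjunct2]
  have "h (\<Sum>j<m. c j *\<^sub>R b j) = (\<Sum>j<m. \<Sum>i<m. (a i j * c j) *\<^sub>R b i)"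
    using a by (simp add: linear_sum[OF l(1)] linear_scale[OF l(1)] frame_mat_def scaleR_sum_right mult.commute)
  also have "\<dots> = (\<Sum>i<m. (\<Sum>j<m. a i j * c j) *\<^sub>R b i)"
    by (subst sum.swap) (simp add: scaleR_sum_left)
  also have "\<dots> = h 0" using c(2) linear_0[OF l(1)] by simp
  finally have "(\<Sum>j<m. c j *\<^sub>R b j) = 0" using l(2) by (simp add: inj_eq)
  then show False using b c(1) by (auto simp: lframe_def)
qed

definition stab :: "(nat \<Rightarrow> 'w) \<Rightarrow> ('w \<Rightarrow> 'w) \<Rightarrow> bool" where
  "stab b h \<longleftrightarrow> h \<in> Sppm S \<and> h ` lspan b = lspan b"

lemma stabD:
  assumes "stab b h"
  shows "h \<in> Sppm S" "x \<in> lspan b \<Longrightarrow> h x \<in> lspan b" "linear h" "inj h" "lspan (\<lambda>i. h (b i)) = lspan b"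
proof -
  show S: "h \<in> Sppm S" and "x \<in> lspan b \<Longrightarrow> h x \<in> lspan b" for x using assms by (auto simp: stab_def)
  show l: "linear h" and "inj h" using simD(1,2)[OF Sppm_sim(1)[OF S]] by (auto simp: bij_is_inj)
  show "lspan (\<lambda>i. h (b i)) = lspan b" using lspan_image[OF l] assms by (simp add: stab_def)
qed

text \<open>The Leray index of the stable Lagrangian relative to \<open>X\<^sup>*\<close> and its image; its exponential is the cochain that makes the
  cocycle explicit on the stabiliser.\<close>

definition p :: "(nat \<Rightarrow> 'w) \<Rightarrow> ('w \<Rightarrow> 'w) \<Rightarrow> int" where
  "p b h = leray ff (\<lambda>i. h (ff i)) b"

definition xi :: "(nat \<Rightarrow> 'w) \<Rightarrow> complex" where
  "xi b = N ff b * N ff b"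

lemma xi_cases: "lframe b \<Longrightarrow> xi b = 1 \<or> xi b = -1"
proof -
  assume b: "lframe b"
  have "xi b ^ 2 = N ff b ^ 4" by (simp add: xi_def power4_eq_xxxx power2_eq_square mult.assoc)
  then have "xi b ^ 2 = 1" using N_pow4[OF lframe_ff b] by simp
  then show ?thesis by (simp add: power2_eq_1_iff)
qed

lemma tw_stab:
  assumes b: "lframe b" and h: "stab b h1" "stab b h2"
  shows "tw h1 h2 = p b (h2 \<circ> h1) - (if lam S h2 = 1 then 1 else -1) * p b h1 - p b h2"
proof -
  note s = stabD(1)[OF h(1)] stabD(1)[OF h(2)]
  let ?P = "\<lambda>i. h2 (h1 (ff i))" and ?Q = "\<lambda>i. h2 (ff i)"
  have l: "lframe ?P" "lframe ?Q" using lframe_sim_ff2[OF s] lframe_sim_ff[OF s(2)] by auto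
  have "leray ?P ?Q b = leray ?P ?Q (\<lambda>i. h2 (b i))"
    by (rule leray_lspan_cong) (simp_all add: stabD(5)[OF h(2)])
  also have "\<dots> = (if lam S h2 = 1 then 1 else -1) * leray (\<lambda>i. h1 (ff i)) ff b"
    by (rule leray_sim[OF Sppm_sim[OF s(2)]])
  also have "leray (\<lambda>i. h1 (ff i)) ff b = - p b h1"
    unfolding p_def by (rule leray_swap[OF lframe_ff lframe_sim_ff[OF s(1)] b])
  finally have 1: "leray ?P ?Q b = - (if lam S h2 = 1 then 1 else -1) * p b h1" by simp
  have 2: "leray ?Q ff b = - p b h2"
    unfolding p_def by (rule leray_swap[OF lframe_ff l(2) b])
  have 3: "leray ff ?P ?Q = leray ff ?P b + leray ?P ?Q b + leray ?Q ff b"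
    by (rule leray_cocycle[OF lframe_ff l b])
  show ?thesis using 1 2 3 by (simp add: tw_def p_def)
qed

text \<open>Compare \<open>X\<^sup>*\<close>, its image under \<open>h\<close> and the stable Lagrangian \<open>b\<close> in the triple formula. Replacing \<open>b\<close> by its image
  changes the orientation by the sign of the determinant, and a factor \<open>-1\<close> conjugates \<open>N\<close>, which leaves the
  square \<open>xi b\<close>.\<close>

lemma M_stab:
  assumes b: "lframe b" and h: "stab b h"
  shows "M h * ipow (p b h) = (if lam S h = -1 then xi b else 1) * sg (fdt b h)"
proof -
  note s = stabD(1)[OF h]
  let ?F = "\<lambda>i. h (ff i)" and ?B = "\<lambda>i. h (b i)"
  let ?A = "N b ff" and ?C = "N ff b" and ?D = "N b ?F" and ?E = "N ?F b"
  have l: "lframe ?F" "lframe ?B" using lframe_sim_ff[OF s] lframe_sim[OF Sppm_sim(1)[OF s] b] by auto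
  obtain a where a: "frame_mat b h a" by (rule frame_mat_exists[OF stabD(2)[OF h]])
  have fd: "fdt b h \<noteq> 0" by (rule fdt_nonzero[OF b stabD(3,4)[OF h] stabD(2)[OF h]])
  have "N ?B ?F = sg (fdet m a) * ?D"
    by (rule N_change[OF b l(2,1) _ stabD(5)[OF h]]) (use a in \<open>simp add: frame_mat_def\<close>)
  moreover have "N ?B ?F = (if lam S h = 1 then ?A else cnj ?A)"
    by (rule N_sim[OF Sppm_sim[OF s] b lframe_ff])
  ultimately have sD: "sg (fdt b h) * ?D = (if lam S h = 1 then ?A else cnj ?A)"
    by (simp add: fdt_eq[OF b a])
  have AC: "?A * ?C = 1" by (rule N_swap[OF b lframe_ff])
  have "cmod ?A ^ 4 = cmod (?A ^ 4)" by (simp only: norm_power)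
  then have "cmod ?A ^ 4 = 1" by (simp only: N_pow4[OF b lframe_ff] norm_one)
  then have "cmod ?A = 1" using power_eq_imp_eq_base[of "cmod ?A" 4 1] by simp
  then have "?A * cnj ?A = 1" unfolding complex_norm_square[symmetric] by simp
  then have cA: "cnj ?A = ?C" using AC by (metis mult_cancel_left mult_zero_left zero_neq_one)
  have DE: "?D * ?E = 1" by (rule N_swap[OF b l(1)])
  have "M h * ?E * ?A = ipow (- p b h)"
    using N_triple[OF lframe_ff l(1) b] by (simp add: M_def p_def)
  then have "(M h * ?E * ?A) * ipow (p b h) = 1" by (simp add: ipow_minus)
  then have "(M h * ipow (p b h)) * (?E * ?A) = 1" by (simp only: mult_ac)
  then have "(M h * ipow (p b h)) * (?E * ?A) * (?D * ?C) = ?D * ?C" by simp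
  then have "(M h * ipow (p b h)) * (?D * ?E) * (?A * ?C) = ?D * ?C" by (simp only: mult_ac)
  then have X: "M h * ipow (p b h) = ?D * ?C" by (simp only: AC DE mult_1_right)
  have "?D = (sg (fdt b h) * sg (fdt b h)) * ?D" using sg_sq[OF fd] by simp
  also have "\<dots> = sg (fdt b h) * (if lam S h = 1 then ?A else ?C)"
    by (simp only: mult.assoc sD cA)
  finally show ?thesis
    using X AC Sppm_sim(2)[OF s] by (auto simp: xi_def mult_ac)
qed

text \<open>On the stabiliser of a Lagrangian the extension is, up to a coboundary, governed by the sign of the
  determinant on that Lagrangian.\<close>

lemma K_stab:
  assumes b: "lframe b" and h: "stab b h1" "stab b h2"
  shows "K h1 h2 = (if lam S h2 = -1 then (if lam S h1 = -1 then et * xi b else 1) * sg (fdt b h1) else 1)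
     * es (p b (h2 \<circ> h1) - p b h1 - p b h2)"
proof (cases "lam S h2 = -1")
  case True
  have "tw h1 h2 = (p b (h2 \<circ> h1) - p b h1 - p b h2) + (p b h1 + p b h1)"
    using tw_stab[OF b h] True by simp
  then have "es (tw h1 h2) = es (p b (h2 \<circ> h1) - p b h1 - p b h2) * ipow (p b h1)"
    by (simp only: es_add es_two[symmetric])
  then have "K h1 h2 = (if lam S h1 = -1 then et else 1) * (M h1 * ipow (p b h1)) * es (p b (h2 \<circ> h1) - p b h1 - p b h2)"
    using True by (simp add: K_def)
  then show ?thesis using True by (simp add: M_stab[OF b h(1)])
next
  case False
  then have "lam S h2 = 1" using Sppm_sim(2)[OF stabD(1)[OF h(2)]] by simp
  then show ?thesis using tw_stab[OF b h] by (simp add: K_def)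
qed

lemma kap_stab:
  assumes b: "lframe b" and h: "stab b h" "stab b g" and c: "h \<circ> g = g \<circ> h"
  shows "kap h g = (if lam S g = -1 then sg (fdt b h) else 1) * (if lam S h = -1 then sg (fdt b g) else 1)"
proof -
  have "fdt b g \<noteq> 0" by (rule fdt_nonzero[OF b stabD(3,4)[OF h(2)] stabD(2)[OF h(2)]])
  then have s: "inverse (sg (fdt b g)) = sg (fdt b g)" using sg_cases by force
  have n: "et * xi b \<noteq> 0" using et_cases xi_cases[OF b] by auto
  have "K g h = (if lam S h = -1 then (if lam S g = -1 then et * xi b else 1) * sg (fdt b g) else 1)
     * es (p b (g \<circ> h) - p b h - p b g)"
    using K_stab[OF b h(2,1)] c by (simp add: algebra_simps)
  moreover have "es (p b (g \<circ> h) - p b h - p b g) \<noteq> 0" by simp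
  moreover have "c * a * e / (c * d * e) = a * d" if "c \<noteq> 0" "e \<noteq> 0" "inverse d = d" for a c d e :: complex
  proof -
    have "c * a * e / (c * d * e) = a / d" using that by simp
    then show ?thesis by (simp only: divide_inverse that(3))
  qed
  ultimately show ?thesis
    unfolding kap_def K_stab[OF b h] using n s by (auto simp: c)
qed

lemma lframe_maximal:
  assumes b: "lframe b" and o: "\<And>i. i < m \<Longrightarrow> om x (b i) = 0"
  shows "x \<in> lspan b"
proof -
  obtain s where "\<And>c. c \<in> {b} \<Longrightarrow> gdet c (tt s) \<noteq> 0"
    by (rule transversal_exists[of "{b}"]) (use b in auto)
  then have s: "gdet b (tt s) \<noteq> 0" by simp
  let ?y = "prj s b x - x"
  have ox: "om x z = 0" if "z \<in> lspan b" for z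
    using that o by (auto simp: lspan_def omb)
  have "?y \<in> lspan (tt s)" by (rule prj_diff[OF b s])
  then obtain c where c: "?y = (\<Sum>j<m. c j *\<^sub>R tt s j)" by (auto simp: lspan_def)
  have "om ?y (b i) = 0" if "i < m" for i
    using o[OF that] lframe_isotropic[OF b prj_props(1)[OF b s] lspan_base[OF that]] by (simp add: omb)
  then have "\<forall>i<m. (\<Sum>j<m. c j * om (tt s j) (b i)) = 0" by (simp add: c omb)
  moreover have "gdet (tt s) b \<noteq> 0" by (rule gdet_nonzero_swap[OF s])
  ultimately have "\<forall>j<m. c j = 0" unfolding gdet_def fdet_eq_0_iff_row by blast
  then have "prj s b x = x" using c by simp
  then show ?thesis using prj_props(1)[OF b s, of x] by simp
qed

lemma lframe_from_independent:
  assumes B: "independent B" "finite B" and b: "inj_on b {..<m}" "b ` {..<m} \<subseteq> B"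
    and iso: "\<And>x y. x \<in> B \<Longrightarrow> y \<in> B \<Longrightarrow> om x y = 0"
  shows "lframe b"
  unfolding lframe_def
proof (intro conjI allI impI)
  show "om (b i) (b j) = 0" if "i < m" "j < m" for i j using iso b(2) that by blast
  fix c i assume c: "(\<Sum>i<m. c i *\<^sub>R b i) = 0" and i: "i < m"
  have "(\<Sum>v\<in>b ` {..<m}. c (inv_into {..<m} b v) *\<^sub>R v) = (\<Sum>i<m. c i *\<^sub>R b i)"
    by (subst sum.reindex[OF b(1)]) (simp add: inv_into_f_f[OF b(1)])
  then have "c (inv_into {..<m} b (b i)) = 0"
    using independentD[OF B(1), of "b ` {..<m}" "\<lambda>v. c (inv_into {..<m} b v)" "b i"] b(2) c i by simp
  then show "c i = 0" using inv_into_f_f[OF b(1)] i by simp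
qed

lemma isotropic_card:
  assumes B: "independent B" "finite B" and iso: "\<And>x y. x \<in> B \<Longrightarrow> y \<in> B \<Longrightarrow> om x y = 0"
  shows "card B \<le> m"
proof (rule ccontr)
  assume "\<not> card B \<le> m"
  then have n: "m < card B" by simp
  obtain b where b: "bij_betw b {0..<card B} B" using ex_bij_betw_nat_finite[OF B(2)] by blast
  have inj: "inj_on b {..m}" by (rule inj_on_subset[OF bij_betw_imp_inj_on[OF b]]) (use n in auto)
  have im: "b ` {..m} \<subseteq> B" using b n by (auto simp: bij_betw_def)
  have l: "lframe b"
    by (rule lframe_from_independent[OF B _ _ iso]) (use inj im in \<open>auto simp: inj_on_def\<close>)
  have "b m \<in> lspan b" by (rule lframe_maximal[OF l], rule iso) (use im in \<open>auto simp: image_subset_iff\<close>)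
  then have "b m \<in> span (b ` {..<m})" by (simp add: lspan_eq_span)
  moreover have "b ` {..<m} \<subseteq> B - {b m}" using inj im by (auto simp: inj_on_def)
  ultimately have "b m \<in> span (B - {b m})" using span_mono by blast
  then have "dependent B" using im real_vector.dependent_def by blast
  then show False using B by simp
qed

lemma independent_frame: "independent (ee ` {..<m} \<union> ff ` {..<m})" "card (ee ` {..<m} \<union> ff ` {..<m}) = 2 * m"
proof -
  let ?F = "ee ` {..<m} \<union> ff ` {..<m}"
  have d: "i = j" if "i < m" "j < m" "ee i = ee j" for i j using om_basis(3)[of i j] om_basis(3)[of j j] that by (auto split: if_splits)
  have d': "i = j" if "i < m" "j < m" "ff i = ff j" for i j using om_basis(3)[of i i] om_basis(3)[of i j] that by (auto split: if_splits)
  have d2: "ee i \<noteq> ff j" if "i < m" "j < m" for i j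
  proof
    assume e: "ee i = ff j"
    have "om (ee i) (ff i) = om (ff j) (ff i)" by (simp only: e)
    then show False using om_basis(2,3) that by simp
  qed
  have "card ?F = card (ee ` {..<m}) + card (ff ` {..<m})"
    by (rule card_Un_disjoint) (use d2 in auto)
  also have "\<dots> = 2 * m" using d d' by (simp add: card_image inj_on_def)
  finally show "card ?F = 2 * m" .
  show "independent ?F"
  proof (rule real_vector.independent_if_scalars_zero)
    show "finite ?F" by simp
    fix u x assume u: "(\<Sum>x\<in>?F. u x *\<^sub>R x) = 0" and x: "x \<in> ?F"
    define y where "y = (if x \<in> ee ` {..<m} then ff (SOME i. i < m \<and> x = ee i) else ee (SOME i. i < m \<and> x = ff i))"
    have y: "om x y \<noteq> 0 \<and> (\<forall>z\<in>?F. z \<noteq> x \<longrightarrow> om z y = 0)"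
    proof (cases "x \<in> ee ` {..<m}")
      case True
      then have "\<exists>i. i < m \<and> x = ee i" by auto
      then have "(SOME i. i < m \<and> x = ee i) < m \<and> x = ee (SOME i. i < m \<and> x = ee i)" by (rule someI_ex)
      then obtain i where i: "i < m" "x = ee i" "y = ff i" using True y_def by auto
      then show ?thesis by (auto simp: om_basis)
    next
      case False
      then have "\<exists>i. i < m \<and> x = ff i" using x by auto
      then have "(SOME i. i < m \<and> x = ff i) < m \<and> x = ff (SOME i. i < m \<and> x = ff i)" by (rule someI_ex)
      then obtain i where i: "i < m" "x = ff i" "y = ee i" using False y_def by auto
      then show ?thesis by (auto simp: om_basis)
    qed
    have "0 = om (\<Sum>x\<in>?F. u x *\<^sub>R x) y" using u by (simp add: omb)
    also have "\<dots> = (\<Sum>z\<in>?F. if z = x then u x * om x y else 0)"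
      unfolding omb by (rule sum.cong) (use y in auto)
    also have "\<dots> = u x * om x y" using x by simp
    finally show "u x = 0" using y by simp
  qed
qed

text \<open>An anti-symplectic involution has two isotropic eigenspaces; as they span, both are Lagrangian.\<close>

lemma involution_frame:
  assumes h: "h \<in> Sppm S" "lam S h = -1" "h \<circ> h = id"
  obtains b where "lframe b" "lspan b = {w. h w = w}"
proof -
  note hs = simD[OF Sppm_sim(1)[OF h(1)], unfolded h(2)]
  have hh: "h (h x) = x" for x using h(3) by (metis comp_apply id_apply)
  let ?P = "{w. h w = w}" and ?N = "{w. h w = - w}"
  have sP: "subspace ?P" "subspace ?N"
    using hs(1) by (auto simp: subspace_def linear_0 linear_add linear_scale)
  have iso: "om x y = 0" if "x \<in> ?P \<and> y \<in> ?P \<or> x \<in> ?N \<and> y \<in> ?N" for x y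
  proof -
    have "om (h x) (h y) = - om x y" using hs(3)[of x y] by simp
    moreover have "om (h x) (h y) = om x y" using that by (elim disjE conjE) (simp_all add: omb)
    ultimately show ?thesis by linarith
  qed
  obtain B where B: "B \<subseteq> ?P" "independent B" "?P \<subseteq> span B" "card B = dim ?P"
    by (rule basis_exists)
  obtain C where C: "C \<subseteq> ?N" "independent C" "?N \<subseteq> span C" "card C = dim ?N"
    by (rule basis_exists)
  have fin: "finite A" if "independent A" for A :: "'w set"
    using real_vector.independent_span_bound[OF _ that, of "ee ` {..<m} \<union> ff ` {..<m}"] span_frame by auto
  have fBC: "finite B" "finite C" using fin B C by auto
  have cB: "card B \<le> m" by (rule isotropic_card[OF B(2) fBC(1)]) (use iso B(1) in auto)
  have cC: "card C \<le> m" by (rule isotropic_card[OF C(2) fBC(2)]) (use iso C(1) in auto)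
  have "x \<in> span (B \<union> C)" for x
  proof -
    have "h (x + h x) = x + h x" "h (x - h x) = - (x - h x)"
      using hs(1) by (simp_all add: linear_add linear_diff hh)
    then have "x + h x \<in> span B" "x - h x \<in> span C" using B(3) C(3) by auto
    then have "x + h x \<in> span (B \<union> C)" "x - h x \<in> span (B \<union> C)"
      using span_mono[of B "B \<union> C"] span_mono[of C "B \<union> C"] by auto
    then have "(x + h x) + (x - h x) \<in> span (B \<union> C)" by (rule span_add)
    then have "(1/2) *\<^sub>R ((x + h x) + (x - h x)) \<in> span (B \<union> C)" by (rule span_scale)
    then show ?thesis by (simp add: scaleR_2[symmetric])
  qed
  then have "2 * m \<le> card (B \<union> C)"
    using real_vector.independent_span_bound[OF _ independent_frame(1), of "B \<union> C"] fBC independent_frame(2) by auto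
  also have "\<dots> \<le> card B + card C" by (rule card_Un_le)
  finally have cm: "card B = m" using cB cC by simp
  obtain b where b: "bij_betw b {0..<card B} B" using ex_bij_betw_nat_finite[OF fBC(1)] by blast
  then have b': "inj_on b {..<m}" "b ` {..<m} = B" by (auto simp: cm bij_betw_def lessThan_atLeast0)
  have l: "lframe b"
    by (rule lframe_from_independent[OF B(2) fBC(1) b'(1)]) (use b' iso B(1) in auto)
  have "span B = ?P" using B(3) span_minimal[OF B(1) sP(1)] by auto
  then show thesis using that[OF l] by (simp add: lspan_eq_span b'(2))
qed

lemma stab_involution:
  assumes "g \<in> Sppm S" "h \<circ> g = g \<circ> h" "lspan b = {w. h w = w}"
  shows "stab b g"
proof -
  have c: "h (g x) = g (h x)" for x using assms(2) by (metis comp_apply)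
  have gb: "bij g" by (rule simD(2)[OF Sppm_sim(1)[OF assms(1)]])
  have "g ` lspan b = lspan b"
  proof (intro equalityI subsetI)
    show "x \<in> lspan b" if "x \<in> g ` lspan b" for x using that c assms(3) by auto
    show "x \<in> g ` lspan b" if "x \<in> lspan b" for x
    proof -
      let ?y = "inv_into UNIV g x"
      have gy: "g ?y = x" using gb by (simp add: bij_is_surj surj_f_inv_f)
      have "g (h ?y) = g ?y" using c[of ?y] that assms(3) gy by simp
      then have "?y \<in> lspan b" using gb assms(3) by (simp add: bij_is_inj inj_eq)
      then show ?thesis using gy by (metis imageI)
    qed
  qed
  then show ?thesis using assms(1) by (simp add: stab_def)
qed

text \<open>The involution acts as the identity on its fixed Lagrangian, so of the two determinant signs in
  the commutator only that of \<open>g\<close> remains.\<close>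

lemma kap_involution:
  assumes h: "h \<in> Sppm S" "lam S h = -1" and g: "g \<in> Sppm S" "h \<circ> g = g \<circ> h"
    and b: "lframe b" "lspan b = {w. h w = w}"
  shows "kap h g = sg (fdt b g)"
proof -
  have "fdt b h = 1" by (rule fdt_fixed[OF b(1)]) (use b(2) in auto)
  then have "sg (fdt b h) = 1" by (simp add: sg_def)
  then show ?thesis
    using kap_stab[OF b(1) stab_involution[OF h(1) refl b(2)] stab_involution[OF g b(2)] g(2)] h(2) by simp
qed

text \<open>A linear complex structure \<open>g\<close> is the square of \<open>(1 + g) / \<surd>2\<close>, so its determinant is positive.\<close>

lemma kap_involution_complex_structure:
  assumes h: "h \<in> Sppm S" "lam S h = -1" "h \<circ> h = id" and g: "g \<in> Sppm S" "h \<circ> g = g \<circ> h" "g \<circ> g = uminus"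
  shows "kap h g = 1"
proof -
  obtain b where b: "lframe b" "lspan b = {w. h w = w}" by (rule involution_frame[OF h])
  have st: "stab b g" by (rule stab_involution[OF g(1,2) b(2)])
  note gl = stabD(3)[OF st]
  let ?k = "\<lambda>x. (1 / sqrt 2) *\<^sub>R (x + g x)"
  have lk: "linear ?k"
    by (rule linearI) (simp_all add: linear_add[OF gl] linear_scale[OF gl] algebra_simps)
  have gg: "g (g x) = - x" for x using g(3) by (metis comp_apply)
  have "?k (?k x) = g x" for x
  proof -
    have "?k (?k x) = (1 / sqrt 2 * (1 / sqrt 2)) *\<^sub>R (x + g x) + (1 / sqrt 2 * (1 / sqrt 2)) *\<^sub>R (g x + g (g x))"
      by (simp only: linear_scale[OF gl] linear_add[OF gl] scaleR_add_right scaleR_scaleR)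
    also have "\<dots> = (1/2) *\<^sub>R (2 *\<^sub>R g x)" unfolding gg scaleR_2 by (simp flip: scaleR_add_right)
    finally show ?thesis by simp
  qed
  then have kk: "?k \<circ> ?k = g" by (simp add: fun_eq_iff)
  have ki: "?k x \<in> lspan b" if "x \<in> lspan b" for x
    using that stabD(2)[OF st that] by (intro subspace_scale[OF subspace_lspan] subspace_add[OF subspace_lspan])
  have "fdt b g = fdt b ?k * fdt b ?k"
    using fdt_comp[OF b(1) lk, of ?k, OF ki ki] by (simp only: kk)
  moreover have "fdt b g \<noteq> 0" by (rule fdt_nonzero[OF b(1) gl stabD(4)[OF st] stabD(2)[OF st]])
  ultimately have "sg (fdt b g) = 1" using sg_sq[of "fdt b ?k"] by (simp add: sg_mult)
  then show ?thesis using kap_involution[OF h(1,2) g(1,2) b] by simp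
qed

end

section \<open>Similitude groups of Hermitian spaces\<close>

context hermitian
begin

lemma ex_form_1:
  assumes "x \<noteq> 0"
  obtains y where "h x y = 1"
proof -
  obtain y where y: "h x y \<noteq> 0" using h_nondeg assms by blast
  then have "h x (ac (inverse (h x y)) y) = 1" by (simp add: h_ac)
  then show thesis by (rule that)
qed

lemma ex_nonzero: obtains x :: 'v where "x \<noteq> 0"
  using H by (auto simp: right_hermitian_space_def)

lemma similitude_unique: "similitude V l g \<Longrightarrow> similitude V l' g \<Longrightarrow> l = l'"
proof -
  assume g: "similitude V l g" "similitude V l' g"
  obtain x :: 'v where "x \<noteq> 0" by (rule ex_nonzero)
  then obtain y where "h x y = 1" by (rule ex_form_1)
  then have "l *\<^sub>R (1::'d) = l' *\<^sub>R 1" using similitudeD(4)[OF g(1), of x y] similitudeD(4)[OF g(2), of x y] by simp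
  then show "l = l'" by simp
qed

lemma sim_factor_eq: "similitude V l g \<Longrightarrow> sim_factor V g = l"
  unfolding sim_factor_def by (rule the_equality) (auto dest: similitude_unique)

lemma Upm_iff: "g \<in> Upm V \<longleftrightarrow> similitude V 1 g \<or> similitude V (-1) g"
proof
  assume "g \<in> Upm V"
  then obtain l where l: "similitude V l g" "sim_factor V g \<in> {1, -1}" by (auto simp: Upm_def GU_def)
  then show "similitude V 1 g \<or> similitude V (-1) g" using sim_factor_eq[OF l(1)] by auto
next
  assume g: "similitude V 1 g \<or> similitude V (-1) g"
  then have "sim_factor V g \<in> {1, -1}" using sim_factor_eq by auto
  moreover have "g \<in> GU V" unfolding GU_def
    using g by (auto intro: exI[of _ 1] exI[of _ "-1"])
  ultimately show "g \<in> Upm V" by (simp add: Upm_def)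
qed

lemma Upm_sim: "g \<in> Upm V \<Longrightarrow> similitude V (sim_factor V g) g"
  "g \<in> Upm V \<Longrightarrow> sim_factor V g = 1 \<or> sim_factor V g = -1"
  using sim_factor_eq by (auto simp: Upm_iff)

lemma U_Upm: "g \<in> U V \<Longrightarrow> g \<in> Upm V"
  by (simp add: U_iff Upm_iff)

lemma Upm_comp: "g \<in> Upm V \<Longrightarrow> g' \<in> Upm V \<Longrightarrow> g \<circ> g' \<in> Upm V"
  using similitude_comp by (fastforce simp: Upm_iff)

lemma Upm_inv: "g \<in> Upm V \<Longrightarrow> inv_into UNIV g \<in> Upm V"
  using similitude_inv[of 1 g] similitude_inv[of "-1" g] by (auto simp: Upm_iff)

lemma Upm_bij: "g \<in> Upm V \<Longrightarrow> bij g"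
  by (auto simp: Upm_iff similitude_def)

lemma Upm_inv_id: "g \<in> Upm V \<Longrightarrow> inv_into UNIV g (g x) = x" "g \<in> Upm V \<Longrightarrow> g (inv_into UNIV g x) = x"
  using Upm_bij by (auto simp: bij_is_inj bij_is_surj surj_f_inv_f)

lemma sim_factor_comp:
  "g \<in> Upm V \<Longrightarrow> g' \<in> Upm V \<Longrightarrow> sim_factor V (g \<circ> g') = sim_factor V g * sim_factor V g'"
  using similitude_comp[OF Upm_sim(1) Upm_sim(1)] sim_factor_eq by blast

lemma sim_factor_U: "g \<in> Upm V \<Longrightarrow> sim_factor V g = 1 \<longleftrightarrow> g \<in> U V"
  using Upm_sim(1)[of g] sim_factor_eq[of 1 g] by (auto simp: U_iff)

end

text \<open>A left Hermitian space is a right one for the action twisted by the involution.\<close>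

definition opp :: "('d::involutive_div_algebra, 'v::ab_group_add) form_space \<Rightarrow> ('d, 'v) form_space" where
  "opp V = \<lparr>act = (\<lambda>d. act V (tau d)), form = form V\<rparr>"

lemma opp_sel [simp]: "act (opp V) d = act V (tau d)" "form (opp V) = form V"
  by (simp_all add: opp_def)

lemma opp_right_hermitian:
  assumes "left_hermitian_space eps V"
  shows "right_hermitian_space eps (opp V)"
proof -
  have ds: "dsubspace (opp V) T \<longleftrightarrow> dsubspace V T" for T
    unfolding dsubspace_def by (simp, metis tau_tau)
  have sp: "dspan (opp V) B = dspan V B" for B unfolding dspan_def hull_def ds ..
  show ?thesis
    unfolding right_hermitian_space_def
  proof (intro conjI)
    show "right_vector_space (opp V)"
      using assms by (simp add: left_hermitian_space_def left_vector_space_def right_vector_space_def tau_add tau_mult)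
    show "dfinite_dimensional (opp V)"
      using assms by (simp add: left_hermitian_space_def dfinite_dimensional_def sp)
    show "\<exists>x::'b. x \<noteq> 0" using assms by (simp add: left_hermitian_space_def)
    show "form_hermitian eps (opp V)"
      using assms unfolding left_hermitian_space_def form_hermitian_def opp_sel by blast
    show "\<forall>a b x y. form (opp V) (act (opp V) a x) (act (opp V) b y) = tau a * form (opp V) x y * b"
      using assms by (simp add: left_hermitian_space_def tau_tau)
    show "form_nondegenerate (opp V)"
      using assms by (simp add: left_hermitian_space_def form_nondegenerate_def)
  qed
qed

lemma opp_similitude: "similitude (opp V) = similitude V"
proof -
  have "dlinear (opp V) g = dlinear V g" for g
    unfolding dlinear_def by (simp, metis tau_tau)
  then show ?thesis by (simp add: fun_eq_iff similitude_def)
qed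

lemma opp_groups: "U (opp V) = U V" "Upm (opp V) = Upm V" "sim_factor (opp V) = sim_factor V"
  by (simp_all add: fun_eq_iff U_def Upm_def GU_def sim_factor_def opp_similitude)

text \<open>Generation by eighth powers, stated as an induction principle, so that a homomorphism into the eighth roots of unity can be
  shown to be trivial by one application.\<close>

definition gen8 :: "('x \<Rightarrow> 'x) set \<Rightarrow> bool" where
  "gen8 G \<longleftrightarrow> (\<forall>P g. P id \<longrightarrow> (\<forall>g\<in>G. \<forall>g'\<in>G. P g \<longrightarrow> P g' \<longrightarrow> P (g \<circ> g')) \<longrightarrow>
     (\<forall>g\<in>G. P (((g \<circ> g) \<circ> (g \<circ> g)) \<circ> ((g \<circ> g) \<circ> (g \<circ> g)))) \<longrightarrow> g \<in> G \<longrightarrow> P g)"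

lemma gen8D:
  assumes "gen8 G" "P id" "\<And>g g'. g \<in> G \<Longrightarrow> g' \<in> G \<Longrightarrow> P g \<Longrightarrow> P g' \<Longrightarrow> P (g \<circ> g')"
    "\<And>g. g \<in> G \<Longrightarrow> P (((g \<circ> g) \<circ> (g \<circ> g)) \<circ> ((g \<circ> g) \<circ> (g \<circ> g)))" "g \<in> G"
  shows "P g"
  using assms unfolding gen8_def by blast

lemma commutes_with_swap: "commutes_with G A B \<longleftrightarrow> commutes_with G B A"
  unfolding commutes_with_def by metis

section \<open>Tensor products\<close>

locale tensor_datum =
  fixes eps1 eps2 :: real
    and V1 :: "('d::normed_involution, 'a::ab_group_add) form_space"
    and V2 :: "('d, 'b::ab_group_add) form_space"
    and t :: "'a \<Rightarrow> 'b \<Rightarrow> 'w::real_vector"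
    and S :: "'w symplectic_datum"
  assumes dual: "dual_pair eps1 eps2 V1 V2 t"
    and form_S: "sform S = tensor_form V1 V2 t"
    and frame_S: "symplectic_frame S"
begin

sublocale V1: hermitian V1 eps1
  by unfold_locales (use dual in \<open>auto simp: dual_pair_def\<close>)

sublocale V2: hermitian "opp V2" eps2
  by unfold_locales (use dual in \<open>auto simp: dual_pair_def opp_right_hermitian\<close>)

lemma eps12: "eps1 * eps2 = -1"
  using dual by (simp add: dual_pair_def)

lemma t_add: "t (x + x') y = t x y + t x' y" "t x (y + y') = t x y + t x y'"
  and t_act: "t (act V1 d x) y = t x (act V2 d y)"
  and t_real: "t (act V1 (of_real r) x) y = r *\<^sub>R t x y"
  using dual by (auto simp: dual_pair_def tensor_product_def balanced_def)

lemma t_real2: "t x (act V2 (of_real r) y) = r *\<^sub>R t x y"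
  by (simp only: t_act[symmetric] t_real)

lemma t_zero [simp]: "t 0 y = 0" "t x 0 = 0"
  using t_add(1)[of 0 0 y] t_add(2)[of x 0 0] by auto

lemma t_minus: "t (- x) y = - t x y" "t x (- y) = - t x y"
  using t_add(1)[of x "- x" y] t_add(2)[of x y "- y"] by (simp_all add: eq_neg_iff_add_eq_0 add.commute)

lemma lift: "balanced V1 V2 f \<Longrightarrow> \<exists>!L. linear L \<and> (\<forall>x y. L (t x y) = (f x y :: real))"
  using dual by (simp add: dual_pair_def tensor_product_def)

text \<open>Uniqueness of the factorisation of the zero map forces the pure tensors to span.\<close>

lemma span_t: "span {t x y | x y. True} = UNIV"
proof (rule ccontr)
  let ?T = "{t x y | x y. True}"
  assume "span ?T \<noteq> UNIV"
  then obtain w where w: "w \<notin> span ?T" by blast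
  obtain B where B: "B \<subseteq> ?T" "independent B" "?T \<subseteq> span B" "card B = dim ?T" by (rule basis_exists)
  have sB: "span B = span ?T"
    using B(1,3) by (metis span_mono span_span subset_antisym)
  have ind: "independent (insert w B)" using B(2) w sB by (simp add: independent_insert)
  obtain g :: "'w \<Rightarrow> real" where g: "linear g" "\<forall>x\<in>insert w B. g x = (if x = w then 1 else 0)"
    using linear_independent_extend[OF ind, of "\<lambda>x. if x = w then 1 else 0"] by blast
  have wB: "w \<notin> B" using w sB span_base by blast
  have "g x = 0" if "x \<in> span B" for x
    by (rule linear_eq_0_on_span[OF g(1) _ that]) (use g(2) wB in auto)
  then have g0: "g (t x y) = 0" for x y using B(3) by blast
  have bal0: "balanced V1 V2 (\<lambda>x y. 0::real)" by (simp add: balanced_def)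
  have "linear (\<lambda>_::'w. 0::real)" by (rule linearI) simp_all
  then have "g = (\<lambda>_. 0)" using lift[OF bal0] g(1) g0 by blast
  then show False using g(2) by auto
qed

lemma linear_eq_t:
  assumes "linear f" "linear g" "\<And>x y. f (t x y) = g (t x y)"
  shows "f = g"
proof
  fix w
  show "f w = g w"
    by (rule linear_eq_on_span[OF assms(1,2), of "{t x y | x y. True}"]) (use assms(3) span_t in auto)
qed

definition val :: "'a \<Rightarrow> 'b \<Rightarrow> 'a \<Rightarrow> 'b \<Rightarrow> real" where
  "val x y x' y' = kappa TYPE('d) * trd (form V1 x x' * tau (form V2 y y'))"

lemma h2_act: "form V2 (act V2 d y) y' = d * form V2 y y'" "form V2 y (act V2 d y') = form V2 y y' * tau d"
  using V2.h_ac(1)[of "tau d" y y'] V2.h_ac(2)[of y "tau d" y'] by (simp_all add: tau_tau)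

lemma val_balanced: "balanced V1 V2 (\<lambda>x y. val x y x' y')"
  unfolding balanced_def
proof (intro conjI allI)
  show "val (x + x1) y x' y' = val x y x' y' + val x1 y x' y'" for x x1 y
    by (simp add: val_def V1.h_add distrib_right trd_add distrib_left)
  show "val x (y + y1) x' y' = val x y x' y' + val x y1 x' y'" for x y y1
    using V2.h_add(1)[of y y1 y'] by (simp add: val_def tau_add distrib_left trd_add)
  show "val (act V1 d x) y x' y' = val x (act V2 d y) x' y'" for d x y
  proof -
    have "trd (tau d * (form V1 x x' * tau (form V2 y y'))) = trd ((form V1 x x' * tau (form V2 y y')) * tau d)"
      by (rule trd_commute)
    then show ?thesis by (simp add: val_def V1.h_ac h2_act tau_mult mult.assoc)
  qed
  show "val (act V1 (of_real r) x) y x' y' = r *\<^sub>R val x y x' y'" for r x y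
    by (simp add: val_def V1.h_ac) (simp add: of_real_def trd_scaleR)
qed

lemma val_balanced_right:
  "val x y (x' + x1) y' = val x y x' y' + val x y x1 y'"
  "val x y x' (y' + y1) = val x y x' y' + val x y x' y1"
  "val x y (act V1 d x') y' = val x y x' (act V2 d y')"
  "val x y (act V1 (of_real r) x') y' = r * val x y x' y'"
proof -
  show "val x y (x' + x1) y' = val x y x' y' + val x y x1 y'"
    by (simp add: val_def V1.h_add distrib_right trd_add distrib_left)
  show "val x y x' (y' + y1) = val x y x' y' + val x y x' y1"
    using V2.h_add(2)[of y y' y1] by (simp add: val_def tau_add distrib_left trd_add)
  show "val x y (act V1 d x') y' = val x y x' (act V2 d y')"
    by (simp add: val_def V1.h_ac h2_act tau_mult tau_tau mult.assoc)
  show "val x y (act V1 (of_real r) x') y' = r * val x y x' y'"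
    by (simp add: val_def V1.h_ac) (simp add: of_real_def trd_scaleR)
qed

lemma tensor_form_props:
  "linear (sform S v)" "linear (\<lambda>v. sform S v w)" "sform S (t x y) (t x' y') = val x y x' y'"
proof -
  let ?P = "\<lambda>B. (\<forall>v. linear (B v)) \<and> (\<forall>w. linear (\<lambda>v. B v w)) \<and> (\<forall>x y x' y'. B (t x y) (t x' y') = val x y x' y')"
  have "\<forall>x' y'. \<exists>L. linear L \<and> (\<forall>x y. L (t x y) = val x y x' y')" using lift[OF val_balanced] by blast
  then obtain L where L: "\<And>x' y'. linear (L x' y')" "\<And>x y x' y'. L x' y' (t x y) = val x y x' y'" by metis
  have "balanced V1 V2 (\<lambda>x' y'. L x' y' w)" for w
  proof -
    have La: "L (x' + x1) y' = (\<lambda>w. L x' y' w + L x1 y' w)" for x' x1 y'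
      by (rule linear_eq_t) (auto simp: L val_balanced_right intro: linear_compose_add)
    have Lb: "L x' (y' + y1) = (\<lambda>w. L x' y' w + L x' y1 w)" for x' y' y1
      by (rule linear_eq_t) (auto simp: L val_balanced_right intro: linear_compose_add)
    have Lc: "L (act V1 d x') y' = L x' (act V2 d y')" for d x' y'
      by (rule linear_eq_t) (auto simp: L val_balanced_right)
    have Ld: "L (act V1 (of_real r) x') y' = (\<lambda>w. r *\<^sub>R L x' y' w)" for r x' y'
      by (rule linear_eq_t[OF L(1) linear_compose_scale_right[OF L(1)]]) (simp only: L(2) val_balanced_right(4) real_scaleR_def)
    show ?thesis unfolding balanced_def
    proof (intro conjI allI)
      show "L (x' + x1) y' w = L x' y' w + L x1 y' w" for x' x1 y' by (simp only: La)
      show "L x' (y' + y1) w = L x' y' w + L x' y1 w" for x' y' y1 by (simp only: Lb)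
      show "L (act V1 d x') y' w = L x' (act V2 d y') w" for d x' y' by (simp only: Lc)
      show "L (act V1 (of_real r) x') y' w = r *\<^sub>R L x' y' w" for r x' y' by (simp only: Ld)
    qed
  qed
  then have "\<forall>w. \<exists>G. linear G \<and> (\<forall>x' y'. G (t x' y') = L x' y' w)" using lift by blast
  then obtain G where G: "\<And>w. linear (G w)" "\<And>w x' y'. G w (t x' y') = L x' y' w" by metis
  have Ga: "G (v + v') = (\<lambda>w. G v w + G v' w)" for v v'
    by (rule linear_eq_t) (auto simp: G linear_add[OF L(1)] intro: linear_compose_add)
  have Gs: "G (r *\<^sub>R v) = (\<lambda>w. r *\<^sub>R G v w)" for r v
    by (rule linear_eq_t[OF G(1) linear_compose_scale_right[OF G(1)]]) (simp add: G linear_scale[OF L(1)])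
  have PG: "?P G" using G L(2) by (auto intro!: linearI simp: Ga Gs)
  have "?P (tensor_form V1 V2 t)"
    unfolding tensor_form_def val_def[symmetric]
  proof (rule theI[where P = ?P, OF PG])
    fix B assume B: "?P B"
    have "B (t x y) = G (t x y)" for x y
      by (rule linear_eq_t) (use B PG in auto)
    then have "(\<lambda>v. B v w) = (\<lambda>v. G v w)" for w
      by (intro linear_eq_t) (use B PG in auto)
    then show "B = G" by (simp add: fun_eq_iff)
  qed
  then show "linear (sform S v)" "linear (\<lambda>v. sform S v w)" "sform S (t x y) (t x' y') = val x y x' y'"
    by (auto simp: form_S)
qed

lemma val_swap: "val x' y' x y = - val x y x' y'"
proof -
  have "form V1 x' x * tau (form V2 y' y) = (eps1 * eps2) *\<^sub>R (tau (form V1 x x') * form V2 y y')"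
    using V2.h_sym[of y' y] unfolding V1.h_sym[of x' x] by (simp add: tau_scaleR tau_tau)
  then have "trd (form V1 x' x * tau (form V2 y' y)) = - trd (tau (form V1 x x') * form V2 y y')"
    by (simp only: eps12 trd_scaleR)
  also have "trd (tau (form V1 x x') * form V2 y y') = trd (tau (tau (form V2 y y') * form V1 x x'))"
    by (simp add: tau_mult tau_tau)
  also have "\<dots> = trd (tau (form V2 y y') * form V1 x x')" by (rule trd_tau)
  also have "\<dots> = trd (form V1 x x' * tau (form V2 y y'))" by (rule trd_commute)
  finally show ?thesis by (simp add: val_def)
qed

lemma form_alt: "sform S v w = - sform S w v"
proof -
  have 1: "sform S (t x y) = (\<lambda>w. - sform S w (t x y))" for x y
  proof (rule linear_eq_t[OF tensor_form_props(1) linear_compose_neg[OF tensor_form_props(2)]])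
    fix x' y'
    show "sform S (t x y) (t x' y') = - sform S (t x' y') (t x y)"
      unfolding tensor_form_props(3) by (rule val_swap)
  qed
  have "(\<lambda>v. sform S v w) = (\<lambda>v. - sform S w v)"
  proof (rule linear_eq_t[OF tensor_form_props(2) linear_compose_neg[OF tensor_form_props(1)]])
    fix x y
    show "sform S (t x y) w = - sform S w (t x y)" using fun_cong[OF 1, of x y w] .
  qed
  then show ?thesis by (rule fun_cong)
qed

lemma half_dim_pos: "half_dim S > 0"
proof (rule ccontr)
  assume "\<not> half_dim S > 0"
  then have "span ({} :: 'w set) = UNIV" using frame_S by (simp add: symplectic_frame_def)
  then have w0: "w = 0" for w :: 'w by auto
  obtain x :: 'a where "x \<noteq> 0" by (rule V1.ex_nonzero)
  then obtain x' where x': "form V1 x x' = 1" by (rule V1.ex_form_1)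
  obtain y :: 'b where "y \<noteq> 0" by (rule V2.ex_nonzero)
  then obtain y' where y': "form V2 y y' = 1" using V2.ex_form_1 by (metis opp_sel(2))
  have "val x y x' y' = sform S (t x y) (t x' y')" by (simp add: tensor_form_props)
  also have "\<dots> = sform S 0 (t x' y')" by (simp only: w0[of "t x y"])
  also have "\<dots> = 0" by (rule linear_0[OF tensor_form_props(2)])
  finally show False using kappa_trd_1[where 'a = 'd] x' y' by (simp add: val_def)
qed

sublocale symplectic S
proof
  show "bilinear_form (sform S)" using tensor_form_props(1,2) by (simp add: bilinear_form_def)
  show "sform S x y = - sform S y x" for x y by (rule form_alt)
qed (rule frame_S, rule half_dim_pos)

text \<open>The universal property is given for real-valued maps; applied to the coordinates in the symplectic frame it yields
  maps into the tensor product itself.\<close>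

lemma lift_W:
  fixes f :: "'a \<Rightarrow> 'b \<Rightarrow> 'w"
  assumes f: "balanced V1 V2 f"
  obtains h where "linear h" "\<And>x y. h (t x y) = f x y"
proof -
  have f': "f (x + x') y = f x y + f x' y" "f x (y + y') = f x y + f x y'"
    "f (act V1 d x) y = f x (act V2 d y)" "f (act V1 (of_real r) x) y = r *\<^sub>R f x y" for x x' y y' d r
    using f unfolding balanced_def by blast+
  have b: "balanced V1 V2 (\<lambda>x y. om (f x y) z)" for z
    unfolding balanced_def
  proof (intro conjI allI)
    show "om (f (act V1 (of_real r) x) y) z = r *\<^sub>R om (f x y) z" for r x y
      by (simp only: f'(4) omb) simp
  qed (simp_all only: f'(1-3) omb)
  have "\<forall>z. \<exists>L. linear L \<and> (\<forall>x y. L (t x y) = om (f x y) z)" using lift[OF b] by blast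
  then obtain L where L: "\<And>z. linear (L z)" "\<And>z x y. L z (t x y) = om (f x y) z" by metis
  let ?h = "\<lambda>w. (\<Sum>j<half_dim S. L (ff j) w *\<^sub>R ee j) - (\<Sum>j<half_dim S. L (ee j) w *\<^sub>R ff j)"
  show thesis
  proof (rule that)
    show "linear ?h"
      by (rule linearI) (simp_all add: linear_add[OF L(1)] linear_scale[OF L(1)] algebra_simps sum.distrib scaleR_sum_right)
    show "?h (t x y) = f x y" for x y unfolding L(2) by (rule expand[symmetric])
  qed
qed

lemma emb_the:
  fixes f :: "'a \<Rightarrow> 'b \<Rightarrow> 'w"
  assumes "balanced V1 V2 f"
  shows "linear (THE h. linear h \<and> (\<forall>x y. h (t x y) = f x y))"
    "(THE h. linear h \<and> (\<forall>x y. h (t x y) = f x y)) (t x y) = f x y"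
proof -
  let ?P = "\<lambda>h. linear h \<and> (\<forall>x y. h (t x y) = f x y)"
  obtain h where h: "?P h" using lift_W[OF assms] by metis
  have "?P (THE h. ?P h)"
    by (rule theI[of ?P, OF h]) (use h in \<open>auto intro: linear_eq_t\<close>)
  then show "linear (THE h. linear h \<and> (\<forall>x y. h (t x y) = f x y))"
    "(THE h. linear h \<and> (\<forall>x y. h (t x y) = f x y)) (t x y) = f x y" by auto
qed

lemma emb1_props:
  assumes "g \<in> Upm V1"
  shows "linear (emb1 t g)" "emb1 t g (t x y) = t (inv_into UNIV g x) y"
proof -
  note s = V1.similitudeD[OF V1.Upm_sim(1)[OF V1.Upm_inv[OF assms]]]
  have "balanced V1 V2 (\<lambda>x y. t (inv_into UNIV g x) y)"
    by (simp add: balanced_def s t_add t_act t_real2)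
  then show "linear (emb1 t g)" "emb1 t g (t x y) = t (inv_into UNIV g x) y"
    unfolding emb1_def by (rule emb_the)+
qed

lemma V2_lin: "g \<in> Upm V2 \<Longrightarrow> g (act V2 d y) = act V2 d (g y)"
  using V2.similitudeD(3)[OF V2.Upm_sim(1), of g "tau d" y] by (simp add: opp_groups tau_tau)

lemma emb2_props:
  assumes g: "g \<in> Upm V2"
  shows "linear (emb2 t g)" "emb2 t g (t x y) = t x (g y)"
proof -
  have "g \<in> Upm (opp V2)" using g by (simp add: opp_groups)
  note s = V2.similitudeD[OF V2.Upm_sim(1)[OF this]]
  have "balanced V1 V2 (\<lambda>x y. t x (g y))"
    by (simp add: balanced_def s V2_lin[OF g] t_add t_act t_real2)
  then show "linear (emb2 t g)" "emb2 t g (t x y) = t x (g y)"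
    unfolding emb2_def by (rule emb_the)+
qed

lemma emb1_comp:
  assumes "g \<in> Upm V1" "g' \<in> Upm V1"
  shows "emb1 t (g \<circ> g') = emb1 t g' \<circ> emb1 t g"
proof (rule linear_eq_t)
  note c = V1.Upm_comp[OF assms]
  show "linear (emb1 t (g \<circ> g'))" by (rule emb1_props(1)[OF c])
  show "linear (emb1 t g' \<circ> emb1 t g)" by (rule linear_compose[OF emb1_props(1) emb1_props(1)]) (use assms in auto)
  have "inv_into UNIV (g \<circ> g') x = inv_into UNIV g' (inv_into UNIV g x)" for x
    using o_inv_distrib[OF V1.Upm_bij[OF assms(1)] V1.Upm_bij[OF assms(2)]] by simp
  then show "emb1 t (g \<circ> g') (t x y) = (emb1 t g' \<circ> emb1 t g) (t x y)" for x y
    by (simp add: emb1_props[OF c] emb1_props[OF assms(1)] emb1_props[OF assms(2)])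
qed

lemma emb2_comp:
  assumes "g \<in> Upm V2" "g' \<in> Upm V2"
  shows "emb2 t (g \<circ> g') = emb2 t g \<circ> emb2 t g'"
proof (rule linear_eq_t)
  have c: "g \<circ> g' \<in> Upm V2" using V2.Upm_comp assms by (simp add: opp_groups)
  show "linear (emb2 t (g \<circ> g'))" by (rule emb2_props(1)[OF c])
  show "linear (emb2 t g \<circ> emb2 t g')" by (rule linear_compose[OF emb2_props(1) emb2_props(1)]) (use assms in auto)
  show "emb2 t (g \<circ> g') (t x y) = (emb2 t g \<circ> emb2 t g') (t x y)" for x y
    by (simp add: emb2_props[OF c] emb2_props[OF assms(1)] emb2_props[OF assms(2)])
qed

lemma emb1_id: "emb1 t id = id"
  by (rule linear_eq_t) (auto simp: emb1_props[OF V1.U_Upm[OF V1.U_id]] linear_id inv_id)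

lemma id_Upm2: "id \<in> Upm V2"
  using V2.U_Upm[OF V2.U_id] by (simp add: opp_groups)

lemma emb2_id: "emb2 t id = id"
  by (rule linear_eq_t) (auto simp: emb2_props[OF id_Upm2] linear_id)

lemma emb_commute: "g \<in> Upm V1 \<Longrightarrow> g' \<in> Upm V2 \<Longrightarrow> emb1 t g \<circ> emb2 t g' = emb2 t g' \<circ> emb1 t g"
  by (rule linear_eq_t) (auto simp: emb1_props emb2_props intro: linear_compose)

lemma form_eq_t:
  assumes "linear f" and "\<And>x y x' y'. om (f (t x y)) (f (t x' y')) = l * om (t x y) (t x' y')"
  shows "om (f v) (f w) = l * om v w"
proof -
  have l1: "linear (\<lambda>w. om (f v) (f w))" for v using linear_compose[OF assms(1) lin_om(1)[of "f v"]] by (simp add: o_def)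
  have l2: "linear (\<lambda>v. om (f v) (f w))" for w using linear_compose[OF assms(1) lin_om(2)[of "f w"]] by (simp add: o_def)
  have r1: "linear (\<lambda>w. l * om v w)" for v using linear_compose_scale_right[OF lin_om(1)[of v], of l] by simp
  have r2: "linear (\<lambda>v. l * om v w)" for w using linear_compose_scale_right[OF lin_om(2)[of w], of l] by simp
  have 1: "(\<lambda>w. om (f (t x y)) (f w)) = (\<lambda>w. l * om (t x y) w)" for x y
    by (rule linear_eq_t[OF l1 r1]) (rule assms(2))
  have "(\<lambda>v. om (f v) (f w)) = (\<lambda>v. l * om v w)"
    by (rule linear_eq_t[OF l2 r2]) (use 1 in \<open>simp add: fun_eq_iff\<close>)
  then show ?thesis by (simp add: fun_eq_iff)
qed

lemma emb1_sim:
  assumes g: "g \<in> Upm V1"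
  shows "sim (sim_factor V1 g) (emb1 t g)"
proof -
  let ?g' = "inv_into UNIV g"
  have g': "?g' \<in> Upm V1" by (rule V1.Upm_inv[OF g])
  have gg: "g \<circ> ?g' = id" "?g' \<circ> g = id" using V1.Upm_inv_id[OF g] by (auto simp: fun_eq_iff)
  have b: "bij (emb1 t g)"
  proof (rule o_bij)
    show "emb1 t ?g' \<circ> emb1 t g = id" using emb1_comp[OF g g'] by (simp add: gg emb1_id)
    show "emb1 t g \<circ> emb1 t ?g' = id" using emb1_comp[OF g' g] by (simp add: gg emb1_id)
  qed
  have il: "inverse (sim_factor V1 g) = sim_factor V1 g" using V1.Upm_sim(2)[OF g] by auto
  have "similitude V1 (sim_factor V1 g) ?g'"
    using V1.similitude_inv[OF V1.Upm_sim(1)[OF g]] V1.Upm_sim(2)[OF g] il by auto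
  then have f: "form V1 (?g' x) (?g' x') = sim_factor V1 g *\<^sub>R form V1 x x'" for x x' by (rule V1.similitudeD(4))
  have "om (emb1 t g v) (emb1 t g w) = sim_factor V1 g * om v w" for v w
    by (rule form_eq_t[OF emb1_props(1)[OF g]])
      (simp add: emb1_props(2)[OF g] tensor_form_props val_def f trd_scaleR)
  then show ?thesis using b emb1_props(1)[OF g] by (simp add: sim_def)
qed

lemma emb2_sim:
  assumes g: "g \<in> Upm V2"
  shows "sim (sim_factor V2 g) (emb2 t g)"
proof -
  let ?g' = "inv_into UNIV g"
  have go: "g \<in> Upm (opp V2)" using g by (simp add: opp_groups)
  have g': "?g' \<in> Upm V2" using V2.Upm_inv[OF go] by (simp add: opp_groups)
  have gg: "g \<circ> ?g' = id" "?g' \<circ> g = id" using V2.Upm_inv_id[OF go] by (auto simp: fun_eq_iff)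
  have b: "bij (emb2 t g)"
  proof (rule o_bij)
    show "emb2 t ?g' \<circ> emb2 t g = id" using emb2_comp[OF g' g] by (simp add: gg emb2_id)
    show "emb2 t g \<circ> emb2 t ?g' = id" using emb2_comp[OF g g'] by (simp add: gg emb2_id)
  qed
  have f: "form V2 (g y) (g y') = sim_factor V2 g *\<^sub>R form V2 y y'" for y y'
    using V2.similitudeD(4)[OF V2.Upm_sim(1)[OF go]] by (simp add: opp_groups)
  have "om (emb2 t g v) (emb2 t g w) = sim_factor V2 g * om v w" for v w
    by (rule form_eq_t[OF emb2_props(1)[OF g]])
      (simp add: emb2_props(2)[OF g] tensor_form_props val_def f tau_scaleR trd_scaleR)
  then show ?thesis using b emb2_props(1)[OF g] by (simp add: sim_def)
qed

lemma emb1_Sppm: "g \<in> Upm V1 \<Longrightarrow> emb1 t g \<in> Sppm S" "g \<in> Upm V1 \<Longrightarrow> lam S (emb1 t g) = sim_factor V1 g"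
  using emb1_sim[of g] V1.Upm_sim(2)[of g] lam_eq by (auto simp: Sppm_iff)

lemma emb2_Sppm: "g \<in> Upm V2 \<Longrightarrow> emb2 t g \<in> Sppm S" "g \<in> Upm V2 \<Longrightarrow> lam S (emb2 t g) = sim_factor V2 g"
  using emb2_sim[of g] V2.Upm_sim(2)[of g] lam_eq by (auto simp: Sppm_iff opp_groups)

lemma commutes_with_iff:
  assumes "A \<subseteq> Upm V1" "B \<subseteq> Upm V2"
  shows "commutes_with (Sppm_hat S) (hat1 t A) (hat2 t B) \<longleftrightarrow> (\<forall>g\<in>A. \<forall>g'\<in>B. kap (emb1 t g) (emb2 t g') = 1)"
    "commutes_with (Sppm_hat S) (hat2 t B) (hat1 t A) \<longleftrightarrow> (\<forall>g\<in>A. \<forall>g'\<in>B. kap (emb1 t g) (emb2 t g') = 1)"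
proof -
  have *: "(rmult (emb1 t g) (emb2 t g'), z * z' * C_tilde S (emb1 t g) (emb2 t g'))
      = (rmult (emb2 t g') (emb1 t g), z' * z * C_tilde S (emb2 t g') (emb1 t g)) \<longleftrightarrow> kap (emb1 t g) (emb2 t g') = 1"
    if "g \<in> A" "g' \<in> B" "z \<in> circle" "z' \<in> circle" for g g' z z'
  proof -
    have "g \<in> Upm V1" "g' \<in> Upm V2" using assms that by auto
    note gg = this
    have "z \<noteq> 0" "z' \<noteq> 0" using that by (auto simp: circle_def)
    then show ?thesis
      using emb_commute[OF gg] C_tilde_commute_iff[OF emb1_Sppm(1)[OF gg(1)] emb2_Sppm(1)[OF gg(2)]]
      by (simp add: rmult_def mult.commute[of z])
  qed
  have one: "1 \<in> circle" by (simp add: circle_def)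
  show "commutes_with (Sppm_hat S) (hat1 t A) (hat2 t B) \<longleftrightarrow> (\<forall>g\<in>A. \<forall>g'\<in>B. kap (emb1 t g) (emb2 t g') = 1)"
    using * one unfolding commutes_with_def hat1_def hat2_def Sppm_hat_def by (auto simp del: prod.inject)
  then show "commutes_with (Sppm_hat S) (hat2 t B) (hat1 t A) \<longleftrightarrow> (\<forall>g\<in>A. \<forall>g'\<in>B. kap (emb1 t g) (emb2 t g') = 1)"
    by (simp only: commutes_with_swap[of _ "hat2 t B"])
qed

lemma kap_id: "f \<in> Sppm S \<Longrightarrow> kap f id = 1"
  using kap_mult[of f id id] kap_pow8[of f id] Sppm_id by auto

text \<open>A commutator that is multiplicative with values in the eighth roots of unity is trivial on a group
  generated by eighth powers.\<close>

lemma kap_trivial_hom: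
  fixes E :: "('x \<Rightarrow> 'x) \<Rightarrow> 'w \<Rightarrow> 'w"
  assumes f: "f \<in> Sppm S" and id: "E id = id"
    and S: "\<And>g. g \<in> G \<Longrightarrow> E g \<in> Sppm S" and cm: "\<And>g. g \<in> G \<Longrightarrow> f \<circ> E g = E g \<circ> f"
    and closed: "\<And>g g'. g \<in> G \<Longrightarrow> g' \<in> G \<Longrightarrow> g \<circ> g' \<in> G"
    and hom: "\<And>g g'. g \<in> G \<Longrightarrow> g' \<in> G \<Longrightarrow> E (g \<circ> g') = E g \<circ> E g' \<or> E (g \<circ> g') = E g' \<circ> E g"
    and gen: "\<And>P. P id \<Longrightarrow> (\<And>g g'. g \<in> G \<Longrightarrow> g' \<in> G \<Longrightarrow> P g \<Longrightarrow> P g' \<Longrightarrow> P (g \<circ> g')) \<Longrightarrow>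
       (\<And>g. g \<in> G \<Longrightarrow> P (((g \<circ> g) \<circ> (g \<circ> g)) \<circ> ((g \<circ> g) \<circ> (g \<circ> g)))) \<Longrightarrow> P g"
  shows "kap f (E g) = 1"
proof (rule gen[of "\<lambda>g. kap f (E g) = 1"])
  show "kap f (E id) = 1" using kap_id[OF f] by (simp add: id)
  have mult: "kap f (E (g \<circ> g')) = kap f (E g) * kap f (E g')" if "g \<in> G" "g' \<in> G" for g g'
    using kap_mult[OF f S[OF that(1)] S[OF that(2)] cm[OF that(1)] cm[OF that(2)]]
      kap_mult[OF f S[OF that(2)] S[OF that(1)] cm[OF that(2)] cm[OF that(1)]] hom[OF that] by (auto simp: mult.commute)
  show "kap f (E (g \<circ> g')) = 1" if "g \<in> G" "g' \<in> G" "kap f (E g) = 1" "kap f (E g') = 1" for g g'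
    using mult that by simp
  show "kap f (E (((g \<circ> g) \<circ> (g \<circ> g)) \<circ> ((g \<circ> g) \<circ> (g \<circ> g)))) = 1" if g: "g \<in> G" for g
  proof -
    have g2: "g \<circ> g \<in> G" "(g \<circ> g) \<circ> (g \<circ> g) \<in> G" using closed g by auto
    have "kap f (E (((g \<circ> g) \<circ> (g \<circ> g)) \<circ> ((g \<circ> g) \<circ> (g \<circ> g)))) = ((kap f (E g) ^ 2) ^ 2) ^ 2"
      by (simp only: mult[OF g2(2) g2(2)] mult[OF g2(1) g2(1)] mult[OF g g] power2_eq_square)
    also have "\<dots> = kap f (E g) ^ 8" by (simp flip: power_mult)
    finally show ?thesis using kap_pow8[OF f S[OF g]] by simp
  qed
qed

lemma kap_U1:
  assumes gen: "gen8 (U V1)" and g: "g \<in> U V1" and g': "g' \<in> Upm V2"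
  shows "kap (emb1 t g) (emb2 t g') = 1"
proof -
  have "kap (emb2 t g') (emb1 t g) = 1"
    by (rule kap_trivial_hom[where E = "emb1 t" and G = "U V1", OF emb2_Sppm(1)[OF g'] emb1_id])
      (auto simp: emb1_Sppm V1.U_Upm V1.U_comp emb_commute[OF _ g'] emb1_comp intro: gen8D[OF gen _ _ _ g])
  then show ?thesis by (simp add: kap_swap[of "emb1 t g"])
qed

lemma kap_U2:
  assumes gen: "gen8 (U V2)" and g: "g \<in> Upm V1" and g': "g' \<in> U V2"
  shows "kap (emb1 t g) (emb2 t g') = 1"
proof -
  have U2: "f \<in> Upm V2" if "f \<in> U V2" for f using V2.U_Upm[of f] that by (simp add: opp_groups)
  have c2: "f \<circ> f' \<in> U V2" if "f \<in> U V2" "f' \<in> U V2" for f f' using V2.U_comp[of f f'] that by (simp add: opp_groups)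
  show ?thesis
    by (rule kap_trivial_hom[where E = "emb2 t" and G = "U V2", OF emb1_Sppm(1)[OF g] emb2_id])
      (auto simp: emb2_Sppm U2 c2 emb_commute[OF g] emb2_comp intro: gen8D[OF gen _ _ _ g'])
qed

lemma kap_mult1:
  assumes "g \<in> Upm V1" "g1 \<in> Upm V1" "f \<in> Upm V2"
  shows "kap (emb1 t (g \<circ> g1)) (emb2 t f) = kap (emb1 t g) (emb2 t f) * kap (emb1 t g1) (emb2 t f)"
proof -
  have "kap (emb2 t f) (emb1 t (g \<circ> g1)) = kap (emb2 t f) (emb1 t g) * kap (emb2 t f) (emb1 t g1)"
    unfolding emb1_comp[OF assms(1,2)]
    by (rule kap_mult) (use assms emb1_Sppm emb2_Sppm emb_commute in auto)
  then show ?thesis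
    by (simp add: kap_swap[of "emb1 t _" "emb2 t f"])
qed

lemma kap_mult2:
  assumes "g \<in> Upm V1" "f \<in> Upm V2" "f1 \<in> Upm V2"
  shows "kap (emb1 t g) (emb2 t (f \<circ> f1)) = kap (emb1 t g) (emb2 t f) * kap (emb1 t g) (emb2 t f1)"
  unfolding emb2_comp[OF assms(2,3)]
  by (subst kap_mult) (use assms emb1_Sppm emb2_Sppm emb_commute in \<open>auto simp: mult.commute\<close>)

text \<open>When both isometry groups are generated by eighth powers, one pair of anti-isometries decides.\<close>

lemma kap_trivial:
  assumes gen: "gen8 (U V1)" "gen8 (U V2)" and g: "g \<in> Upm V1" and g': "g' \<in> Upm V2"
    and anti: "sim_factor V1 g = -1 \<Longrightarrow> sim_factor V2 g' = -1 \<Longrightarrow>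
      \<exists>s\<in>Upm V1. \<exists>s'\<in>Upm V2. sim_factor V1 s = -1 \<and> sim_factor V2 s' = -1 \<and> kap (emb1 t s) (emb2 t s') = 1"
  shows "kap (emb1 t g) (emb2 t g') = 1"
proof -
  have go: "g' \<in> Upm (opp V2)" using g' by (simp add: opp_groups)
  consider "sim_factor V1 g = 1" | "sim_factor V2 g' = 1" | "sim_factor V1 g = -1" "sim_factor V2 g' = -1"
    using V1.Upm_sim(2)[OF g] V2.Upm_sim(2)[OF go] by (auto simp: opp_groups)
  then show ?thesis
  proof cases
    case 1
    then have "g \<in> U V1" using V1.sim_factor_U[OF g] by simp
    then show ?thesis by (rule kap_U1[OF gen(1) _ g'])
  next
    case 2
    then have "g' \<in> U V2" using V2.sim_factor_U[OF go] by (simp add: opp_groups)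
    then show ?thesis by (rule kap_U2[OF gen(2) g])
  next
    case 3
    then obtain s s' where s: "s \<in> Upm V1" "s' \<in> Upm V2" "sim_factor V1 s = -1" "sim_factor V2 s' = -1"
      "kap (emb1 t s) (emb2 t s') = 1" using anti by blast
    have so: "s' \<in> Upm (opp V2)" using s by (simp add: opp_groups)
    let ?u = "inv_into UNIV s \<circ> g" and ?u' = "inv_into UNIV s' \<circ> g'"
    have u: "?u \<in> Upm V1" "?u' \<in> Upm (opp V2)" using V1.Upm_comp V1.Upm_inv V2.Upm_comp V2.Upm_inv s g so go by auto
    have su: "s \<circ> ?u = g" "s' \<circ> ?u' = g'" using V1.Upm_inv_id[OF s(1)] V2.Upm_inv_id[OF so] by (auto simp: fun_eq_iff)
    have "sim_factor V1 ?u = 1" using V1.sim_factor_comp[OF s(1) u(1)] 3 s by (simp add: su)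
    then have uU: "?u \<in> U V1" using V1.sim_factor_U[OF u(1)] by simp
    have "sim_factor V2 ?u' = 1" using V2.sim_factor_comp[OF so u(2)] 3 s by (simp add: su opp_groups)
    then have uU': "?u' \<in> U V2" using V2.sim_factor_U[OF u(2)] by (simp add: opp_groups)
    have u2: "?u' \<in> Upm V2" using u(2) by (simp add: opp_groups)
    have "kap (emb1 t g) (emb2 t g') = kap (emb1 t s) (emb2 t g') * kap (emb1 t ?u) (emb2 t g')"
      using kap_mult1[OF s(1) u(1) g'] by (simp add: su)
    also have "\<dots> = kap (emb1 t s) (emb2 t g')" using kap_U1[OF gen(1) uU g'] by simp
    also have "\<dots> = kap (emb1 t s) (emb2 t s') * kap (emb1 t s) (emb2 t ?u')"
      using kap_mult2[OF s(1,2) u2] by (simp add: su)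
    also have "\<dots> = 1" using s kap_U2[OF gen(2) s(1) uU'] by simp
    finally show ?thesis .
  qed
qed

text \<open>The tensor products with the identity of an involution and of a complex structure are again such; the
  determinant of a complex structure on the fixed Lagrangian of the involution is positive.\<close>

lemma kap_structure_2:
  assumes s: "s \<in> Upm V1" "sim_factor V1 s = -1" "s \<circ> s = id" and j: "j \<in> Upm V2" "j \<circ> j = uminus"
  shows "kap (emb1 t s) (emb2 t j) = 1"
proof (rule kap_involution_complex_structure)
  show "emb1 t s \<in> Sppm S" "lam S (emb1 t s) = -1" using emb1_Sppm[OF s(1)] s(2) by auto
  show "emb1 t s \<circ> emb1 t s = id" using emb1_comp[OF s(1,1)] by (simp add: s emb1_id)
  show "emb2 t j \<in> Sppm S" by (rule emb2_Sppm(1)[OF j(1)])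
  show "emb1 t s \<circ> emb2 t j = emb2 t j \<circ> emb1 t s" by (rule emb_commute[OF s(1) j(1)])
  have jj: "j (j y) = - y" for y using j(2) by (metis comp_apply)
  show "emb2 t j \<circ> emb2 t j = uminus"
    by (rule linear_eq_t)
      (auto simp: emb2_props[OF j(1)] jj t_minus intro: linear_compose linear_uminus)
qed

lemma kap_structure_1:
  assumes j: "j \<in> Upm V1" "j \<circ> j = uminus" and s: "s \<in> Upm V2" "sim_factor V2 s = -1" "s \<circ> s = id"
  shows "kap (emb1 t j) (emb2 t s) = 1"
proof -
  have "kap (emb2 t s) (emb1 t j) = 1"
  proof (rule kap_involution_complex_structure)
    show "emb2 t s \<in> Sppm S" "lam S (emb2 t s) = -1" using emb2_Sppm[OF s(1)] s(2) by auto
    show "emb2 t s \<circ> emb2 t s = id" using emb2_comp[OF s(1,1)] by (simp add: s emb2_id)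
    show "emb1 t j \<in> Sppm S" by (rule emb1_Sppm(1)[OF j(1)])
    show "emb2 t s \<circ> emb1 t j = emb1 t j \<circ> emb2 t s" by (rule emb_commute[OF j(1) s(1), symmetric])
    have jj: "j (j x) = - x" for x using j(2) by (metis comp_apply)
    have ij: "inv_into UNIV j x = - j x" for x
      using V1.Upm_inv_id(1)[OF j(1), of "- j x"] V1.similitudeD(6)[OF V1.Upm_sim(1)[OF j(1)]] by (simp add: jj)
    show "emb1 t j \<circ> emb1 t j = uminus"
      by (rule linear_eq_t)
        (auto simp: emb1_props[OF j(1)] linear_neg[OF emb1_props(1)[OF j(1)]] ij jj t_minus
            V1.similitudeD(6)[OF V1.Upm_sim(1)[OF j(1)]] intro: linear_compose linear_uminus)
  qed
  then show ?thesis by (simp add: kap_swap[of "emb1 t j"])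
qed

lemma emb2_inj:
  assumes "g \<in> Upm V2" "g' \<in> Upm V2" "emb2 t g = emb2 t g'"
  shows "g = g'"
proof
  fix y
  show "g y = g' y"
  proof (rule ccontr)
    assume n: "g y \<noteq> g' y"
    let ?z = "g y - g' y"
    have "t x (g y) = t x (g' y)" for x
      using emb2_props(2)[OF assms(1), of x y] emb2_props(2)[OF assms(2), of x y] assms(3) by simp
    then have tz: "t x ?z = 0" for x using t_add(2)[of x "?z" "g' y"] by simp
    obtain x :: 'a where "x \<noteq> 0" by (rule V1.ex_nonzero)
    then obtain x' where x': "form V1 x x' = 1" by (rule V1.ex_form_1)
    obtain y' where y': "form V2 ?z y' = 1" using V2.ex_form_1[of ?z] n by (metis eq_iff_diff_eq_0 opp_sel(2))
    have "val x ?z x' y' = om (t x ?z) (t x' y')" by (simp add: tensor_form_props)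
    then have "val x ?z x' y' = 0" by (simp add: tz omb)
    then show False using kappa_trd_1[where 'a = 'd] x' y' by (simp add: val_def)
  qed
qed

end

section \<open>Complex and quaternionic dual pairs\<close>

lemma (in rotating_hermitian) gen8_U: "gen8 (U V)"
  unfolding gen8_def
proof (intro allI impI)
  fix P :: "('v \<Rightarrow> 'v) \<Rightarrow> bool" and g
  assume a: "P id" "\<forall>g\<in>U V. \<forall>g'\<in>U V. P g \<longrightarrow> P g' \<longrightarrow> P (g \<circ> g')"
    "\<forall>g\<in>U V. P (((g \<circ> g) \<circ> (g \<circ> g)) \<circ> ((g \<circ> g) \<circ> (g \<circ> g)))" "g \<in> U V"
  show "P g"
  proof (rule U_eighth_powers[of P, OF a(1) _ _ a(4)])
    show "P (g \<circ> g')" if "g \<in> U V" "g' \<in> U V" "P g" "P g'" for g g' using a(2) that by blast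
    show "P (dbl (dbl (dbl g)))" if "g \<in> U V" for g unfolding dbl_def using a(3) that by blast
  qed
qed

text \<open>Over a commutative field multiplication by \<open>\<i>\<close> is an isometry that commutes with \<open>s\<close>.\<close>

lemma complex_anti_structure:
  fixes V :: "(complex, 'v::ab_group_add) form_space"
  assumes "hermitian V eps" and s: "similitude V (-1) s" "s \<circ> s = id"
  shows "\<exists>j. similitude V (-1) j \<and> j \<circ> j = uminus"
proof -
  interpret hermitian V eps by fact
  have ii: "ac \<i> (ac \<i> x) = - x" for x
    using ac_mult[of \<i> \<i> x] ac_minus(1)[of 1 x] by simp
  have "bij (ac \<i>)"
    by (rule o_bij[where g = "\<lambda>x. - ac \<i> x"]) (auto simp: fun_eq_iff ii ac_minus)
  moreover have "dlinear V (ac \<i>)"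
    by (simp add: dlinear_def ac_add ac_mult[symmetric] mult.commute)
  ultimately have "similitude V 1 (ac \<i>)"
    by (simp add: similitude_def h_ac tau_complex_def complex_eq_iff)
  then have "similitude V (-1) (ac \<i> \<circ> s)" using similitude_comp s(1) by fastforce
  moreover have "(ac \<i> \<circ> s) \<circ> (ac \<i> \<circ> s) = uminus"
  proof
    fix x
    have "s (s x) = x" using s(2) by (metis comp_apply id_apply)
    then show "((ac \<i> \<circ> s) \<circ> (ac \<i> \<circ> s)) x = - x" by (simp add: similitudeD(3)[OF s(1)] ii)
  qed
  ultimately show ?thesis by blast
qed

text \<open>A pure quaternion anticommutes with every pure unit orthogonal to it.\<close>

lemma quat_anticommuting_unit:
  fixes q :: quat
  assumes "tau q = - q"
  shows "\<exists>j. j * j = -1 \<and> tau j * q * j = - q"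
proof -
  obtain a b c where q: "q = Quat 0 a b c"
    using assms by (cases q) (auto simp: tau_quat_def uminus_quat_def)
  have "\<exists>u v. u * u + v * v = 1 \<and> a * u + b * v = (0::real)"
  proof (cases "a = 0 \<and> b = 0")
    case False
    define n where "n = sqrt (a * a + b * b)"
    have "a * a + b * b > 0" using False by (simp add: sum_squares_gt_zero_iff)
    then have n: "n > 0" "n * n = a * a + b * b" unfolding n_def by auto
    have "(- b / n) * (- b / n) + (a / n) * (a / n) = (a * a + b * b) / (n * n)"
      by (simp add: add_divide_distrib)
    also have "\<dots> = 1" using n(1) by (simp only: n(2)[symmetric]) simp
    finally have "(- b / n) * (- b / n) + (a / n) * (a / n) = 1" .
    moreover have "a * (- b / n) + b * (a / n) = 0" by simp
    ultimately show ?thesis by blast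
  qed (auto intro: exI[of _ 1])
  then obtain u v where uv: "u * u + v * v = 1" "a * u + b * v = 0" by blast
  let ?j = "Quat 0 u v 0"
  have "u * a + v * b = 0" using uv(2) by (simp add: mult.commute)
  then have anti: "q * ?j = - (?j * q)"
    using uv(2) by (simp add: q times_quat_def uminus_quat_def mult.commute)
  have j2: "?j * ?j = -1" using uv(1) by (simp add: times_quat_def one_quat_def uminus_quat_def)
  have "tau ?j * q * ?j = (- ?j) * (q * ?j)"
    by (simp add: tau_quat_def uminus_quat_def mult.assoc)
  also have "\<dots> = (?j * ?j) * q" by (simp add: anti mult.assoc)
  finally show ?thesis using j2 by auto
qed

lemma quat_involutions:
  fixes V :: "(quat, 'v::ab_group_add) form_space"
  assumes "rotating_hermitian V eps" and g: "similitude V (-1) g"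
  shows "eps = 1 \<Longrightarrow> \<exists>s. similitude V (-1) s \<and> s \<circ> s = id"
    "eps = -1 \<Longrightarrow> \<exists>j. similitude V (-1) j \<and> j \<circ> j = uminus"
proof -
  interpret rotating_hermitian V eps by fact
  have e: "eps = 1 \<or> (\<exists>d::quat. tau d \<noteq> d)" using ex_tau_neq by blast
  show "\<exists>s. similitude V (-1) s \<and> s \<circ> s = id" if "eps = 1"
  proof -
    have cen: "h v v * d = d * h v v" for v d
    proof -
      have "tau (h v v) = h v v" using tau_h[of v v] that by simp
      then have "h v v = Quat (qre (h v v)) 0 0 0"
        by (cases "h v v") (simp add: tau_quat_def)
      then obtain r where r: "h v v = Quat r 0 0 0" by blast
      show ?thesis unfolding r by (simp add: times_quat_def mult.commute)
    qed
    show ?thesis using anti_involution[OF e cen g] by metis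
  qed
  show "\<exists>j. similitude V (-1) j \<and> j \<circ> j = uminus" if "eps = -1"
  proof -
    have "\<exists>j. j * j = -1 \<and> tau j * q * j = - q" if "tau q = eps *\<^sub>R q" for q :: quat
      using quat_anticommuting_unit[of q] that \<open>eps = -1\<close> by simp
    then show ?thesis using anti_complex_structure[OF e] by metis
  qed
qed

context
  fixes eps1 eps2 :: real
    and V1 :: "('d::rotating_involution, 'a::ab_group_add) form_space"
    and V2 :: "('d, 'b::ab_group_add) form_space"
    and t :: "'a \<Rightarrow> 'b \<Rightarrow> 'w::real_vector"
    and S :: "'w symplectic_datum"
  assumes TD: "tensor_datum eps1 eps2 V1 V2 t S"
begin

interpretation T: tensor_datum eps1 eps2 V1 V2 t S by (rule TD)
interpretation R1: rotating_hermitian V1 eps1 by unfold_locales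
interpretation R2: rotating_hermitian "opp V2" eps2 by unfold_locales

lemma rotating_commutes:
  assumes anti: "\<And>g g'. similitude V1 (-1) g \<Longrightarrow> similitude (opp V2) (-1) g' \<Longrightarrow>
     (\<exists>s. similitude V1 (-1) s \<and> s \<circ> s = id) \<and> (\<exists>j. similitude (opp V2) (-1) j \<and> j \<circ> j = uminus) \<or>
     (\<exists>j. similitude V1 (-1) j \<and> j \<circ> j = uminus) \<and> (\<exists>s. similitude (opp V2) (-1) s \<and> s \<circ> s = id)"
  shows "commutes_with (Sppm_hat S) (hat1 t (Upm V1)) (hat2 t (Upm V2))"
proof -
  have "T.kap (emb1 t g) (emb2 t g') = 1" if g: "g \<in> Upm V1" and g': "g' \<in> Upm V2" for g g'
  proof (rule T.kap_trivial[OF R1.gen8_U _ g g'])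
    show "gen8 (U V2)" using R2.gen8_U by (simp add: opp_groups)
    assume "sim_factor V1 g = -1" "sim_factor V2 g' = -1"
    then have sim: "similitude V1 (-1) g" "similitude (opp V2) (-1) g'"
      using T.V1.Upm_sim(1)[OF g] T.V2.Upm_sim(1)[of g'] g' by (auto simp: opp_groups)
    have 1: "s \<in> Upm V1" "sim_factor V1 s = -1" if "similitude V1 (-1) s" for s
      using that T.V1.Upm_iff T.V1.sim_factor_eq by auto
    have 2: "s \<in> Upm V2" "sim_factor V2 s = -1" if "similitude (opp V2) (-1) s" for s
      using that T.V2.Upm_iff T.V2.sim_factor_eq by (auto simp: opp_groups)
    from anti[OF sim] show "\<exists>s\<in>Upm V1. \<exists>s'\<in>Upm V2. sim_factor V1 s = -1 \<and> sim_factor V2 s' = -1 \<and>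
        T.kap (emb1 t s) (emb2 t s') = 1"
    proof (elim disjE conjE exE)
      fix s j assume "similitude V1 (-1) s" "s \<circ> s = id" "similitude (opp V2) (-1) j" "j \<circ> j = uminus"
      then show ?thesis using T.kap_structure_2[of s j] 1[of s] 2[of j] by blast
    next
      fix s j assume "similitude V1 (-1) j" "j \<circ> j = uminus" "similitude (opp V2) (-1) s" "s \<circ> s = id"
      then show ?thesis using T.kap_structure_1[of j s] 1[of j] 2[of s] by blast
    qed
  qed
  then show ?thesis using T.commutes_with_iff(1)[OF subset_refl subset_refl] by blast
qed

end

theorem complex_pair_commutes:
  fixes V1 :: "(complex, 'a::ab_group_add) form_space"
  assumes TD: "tensor_datum eps1 eps2 V1 V2 t S"
  shows "commutes_with (Sppm_hat S) (hat1 t (Upm V1)) (hat2 t (Upm V2))"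
proof (rule rotating_commutes[OF TD], rule disjI1)
  interpret T: tensor_datum eps1 eps2 V1 V2 t S by (rule TD)
  interpret R1: rotating_hermitian V1 eps1 by unfold_locales
  interpret R2: rotating_hermitian "opp V2" eps2 by unfold_locales
  fix g g' assume g: "similitude V1 (-1) g" "similitude (opp V2) (-1) g'"
  have 1: "\<exists>s. similitude V1 (-1) s \<and> s \<circ> s = id"
    using T.V1.anti_involution[OF disjI2[OF R1.ex_tau_neq] mult.commute g(1)] by metis
  have "\<exists>s. similitude (opp V2) (-1) s \<and> s \<circ> s = id"
    using T.V2.anti_involution[OF disjI2[OF R2.ex_tau_neq] mult.commute g(2)] by metis
  then show "(\<exists>s. similitude V1 (-1) s \<and> s \<circ> s = id) \<and> (\<exists>j. similitude (opp V2) (-1) j \<and> j \<circ> j = uminus)"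
    using 1 complex_anti_structure[OF T.V2.hermitian_axioms] by blast
qed

theorem quaternionic_pair_commutes:
  fixes V1 :: "(quat, 'a::ab_group_add) form_space"
  assumes TD: "tensor_datum eps1 eps2 V1 V2 t S"
  shows "commutes_with (Sppm_hat S) (hat1 t (Upm V1)) (hat2 t (Upm V2))"
proof (rule rotating_commutes[OF TD])
  interpret T: tensor_datum eps1 eps2 V1 V2 t S by (rule TD)
  interpret R1: rotating_hermitian V1 eps1 by unfold_locales
  interpret R2: rotating_hermitian "opp V2" eps2 by unfold_locales
  fix g g' assume g: "similitude V1 (-1) g" "similitude (opp V2) (-1) g'"
  note q = quat_involutions[OF R1.rotating_hermitian_axioms g(1)]
    quat_involutions[OF R2.rotating_hermitian_axioms g(2)]
  consider "eps1 = 1" "eps2 = -1" | "eps1 = -1" "eps2 = 1"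
    using T.V1.eps T.V2.eps T.eps12 by auto
  then show "(\<exists>s. similitude V1 (-1) s \<and> s \<circ> s = id) \<and> (\<exists>j. similitude (opp V2) (-1) j \<and> j \<circ> j = uminus) \<or>
     (\<exists>j. similitude V1 (-1) j \<and> j \<circ> j = uminus) \<and> (\<exists>s. similitude (opp V2) (-1) s \<and> s \<circ> s = id)"
    by cases (use q in simp_all)
qed

section \<open>Real spaces with a form\<close>

locale real_hermitian = hermitian V eps
  for V :: "(real, 'v::ab_group_add) form_space" and eps
begin

sublocale vs: vector_space ac
  using real_space by simp

lemma dspan_eq: "dspan V B = vs.span B"
proof -
  have "dsubspace V T \<longleftrightarrow> vs.subspace T" for T
    unfolding dsubspace_def vs.subspace_def by blast
  then have "dsubspace V = vs.subspace" by blast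
  then show ?thesis by (simp add: dspan_def vs.span_def)
qed

lemma dbasis_iff: "dbasis V B \<longleftrightarrow> vs.independent B \<and> vs.span B = UNIV"
  unfolding dbasis_def dspan_eq vs.dependent_def by blast

lemma ddim_eq_card:
  assumes B: "dbasis V B"
  shows "ddim V = card B"
proof -
  have *: "vs.dim UNIV = card B" if "dbasis V B" for B
    using that vs.dim_eq_card[of B UNIV] by (simp add: dbasis_iff)
  have "dbasis V (SOME B. dbasis V B)" using B by (rule someI)
  then show ?thesis unfolding ddim_def using *[of "SOME B. dbasis V B"] *[OF B] by simp
qed

definition ibasis :: "nat \<Rightarrow> (nat \<Rightarrow> 'v) \<Rightarrow> bool" where
  "ibasis n b \<longleftrightarrow> inj_on b {..<n} \<and> dbasis V (b ` {..<n})"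

lemma ibasis_dim: "ibasis n b \<Longrightarrow> ddim V = n"
  using ddim_eq_card[of "b ` {..<n}"] by (simp add: ibasis_def card_image)

lemma ibasis_indep:
  assumes b: "ibasis n b" and z: "(\<Sum>i<n. ac (c i) (b i)) = 0" and i: "i < n"
  shows "c i = 0"
proof -
  let ?u = "\<lambda>v. c (the_inv_into {..<n} b v)"
  have inj: "inj_on b {..<n}" and ind: "vs.independent (b ` {..<n})" using b by (auto simp: ibasis_def dbasis_iff)
  have "(\<Sum>v\<in>b ` {..<n}. ac (?u v) v) = (\<Sum>i<n. ac (?u (b i)) (b i))" by (simp add: sum.reindex[OF inj])
  also have "\<dots> = 0" using z by (simp add: the_inv_into_f_f[OF inj])
  finally have z': "(\<Sum>v\<in>b ` {..<n}. ac (?u v) v) = 0" .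
  have "?u (b i) = 0"
    by (rule vs.independentD[where s = "b ` {..<n}" and t = "b ` {..<n}" and u = ?u and v = "b i", OF ind _ _ z'])
      (use i in auto)
  then show ?thesis using i by (simp add: the_inv_into_f_f[OF inj])
qed

lemma ibasis_unique:
  assumes b: "ibasis n b" and e: "(\<Sum>i<n. ac (c i) (b i)) = (\<Sum>i<n. ac (c' i) (b i))" and i: "i < n"
  shows "c i = c' i"
proof -
  have "(\<Sum>i<n. ac (c i - c' i) (b i)) = 0" using e by (simp add: ac_diff sum_subtractf)
  from ibasis_indep[OF b this i] show ?thesis by simp
qed

lemma ibasis_coord:
  assumes b: "ibasis n b"
  obtains c where "x = (\<Sum>i<n. ac (c i) (b i))"
proof -
  have inj: "inj_on b {..<n}" and sp: "vs.span (b ` {..<n}) = UNIV" using b by (auto simp: ibasis_def dbasis_iff)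
  have "x \<in> vs.span (b ` {..<n})" by (simp add: sp)
  then obtain u where "x = (\<Sum>v\<in>b ` {..<n}. ac (u v) v)" by (auto simp: vs.span_finite)
  then have "x = (\<Sum>i<n. ac (u (b i)) (b i))" by (simp add: sum.reindex[OF inj])
  then show thesis by (rule that)
qed

lemma ibasis_coords:
  assumes b: "ibasis n b"
  obtains a :: "nat \<Rightarrow> nat \<Rightarrow> real" where "\<And>j. c j = (\<Sum>i<n. ac (a i j) (b i))"
proof -
  have "\<forall>j. \<exists>u. c j = (\<Sum>i<n. ac (u i) (b i))" using ibasis_coord[OF b] by metis
  then obtain u where "\<And>j. c j = (\<Sum>i<n. ac (u j i) (b i))" by metis
  then show thesis by (rule that[of "\<lambda>i j. u j i"])
qed

lemma ibasisI:
  assumes sp: "\<And>x. \<exists>c. x = (\<Sum>i<n. ac (c i) (b i))"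
    and ind: "\<And>c i. (\<Sum>i<n. ac (c i) (b i)) = 0 \<Longrightarrow> i < n \<Longrightarrow> c i = 0"
  shows "ibasis n b"
proof -
  have inj: "inj_on b {..<n}"
  proof (rule inj_onI, rule ccontr)
    fix i j assume ij: "i \<in> {..<n}" "j \<in> {..<n}" "b i = b j" "i \<noteq> j"
    let ?c = "\<lambda>l. (if l = i then 1 else 0) - (if l = j then 1 else (0::real))"
    have "(\<Sum>l<n. ac (?c l) (b l)) = (\<Sum>l<n. if l = i then b l else 0) - (\<Sum>l<n. if l = j then b l else 0)"
      unfolding sum_subtractf[symmetric] by (rule sum.cong) (auto simp: ac_diff)
    also have "\<dots> = 0" using ij by simp
    finally have "?c i = 0" using ij(1) by (intro ind) auto
    then show False using ij(4) by simp
  qed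
  have "vs.span (b ` {..<n}) = UNIV"
  proof (rule UNIV_eq_I[symmetric])
    fix x obtain c where x: "x = (\<Sum>i<n. ac (c i) (b i))" using sp by blast
    show "x \<in> vs.span (b ` {..<n})" unfolding x by (intro vs.span_sum vs.span_scale vs.span_base) auto
  qed
  moreover have "vs.independent (b ` {..<n})"
  proof (rule vs.independent_if_scalars_zero)
    fix u v assume z: "(\<Sum>x\<in>b ` {..<n}. ac (u x) x) = 0" and "v \<in> b ` {..<n}"
    then obtain i where i: "i < n" "v = b i" by auto
    have "(\<Sum>i<n. ac (u (b i)) (b i)) = 0" using z by (simp add: sum.reindex[OF inj])
    from ind[OF this i(1)] show "u v = 0" by (simp add: i)
  qed simp
  ultimately show ?thesis by (simp add: ibasis_def dbasis_iff inj)
qed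

lemma dlinear_sum:
  assumes "dlinear V g"
  shows "g (\<Sum>i\<in>A. ac (c i) (b i)) = (\<Sum>i\<in>A. ac (c i) (g (b i)))"
proof -
  have 0: "g 0 = 0" using assms unfolding dlinear_def by (metis ac_0(1))
  have a: "g (x + y) = g x + g y" "g (ac d x) = ac d (g x)" for x y d using assms by (auto simp: dlinear_def)
  show ?thesis by (induction A rule: infinite_finite_induct) (auto simp: 0 a)
qed

lemma sum_sum_ac: "(\<Sum>k<n. ac (c k) (\<Sum>i<n'. ac (a i k) (b i))) = (\<Sum>i<n'. ac (\<Sum>k<n. a i k * c k) (b i))"
proof -
  have "(\<Sum>k<n. ac (c k) (\<Sum>i<n'. ac (a i k) (b i))) = (\<Sum>k<n. \<Sum>i<n'. ac (a i k * c k) (b i))"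
    by (simp add: ac_sum mult.commute)
  also have "\<dots> = (\<Sum>i<n'. \<Sum>k<n. ac (a i k * c k) (b i))" by (rule sum.swap)
  also have "\<dots> = (\<Sum>i<n'. ac (\<Sum>k<n. a i k * c k) (b i))" by (simp add: vs.scale_sum_left)
  finally show ?thesis .
qed

lemma fdet_change_basis:
  assumes b: "ibasis n b" and b': "ibasis n b'" and g: "dlinear V g"
    and a: "\<And>j. j < n \<Longrightarrow> g (b j) = (\<Sum>i<n. ac (a i j) (b i))"
    and a': "\<And>j. j < n \<Longrightarrow> g (b' j) = (\<Sum>i<n. ac (a' i j) (b' i))"
  shows "fdet n a' = fdet n a"
proof -
  obtain p where p: "\<And>j. b' j = (\<Sum>i<n. ac (p i j) (b i))" by (rule ibasis_coords[OF b, where c = b']) blast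
  obtain q where q: "\<And>j. b j = (\<Sum>i<n. ac (q i j) (b' i))" by (rule ibasis_coords[OF b', where c = b]) blast
  have qp: "(\<Sum>k<n. p i k * q k j) = (if i = j then 1 else 0)" if "i < n" "j < n" for i j
  proof -
    have "(\<Sum>i<n. ac (\<Sum>k<n. p i k * q k j) (b i)) = (\<Sum>k<n. ac (q k j) (\<Sum>i<n. ac (p i k) (b i)))"
      by (rule sum_sum_ac[symmetric])
    also have "\<dots> = b j" by (simp only: p[symmetric] q[symmetric])
    also have "\<dots> = (\<Sum>i<n. if i = j then b i else 0)" using that by simp
    also have "\<dots> = (\<Sum>i<n. ac (if i = j then 1 else 0) (b i))" by (rule sum.cong) auto
    finally show ?thesis by (rule ibasis_unique[OF b _ that(1)])
  qed
  have "fdet n p * fdet n q = fdet n (\<lambda>i j. if i = j then 1 else 0)"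
    unfolding fdet_mult[symmetric] by (rule fdet_cong) (rule qp)
  then have pq1: "fdet n p * fdet n q = 1" by (simp add: fdet_delta)
  have "(\<Sum>k<n. a i k * p k j) = (\<Sum>k<n. p i k * a' k j)" if "i < n" "j < n" for i j
  proof -
    have "g (b' j) = (\<Sum>k<n. ac (p k j) (\<Sum>i<n. ac (a i k) (b i)))"
      unfolding p[of j] dlinear_sum[OF g] by (rule sum.cong) (auto simp: a)
    then have 1: "g (b' j) = (\<Sum>i<n. ac (\<Sum>k<n. a i k * p k j) (b i))" by (simp only: sum_sum_ac)
    have "g (b' j) = (\<Sum>k<n. ac (a' k j) (b' k))" by (rule a'[OF that(2)])
    also have "\<dots> = (\<Sum>k<n. ac (a' k j) (\<Sum>i<n. ac (p i k) (b i)))" by (simp only: p[symmetric])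
    also have "\<dots> = (\<Sum>i<n. ac (\<Sum>k<n. p i k * a' k j) (b i))" by (rule sum_sum_ac)
    finally have 2: "g (b' j) = (\<Sum>i<n. ac (\<Sum>k<n. p i k * a' k j) (b i))" .
    show ?thesis by (rule ibasis_unique[OF b _ that(1)]) (simp only: 1[symmetric] 2[symmetric])
  qed
  then have "fdet n (\<lambda>i j. \<Sum>k<n. a i k * p k j) = fdet n (\<lambda>i j. \<Sum>k<n. p i k * a' k j)"
    by (intro fdet_cong)
  then have "fdet n a * fdet n p = fdet n p * fdet n a'" by (simp only: fdet_mult)
  moreover have "fdet n p \<noteq> 0" using pq1 by auto
  ultimately show ?thesis by simp
qed

text \<open>Matrices of the same map in two bases are conjugate, so the descriptive definition of the determinant is unambiguous.\<close>

lemma endo_det_eq: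
  assumes b: "ibasis n b" and g: "dlinear V g"
    and a: "\<And>j. j < n \<Longrightarrow> g (b j) = (\<Sum>i<n. ac (a i j) (b i))"
  shows "endo_det V g = fdet n a"
  unfolding endo_det_def
proof (rule the_equality)
  let ?A = "mat n n (\<lambda>(i, j). a i j)"
  have "g (b j) = (\<Sum>i<n. ac (?A $$ (i, j)) (b i))" if "j < n" for j
    unfolding a[OF that] by (rule sum.cong) (use that in auto)
  then show "\<exists>n' b A. inj_on b {..<n'} \<and> dbasis V (b ` {..<n'}) \<and> A \<in> carrier_mat n' n' \<and>
     (\<forall>j<n'. g (b j) = (\<Sum>i<n'. ac (A $$ (i, j)) (b i))) \<and> fdet n a = Determinant.det A"
    using b by (intro exI[of _ n] exI[of _ b] exI[of _ ?A]) (simp add: ibasis_def fdet_def)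
next
  fix d
  assume "\<exists>n b A. inj_on b {..<n} \<and> dbasis V (b ` {..<n}) \<and> A \<in> carrier_mat n n \<and>
     (\<forall>j<n. g (b j) = (\<Sum>i<n. ac (A $$ (i, j)) (b i))) \<and> d = Determinant.det A"
  then obtain n' b' A where A: "ibasis n' b'" "A \<in> carrier_mat n' n'"
    "\<And>j. j < n' \<Longrightarrow> g (b' j) = (\<Sum>i<n'. ac (A $$ (i, j)) (b' i))" "d = Determinant.det A"
    unfolding ibasis_def by blast
  have n: "n' = n" using ibasis_dim[OF b] ibasis_dim[OF A(1)] by simp
  have "mat n n (\<lambda>(i, j). A $$ (i, j)) = A" using A(2) n by (intro eq_matI) auto
  then have "d = fdet n (\<lambda>i j. A $$ (i, j))" using A(4) by (simp add: fdet_def)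
  also have "\<dots> = fdet n a" by (rule fdet_change_basis[OF b _ g a]) (use A n in auto)
  finally show "d = fdet n a" .
qed

lemma endo_det_comp:
  assumes b: "ibasis n b" and g: "dlinear V g" "dlinear V g'"
  shows "endo_det V (g \<circ> g') = endo_det V g * endo_det V g'"
proof -
  obtain a where a: "\<And>j. g (b j) = (\<Sum>i<n. ac (a i j) (b i))" by (rule ibasis_coords[OF b, where c = "\<lambda>j. g (b j)"]) blast
  obtain a' where a': "\<And>j. g' (b j) = (\<Sum>i<n. ac (a' i j) (b i))" by (rule ibasis_coords[OF b, where c = "\<lambda>j. g' (b j)"]) blast
  have gg: "dlinear V (g \<circ> g')" using g by (simp add: dlinear_def)
  have "(g \<circ> g') (b j) = (\<Sum>i<n. ac (\<Sum>k<n. a i k * a' k j) (b i))" for j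
    by (simp add: a' dlinear_sum[OF g(1)] a sum_sum_ac)
  then have "endo_det V (g \<circ> g') = fdet n (\<lambda>i j. \<Sum>k<n. a i k * a' k j)" by (intro endo_det_eq[OF b gg])
  then show ?thesis
    unfolding endo_det_eq[OF b g(1) a] endo_det_eq[OF b g(2) a'] by (simp add: fdet_mult)
qed

lemma endo_det_diagonal:
  assumes b: "ibasis n b" and g: "dlinear V g" and a: "\<And>j. j < n \<Longrightarrow> g (b j) = ac (a j) (b j)"
  shows "endo_det V g = (\<Prod>j<n. a j)"
proof -
  have "endo_det V g = fdet n (\<lambda>i j. if i = j then a j else 0)"
  proof (rule endo_det_eq[OF b g])
    fix j assume j: "j < n"
    have "(\<Sum>i<n. ac (if i = j then a j else 0) (b i)) = (\<Sum>i<n. if i = j then ac (a j) (b j) else 0)"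
      by (rule sum.cong) auto
    then show "g (b j) = (\<Sum>i<n. ac (if i = j then a j else 0) (b i))" using j by (simp add: a)
  qed
  then show ?thesis by (simp add: fdet_diag)
qed

lemma endo_det_id: "ibasis n b \<Longrightarrow> endo_det V id = 1"
  using endo_det_diagonal[of n b id "\<lambda>_. 1"] by (simp add: dlinear_def)

end

section \<open>Quadratic spaces\<close>

locale quadratic_space = real_hermitian V 1
  for V :: "(real, 'v::ab_group_add) form_space"
begin

lemma h_commute: "h y x = h x y"
  using h_sym[of y x] by (simp add: tau_real_def)

lemma h_scale: "h (ac a x) y = a * h x y" "h x (ac a y) = a * h x y"
  by (simp_all add: h_ac tau_real_def)

lemma orth_set_basis:
  assumes Q: "orth_set Q" "perp Q = {0}" and v: "bij_betw v {..<n} Q"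
  shows "ibasis n v" "i < n \<Longrightarrow> h (v i) (v i) \<noteq> 0" "i < n \<Longrightarrow> j < n \<Longrightarrow> i \<noteq> j \<Longrightarrow> h (v i) (v j) = 0"
proof -
  have vQ: "v i \<in> Q" if "i < n" for i using v that by (auto simp: bij_betw_def)
  have vne: "v i \<noteq> v j" if "i < n" "j < n" "i \<noteq> j" for i j using v that by (auto simp: bij_betw_def inj_on_def)
  show n: "h (v i) (v i) \<noteq> 0" if "i < n" for i using Q(1) vQ[OF that] by (auto simp: orth_set_def)
  show o: "h (v i) (v j) = 0" if "i < n" "j < n" "i \<noteq> j" for i j
    using Q(1) vQ that vne by (auto simp: orth_set_def)
  show "ibasis n v"
  proof (rule ibasisI)
    fix x
    have "x = (\<Sum>i<n. ac (inverse (h (v i) (v i)) * h (v i) x) (v i))"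
      using orth_expand_full[OF Q, of x] sum.reindex_bij_betw[OF v, of "\<lambda>v. ac (inverse (h v v) * h v x) v"] by simp
    then show "\<exists>c. x = (\<Sum>i<n. ac (c i) (v i))"
      by (rule exI[of _ "\<lambda>i. inverse (h (v i) (v i)) * h (v i) x"])
  next
    fix c i assume z: "(\<Sum>i<n. ac (c i) (v i)) = 0" and i: "i < n"
    have "h (v i) (\<Sum>j<n. ac (c j) (v j)) = (\<Sum>j<n. if j = i then c i * h (v i) (v i) else 0)"
      unfolding h_sum by (rule sum.cong) (use o i in \<open>auto simp: h_scale\<close>)
    then show "c i = 0" using i n by (simp add: z)
  qed
qed

lemma orthogonal_basis_exists:
  obtains n v where "ibasis n v" "\<And>i. i < n \<Longrightarrow> h (v i) (v i) \<noteq> 0"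
    "\<And>i j. i < n \<Longrightarrow> j < n \<Longrightarrow> i \<noteq> j \<Longrightarrow> h (v i) (v j) = 0"
proof -
  obtain Q where Q: "orth_set Q" "perp Q = {0}" by (rule full_orth_set_exists) auto
  then have "finite Q" by (simp add: orth_set_def)
  then obtain v where v: "bij_betw v {..<card Q} Q" using ex_bij_betw_nat_finite[of Q] by (auto simp: atLeast0LessThan)
  show thesis by (rule that[OF orth_set_basis[OF Q v]])
qed

text \<open>Take determinants in \<open>l G = A\<^sup>T G A\<close>, where \<open>G\<close> is the Gram matrix of an orthogonal basis.\<close>

lemma endo_det_similitude:
  assumes g: "similitude V l g"
  shows "endo_det V g * endo_det V g = l ^ ddim V"
proof -
  obtain n v where v: "ibasis n v" "\<And>i. i < n \<Longrightarrow> h (v i) (v i) \<noteq> 0"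
    "\<And>i j. i < n \<Longrightarrow> j < n \<Longrightarrow> i \<noteq> j \<Longrightarrow> h (v i) (v j) = 0" by (rule orthogonal_basis_exists) blast
  have dl: "dlinear V g" using g by (simp add: similitude_def)
  obtain a where a: "\<And>j. g (v j) = (\<Sum>i<n. ac (a i j) (v i))" by (rule ibasis_coords[OF v(1), where c = "\<lambda>j. g (v j)"]) blast
  have det: "endo_det V g = fdet n a" by (rule endo_det_eq[OF v(1) dl a])
  let ?G = "\<lambda>i j. h (v i) (v j)"
  have "l * ?G i j = (\<Sum>k<n. a k i * (\<Sum>k'<n. ?G k k' * a k' j))" for i j
  proof -
    have "l * ?G i j = h (g (v i)) (g (v j))" by (simp add: similitudeD(4)[OF g])
    also have "\<dots> = (\<Sum>k<n. a k i * h (v k) (\<Sum>k'<n. ac (a k' j) (v k')))"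
      by (simp only: a h_sum(1) h_scale(1))
    also have "\<dots> = (\<Sum>k<n. a k i * (\<Sum>k'<n. ?G k k' * a k' j))"
      unfolding h_sum(2) h_scale(2) by (intro sum.cong refl arg_cong2[where f = "(*)"] mult.commute)
    finally show ?thesis .
  qed
  then have "fdet n (\<lambda>i j. l * ?G i j) = fdet n (\<lambda>i j. \<Sum>k<n. a k i * (\<Sum>k'<n. ?G k k' * a k' j))" by simp
  also have "\<dots> = fdet n (\<lambda>i j. a j i) * (fdet n ?G * fdet n a)"
    unfolding fdet_mult[symmetric] ..
  finally have "l ^ n * fdet n ?G = fdet n a * (fdet n ?G * fdet n a)"
    unfolding fdet_scale[of n l ?G] fdet_transpose[of n a] .
  moreover have "fdet n ?G \<noteq> 0"
    using v(2) by (subst fdet_diag) (auto simp: v(3))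
  ultimately show ?thesis using ibasis_dim[OF v(1)] by (simp add: det)
qed

lemma endo_det_nonzero:
  assumes "g \<in> Upm V"
  shows "endo_det V g \<noteq> 0"
proof -
  obtain l where "similitude V l g" "l = 1 \<or> l = -1" using Upm_iff assms by blast
  then show ?thesis using endo_det_similitude[of l g] by auto
qed

lemma Upm_dlinear: "g \<in> Upm V \<Longrightarrow> dlinear V g"
  by (auto simp: Upm_iff similitude_def)

lemma endo_det_mult:
  assumes "g \<in> Upm V" "g' \<in> Upm V"
  shows "endo_det V (g \<circ> g') = endo_det V g * endo_det V g'"
proof -
  obtain n v where "ibasis n v" by (rule orthogonal_basis_exists) blast
  then show ?thesis by (rule endo_det_comp[OF _ Upm_dlinear Upm_dlinear]) (use assms in auto)
qed

lemma endo_det_1: "endo_det V id = 1"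
proof -
  obtain n v where "ibasis n v" by (rule orthogonal_basis_exists) blast
  then show ?thesis by (rule endo_det_id)
qed

text \<open>Taking determinants, an anti-isometry gives \<open>det\<^sup>2 = (-1)\<^sup>n\<close>.\<close>

lemma anti_isometry_even:
  assumes "similitude V (-1) g"
  shows "even (ddim V)"
proof (rule ccontr)
  assume "odd (ddim V)"
  then have "endo_det V g * endo_det V g = -1" using endo_det_similitude[OF assms] by simp
  then show False using zero_le_square[of "endo_det V g"] by simp
qed

lemma reflection_exists:
  obtains g where "g \<in> U V" "endo_det V g = -1"
proof -
  obtain n v where v: "ibasis n v" "\<And>i. i < n \<Longrightarrow> h (v i) (v i) \<noteq> 0"
    "\<And>i j. i < n \<Longrightarrow> j < n \<Longrightarrow> i \<noteq> j \<Longrightarrow> h (v i) (v j) = 0" by (rule orthogonal_basis_exists) blast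
  have "n > 0"
  proof (rule ccontr)
    assume "\<not> n > 0"
    then have "x = 0" for x :: 'v using ibasis_coord[OF v(1), of x] by auto
    then show False using ex_nonzero by metis
  qed
  let ?u = "v 0" let ?a = "- 2 / h ?u ?u"
  have nz: "h ?u ?u \<noteq> 0" using v(2) \<open>n > 0\<close> by blast
  have c: "cond ?u ?a" using nz by (simp add: cond_def tau_real_def field_simps)
  have gU: "R ?u ?a \<in> U V" by (rule R_in_U[OF c])
  have "R ?u ?a (v j) = ac (if j = 0 then -1 else 1) (v j)" if j: "j < n" for j
  proof (cases "j = 0")
    case True
    have "?u + ac (?a * h ?u ?u) ?u = ?u + ac (- 2) ?u" using nz by simp
    also have "\<dots> = ac (1 + - 2) ?u" by (simp only: ac_plus ac_1)
    finally show ?thesis using True by (simp add: R_def)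
  next
    case False
    then show ?thesis using v(3)[of 0 j] j \<open>n > 0\<close> by (simp add: R_fix)
  qed
  then have "endo_det V (R ?u ?a) = (\<Prod>j<n. if j = 0 then -1 else 1)"
    by (rule endo_det_diagonal[OF v(1) Upm_dlinear[OF U_Upm[OF gU]]])
  also have "\<dots> = -1" using \<open>n > 0\<close> by (simp add: prod.delta)
  finally show thesis by (rule that[OF gU])
qed

text \<open>An anti-isometric involution swaps the positive and the negative members of an orthogonal
  basis; each swapped pair spans a hyperbolic plane.\<close>

lemma anti_isometry_hyperbolic:
  assumes "similitude V (-1) g0"
  shows "hyperbolic_space V"
proof -
  obtain g Q where g: "similitude V (-1) g" "g \<circ> g = id" and Q: "orth_set Q" "perp Q = {0}" "g ` Q \<subseteq> Q"
    by (rule anti_involution[OF _ _ assms]) auto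
  note gD = similitudeD[OF g(1)]
  have gg: "g (g x) = x" for x using g(2) by (metis comp_apply id_apply)
  have hg: "h (g x) (g y) = - h x y" for x y using gD(4)[of x y] by simp
  let ?P = "{x\<in>Q. h x x > 0}"
  have Qo: "h x y = 0" if "x \<in> Q" "y \<in> Q" "x \<noteq> y" for x y using Q(1) that unfolding orth_set_def by blast
  have Qn: "h x x \<noteq> 0" if "x \<in> Q" for x using Q(1) that unfolding orth_set_def by blast
  have "finite Q" using Q(1) by (simp add: orth_set_def)
  then have "finite ?P" by simp
  then obtain e0 where e0: "bij_betw e0 {1..card ?P} ?P" using ex_bij_betw_nat_finite_1 by blast
  define n where "n = card ?P"
  have e: "e0 i \<in> Q" "h (e0 i) (e0 i) > 0" if "i \<in> {1..n}" for i
    using bij_betw_apply[OF e0, of i] that by (auto simp: n_def)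
  have ne: "e0 i \<noteq> e0 j" if "i \<in> {1..n}" "j \<in> {1..n}" "i \<noteq> j" for i j
    using e0 that unfolding n_def bij_betw_def inj_on_def by blast
  have oo: "h (e0 i) (e0 j) = 0" if "i \<in> {1..n}" "j \<in> {1..n}" "i \<noteq> j" for i j
    by (rule Qo[OF e(1)[OF that(1)] e(1)[OF that(2)] ne[OF that]])
  have og: "h (e0 i) (g (e0 j)) = 0" if ij: "i \<in> {1..n}" "j \<in> {1..n}" for i j
  proof -
    have "g (e0 j) \<noteq> e0 i"
    proof
      assume "g (e0 j) = e0 i"
      then have "h (e0 i) (e0 i) = - h (e0 j) (e0 j)" using hg[of "e0 j" "e0 j"] by metis
      then show False using e(2)[OF ij(1)] e(2)[OF ij(2)] by linarith
    qed
    then show ?thesis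
      by (intro Qo e(1)[OF ij(1)] subsetD[OF Q(3) imageI[OF e(1)[OF ij(2)]]]) simp
  qed
  define f where "f i = e0 i + g (e0 i)" for i
  define f' where "f' i = ac (1 / (2 * h (e0 i) (e0 i))) (e0 i - g (e0 i))" for i
  have og': "h (g (e0 i)) (e0 j) = 0" if "i \<in> {1..n}" "j \<in> {1..n}" for i j
    using og[OF that(2,1)] by (simp add: h_commute[of "g (e0 i)"])
  have rel: "h (f i) (f j) = 0 \<and> h (f' i) (f' j) = 0 \<and> h (f i) (f' j) = (if i = j then 1 else 0)"
    if ij: "i \<in> {1..n}" "j \<in> {1..n}" for i j
  proof -
    have 1: "h (e0 i) (g (e0 j)) = 0" "h (g (e0 i)) (e0 j) = 0" "h (g (e0 i)) (g (e0 j)) = - h (e0 i) (e0 j)"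
      using og[OF ij] og'[OF ij] hg by auto
    show ?thesis
    proof (cases "i = j")
      case True
      then show ?thesis using 1 e(2)[OF ij(1)] by (simp add: f_def f'_def h_scale h_add h_diff)
    next
      case False
      then show ?thesis using 1 oo[OF ij False] by (simp add: f_def f'_def h_scale h_add h_diff)
    qed
  qed
  let ?T = "f ` {1..n} \<union> f' ` {1..n}"
  have eT: "e0 i \<in> vs.span ?T" "g (e0 i) \<in> vs.span ?T" if i: "i \<in> {1..n}" for i
  proof -
    let ?c = "h (e0 i) (e0 i)"
    have fs: "f i \<in> vs.span ?T" "ac (2 * ?c) (f' i) \<in> vs.span ?T"
      using i by (auto intro!: vs.span_base vs.span_scale)
    have d: "ac (2 * ?c) (f' i) = e0 i - g (e0 i)" using e(2)[OF i]
      by (simp add: f'_def ac_mult[symmetric])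
    have half: "ac (1/2) x + ac (1/2) x = x" for x by (simp add: ac_plus[symmetric])
    have "ac (1/2) (f i + ac (2 * ?c) (f' i)) = e0 i"
      unfolding d f_def by (simp add: ac_add ac_diff half algebra_simps)
    moreover have "ac (1/2) (f i - ac (2 * ?c) (f' i)) = g (e0 i)"
      unfolding d f_def by (simp add: ac_add ac_diff half algebra_simps)
    ultimately show "e0 i \<in> vs.span ?T" "g (e0 i) \<in> vs.span ?T"
      using vs.span_scale[OF vs.span_add[OF fs], of "1/2"] vs.span_scale[OF vs.span_diff[OF fs], of "1/2"] by simp_all
  qed
  have QT: "x \<in> vs.span ?T" if x: "x \<in> Q" for x
  proof (cases "h x x > 0")
    case True
    then have "x \<in> e0 ` {1..n}" using x e0 unfolding n_def bij_betw_def by blast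
    then show ?thesis using eT by blast
  next
    case False
    then have "h x x < 0" using Qn[OF x] by linarith
    then have "h (g x) (g x) > 0" using hg[of x x] by linarith
    moreover have "g x \<in> Q" using x Q(3) by blast
    ultimately have "g x \<in> ?P" by blast
    then have "g x \<in> e0 ` {1..n}" using e0 unfolding n_def bij_betw_def by blast
    then obtain i where i: "i \<in> {1..n}" "g x = e0 i" by blast
    have "x = g (e0 i)" using gg[of x] i(2) by simp
    then show ?thesis using eT(2)[OF i(1)] by simp
  qed
  have "x \<in> vs.span ?T" for x
    by (subst orth_expand_full[OF Q(1,2), of x]) (intro vs.span_sum vs.span_scale QT)
  then have "dspan V ?T = UNIV" by (auto simp: dspan_eq)
  then have "hyperbolic_basis V n f f'" using rel by (simp add: hyperbolic_basis_def)
  then show ?thesis by (auto simp: hyperbolic_space_def)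
qed

end

section \<open>Blocks and families of vectors\<close>

lemma sum_split: "(\<Sum>i<k + n. F i) = (\<Sum>i<k. F i) + (\<Sum>i<n. F (k + i :: nat) :: 'x::comm_monoid_add)"
  by (induction n) (simp_all add: add.assoc)

lemma sum_blocks: "(\<Sum>q<k * n. F q) = (\<Sum>i<k. \<Sum>l<n. F (i * n + l :: nat) :: 'x::comm_monoid_add)"
proof (induction k)
  case (Suc k)
  have "Suc k * n = k * n + n" by simp
  then show ?case by (simp only: sum_split Suc sum.lessThan_Suc)
qed simp

lemma fdet_blocks:
  assumes n: "n > 0"
  shows "fdet (k * n) (\<lambda>q' q. if q' div n = q div n then a (q' mod n) (q mod n) else 0) = fdet n a ^ k"
proof (induction k)
  case 0
  show ?case by (subst fdet_diag) auto
next
  case (Suc k)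
  let ?d = "\<lambda>q' q. if q' div n = q div n then a (q' mod n) (q mod n) else 0"
  have ge: "q div n = Suc ((q - n) div n)" "q mod n = (q - n) mod n" if "\<not> q < n" for q
    using that n by (simp_all add: le_div_geq le_mod_geq)
  have "fdet (Suc k * n) ?d = fdet (n + k * n) (\<lambda>i j. if i < n \<and> j < n then a i j
      else if \<not> i < n \<and> \<not> j < n then ?d (i - n) (j - n) else 0)"
    unfolding mult_Suc
  proof (rule fdet_cong)
    fix i j
    show "?d i j = (if i < n \<and> j < n then a i j
      else if \<not> i < n \<and> \<not> j < n then ?d (i - n) (j - n) else 0)"
      by (cases "i < n"; cases "j < n") (simp_all add: ge)
  qed
  also have "\<dots> = fdet n a * fdet (k * n) ?d" by (rule fdet_block)
  finally show ?case using Suc by simp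
qed

lemma span_family:
  fixes b :: "nat \<Rightarrow> 'x::real_vector"
  assumes "w \<in> span (b ` {..<n})"
  shows "\<exists>c. w = (\<Sum>i<n. c i *\<^sub>R b i)"
proof -
  let ?L = "{\<Sum>i<n. c i *\<^sub>R b i | c. True}"
  have "span (b ` {..<n}) \<subseteq> ?L"
  proof (rule span_minimal)
    show "b ` {..<n} \<subseteq> ?L"
    proof
      fix x assume "x \<in> b ` {..<n}"
      then obtain j where j: "j < n" "x = b j" by auto
      have "(\<Sum>i<n. (if i = j then 1 else 0) *\<^sub>R b i) = (\<Sum>i<n. if i = j then b i else 0)"
        by (rule sum.cong) auto
      also have "\<dots> = b j" using j(1) by simp
      finally show "x \<in> ?L" unfolding j(2) by (intro CollectI exI[of _ "\<lambda>i. if i = j then 1 else 0"]) simp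
    qed
    show "subspace ?L"
    proof (rule subspaceI)
      show "0 \<in> ?L" by (intro CollectI exI[of _ "\<lambda>_. 0"]) simp
    next
      fix x y assume "x \<in> ?L" "y \<in> ?L"
      then obtain c c' where c: "x = (\<Sum>i<n. c i *\<^sub>R b i)" "y = (\<Sum>i<n. c' i *\<^sub>R b i)" by blast
      show "x + y \<in> ?L" unfolding c
        by (intro CollectI exI[of _ "\<lambda>i. c i + c' i"]) (simp add: scaleR_add_left sum.distrib)
    next
      fix r x assume "x \<in> ?L"
      then obtain c where c: "x = (\<Sum>i<n. c i *\<^sub>R b i)" by blast
      show "r *\<^sub>R x \<in> ?L" unfolding c
        by (intro CollectI exI[of _ "\<lambda>i. r * c i"]) (simp add: scaleR_sum_right)
    qed
  qed
  then show ?thesis using assms by blast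
qed

text \<open>Otherwise the matrix expressing \<open>b0\<close> in terms of \<open>b\<close> has a nontrivial kernel.\<close>

lemma independent_family_le:
  fixes b b0 :: "nat \<Rightarrow> 'x::real_vector"
  assumes ind: "\<And>c. (\<Sum>j<n2. c j *\<^sub>R b0 j) = 0 \<Longrightarrow> \<forall>j<n2. c j = 0"
    and sp: "\<And>j. j < n2 \<Longrightarrow> \<exists>c. b0 j = (\<Sum>i<n1. c i *\<^sub>R b i)"
  shows "n2 \<le> n1"
proof (rule ccontr)
  assume "\<not> n2 \<le> n1"
  then have lt: "n1 < n2" by simp
  have "\<forall>j. \<exists>c. j < n2 \<longrightarrow> b0 j = (\<Sum>i<n1. c i *\<^sub>R b i)" using sp by blast
  then obtain A where A: "\<And>j. j < n2 \<Longrightarrow> b0 j = (\<Sum>i<n1. A j i *\<^sub>R b i)" by metis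
  obtain c where c: "\<exists>i<n2. c i \<noteq> 0" "\<And>j. j < n1 \<Longrightarrow> (\<Sum>i<n2. A i j * c i) = 0"
    using underdetermined_system[OF lt, of "\<lambda>j i. A i j"] by blast
  have "(\<Sum>j<n2. c j *\<^sub>R b0 j) = (\<Sum>j<n2. \<Sum>i<n1. (A j i * c j) *\<^sub>R b i)"
    by (rule sum.cong) (simp_all add: A scaleR_sum_right mult.commute)
  also have "\<dots> = (\<Sum>i<n1. \<Sum>j<n2. (A j i * c j) *\<^sub>R b i)" by (rule sum.swap)
  also have "\<dots> = (\<Sum>i<n1. (\<Sum>j<n2. A j i * c j) *\<^sub>R b i)" by (simp add: scaleR_sum_left)
  also have "\<dots> = 0" using c(2) by simp
  finally show False using ind c(1) by blast
qed

lemma (in real_hermitian) split_ibasis: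
  assumes ex: "\<And>z. z = (\<Sum>i<k. ac (\<alpha> i z) (x i) + ac (\<beta> i z) (y i))"
    and xx: "\<And>i j. i < k \<Longrightarrow> j < k \<Longrightarrow> h (x i) (x j) = 0"
    and yy: "\<And>i j. i < k \<Longrightarrow> j < k \<Longrightarrow> h (y i) (y j) = 0"
    and xy: "\<And>i j. i < k \<Longrightarrow> j < k \<Longrightarrow> h (x i) (y j) = (if i = j then 1 else 0)"
  shows "ibasis (k + k) (\<lambda>i. if i < k then x i else y (i - k))"
proof (rule ibasisI)
  fix z
  have "z = (\<Sum>i<k + k. ac (if i < k then \<alpha> i z else \<beta> (i - k) z) (if i < k then x i else y (i - k)))"
    unfolding sum_split by (subst ex[of z]) (simp add: sum.distrib)
  then show "\<exists>c. z = (\<Sum>i<k + k. ac (c i) (if i < k then x i else y (i - k)))"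
    by (rule exI[of _ "\<lambda>i. if i < k then \<alpha> i z else \<beta> (i - k) z"])
next
  fix c i
  assume "(\<Sum>i<k + k. ac (c i) (if i < k then x i else y (i - k))) = 0" and i: "i < k + k"
  then have z: "(\<Sum>i<k. ac (c i) (x i)) + (\<Sum>i<k. ac (c (k + i)) (y i)) = 0" by (simp add: sum_split)
  have A: "c j = 0" if j: "j < k" for j
  proof -
    have 1: "(\<Sum>i<k. h (ac (c i) (x i)) (y j)) = (\<Sum>i<k. if i = j then c j else 0)"
      by (rule sum.cong) (use xy j in \<open>auto simp: h_ac tau_real_def\<close>)
    have 2: "(\<Sum>i<k. h (ac (c (k + i)) (y i)) (y j)) = 0"
      by (rule sum.neutral) (use yy j in \<open>auto simp: h_ac\<close>)
    have "h ((\<Sum>i<k. ac (c i) (x i)) + (\<Sum>i<k. ac (c (k + i)) (y i))) (y j) = c j"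
      unfolding h_add(1) h_sum(1) 1 2 using j by simp
    then show ?thesis unfolding z by simp
  qed
  have B: "c (k + j) = 0" if j: "j < k" for j
  proof -
    have 1: "(\<Sum>i<k. h (x j) (ac (c i) (x i))) = 0"
      by (rule sum.neutral) (use xx j in \<open>auto simp: h_ac\<close>)
    have 2: "(\<Sum>i<k. h (x j) (ac (c (k + i)) (y i))) = (\<Sum>i<k. if i = j then c (k + j) else 0)"
      by (rule sum.cong) (use xy j in \<open>auto simp: h_ac\<close>)
    have "h (x j) ((\<Sum>i<k. ac (c i) (x i)) + (\<Sum>i<k. ac (c (k + i)) (y i))) = c (k + j)"
      unfolding h_add(2) h_sum(2) 1 2 using j by simp
    then show ?thesis unfolding z by simp
  qed
  show "c i = 0"
  proof (cases "i < k")
    case False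
    then have "i - k < k" "k + (i - k) = i" using i by linarith+
    then show ?thesis using B[of "i - k"] by simp
  qed (rule A)
qed

lemma opp_real: "opp V = (V :: (real, 'v::ab_group_add) form_space)"
  by (cases V) (simp add: opp_def tau_real_def)

section \<open>Symplectic-orthogonal pairs\<close>

locale real_pair = tensor_datum "-1" 1 V1 V2 t S
  for V1 :: "(real, 'a::ab_group_add) form_space" and V2 :: "(real, 'b::ab_group_add) form_space"
    and t :: "'a \<Rightarrow> 'b \<Rightarrow> 'w::real_vector" and S :: "'w symplectic_datum"
begin

lemma real_symplectic_V1: "real_symplectic V1"
  by (simp add: real_symplectic_def V1.hermitian_axioms)

lemma real_hermitian_V1: "real_hermitian V1 (-1)"
  by (simp add: real_hermitian_def V1.hermitian_axioms)

lemma quadratic_space_V2: "quadratic_space V2"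
  using V2.hermitian_axioms by (simp add: quadratic_space_def real_hermitian_def opp_real)

interpretation Q1: real_symplectic V1 by (rule real_symplectic_V1)
interpretation A1: real_hermitian V1 "-1" by (rule real_hermitian_V1)
interpretation Q2: quadratic_space V2 by (rule quadratic_space_V2)

lemma t_scale: "t (act V1 r x) y = r *\<^sub>R t x y" "t x (act V2 r y) = r *\<^sub>R t x y"
  using t_real[of r x y] t_real2[of x r y] by simp_all

lemma t_sum: "t (\<Sum>i\<in>I. f i) y = (\<Sum>i\<in>I. t (f i) y)" "t x (\<Sum>i\<in>J. g i) = (\<Sum>i\<in>J. t x (g i))"
proof -
  show "t (\<Sum>i\<in>I. f i) y = (\<Sum>i\<in>I. t (f i) y)"
    by (induction I rule: infinite_finite_induct) (simp_all add: t_add)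
  show "t x (\<Sum>i\<in>J. g i) = (\<Sum>i\<in>J. t x (g i))"
    by (induction J rule: infinite_finite_induct) (simp_all add: t_add)
qed

text \<open>The flip of half of a symplectic basis of \<open>V1\<close> with first halves \<open>x i\<close>. With an orthogonal basis \<open>v j\<close> of \<open>V2\<close> the
  vectors \<open>x i \<otimes> v j\<close>, ordered blockwise in \<open>i\<close>, form a basis of its fixed space in the tensor product, on which an
  element of the orthogonal group acts by \<open>k\<close> equal blocks.\<close>

lemma anti_symplectic:
  obtains s k b where "s \<in> Upm V1" "sim_factor V1 s = -1" "s \<circ> s = id" "ddim V1 = 2 * k"
    "lframe b" "lspan b = {w. emb1 t s w = w}"
    "\<And>g. g \<in> Upm V2 \<Longrightarrow> fdt b (emb2 t g) = endo_det V2 g ^ k"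
proof -
  obtain P where P: "Q1.spairs P" "Q1.sperp P = {0}" by (rule Q1.full_spairs_exists)
  have "finite P" using P(1) by (simp add: Q1.spairs_def)
  then obtain e where "bij_betw e {0..<card P} P" using ex_bij_betw_nat_finite by blast
  then have e: "bij_betw e {..<card P} P" by (simp add: atLeast0LessThan)
  define k where "k = card P"
  define x where "x i = fst (e i)" for i
  define y where "y i = snd (e i)" for i
  have eP: "e i \<in> P" if "i < k" for i using bij_betw_apply[OF e, of i] that by (simp add: k_def)
  have ei: "e i = e j \<longleftrightarrow> i = j" if "i < k" "j < k" for i j
    using inj_on_eq_iff[OF bij_betw_imp_inj_on[OF e], of i j] that by (simp add: k_def)
  have rel: "form V1 (x i) (x j) = 0" "form V1 (y i) (y j) = 0" "form V1 (x i) (y j) = (if i = j then 1 else 0)"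
    if ij: "i < k" "j < k" for i j
    using Q1.spairsD[OF P(1) eP[OF ij(1)] eP[OF ij(2)]] ei[OF ij] by (simp_all add: x_def y_def)
  have ex: "z = (\<Sum>i<k. act V1 (- form V1 (y i) z) (x i) + act V1 (form V1 (x i) z) (y i))" for z
    using Q1.spart_full[OF P, of z]
      sum.reindex_bij_betw[OF e, of "\<lambda>p. act V1 (- form V1 (snd p) z) (fst p) + act V1 (form V1 (fst p) z) (snd p)"]
    by (simp add: Q1.spart_def k_def x_def y_def)
  let ?s = "Q1.sflip P"
  note s = Q1.sflip[OF P]
  note sD = V1.similitudeD[OF s(1)]
  have sU: "?s \<in> Upm V1" using s(1) V1.Upm_iff by blast
  have sf: "sim_factor V1 ?s = -1" by (rule V1.sim_factor_eq[OF s(1)])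
  have sx: "?s (x i) = x i" "?s (y i) = - y i" if "i < k" for i
    using s(3,4)[OF eP[OF that]] by (simp_all add: x_def y_def)
  have dim: "ddim V1 = 2 * k"
    using A1.ibasis_dim[OF A1.split_ibasis[OF ex rel]] by simp
  obtain n v where v: "Q2.ibasis n v" "\<And>i. i < n \<Longrightarrow> form V2 (v i) (v i) \<noteq> 0"
    "\<And>i j. i < n \<Longrightarrow> j < n \<Longrightarrow> i \<noteq> j \<Longrightarrow> form V2 (v i) (v j) = 0" by (rule Q2.orthogonal_basis_exists) blast
  have n0: "n > 0"
  proof (rule ccontr)
    assume n: "\<not> n > 0"
    obtain z :: 'b where z: "z \<noteq> 0" by (rule Q2.ex_nonzero)
    obtain c where "z = (\<Sum>i<n. act V2 (c i) (v i))" by (rule Q2.ibasis_coord[OF v(1)])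
    then show False using n z by simp
  qed
  let ?E = "emb1 t ?s"
  define b where "b q = t (x (q div n)) (v (q mod n))" for q
  have bq: "b (i * n + l) = t (x i) (v l)" if "l < n" for i l using that by (simp add: b_def)
  have E: "?E \<in> Sppm S" "lam S ?E = -1" using emb1_Sppm[OF sU] sf by auto
  have EE: "?E \<circ> ?E = id" using emb1_comp[OF sU sU] by (simp add: s(2) emb1_id)
  have linE: "linear ?E" by (rule emb1_props(1)[OF sU])
  have ss: "?s (?s z) = z" for z using s(2) by (metis comp_apply id_apply)
  have invs: "inv_into UNIV ?s = ?s" by (rule inv_equality) (simp_all add: ss)
  have Et: "?E (t z w) = t (?s z) w" for z w using emb1_props(2)[OF sU] by (simp add: invs)
  have Eb: "?E (b q) = b q" if "q < k * n" for q
    using sx(1)[OF less_mult_imp_div_less[OF that]] by (simp add: b_def Et)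
  \<comment> \<open>symmetrising pure tensors produces the fixed space\<close>
  let ?f = "\<lambda>w. (1/2) *\<^sub>R (w + ?E w)"
  have linf: "linear ?f" by (rule linear_compose_scale_right[OF linear_compose_add[OF linear_ident linE]])
  have "?f (t X Y) \<in> span (b ` {..<k * n})" for X Y
  proof -
    obtain c where c: "Y = (\<Sum>j<n. act V2 (c j) (v j))" by (rule Q2.ibasis_coord[OF v(1)])
    define \<alpha> where "\<alpha> i = - form V1 (y i) X" for i
    define \<beta> where "\<beta> i = form V1 (x i) X" for i
    have X: "X = (\<Sum>i<k. act V1 (\<alpha> i) (x i) + act V1 (\<beta> i) (y i))" unfolding \<alpha>_def \<beta>_def by (rule ex)
    have "?s X = (\<Sum>i<k. ?s (act V1 (\<alpha> i) (x i) + act V1 (\<beta> i) (y i)))"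
      by (subst X) (rule V1.similitude_sum[OF s(1)])
    also have "\<dots> = (\<Sum>i<k. act V1 (\<alpha> i) (x i) - act V1 (\<beta> i) (y i))"
      by (rule sum.cong) (simp_all add: sD sx V1.ac_minus)
    finally have "X + ?s X = (\<Sum>i<k. act V1 (\<alpha> i) (x i) + act V1 (\<alpha> i) (x i))"
      by (subst X) (simp add: sum.distrib[symmetric])
    also have "\<dots> = (\<Sum>i<k. act V1 (2 * \<alpha> i) (x i))"
      by (rule sum.cong) (simp_all add: V1.ac_plus[symmetric])
    finally have Xs: "X + ?s X = (\<Sum>i<k. act V1 (2 * \<alpha> i) (x i))" .
    have "?f (t X Y) = (1/2) *\<^sub>R t (X + ?s X) Y" by (simp only: Et t_add(1))
    also have "\<dots> = (1/2) *\<^sub>R (\<Sum>i<k. \<Sum>j<n. (2 * \<alpha> i) *\<^sub>R c j *\<^sub>R b (i * n + j))"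
    proof -
      have "t (X + ?s X) Y = (\<Sum>i<k. (2 * \<alpha> i) *\<^sub>R t (x i) Y)" unfolding Xs by (simp add: t_sum(1) t_scale(1))
      moreover have "t (x i) Y = (\<Sum>j<n. c j *\<^sub>R b (i * n + j))" for i
        unfolding c by (simp add: t_sum(2) t_scale(2) bq)
      ultimately show ?thesis by (simp only: scaleR_sum_right)
    qed
    also have "\<dots> \<in> span (b ` {..<k * n})"
    proof (intro span_scale span_sum span_base imageI)
      fix i j assume ij: "i \<in> {..<k}" "j \<in> {..<n}"
      then have "i * n + j < Suc i * n" by simp
      also have "\<dots> \<le> k * n" using ij by (intro mult_le_mono1) simp
      finally show "i * n + j \<in> {..<k * n}" by simp
    qed
    finally show ?thesis .
  qed
  then have "span (?f ` {t x y | x y. True}) \<subseteq> span (b ` {..<k * n})"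
    by (intro span_minimal subspace_span) auto
  then have fsp: "?f w \<in> span (b ` {..<k * n})" for w
    using span_t linear_span_image[OF linf, of "{t x y | x y. True}"] by auto
  have fix_sp: "w \<in> span (b ` {..<k * n})" if "?E w = w" for w
  proof -
    have "?f w = w" using that by (simp add: scaleR_2[symmetric])
    then show ?thesis using fsp[of w] by simp
  qed
  have fixI: "?E (\<Sum>q<k * n. c q *\<^sub>R b q) = (\<Sum>q<k * n. c q *\<^sub>R b q)" for c
    by (simp add: linear_sum[OF linE] linear_scale[OF linE] Eb)
  have ind: "\<forall>q<k * n. c q = 0" if c: "(\<Sum>q<k * n. c q *\<^sub>R b q) = 0" for c
  proof (intro allI impI)
    fix q assume q: "q < k * n"
    define i where "i = q div n"
    define j where "j = q mod n"
    have ij: "i < k" "j < n" using less_mult_imp_div_less[OF q] n0 by (auto simp: i_def j_def)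
    have pair: "om (b q') (t (y i) (v j)) = (if q' = q then form V2 (v j) (v j) else 0)" if "q' < k * n" for q'
    proof -
      have 1: "q' div n < k" "q' mod n < n" using less_mult_imp_div_less[OF that] n0 by auto
      have 2: "q' = q \<longleftrightarrow> q' div n = i \<and> q' mod n = j"
        unfolding i_def j_def using div_mult_mod_eq[of q' n] div_mult_mod_eq[of q n] by metis
      have "om (b q') (t (y i) (v j)) = form V1 (x (q' div n)) (y i) * form V2 (v (q' mod n)) (v j)"
        by (simp add: b_def tensor_form_props val_def kappa_real_def trd_real_def tau_real_def)
      then show ?thesis using v(3)[OF 1(2) ij(2)] by (auto simp: rel(3)[OF 1(1) ij(1)] 2)
    qed
    have "om (\<Sum>q'<k * n. c q' *\<^sub>R b q') (t (y i) (v j)) = (\<Sum>q'<k * n. c q' * om (b q') (t (y i) (v j)))"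
      by (simp add: linear_sum[OF lin_om(2)] linear_scale[OF lin_om(2)])
    also have "\<dots> = (\<Sum>q'<k * n. if q' = q then c q * form V2 (v j) (v j) else 0)"
      by (rule sum.cong) (use pair in auto)
    also have "\<dots> = c q * form V2 (v j) (v j)" using q by simp
    finally have "c q * form V2 (v j) (v j) = 0" unfolding c using linear_0[OF lin_om(2)] by simp
    then show "c q = 0" using v(2)[OF ij(2)] by simp
  qed
  obtain b0 where b0: "lframe b0" "lspan b0 = {w. ?E w = w}" by (rule involution_frame[OF E EE])
  have b0i: "\<forall>j<m. c j = 0" if "(\<Sum>j<m. c j *\<^sub>R b0 j) = 0" for c
    using b0(1) that unfolding lframe_def by blast
  have "b0 j \<in> lspan b0" if "j < m" for j using that by (rule lspan_base)
  then have b0f: "?E (b0 j) = b0 j" if "j < m" for j using that b0(2) by blast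
  have "m \<le> k * n"
  proof (rule independent_family_le[of b0 m b "k * n", OF b0i])
    fix j assume "j < m"
    then show "\<exists>c. b0 j = (\<Sum>i<k * n. c i *\<^sub>R b i)" by (intro span_family fix_sp b0f)
  qed
  moreover have "k * n \<le> m"
  proof (rule independent_family_le[where b = b0, OF ind])
    fix q assume "q < k * n"
    then have "b q \<in> lspan b0" using b0(2) Eb by blast
    then show "\<exists>c. b q = (\<Sum>i<m. c i *\<^sub>R b0 i)" unfolding lspan_def by blast
  qed
  ultimately have kn: "m = k * n" by simp
  have bl: "b q \<in> lspan b0" if "q < k * n" for q using b0(2) Eb[OF that] by blast
  have lf: "lframe b"
    unfolding lframe_def
  proof (intro conjI allI impI)
    show "om (b i) (b j) = 0" if "i < m" "j < m" for i j
      using lframe_isotropic[OF b0(1) bl bl] that kn by simp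
    show "c q = 0" if "(\<Sum>i<m. c i *\<^sub>R b i) = 0" "q < m" for c q
      using ind[of c] that unfolding kn by blast
  qed
  have ls: "lspan b = {w. ?E w = w}"
  proof
    show "lspan b \<subseteq> {w. ?E w = w}" using fixI unfolding lspan_def kn by blast
    show "{w. ?E w = w} \<subseteq> lspan b" using fix_sp unfolding lspan_eq_span kn by blast
  qed
  have det: "fdt b (emb2 t g) = endo_det V2 g ^ k" if g: "g \<in> Upm V2" for g
  proof -
    have gl: "dlinear V2 g" by (rule Q2.Upm_dlinear[OF g])
    obtain a where a: "\<And>j. g (v j) = (\<Sum>i<n. act V2 (a i j) (v i))"
      by (rule Q2.ibasis_coords[OF v(1), where c = "\<lambda>j. g (v j)"]) blast
    let ?A = "\<lambda>q' q. if q' div n = q div n then a (q' mod n) (q mod n) else 0"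
    have "emb2 t g (b q) = (\<Sum>q'<m. ?A q' q *\<^sub>R b q')" if q: "q < m" for q
    proof -
      have qk: "q div n < k" using q kn less_mult_imp_div_less by simp
      have "emb2 t g (b q) = t (x (q div n)) (\<Sum>l<n. act V2 (a l (q mod n)) (v l))"
        by (simp add: b_def emb2_props(2)[OF g] a)
      also have "\<dots> = (\<Sum>l<n. a l (q mod n) *\<^sub>R t (x (q div n)) (v l))" by (simp add: t_sum t_scale)
      finally have 1: "emb2 t g (b q) = (\<Sum>l<n. a l (q mod n) *\<^sub>R t (x (q div n)) (v l))" .
      have "(\<Sum>q'<m. ?A q' q *\<^sub>R b q') = (\<Sum>i<k. \<Sum>l<n. ?A (i * n + l) q *\<^sub>R b (i * n + l))"
        unfolding kn by (rule sum_blocks)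
      also have "\<dots> = (\<Sum>i<k. if i = q div n then (\<Sum>l<n. a l (q mod n) *\<^sub>R t (x (q div n)) (v l)) else 0)"
        by (intro sum.cong refl) (simp add: bq)
      also have "\<dots> = (\<Sum>l<n. a l (q mod n) *\<^sub>R t (x (q div n)) (v l))" using qk by simp
      finally show ?thesis using 1 by simp
    qed
    then have "frame_mat b (emb2 t g) ?A" by (simp add: frame_mat_def)
    then have "fdt b (emb2 t g) = fdet m ?A" by (rule fdt_eq[OF lf])
    also have "\<dots> = fdet n a ^ k" unfolding kn by (rule fdet_blocks[OF n0])
    also have "fdet n a = endo_det V2 g" by (rule Q2.endo_det_eq[OF v(1) gl a, symmetric])
    finally show ?thesis .
  qed
  show thesis by (rule that[OF sU sf s(2) dim lf ls det])
qed

lemma gen8_V1: "gen8 (U V1)"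
  unfolding gen8_def
proof (intro allI impI)
  fix P :: "('a \<Rightarrow> 'a) \<Rightarrow> bool" and g
  assume a: "P id" "\<forall>g\<in>U V1. \<forall>g'\<in>U V1. P g \<longrightarrow> P g' \<longrightarrow> P (g \<circ> g')"
    "\<forall>g\<in>U V1. P (((g \<circ> g) \<circ> (g \<circ> g)) \<circ> ((g \<circ> g) \<circ> (g \<circ> g)))" "g \<in> U V1"
  show "P g"
  proof (rule Q1.Sp_eighth_powers[of P, OF a(1) _ _ a(4)])
    show "P (g \<circ> g')" if "g \<in> U V1" "g' \<in> U V1" "P g" "P g'" for g g' using a(2) that by blast
    show "P (V1.dbl (V1.dbl (V1.dbl g)))" if "g \<in> U V1" for g unfolding V1.dbl_def using a(3) that by blast
  qed
qed

text \<open>A similitude of factor \<open>-1\<close> is the flip times an isometry, and isometries of \<open>V1\<close> contribute nothing.\<close>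

lemma kap_real:
  obtains s k where "s \<in> Upm V1" "sim_factor V1 s = -1" "ddim V1 = 2 * k"
    "\<And>g g'. g \<in> Upm V1 \<Longrightarrow> g' \<in> Upm V2 \<Longrightarrow>
       kap (emb1 t g) (emb2 t g') = (if sim_factor V1 g = 1 then 1 else sg (endo_det V2 g' ^ k))"
proof -
  obtain s k b where s: "s \<in> Upm V1" "sim_factor V1 s = -1" "s \<circ> s = id" "ddim V1 = 2 * k"
    and b: "lframe b" "lspan b = {w. emb1 t s w = w}"
    and d: "\<And>g. g \<in> Upm V2 \<Longrightarrow> fdt b (emb2 t g) = endo_det V2 g ^ k" by (rule anti_symplectic) blast
  have "kap (emb1 t g) (emb2 t g') = (if sim_factor V1 g = 1 then 1 else sg (endo_det V2 g' ^ k))"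
    if g: "g \<in> Upm V1" and g': "g' \<in> Upm V2" for g g'
  proof (cases "sim_factor V1 g = 1")
    case True
    then have "g \<in> U V1" using V1.sim_factor_U[OF g] by simp
    then show ?thesis using kap_U1[OF gen8_V1 _ g'] True by simp
  next
    case False
    then have l: "sim_factor V1 g = -1" using V1.Upm_sim(2)[OF g] by blast
    let ?u = "s \<circ> g"
    have u: "?u \<in> Upm V1" by (rule V1.Upm_comp[OF s(1) g])
    have su: "s \<circ> ?u = g" using s(3) by (simp add: o_assoc)
    have "sim_factor V1 ?u = 1" using V1.sim_factor_comp[OF s(1) g] l s(2) by simp
    then have uU: "?u \<in> U V1" using V1.sim_factor_U[OF u] by simp
    have "kap (emb1 t g) (emb2 t g') = kap (emb1 t s) (emb2 t g') * kap (emb1 t ?u) (emb2 t g')"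
      using kap_mult1[OF s(1) u g'] by (simp only: su)
    also have "\<dots> = kap (emb1 t s) (emb2 t g')" using kap_U1[OF gen8_V1 uU g'] by simp
    also have "\<dots> = sg (fdt b (emb2 t g'))"
    proof (rule kap_involution[OF _ _ _ _ b])
      show "emb1 t s \<in> Sppm S" "lam S (emb1 t s) = -1" using emb1_Sppm[OF s(1)] s(2) by auto
      show "emb2 t g' \<in> Sppm S" by (rule emb2_Sppm(1)[OF g'])
      show "emb1 t s \<circ> emb2 t g' = emb2 t g' \<circ> emb1 t s" by (rule emb_commute[OF s(1) g'])
    qed
    finally show ?thesis using False d[OF g'] by simp
  qed
  then show thesis by (rule that[OF s(1,2,4)])
qed

text \<open>The sign of \<open>det\<^sup>k\<close> is trivial for even \<open>k\<close>, i.e. when \<open>4\<close> divides \<open>ddim V1 = 2 k\<close>, and otherwise it is the sign of the determinant.\<close>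

lemma commutes_real:
  assumes B: "B \<subseteq> Upm V2"
  shows "commutes_with (Sppm_hat S) (hat1 t (Upm V1)) (hat2 t B) \<longleftrightarrow> 4 dvd ddim V1 \<or> (\<forall>g\<in>B. endo_det V2 g > 0)"
    "commutes_with (Sppm_hat S) (hat2 t B) (hat1 t (Upm V1)) \<longleftrightarrow> 4 dvd ddim V1 \<or> (\<forall>g\<in>B. endo_det V2 g > 0)"
    "commutes_with (Sppm_hat S) (hat2 t B) (hat1 t (U V1))"
proof -
  obtain s k where s: "s \<in> Upm V1" "sim_factor V1 s = -1" "ddim V1 = 2 * k"
    and kap: "\<And>g g'. g \<in> Upm V1 \<Longrightarrow> g' \<in> Upm V2 \<Longrightarrow>
       kap (emb1 t g) (emb2 t g') = (if sim_factor V1 g = 1 then 1 else sg (endo_det V2 g' ^ k))"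
    by (rule kap_real) blast
  have sg1: "sg r = 1 \<longleftrightarrow> r > 0" for r by (auto simp: sg_def sgn_if)
  have sgk: "sg (d ^ k) = 1 \<longleftrightarrow> even k \<or> d > 0" if "d \<noteq> 0" for d :: real
    unfolding sg1 zero_less_power_eq using that by auto
  have even: "4 dvd ddim V1 \<longleftrightarrow> even k" unfolding s(3) by presburger
  have one: "kap (emb1 t s) (emb2 t g') = 1 \<longleftrightarrow> even k \<or> endo_det V2 g' > 0" if "g' \<in> B" for g'
  proof -
    have g': "g' \<in> Upm V2" using B that by blast
    show ?thesis using kap[OF s(1) g'] sgk[OF Q2.endo_det_nonzero[OF g']] s(2) by simp
  qed
  have two: "kap (emb1 t g) (emb2 t g') = 1" if "g \<in> Upm V1" "g' \<in> B" "even k \<or> endo_det V2 g' > 0" for g g'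
  proof -
    have g': "g' \<in> Upm V2" using B that by blast
    show ?thesis using kap[OF that(1) g'] sgk[OF Q2.endo_det_nonzero[OF g']] that(3) by simp
  qed
  have all: "(\<forall>g\<in>Upm V1. \<forall>g'\<in>B. kap (emb1 t g) (emb2 t g') = 1) \<longleftrightarrow> 4 dvd ddim V1 \<or> (\<forall>g\<in>B. endo_det V2 g > 0)"
    unfolding even using one two s(1) by blast
  show "commutes_with (Sppm_hat S) (hat1 t (Upm V1)) (hat2 t B) \<longleftrightarrow> 4 dvd ddim V1 \<or> (\<forall>g\<in>B. endo_det V2 g > 0)"
    "commutes_with (Sppm_hat S) (hat2 t B) (hat1 t (Upm V1)) \<longleftrightarrow> 4 dvd ddim V1 \<or> (\<forall>g\<in>B. endo_det V2 g > 0)"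
    unfolding commutes_with_iff[OF subset_refl B] all by (rule refl)+
  have UU: "U V1 \<subseteq> Upm V1" using V1.U_Upm by blast
  have "kap (emb1 t g) (emb2 t g') = 1" if "g \<in> U V1" "g' \<in> B" for g g'
    using kap_U1[OF gen8_V1 that(1)] that(2) B by blast
  then show "commutes_with (Sppm_hat S) (hat2 t B) (hat1 t (U V1))"
    unfolding commutes_with_iff(2)[OF UU B] by blast
qed

end

section \<open>Hyperbolic spaces\<close>

lemma ball_Suc: "(\<forall>i\<in>{1..r}. Q i) \<longleftrightarrow> (\<forall>j<r. Q (Suc j))"
proof (intro iffI ballI allI impI)
  fix i assume a: "\<forall>j<r. Q (Suc j)" "i \<in> {1..r}"
  then obtain j where "i = Suc j" by (cases i) auto
  then show "Q i" using a by simp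
qed auto

lemma image_Suc: "f ` {1..r} = (\<lambda>i. f (Suc i)) ` {..<r}"
  unfolding image_image[symmetric, of f Suc] by (simp add: image_Suc_lessThan)

lemma sum_indicator:
  fixes F :: "nat \<Rightarrow> real"
  assumes "j < r" "\<And>i. i < r \<Longrightarrow> F i = (if i = j then a else 0)"
  shows "(\<Sum>i<r. F i) = a"
proof -
  have "(\<Sum>i<r. F i) = (\<Sum>i<r. if i = j then a else 0)" by (rule sum.cong) (use assms(2) in auto)
  then show ?thesis using assms(1) by simp
qed

locale hyperbolic = quadratic_space V for V :: "(real, 'v::ab_group_add) form_space" +
  fixes r :: nat and f f' :: "nat \<Rightarrow> 'v"
  assumes hb: "hyperbolic_basis V r f f'"
begin

abbreviation u :: "nat \<Rightarrow> 'v" where "u i \<equiv> f (Suc i)"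
abbreviation u' :: "nat \<Rightarrow> 'v" where "u' i \<equiv> f' (Suc i)"

lemma hyp_rel:
  assumes "i < r" "j < r"
  shows "h (u i) (u j) = 0" "h (u' i) (u' j) = 0" "h (u i) (u' j) = (if i = j then 1 else 0)"
    "h (u' i) (u j) = (if i = j then 1 else 0)"
proof -
  have "Suc i \<in> {1..r}" "Suc j \<in> {1..r}" using assms by auto
  then show "h (u i) (u j) = 0" "h (u' i) (u' j) = 0" "h (u i) (u' j) = (if i = j then 1 else 0)"
    "h (u' i) (u j) = (if i = j then 1 else 0)"
    using hb unfolding hyperbolic_basis_def by (auto simp: h_commute[of "u' i" "u j"])
qed

lemma hyp_coord:
  assumes j: "j < r"
  shows "h (u' j) (\<Sum>i<r. ac (\<alpha> i) (u i) + ac (\<beta> i) (u' i)) = \<alpha> j"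
    "h (u j) (\<Sum>i<r. ac (\<alpha> i) (u i) + ac (\<beta> i) (u' i)) = \<beta> j"
proof -
  show "h (u' j) (\<Sum>i<r. ac (\<alpha> i) (u i) + ac (\<beta> i) (u' i)) = \<alpha> j"
    unfolding h_sum(2) h_add(2) h_scale by (rule sum_indicator[OF j]) (simp add: hyp_rel[OF j])
  show "h (u j) (\<Sum>i<r. ac (\<alpha> i) (u i) + ac (\<beta> i) (u' i)) = \<beta> j"
    unfolding h_sum(2) h_add(2) h_scale by (rule sum_indicator[OF j]) (simp add: hyp_rel[OF j])
qed

lemma hyp_expand: "z = (\<Sum>i<r. ac (h (u' i) z) (u i) + ac (h (u i) z) (u' i))" (is "z = ?e z")
proof -
  let ?y = "z - ?e z"
  have 1: "h ?y (u j) = 0" "h ?y (u' j) = 0" if "j < r" for j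
    using hyp_coord[OF that, of "\<lambda>i. h (u' i) z" "\<lambda>i. h (u i) z"]
    by (simp_all add: h_commute[of ?y] h_diff(2))
  have sub: "vs.subspace {w. h ?y w = 0}" by (rule vs.subspaceI) (simp_all add: h_add h_scale)
  have gen: "f ` {1..r} \<union> f' ` {1..r} \<subseteq> {w. h ?y w = 0}" unfolding image_Suc using 1 by auto
  have "vs.span (f ` {1..r} \<union> f' ` {1..r}) = UNIV" using hb by (simp add: hyperbolic_basis_def dspan_eq)
  then have "h ?y w = 0" for w using vs.span_minimal[OF gen sub] by blast
  then have "?y = 0" by (rule h_nondeg)
  then show ?thesis by simp
qed

lemma hyp_basis: "ibasis (r + r) (\<lambda>i. if i < r then u i else u' (i - r))"
  by (rule split_ibasis[OF hyp_expand]) (simp_all add: hyp_rel)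

lemma hyp_dim: "ddim V = 2 * r"
  using ibasis_dim[OF hyp_basis] by simp

lemma hyp_form: "h z w = (\<Sum>i<r. h (u' i) z * h (u i) w + h (u i) z * h (u' i) w)"
proof -
  have "h z w = h (\<Sum>i<r. ac (h (u' i) z) (u i) + ac (h (u i) z) (u' i)) w" by (subst hyp_expand[of z]) (rule refl)
  then show ?thesis by (simp only: h_sum(1) h_add(1) h_scale)
qed

definition flip :: "'v \<Rightarrow> 'v" where
  "flip z = (\<Sum>i<r. ac (h (u' i) z) (u i) + ac (- h (u i) z) (u' i))"

lemma flip_coord: "j < r \<Longrightarrow> h (u' j) (flip z) = h (u' j) z" "j < r \<Longrightarrow> h (u j) (flip z) = - h (u j) z"
  unfolding flip_def using hyp_coord[of j "\<lambda>i. h (u' i) z" "\<lambda>i. - h (u i) z"] by blast+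

lemma dlinear_flip: "dlinear V flip"
  unfolding dlinear_def flip_def
proof (intro conjI allI)
  show "(\<Sum>i<r. ac (h (u' i) (x + y)) (u i) + ac (- h (u i) (x + y)) (u' i)) =
     (\<Sum>i<r. ac (h (u' i) x) (u i) + ac (- h (u i) x) (u' i)) + (\<Sum>i<r. ac (h (u' i) y) (u i) + ac (- h (u i) y) (u' i))" for x y
    unfolding sum.distrib[symmetric] by (rule sum.cong) (simp_all add: h_add ac_plus ac_minus ac_diff algebra_simps)
  show "(\<Sum>i<r. ac (h (u' i) (ac d x)) (u i) + ac (- h (u i) (ac d x)) (u' i)) =
     ac d (\<Sum>i<r. ac (h (u' i) x) (u i) + ac (- h (u i) x) (u' i))" for d x
    unfolding ac_sum by (rule sum.cong) (simp_all add: h_scale ac_add ac_diff)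
qed

lemma flip_flip: "flip (flip z) = z"
proof -
  have "flip (flip z) = (\<Sum>i<r. ac (h (u' i) z) (u i) + ac (h (u i) z) (u' i))"
    unfolding flip_def[of "flip z"] by (rule sum.cong) (simp_all add: flip_coord)
  then show ?thesis using hyp_expand[of z] by simp
qed

lemma flip_u: "j < r \<Longrightarrow> flip (u j) = u j" "j < r \<Longrightarrow> flip (u' j) = - u' j"
proof -
  assume j: "j < r"
  have 1: "flip (u j) = (\<Sum>i<r. if i = j then u j else 0)"
    unfolding flip_def by (rule sum.cong) (use hyp_rel j in auto)
  have 2: "flip (u' j) = (\<Sum>i<r. if i = j then - u' j else 0)"
    unfolding flip_def by (rule sum.cong) (use hyp_rel j in \<open>auto simp: ac_minus\<close>)
  show "flip (u j) = u j" "flip (u' j) = - u' j" using j by (simp_all add: 1 2)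
qed

lemma flip_similitude: "similitude V (-1) flip"
proof -
  have "bij flip" by (rule o_bij[where g = flip]) (simp_all add: fun_eq_iff flip_flip)
  moreover have "h (flip z) (flip w) = - h z w" for z w
  proof -
    have "h (flip z) (flip w) = (\<Sum>i<r. - (h (u' i) z * h (u i) w + h (u i) z * h (u' i) w))"
      unfolding hyp_form[of "flip z"] by (rule sum.cong) (simp_all add: flip_coord)
    then show ?thesis unfolding hyp_form[of z w] by (simp only: sum_negf)
  qed
  ultimately show ?thesis by (simp add: similitude_def dlinear_flip)
qed

lemma flip_Upm: "flip \<in> Upm V"
  using flip_similitude Upm_iff by blast

lemma s2_minus1_eq: "s2_minus1 V r f f' = flip"
  unfolding s2_minus1_def ball_Suc
proof (rule the_equality)
  show "dlinear V flip \<and> (\<forall>j<r. flip (u j) = u j \<and> flip (u' j) = - u' j)"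
    by (simp add: dlinear_flip flip_u)
next
  fix g assume g: "dlinear V g \<and> (\<forall>j<r. g (u j) = u j \<and> g (u' j) = - u' j)"
  show "g = flip"
  proof
    fix z
    have "g z = g ((\<Sum>i<r. ac (h (u' i) z) (u i)) + (\<Sum>i<r. ac (h (u i) z) (u' i)))"
      using hyp_expand[of z] by (simp add: sum.distrib)
    also have "\<dots> = g (\<Sum>i<r. ac (h (u' i) z) (u i)) + g (\<Sum>i<r. ac (h (u i) z) (u' i))"
      using g unfolding dlinear_def by blast
    also have "\<dots> = (\<Sum>i<r. ac (h (u' i) z) (g (u i))) + (\<Sum>i<r. ac (h (u i) z) (g (u' i)))"
      by (simp only: dlinear_sum[OF conjunct1[OF g]])
    also have "\<dots> = flip z" unfolding flip_def sum.distrib[symmetric]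
      by (rule sum.cong) (use g in \<open>auto simp: ac_minus\<close>)
    finally show "g z = flip z" .
  qed
qed

lemma endo_det_flip: "endo_det V flip = (-1) ^ r"
proof -
  have "endo_det V flip = (\<Prod>j<r + r. if j < r then 1 else -1)"
    by (rule endo_det_diagonal[OF hyp_basis dlinear_flip]) (auto simp: flip_u ac_minus)
  also have "\<dots> = (-1) ^ r"
  proof -
    have "(\<Prod>j<r + n. if j < r then 1 else -1) = (-1 :: real) ^ n" for n by (induction n) auto
    then show ?thesis .
  qed
  finally show ?thesis .
qed

text \<open>An orthonormal basis of vectors of square \<open>1\<close> and \<open>-1\<close>, swapped by the flip.\<close>

definition pv :: "nat \<Rightarrow> 'v" where "pv i = u i + ac (1/2) (u' i)"
definition nv :: "nat \<Rightarrow> 'v" where "nv i = u i - ac (1/2) (u' i)"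

lemma pv_rel:
  assumes "i < r" "j < r"
  shows "h (pv i) (pv j) = (if i = j then 1 else 0)" "h (nv i) (nv j) = (if i = j then -1 else 0)"
    "h (pv i) (nv j) = 0" "h (nv i) (pv j) = 0"
  using hyp_rel[OF assms] by (simp_all add: pv_def nv_def h_add h_diff h_scale)

lemma flip_pv: "i < r \<Longrightarrow> flip (pv i) = nv i" "i < r \<Longrightarrow> flip (nv i) = pv i"
  using similitudeD(2,3,7)[OF flip_similitude] by (simp_all add: pv_def nv_def flip_u ac_minus)

lemma pv_form: "h z w = (\<Sum>i<r. h (pv i) z * h (pv i) w) - (\<Sum>i<r. h (nv i) z * h (nv i) w)"
  unfolding hyp_form[of z w] sum_subtractf[symmetric]
  by (rule sum.cong) (simp_all add: pv_def nv_def h_add h_diff h_scale algebra_simps)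

lemma orth_pv_nonpos: "(\<And>i. i < r \<Longrightarrow> h (pv i) z = 0) \<Longrightarrow> h z z \<le> 0"
  unfolding pv_form[of z z] by (simp add: sum_nonneg)

lemma orth_nv_nonneg: "(\<And>i. i < r \<Longrightarrow> h (nv i) z = 0) \<Longrightarrow> h z z \<ge> 0"
  unfolding pv_form[of z z] by (simp add: sum_nonneg)

text \<open>The positive part is kept and the negative part scaled by \<open>s\<close>; for \<open>0 \<le> s \<le> 1\<close> this joins the projection to the
  span of the \<open>pv i\<close> with the identity, and the square of \<open>damp s w\<close> is at least that of \<open>w\<close>.\<close>

definition damp :: "real \<Rightarrow> 'v \<Rightarrow> 'v" where
  "damp s w = (\<Sum>l<r. ac (h (pv l) w) (pv l)) - (\<Sum>l<r. ac (s * h (nv l) w) (nv l))"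

lemma pv_sum: "j < r \<Longrightarrow> h (pv j) (\<Sum>l<r. ac (c l) (pv l)) = c j" "j < r \<Longrightarrow> h (pv j) (\<Sum>l<r. ac (c l) (nv l)) = 0"
  "j < r \<Longrightarrow> h (nv j) (\<Sum>l<r. ac (c l) (pv l)) = 0" "j < r \<Longrightarrow> h (nv j) (\<Sum>l<r. ac (c l) (nv l)) = - c j"
proof -
  assume j: "j < r"
  show "h (pv j) (\<Sum>l<r. ac (c l) (pv l)) = c j" "h (nv j) (\<Sum>l<r. ac (c l) (nv l)) = - c j"
    unfolding h_sum(2) h_scale by (rule sum_indicator[OF j], simp add: pv_rel[OF j])+
  show "h (pv j) (\<Sum>l<r. ac (c l) (nv l)) = 0" "h (nv j) (\<Sum>l<r. ac (c l) (pv l)) = 0"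
    unfolding h_sum(2) h_scale by (rule sum.neutral, simp add: pv_rel[OF j])+
qed

lemma damp_coord: "j < r \<Longrightarrow> h (pv j) (damp s w) = h (pv j) w" "j < r \<Longrightarrow> h (nv j) (damp s w) = s * h (nv j) w"
  unfolding damp_def h_diff(2) by (simp_all add: pv_sum)

lemma damp_1: "damp 1 w = w"
proof -
  have "h (damp 1 w - w) z = 0" for z
    unfolding pv_form[of "damp 1 w - w" z] by (simp add: h_diff(2) damp_coord)
  then have "damp 1 w - w = 0" by (rule h_nondeg)
  then show ?thesis by simp
qed

lemma damp_add: "damp s (w + z) = damp s w + damp s z"
  and damp_scale: "damp s (ac d w) = ac d (damp s w)"
proof -
  have "h (damp s (w + z) - (damp s w + damp s z)) y = 0" for y
    unfolding pv_form[of "damp s (w + z) - (damp s w + damp s z)" y]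
    by (simp add: h_diff(2) h_add(2) damp_coord algebra_simps)
  then have "damp s (w + z) - (damp s w + damp s z) = 0" by (rule h_nondeg)
  then show "damp s (w + z) = damp s w + damp s z" by simp
  have "h (damp s (ac d w) - ac d (damp s w)) y = 0" for y
    unfolding pv_form[of "damp s (ac d w) - ac d (damp s w)" y]
    by (simp add: h_diff(2) h_scale damp_coord)
  then have "damp s (ac d w) - ac d (damp s w) = 0" by (rule h_nondeg)
  then show "damp s (ac d w) = ac d (damp s w)" by simp
qed

lemma dlinear_damp: "dlinear V (damp s)"
  by (simp add: dlinear_def damp_add damp_scale)

text \<open>The determinant of the block acting on the positive definite subspace spanned by the \<open>pv i\<close>; its sign is a
  character of the orthogonal group.\<close>

definition pblock :: "('v \<Rightarrow> 'v) \<Rightarrow> real" where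
  "pblock g = fdet r (\<lambda>i j. h (pv i) (g (pv j)))"

lemma U_dlinear: "g \<in> U V \<Longrightarrow> dlinear V g"
  by (simp add: U_iff similitude_def)

lemma U_form: "g \<in> U V \<Longrightarrow> h (g x) (g y) = h x y"
  using similitudeD(4)[of 1 g x y] by (simp add: U_iff)

lemma sum_squares_zero:
  assumes "(\<Sum>j<r. c j * c j :: real) \<le> 0" "j < r"
  shows "c j = 0"
proof -
  have "(\<Sum>j<r. c j * c j) = 0" by (intro antisym assms(1) sum_nonneg) simp
  then have "\<forall>j\<in>{..<r}. c j * c j = 0" by (subst (asm) sum_nonneg_eq_0_iff) auto
  then show ?thesis using assms(2) by simp
qed

text \<open>Insert \<open>damp s\<close> between the factors. At \<open>s = 0\<close> the block of the product is the product of the blocks. It stays invertible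
  along the way: a kernel vector would produce a vector that is mapped by the isometry \<open>g\<close> to the orthogonal complement of
  the \<open>pv i\<close>, where the form is nonpositive, although its square is at least that of a nonzero vector of the positive definite subspace.\<close>

lemma pblock_mult_sgn:
  assumes g: "g \<in> U V" and q: "q \<in> U V"
  shows "sgn (pblock (g \<circ> q)) = sgn (pblock g) * sgn (pblock q)"
proof -
  note gl = U_dlinear[OF g] and ql = U_dlinear[OF q]
  define a where "a s i j = h (pv i) (g (damp s (q (pv j))))" for s i j
  define D where "D i j = (\<Sum>l<r. h (pv i) (g (pv l)) * h (pv l) (q (pv j)))" for i j
  define Z where "Z i j = (\<Sum>l<r. h (nv l) (q (pv j)) * h (pv i) (g (nv l)))" for i j
  have gd: "g (x - y) = g x - g y" for x y using similitudeD(7)[of 1 g] g by (simp add: U_iff)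
  have a: "a s i j = D i j - s * Z i j" for s i j
  proof -
    have 1: "h (pv i) (g (\<Sum>l<r. ac (h (pv l) (q (pv j))) (pv l))) = D i j"
      unfolding dlinear_sum[OF gl] h_sum(2) h_scale D_def by (rule sum.cong) simp_all
    have 2: "h (pv i) (g (\<Sum>l<r. ac (s * h (nv l) (q (pv j))) (nv l))) = s * Z i j"
      unfolding dlinear_sum[OF gl] h_sum(2) h_scale Z_def sum_distrib_left by (rule sum.cong) simp_all
    show ?thesis unfolding a_def damp_def gd h_diff(2) 1 2 ..
  qed
  have "sgn (fdet r (a 0)) = sgn (fdet r (a 1))"
  proof (rule fdet_sgn_homotopy)
    show "continuous_on {0..1} (\<lambda>s. a s i j)" for i j unfolding a by (intro continuous_intros)
    show "fdet r (a s) \<noteq> 0" if s: "0 \<le> s" "s \<le> 1" for s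
    proof
      assume "fdet r (a s) = 0"
      then obtain c where c: "\<exists>i<r. c i \<noteq> 0" "\<And>i. i < r \<Longrightarrow> (\<Sum>j<r. a s i j * c j) = 0"
        unfolding fdet_eq_0_iff by blast
      let ?p = "\<Sum>j<r. ac (c j) (pv j)"
      let ?w = "q ?p"
      let ?y = "damp s ?w"
      have y: "g ?y = (\<Sum>j<r. ac (c j) (g (damp s (q (pv j)))))"
        by (simp only: dlinear_sum[OF ql] dlinear_sum[OF dlinear_damp] dlinear_sum[OF gl])
      have "h (pv i) (g ?y) = (\<Sum>j<r. a s i j * c j)" for i
        unfolding y h_sum(2) h_scale a_def by (simp only: mult.commute)
      then have "h (g ?y) (g ?y) \<le> 0" by (intro orth_pv_nonpos) (simp add: c(2))
      then have "h ?y ?y \<le> 0" by (simp add: U_form[OF g])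
      then have 1: "(\<Sum>l<r. h (pv l) ?w * h (pv l) ?w) - s * s * (\<Sum>l<r. h (nv l) ?w * h (nv l) ?w) \<le> 0"
        unfolding pv_form[of ?y ?y] by (simp add: damp_coord sum_distrib_left mult.assoc mult.left_commute)
      have "h ?w ?w = (\<Sum>j<r. c j * c j)"
        unfolding U_form[OF q] pv_form[of ?p ?p] by (simp add: pv_sum)
      then have 2: "(\<Sum>j<r. c j * c j) = (\<Sum>l<r. h (pv l) ?w * h (pv l) ?w) - (\<Sum>l<r. h (nv l) ?w * h (nv l) ?w)"
        using pv_form[of ?w ?w] by simp
      have n: "(\<Sum>l<r. h (nv l) ?w * h (nv l) ?w) \<ge> 0" by (intro sum_nonneg) simp
      have "s * s \<le> 1" using s mult_le_one[of s s] by simp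
      then have "s * s * (\<Sum>l<r. h (nv l) ?w * h (nv l) ?w) \<le> 1 * (\<Sum>l<r. h (nv l) ?w * h (nv l) ?w)"
        by (rule mult_right_mono[OF _ n])
      then have "(\<Sum>j<r. c j * c j) \<le> 0" using 1 2 by linarith
      then show False using sum_squares_zero c(1) by blast
    qed
  qed
  moreover have "fdet r (a 0) = pblock g * pblock q"
    unfolding pblock_def fdet_mult[symmetric] by (rule fdet_cong) (simp add: a D_def)
  moreover have "fdet r (a 1) = pblock (g \<circ> q)"
    unfolding pblock_def by (rule fdet_cong) (simp add: a_def damp_1)
  ultimately show ?thesis by (simp add: sgn_mult)
qed

lemma pblock_id: "pblock id = 1"
proof -
  have "pblock id = fdet r (\<lambda>i j. if i = j then 1 else 0)"
    unfolding pblock_def by (rule fdet_cong) (simp add: pv_rel)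
  then show ?thesis by (simp add: fdet_delta)
qed

lemma pblock_nonzero:
  assumes g: "g \<in> U V"
  shows "pblock g \<noteq> 0"
proof
  assume 0: "pblock g = 0"
  have "g \<circ> inv_into UNIV g = id"
    using Upm_inv_id(2)[OF U_Upm[OF g]] by (simp add: fun_eq_iff)
  then show False using pblock_mult_sgn[OF g U_inv[OF g]] by (simp add: 0 pblock_id)
qed

lemma pv_basis: "ibasis (r + r) (\<lambda>i. if i < r then pv i else nv (i - r))"
proof (rule ibasisI)
  fix w
  have "w = (\<Sum>l<r. ac (h (pv l) w) (pv l)) + (\<Sum>l<r. ac (- h (nv l) w) (nv l))"
    using damp_1[of w] unfolding damp_def by (simp add: ac_minus sum_negf)
  then have "w = (\<Sum>i<r + r. ac (if i < r then h (pv i) w else - h (nv (i - r)) w) (if i < r then pv i else nv (i - r)))"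
    unfolding sum_split by simp
  then show "\<exists>c. w = (\<Sum>i<r + r. ac (c i) (if i < r then pv i else nv (i - r)))"
    by (rule exI[of _ "\<lambda>i. if i < r then h (pv i) w else - h (nv (i - r)) w"])
next
  fix c i
  assume "(\<Sum>i<r + r. ac (c i) (if i < r then pv i else nv (i - r))) = 0" and i: "i < r + r"
  then have z: "(\<Sum>i<r. ac (c i) (pv i)) + (\<Sum>i<r. ac (c (r + i)) (nv i)) = 0" by (simp add: sum_split)
  have 1: "c j = 0" if j: "j < r" for j
  proof -
    have "h (pv j) ((\<Sum>i<r. ac (c i) (pv i)) + (\<Sum>i<r. ac (c (r + i)) (nv i))) = c j"
      unfolding h_add(2) pv_sum[OF j] by simp
    then show ?thesis unfolding z by simp
  qed
  have 2: "c (r + j) = 0" if j: "j < r" for j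
  proof -
    have "h (nv j) ((\<Sum>i<r. ac (c i) (pv i)) + (\<Sum>i<r. ac (c (r + i)) (nv i))) = - c (r + j)"
      unfolding h_add(2) pv_sum(3,4)[OF j] by simp
    then show ?thesis unfolding z by simp
  qed
  show "c i = 0"
  proof (cases "i < r")
    case False
    then have "i - r < r" "r + (i - r) = i" using i by linarith+
    then show ?thesis using 2[of "i - r"] by simp
  qed (rule 1)
qed

text \<open>Scale the off-diagonal blocks with respect to the \<open>pv i\<close> and the \<open>nv i\<close> from \<open>1\<close> down to \<open>0\<close>. A kernel vector with
  parts \<open>c\<close>, \<open>d\<close> at scale \<open>s\<close> would satisfy \<open>\<bar>c\<bar>\<^sup>2 \<le> s\<^sup>2 \<bar>d\<bar>\<^sup>2\<close> and \<open>\<bar>d\<bar>\<^sup>2 \<le> s\<^sup>2 \<bar>c\<bar>\<^sup>2\<close>, because an isometry maps a certain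
  combination into a negative, respectively positive, semidefinite subspace; so it vanishes for \<open>s < 1\<close>. Conjugation by the
  flip exchanges the two diagonal blocks up to a sign.\<close>

lemma endo_det_sgn:
  assumes q: "q \<in> U V"
  shows "sgn (endo_det V q) = sgn (pblock q) * sgn (pblock (flip \<circ> q \<circ> flip))"
proof -
  note ql = U_dlinear[OF q]
  let ?B = "\<lambda>i. if i < r then pv i else nv (i - r)"
  define \<sigma> where "\<sigma> i = (if i < r then 1 else -1 :: real)" for i
  define a where "a s i j = \<sigma> i * (if (i < r) = (j < r) then 1 else s) * h (?B i) (q (?B j))" for s i j
  have coord: "x = (\<Sum>i<r + r. ac (\<sigma> i * h (?B i) x) (?B i))" for x
  proof -
    have "x = (\<Sum>l<r. ac (h (pv l) x) (pv l)) + (\<Sum>l<r. ac (- h (nv l) x) (nv l))"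
      using damp_1[of x] unfolding damp_def by (simp add: ac_minus sum_negf)
    then show ?thesis unfolding sum_split by (simp add: \<sigma>_def)
  qed
  have det1: "endo_det V q = fdet (r + r) (a 1)"
  proof (rule endo_det_eq[OF pv_basis ql])
    fix j
    have "q (?B j) = (\<Sum>i<r + r. ac (\<sigma> i * h (?B i) (q (?B j))) (?B i))" by (rule coord)
    then show "q (?B j) = (\<Sum>i<r + r. ac (a 1 i j) (?B i))" unfolding a_def by simp
  qed
  have "sgn (fdet (r + r) (a 0)) = sgn (fdet (r + r) (a 1))"
  proof (rule fdet_sgn_homotopy)
    show "continuous_on {0..1} (\<lambda>s. a s i j)" for i j
      unfolding a_def by (cases "(i < r) = (j < r)") (auto intro!: continuous_intros)
    show "fdet (r + r) (a s) \<noteq> 0" if s: "0 \<le> s" "s \<le> 1" for s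
    proof (cases "s = 1")
      case True
      then show ?thesis using endo_det_nonzero[OF U_Upm[OF q]] det1 by simp
    next
      case False
      then have s1: "s < 1" using s by simp
      show ?thesis
      proof
        assume "fdet (r + r) (a s) = 0"
        then obtain c where c: "\<exists>i<r + r. c i \<noteq> 0" "\<And>i. i < r + r \<Longrightarrow> (\<Sum>j<r + r. a s i j * c j) = 0"
          unfolding fdet_eq_0_iff by blast
        let ?x = "\<Sum>j<r. ac (c j) (pv j)" and ?y = "\<Sum>j<r. ac (c (r + j)) (nv j)"
        have qa: "q (x + y) = q x + q y" "q (ac d x) = ac d (q x)" for x y d using ql by (auto simp: dlinear_def)
        have hx: "h z (q ?x) = (\<Sum>j<r. c j * h z (q (pv j)))"
          and hy: "h z (q ?y) = (\<Sum>j<r. c (r + j) * h z (q (nv j)))" for z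
          by (simp_all only: dlinear_sum[OF ql] h_sum(2) h_scale)
        have P: "h (pv i) (q (?x + ac s ?y)) = 0" if i: "i < r" for i
        proof -
          have "(\<Sum>j<r + r. a s i j * c j) = h (pv i) (q ?x) + s * h (pv i) (q ?y)"
            unfolding hx hy sum_split using i
            by (simp add: a_def \<sigma>_def sum_distrib_left mult.commute mult.left_commute)
          then show ?thesis using c(2)[of i] i by (simp add: qa h_add h_scale)
        qed
        have Q: "h (nv i) (q (ac s ?x + ?y)) = 0" if i: "i < r" for i
        proof -
          have "(\<Sum>j<r + r. a s (r + i) j * c j) = - (s * h (nv i) (q ?x) + h (nv i) (q ?y))"
            unfolding hx hy sum_split using i
            by (simp add: a_def \<sigma>_def sum_distrib_left sum_negf mult.commute mult.left_commute)
          then show ?thesis using c(2)[of "r + i"] i by (simp add: qa h_add h_scale)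
        qed
        let ?X = "\<Sum>j<r. c j * c j" and ?Y = "\<Sum>j<r. c (r + j) * c (r + j)"
        have xx: "h ?x ?x = ?X" "h ?y ?y = - ?Y" "h ?x ?y = 0" "h ?y ?x = 0"
          unfolding pv_form[of ?x ?x] pv_form[of ?y ?y] pv_form[of ?x ?y] pv_form[of ?y ?x] by (simp_all add: pv_sum)
        have "h (q (?x + ac s ?y)) (q (?x + ac s ?y)) \<le> 0" by (rule orth_pv_nonpos[OF P])
        then have 1: "?X \<le> s * s * ?Y" by (simp add: U_form[OF q] h_add h_scale xx)
        have "h (q (ac s ?x + ?y)) (q (ac s ?x + ?y)) \<ge> 0" by (rule orth_nv_nonneg[OF Q])
        then have 2: "?Y \<le> s * s * ?X" by (simp add: U_form[OF q] h_add h_scale xx)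
        have ss: "0 \<le> s * s" "s * s < 1" using s s1 mult_strict_mono'[of s 1 s 1] by auto
        have X0: "?X \<ge> 0" and Y0: "?Y \<ge> 0" by (auto intro: sum_nonneg)
        have "?Y \<le> ?X" using 2 mult_right_mono[of "s * s" 1 ?X] ss X0 by linarith
        then have "?X \<le> s * s * ?X" using 1 mult_left_mono[of ?Y ?X "s * s"] ss by linarith
        then have "(1 - s * s) * ?X \<le> 0" by (simp add: left_diff_distrib)
        then have X: "?X \<le> 0" using ss by (simp add: mult_le_0_iff)
        then have Y: "?Y \<le> 0" using \<open>?Y \<le> ?X\<close> by linarith
        obtain i where i: "i < r + r" "c i \<noteq> 0" using c(1) by blast
        show False
        proof (cases "i < r")
          case True
          then show False using sum_squares_zero[OF X] i by blast
        next
          case False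
          then have "i - r < r" "r + (i - r) = i" using i by linarith+
          then show False using sum_squares_zero[OF Y, of "i - r"] i by simp
        qed
      qed
    qed
  qed
  moreover have "fdet (r + r) (a 0) = pblock q * fdet r (\<lambda>i j. - h (nv i) (q (nv j)))"
    unfolding pblock_def fdet_block[symmetric] by (rule fdet_cong) (auto simp: a_def \<sigma>_def)
  moreover have "fdet r (\<lambda>i j. - h (nv i) (q (nv j))) = pblock (flip \<circ> q \<circ> flip)"
    unfolding pblock_def
  proof (rule fdet_cong)
    fix i j assume ij: "i < r" "j < r"
    have "h (flip (nv i)) (flip (q (nv j))) = - h (nv i) (q (nv j))"
      using similitudeD(4)[OF flip_similitude, of "nv i" "q (nv j)"] by simp
    then show "- h (nv i) (q (nv j)) = h (pv i) ((flip \<circ> q \<circ> flip) (pv j))"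
      using ij by (simp add: flip_pv)
  qed
  ultimately show ?thesis by (simp add: det1 sgn_mult)
qed

text \<open>The relation is that of a cochain trivialising the sign cocycle on the right. For even \<open>k\<close> only the factor \<open>uu\<close>
  matters and is absorbed by a square root. For odd \<open>k\<close> take the character \<open>X = sgn pblock\<close> on isometries and \<open>c X(g flip)\<close> on
  anti-isometries: conjugation by the flip multiplies \<open>X\<close> by the sign of the determinant, and \<open>c\<close> is a square root of \<open>uu\<close> times the sign of
  the determinant of the flip.\<close>

lemma twisted_character:
  assumes uu: "uu = 1 \<or> uu = (-1 :: complex)"
  shows "\<exists>\<beta>. \<beta> id = 1 \<and> (\<forall>g\<in>Upm V. cmod (\<beta> g) = 1) \<and>
    (\<forall>g\<in>Upm V. \<forall>g'\<in>Upm V. \<beta> g * \<beta> g' = (if sim_factor V g' = -1 then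
        (if sim_factor V g = -1 then uu else 1) * sg (endo_det V g ^ k) else 1) * \<beta> (g' \<circ> g))"
proof -
  have fid: "sim_factor V id = 1" using sim_factor_eq[of 1 id] U_id by (simp add: U_iff)
  note sfc = sim_factor_comp
  have cases: "sim_factor V g = 1 \<or> sim_factor V g = -1" if "g \<in> Upm V" for g using Upm_sim(2)[OF that] .
  have fl: "sim_factor V flip = -1" by (rule sim_factor_eq[OF flip_similitude])
  show ?thesis
  proof (cases "even k")
    case True
    define c where "c = (if uu = 1 then 1 else \<i>)"
    have c: "c * c = uu" "cmod c = 1" using uu by (auto simp: c_def)
    have sg: "sg (endo_det V g ^ k) = 1" if "g \<in> Upm V" for g
    proof -
      have "endo_det V g ^ k > 0" using endo_det_nonzero[OF that] True by (simp add: zero_less_power_eq)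
      then show ?thesis unfolding sg_def by (simp only: sgn_pos of_real_1)
    qed
    let ?\<beta> = "\<lambda>g. if sim_factor V g = 1 then 1 else c"
    have "?\<beta> g * ?\<beta> g' = (if sim_factor V g' = -1 then
        (if sim_factor V g = -1 then uu else 1) * sg (endo_det V g ^ k) else 1) * ?\<beta> (g' \<circ> g)"
      if g: "g \<in> Upm V" and g': "g' \<in> Upm V" for g g'
      using cases[OF g] cases[OF g'] by (auto simp: sg[OF g] sfc[OF g' g] c)
    then show ?thesis using c(2) fid by (intro exI[of _ ?\<beta>]) simp
  next
    case False
    then have k: "odd k" .
    define X where "X g = sg (pblock g)" for g
    define A where "A g = sg (endo_det V g)" for g
    have Xm: "X (g \<circ> q) = X g * X q" if "g \<in> U V" "q \<in> U V" for g q
      using pblock_mult_sgn[OF that] by (simp add: X_def sg_def)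
    have X1: "X g * X g = 1" if "g \<in> U V" for g unfolding X_def by (rule sg_sq[OF pblock_nonzero[OF that]])
    have XA: "X q * X (flip \<circ> q \<circ> flip) = A q" if "q \<in> U V" for q
      using endo_det_sgn[OF that] by (simp add: X_def A_def sg_def)
    have A1: "A g * A g = 1" if "g \<in> Upm V" for g unfolding A_def by (rule sg_sq[OF endo_det_nonzero[OF that]])
    have Am: "A (g \<circ> q) = A g * A q" if "g \<in> Upm V" "q \<in> Upm V" for g q
      by (simp add: A_def endo_det_mult[OF that] sg_mult)
    have Ak: "sg (endo_det V g ^ k) = A g" if "g \<in> Upm V" for g
    proof -
      have "sg (endo_det V g ^ k) = A g ^ k" by (simp add: A_def sg_def)
      moreover have "A g = 1 \<or> A g = -1" using A1[OF that] by (simp add: square_eq_1_iff)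
      ultimately show ?thesis using k by auto
    qed
    have X0: "X (flip \<circ> q \<circ> flip) = A q * X q" if "q \<in> U V" for q
    proof -
      have "X (flip \<circ> q \<circ> flip) = (X q * X q) * X (flip \<circ> q \<circ> flip)" by (simp add: X1[OF that])
      also have "\<dots> = X q * A q" by (simp only: XA[OF that, symmetric] mult.assoc)
      finally show ?thesis by (simp add: mult.commute)
    qed
    have Af: "A flip = 1 \<or> A flip = -1" using A1[OF flip_Upm] by (simp add: square_eq_1_iff)
    define c where "c = (if uu * A flip = 1 then 1 else \<i>)"
    have c: "c * c = uu * A flip" "cmod c = 1" using uu Af by (auto simp: c_def)
    let ?\<beta> = "\<lambda>g. if sim_factor V g = 1 then X g else c * X (g \<circ> flip)"
    have U1: "g \<in> U V" if "g \<in> Upm V" "sim_factor V g = 1" for g using sim_factor_U that by blast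
    have Uf: "g \<circ> flip \<in> U V" "flip \<circ> g \<in> U V" if "g \<in> Upm V" "sim_factor V g = -1" for g
      using sim_factor_U[OF Upm_comp[OF that(1) flip_Upm]] sim_factor_U[OF Upm_comp[OF flip_Upm that(1)]]
        sfc[OF that(1) flip_Upm] sfc[OF flip_Upm that(1)] that(2) fl by auto
    have ff: "flip \<circ> flip = id" by (simp add: fun_eq_iff flip_flip)
    have cX: "cmod (X g) = 1" if "g \<in> U V" for g
      using X1[OF that] by (auto simp: square_eq_1_iff)
    have "cmod (?\<beta> g) = 1" if g: "g \<in> Upm V" for g
      using cases[OF g] cX[OF U1[OF g]] cX[OF Uf(1)[OF g]] by (auto simp: norm_mult c)
    moreover have "?\<beta> g * ?\<beta> g' = (if sim_factor V g' = -1 then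
        (if sim_factor V g = -1 then uu else 1) * sg (endo_det V g ^ k) else 1) * ?\<beta> (g' \<circ> g)"
      if g: "g \<in> Upm V" and g': "g' \<in> Upm V" for g g'
    proof -
      consider (pp) "sim_factor V g = 1" "sim_factor V g' = 1" | (pm) "sim_factor V g = 1" "sim_factor V g' = -1"
        | (mp) "sim_factor V g = -1" "sim_factor V g' = 1" | (mm) "sim_factor V g = -1" "sim_factor V g' = -1"
        using cases[OF g] cases[OF g'] by blast
      then show ?thesis
      proof cases
        case pp
        then show ?thesis using Xm[OF U1[OF g'] U1[OF g]] by (simp add: sfc[OF g' g] mult.commute)
      next
        case pm
        let ?q = "flip \<circ> g \<circ> flip"
        have gU: "g \<in> U V" by (rule U1[OF g pm(1)])
        have qP: "?q \<in> Upm V" using Upm_comp[OF Upm_comp[OF flip_Upm g] flip_Upm] .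
        have "sim_factor V ?q = 1"
          using sfc[OF Upm_comp[OF flip_Upm g] flip_Upm] sfc[OF flip_Upm g] fl pm by simp
        then have qU: "?q \<in> U V" by (rule U1[OF qP])
        have e: "(g' \<circ> flip) \<circ> ?q = (g' \<circ> g) \<circ> flip" by (simp add: fun_eq_iff flip_flip)
        have "X ((g' \<circ> g) \<circ> flip) = X (g' \<circ> flip) * (A g * X g)"
          using Xm[OF Uf(1)[OF g' pm(2)] qU] unfolding e X0[OF gU] .
        then have "A g * (c * X ((g' \<circ> g) \<circ> flip)) = (A g * A g) * (X g * (c * X (g' \<circ> flip)))"
          by (simp add: mult.assoc mult.left_commute)
        then have "X g * (c * X (g' \<circ> flip)) = A g * (c * X ((g' \<circ> g) \<circ> flip))"
          by (simp only: A1[OF g] mult_1_left)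
        then show ?thesis using pm by (simp add: sfc[OF g' g] Ak[OF g])
      next
        case mp
        have e: "g' \<circ> (g \<circ> flip) = (g' \<circ> g) \<circ> flip" by (simp add: o_assoc)
        have "X ((g' \<circ> g) \<circ> flip) = X g' * X (g \<circ> flip)"
          using Xm[OF U1[OF g' mp(2)] Uf(1)[OF g mp(1)]] unfolding e .
        then show ?thesis using mp by (simp add: sfc[OF g' g] mult.commute mult.left_commute)
      next
        case mm
        let ?q = "g \<circ> flip"
        note qU = Uf(1)[OF g mm(1)]
        have e1: "flip \<circ> ?q \<circ> flip = flip \<circ> g" by (simp add: fun_eq_iff flip_flip)
        have e2: "(g' \<circ> flip) \<circ> (flip \<circ> g) = g' \<circ> g" by (simp add: fun_eq_iff flip_flip)
        have "X (flip \<circ> g) = A ?q * X ?q" using X0[OF qU] unfolding e1 .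
        then have 1: "X (g' \<circ> g) = X (g' \<circ> flip) * ((A g * A flip) * X ?q)"
          using Xm[OF Uf(1)[OF g' mm(2)] Uf(2)[OF g mm(1)]] unfolding e2 Am[OF g flip_Upm] by simp
        have "uu * A g * X (g' \<circ> g) = (A g * A g) * (uu * A flip) * (X ?q * X (g' \<circ> flip))"
          unfolding 1 by (simp only: ac_simps)
        also have "\<dots> = (c * X ?q) * (c * X (g' \<circ> flip))"
          unfolding A1[OF g] c(1)[symmetric] by (simp only: ac_simps mult_1_left)
        finally show ?thesis using mm by (simp add: sfc[OF g' g] Ak[OF g])
      qed
    qed
    moreover have "?\<beta> id = 1" using fid by (simp add: X_def pblock_id sg_def)
    ultimately show ?thesis by (intro exI[of _ ?\<beta>]) blast
  qed
qed

end

section \<open>Commutation and splitting for orthogonal groups\<close>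

context hyperbolic
begin

lemma group_right_Upm: "group (right_Upm_group V)"
proof (rule groupI)
  fix x assume "x \<in> carrier (right_Upm_group V)"
  then have x: "x \<in> Upm V" by (simp add: right_Upm_group_def)
  have "rmult (inv_into UNIV x) x = id"
    using Upm_inv_id(2)[OF x] by (simp add: rmult_def fun_eq_iff)
  then show "\<exists>y\<in>carrier (right_Upm_group V). y \<otimes>\<^bsub>right_Upm_group V\<^esub> x = \<one>\<^bsub>right_Upm_group V\<^esub>"
    using Upm_inv[OF x] by (intro bexI[of _ "inv_into UNIV x"]) (simp_all add: right_Upm_group_def)
qed (simp_all add: right_Upm_group_def rmult_def Upm_comp U_Upm U_id o_assoc)

lemma SO_U: "g \<in> SO V \<Longrightarrow> g \<in> U V" "g \<in> SO V \<Longrightarrow> endo_det V g = 1"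
  by (simp_all add: SO_def)

lemma SOpm_incl: "SO V \<subseteq> SOpm V r f f'" "flip \<in> SOpm V r f f'" "SOpm V r f f' \<subseteq> Upm V"
proof -
  show "SO V \<subseteq> SOpm V r f f'" "flip \<in> SOpm V r f f'"
    unfolding SOpm_def s2_minus1_eq by (auto intro: generate.incl)
  have "SO V \<union> {flip} \<subseteq> carrier (right_Upm_group V)"
    using U_Upm[OF SO_U(1)] flip_Upm unfolding right_Upm_group_def by (simp add: subset_iff)
  from group.generate_incl[OF group_right_Upm this] show "SOpm V r f f' \<subseteq> Upm V"
    unfolding SOpm_def s2_minus1_eq by (simp add: right_Upm_group_def)
qed

text \<open>The generators lie in the subgroup of positive determinant: \<open>s\<^sub>2(-1)\<close> has determinant \<open>(-1)\<^sup>r\<close>.\<close>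

lemma SOpm_det_pos:
  assumes r: "even r" and g: "g \<in> SOpm V r f f'"
  shows "endo_det V g > 0"
proof -
  let ?G = "right_Upm_group V"
  let ?I = "{g \<in> Upm V. endo_det V g > 0}"
  interpret G: group ?G by (rule group_right_Upm)
  have sub: "subgroup ?I ?G"
  proof
    show "?I \<subseteq> carrier ?G" by (auto simp: right_Upm_group_def)
    show "x \<otimes>\<^bsub>?G\<^esub> y \<in> ?I" if "x \<in> ?I" "y \<in> ?I" for x y
      using that by (simp add: right_Upm_group_def rmult_def Upm_comp endo_det_mult)
    show "\<one>\<^bsub>?G\<^esub> \<in> ?I" by (simp add: right_Upm_group_def U_Upm U_id endo_det_1)
    show "inv\<^bsub>?G\<^esub> x \<in> ?I" if x: "x \<in> ?I" for x
    proof -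
      have xc: "x \<in> carrier ?G" using x by (simp add: right_Upm_group_def)
      have i: "inv\<^bsub>?G\<^esub> x \<in> Upm V" using G.inv_closed[OF xc] by (simp add: right_Upm_group_def)
      have "x \<circ> inv\<^bsub>?G\<^esub> x = id" using G.l_inv[OF xc] by (simp add: right_Upm_group_def rmult_def)
      then have "endo_det V x * endo_det V (inv\<^bsub>?G\<^esub> x) = 1"
        using endo_det_mult[of x "inv\<^bsub>?G\<^esub> x"] x i by (simp add: endo_det_1)
      then have "0 < endo_det V x * endo_det V (inv\<^bsub>?G\<^esub> x)" by simp
      then have "0 < endo_det V (inv\<^bsub>?G\<^esub> x)" by (rule zero_less_mult_pos) (use x in simp)
      then show ?thesis using i by simp
    qed
  qed
  have "SO V \<union> {flip} \<subseteq> ?I"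
  proof
    fix x assume "x \<in> SO V \<union> {flip}"
    then consider "x \<in> SO V" | "x = flip" by blast
    then show "x \<in> ?I"
    proof cases
      case 1
      then show ?thesis using U_Upm[OF SO_U(1)] SO_U(2) by simp
    next
      case 2
      then show ?thesis using flip_Upm r by (simp add: endo_det_flip)
    qed
  qed
  from G.generate_subgroup_incl[OF this sub] show ?thesis
    using g unfolding SOpm_def s2_minus1_eq by blast
qed

end

context real_pair
begin

text \<open>The cocycle is computed on the stabiliser of the fixed Lagrangian of an anti-symplectic
  involution; there it is the coboundary of the Leray index times an explicit sign cocycle.\<close>

lemma hat2_splits_hyperbolic:
  assumes hyp: "hyperbolic_basis V2 r f f'"
  shows "hat2_splits S t V2"
proof -
  interpret Q2: quadratic_space V2 by (rule quadratic_space_V2)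
  interpret Y: hyperbolic V2 r f f' by unfold_locales (rule hyp)
  obtain s k b where s: "s \<in> Upm V1" "sim_factor V1 s = -1" "s \<circ> s = id" "ddim V1 = 2 * k"
    and b: "lframe b" "lspan b = {w. emb1 t s w = w}"
    and d: "\<And>g. g \<in> Upm V2 \<Longrightarrow> fdt b (emb2 t g) = endo_det V2 g ^ k" by (rule anti_symplectic) blast
  have st: "stab b (emb2 t g)" if g: "g \<in> Upm V2" for g
    by (rule stab_involution[OF emb2_Sppm(1)[OF g] emb_commute[OF s(1) g] b(2)])
  have uu: "et * xi b = 1 \<or> et * xi b = -1" using et_cases xi_cases[OF b(1)] by auto
  obtain \<beta>0 where \<beta>0: "\<beta>0 id = 1" "\<And>g. g \<in> Upm V2 \<Longrightarrow> cmod (\<beta>0 g) = 1"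
    "\<And>g g'. g \<in> Upm V2 \<Longrightarrow> g' \<in> Upm V2 \<Longrightarrow> \<beta>0 g * \<beta>0 g' = (if sim_factor V2 g' = -1 then
        (if sim_factor V2 g = -1 then et * xi b else 1) * sg (endo_det V2 g ^ k) else 1) * \<beta>0 (g' \<circ> g)"
    using Y.twisted_character[OF uu, of k] by blast
  define \<beta> where "\<beta> g = pz (es (- p b (emb2 t g)) * \<beta>0 g)" for g
  have mult: "\<beta> g * \<beta> g' = C_tilde S (emb2 t g) (emb2 t g') * \<beta> (g' \<circ> g)"
    if g: "g \<in> Upm V2" and g': "g' \<in> Upm V2" for g g'
  proof -
    let ?p1 = "p b (emb2 t g)" and ?p2 = "p b (emb2 t g')" and ?p12 = "p b (emb2 t (g' \<circ> g))"
    have K: "K (emb2 t g) (emb2 t g') = (if sim_factor V2 g' = -1 then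
        (if sim_factor V2 g = -1 then et * xi b else 1) * sg (endo_det V2 g ^ k) else 1) * es (?p12 - ?p1 - ?p2)"
      using K_stab[OF b(1) st[OF g] st[OF g']] by (simp only: emb2_Sppm(2)[OF g] emb2_Sppm(2)[OF g'] d[OF g] emb2_comp[OF g' g])
    have "es (- ?p1) * es (- ?p2) = es (?p12 - ?p1 - ?p2) * es (- ?p12)"
      unfolding es_add[symmetric] by simp
    then have "(es (- ?p1) * es (- ?p2)) * (\<beta>0 g * \<beta>0 g') = K (emb2 t g) (emb2 t g') * (es (- ?p12) * \<beta>0 (g' \<circ> g))"
      unfolding K \<beta>0(3)[OF g g'] by (simp only: ac_simps)
    then have "(es (- ?p1) * \<beta>0 g) * (es (- ?p2) * \<beta>0 g') = K (emb2 t g) (emb2 t g') * (es (- ?p12) * \<beta>0 (g' \<circ> g))"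
      by (simp only: ac_simps)
    then show ?thesis
      unfolding \<beta>_def C_tilde_eq[OF emb2_Sppm(1)[OF g] emb2_Sppm(1)[OF g']] pz_simps(1)[symmetric] by (simp only:)
  qed
  have norm: "cmod (\<beta> g) = 1" if "g \<in> Upm V2" for g
    using \<beta>0(2)[OF that] by (simp add: \<beta>_def pz_def norm_mult)
  have "p b id = 0" unfolding p_def by (rule leray_degenerate) (simp_all add: lframe_ff b(1))
  then have \<beta>1: "\<beta> id = 1" by (simp add: \<beta>_def emb2_id \<beta>0(1) pz_simps(2))
  define G where "G = inv_into (Upm V2) (emb2 t)"
  have inj: "inj_on (emb2 t) (Upm V2)" using emb2_inj by (rule inj_onI)
  have G: "G (emb2 t g) = g" if "g \<in> Upm V2" for g unfolding G_def by (rule inv_into_f_f[OF inj that])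
  define \<phi> where "\<phi> = (\<lambda>x. (G (fst x), snd x * \<beta> (G (fst x))))"
  have \<phi>: "\<phi> (emb2 t g, z) = (g, z * \<beta> g)" if "g \<in> Upm V2" for g z by (simp add: \<phi>_def G[OF that])
  let ?A = "(Sppm_hat S)\<lparr>carrier := hat2 t (Upm V2)\<rparr>" and ?B = "right_Upm_group V2 \<times>\<times> circle_group"
  have cA: "carrier ?A = hat2 t (Upm V2)" and cB: "carrier ?B = Upm V2 \<times> circle"
    by (simp_all add: right_Upm_group_def circle_group_def DirProd_def)
  have elem: "\<exists>g z. x = (emb2 t g, z) \<and> g \<in> Upm V2 \<and> z \<in> circle" if "x \<in> hat2 t (Upm V2)" for x
    using that by (auto simp: hat2_def)
  have circ: "z * \<beta> g \<in> circle" "z * inverse (\<beta> g) \<in> circle" if "z \<in> circle" "g \<in> Upm V2" for z g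
    using that norm[OF that(2)] by (simp_all add: circle_def norm_mult norm_inverse)
  have nz: "\<beta> g \<noteq> 0" if "g \<in> Upm V2" for g using norm[OF that] by auto
  have to: "\<phi> x \<in> Upm V2 \<times> circle" if "x \<in> hat2 t (Upm V2)" for x
    using elem[OF that] circ(1) \<phi> by fastforce
  have hom: "\<phi> \<in> hom ?A ?B"
  proof (rule homI)
    show "\<phi> x \<in> carrier ?B" if "x \<in> carrier ?A" for x using to that unfolding cA cB .
    fix x y assume "x \<in> carrier ?A" "y \<in> carrier ?A"
    then obtain g z g' z' where x: "x = (emb2 t g, z)" "g \<in> Upm V2" and y: "y = (emb2 t g', z')" "g' \<in> Upm V2"
      unfolding cA using elem by metis
    have gg: "g' \<circ> g \<in> Upm V2" by (rule Q2.Upm_comp[OF y(2) x(2)])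
    have "x \<otimes>\<^bsub>?A\<^esub> y = (emb2 t (g' \<circ> g), z * z' * C_tilde S (emb2 t g) (emb2 t g'))"
      by (simp add: x(1) y(1) Sppm_hat_def rmult_def emb2_comp[OF y(2) x(2)])
    then have "\<phi> (x \<otimes>\<^bsub>?A\<^esub> y) = (g' \<circ> g, z * z' * (\<beta> g * \<beta> g'))"
      by (simp add: \<phi>[OF gg] mult[OF x(2) y(2)] mult.assoc)
    then show "\<phi> (x \<otimes>\<^bsub>?A\<^esub> y) = \<phi> x \<otimes>\<^bsub>?B\<^esub> \<phi> y"
      by (simp add: x(1) y(1) \<phi>[OF x(2)] \<phi>[OF y(2)] DirProd_def right_Upm_group_def circle_group_def rmult_def ac_simps)
  qed
  have "bij_betw \<phi> (hat2 t (Upm V2)) (Upm V2 \<times> circle)"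
  proof (rule bij_betwI[where g = "\<lambda>x. (emb2 t (fst x), snd x * inverse (\<beta> (fst x)))"])
    show "\<phi> \<in> hat2 t (Upm V2) \<rightarrow> Upm V2 \<times> circle" using to by blast
    show "(\<lambda>x. (emb2 t (fst x), snd x * inverse (\<beta> (fst x)))) \<in> Upm V2 \<times> circle \<rightarrow> hat2 t (Upm V2)"
      using circ(2) by (auto simp: hat2_def)
    show "(emb2 t (fst (\<phi> x)), snd (\<phi> x) * inverse (\<beta> (fst (\<phi> x)))) = x" if xh: "x \<in> hat2 t (Upm V2)" for x
    proof -
      obtain g z where x: "x = (emb2 t g, z)" "g \<in> Upm V2" using elem[OF xh] by blast
      show ?thesis by (simp add: x(1) \<phi>[OF x(2)] nz[OF x(2)])
    qed
    show "\<phi> (emb2 t (fst y), snd y * inverse (\<beta> (fst y))) = y" if yh: "y \<in> Upm V2 \<times> circle" for y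
    proof -
      have y: "fst y \<in> Upm V2" using yh by auto
      show ?thesis by (simp add: \<phi>[OF y] mult.assoc left_inverse[OF nz[OF y]])
    qed
  qed
  then have "\<phi> \<in> iso ?A ?B" using hom unfolding iso_def cA cB by blast
  moreover have "\<forall>g\<in>Upm V2. \<forall>z\<in>circle. fst (\<phi> (emb2 t g, z)) = g" by (simp add: \<phi>)
  moreover have "\<forall>z\<in>circle. \<phi> (id, z) = (id, z)"
    using \<phi>[OF id_Upm2] by (simp add: emb2_id \<beta>1)
  ultimately show ?thesis unfolding hat2_splits_def by blast
qed

lemma only_commutes_Upm1:
  assumes n4: "\<not> 4 dvd ddim V1" and B: "B \<subseteq> Upm V2" "\<And>g. g \<in> B \<Longrightarrow> endo_det V2 g > 0"
    and Hs: "\<And>H. H \<in> Hs \<Longrightarrow> B \<subset> H \<Longrightarrow> H \<subseteq> Upm V2 \<and> (\<exists>g\<in>H. endo_det V2 g < 0)"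
  shows "only_commutes_with (Sppm_hat S) (hat2 t) Hs (hat1 t (Upm V1)) B"
  unfolding only_commutes_with_def
proof (intro conjI ballI impI)
  show "commutes_with (Sppm_hat S) (hat1 t (Upm V1)) (hat2 t B)"
    using commutes_real(1)[OF B(1)] B(2) by blast
  fix H assume "H \<in> Hs" "B \<subset> H"
  from Hs[OF this] obtain g where H: "H \<subseteq> Upm V2" "g \<in> H" "endo_det V2 g < 0" by blast
  show "\<not> commutes_with (Sppm_hat S) (hat1 t (Upm V1)) (hat2 t H)"
    unfolding commutes_real(1)[OF H(1)] using n4 H(2,3) by (meson less_asym)
qed

lemma only_commutes_U1:
  assumes n4: "\<not> 4 dvd ddim V1" and B: "U V2 \<subseteq> B" "B \<subseteq> Upm V2"
  shows "only_commutes_with (Sppm_hat S) (hat1 t) {U V1, Upm V1} (hat2 t B) (U V1)"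
  unfolding only_commutes_with_def
proof (intro conjI ballI impI)
  interpret Q2: quadratic_space V2 by (rule quadratic_space_V2)
  show "commutes_with (Sppm_hat S) (hat2 t B) (hat1 t (U V1))" by (rule commutes_real(3)[OF B(2)])
  fix H assume "H \<in> {U V1, Upm V1}" "U V1 \<subset> H"
  then have H: "H = Upm V1" by blast
  obtain g where g: "g \<in> U V2" "endo_det V2 g = -1" by (rule Q2.reflection_exists)
  then have "g \<in> B" "\<not> endo_det V2 g > 0" using B(1) by auto
  then show "\<not> commutes_with (Sppm_hat S) (hat2 t B) (hat1 t H)"
    unfolding H commutes_real(2)[OF B(2)] using n4 by blast
qed

theorem nonhyperbolic_pair:
  assumes "\<not> 2 dvd ddim V2 \<or> \<not> hyperbolic_space V2"
  shows "Upm V2 = U V2 \<and>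
           (4 dvd ddim V1 \<longrightarrow>
              commutes_with (Sppm_hat S) (hat1 t (Upm V1)) (hat2 t (U V2))) \<and>
           (\<not> 4 dvd ddim V1 \<longrightarrow>
              only_commutes_with (Sppm_hat S) (hat2 t) {SO V2, U V2}
                (hat1 t (Upm V1)) (SO V2) \<and>
              only_commutes_with (Sppm_hat S) (hat1 t) {U V1, Upm V1}
                (hat2 t (U V2)) (U V1))"
proof -
  interpret Q2: quadratic_space V2 by (rule quadratic_space_V2)
  have "\<not> similitude V2 (-1) g" for g
    using Q2.anti_isometry_even[of g] Q2.anti_isometry_hyperbolic[of g] assms by blast
  then have eq: "Upm V2 = U V2" using Q2.Upm_iff Q2.U_iff by blast
  have UU: "U V2 \<subseteq> Upm V2" by (simp add: eq)
  obtain g where g: "g \<in> U V2" "endo_det V2 g = -1" by (rule Q2.reflection_exists)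
  have "only_commutes_with (Sppm_hat S) (hat2 t) {SO V2, U V2} (hat1 t (Upm V1)) (SO V2)" if "\<not> 4 dvd ddim V1"
  proof (rule only_commutes_Upm1[OF that])
    show "SO V2 \<subseteq> Upm V2" using UU by (auto simp: SO_def)
    show "endo_det V2 g > 0" if "g \<in> SO V2" for g using that by (simp add: SO_def)
    fix H assume "H \<in> {SO V2, U V2}" "SO V2 \<subset> H"
    then have H: "H = U V2" by blast
    have "endo_det V2 g < 0" using g(2) by simp
    then show "H \<subseteq> Upm V2 \<and> (\<exists>g\<in>H. endo_det V2 g < 0)" unfolding H using UU g(1) by blast
  qed
  then show ?thesis using eq commutes_real(1)[OF UU] only_commutes_U1[OF _ subset_refl UU] by blast
qed

theorem hyperbolic_pair:
  assumes hyp: "hyperbolic_basis V2 r f f'" and n4: "\<not> 4 dvd ddim V1"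
  shows "4 dvd ddim V2 \<Longrightarrow> only_commutes_with (Sppm_hat S) (hat2 t)
      {SO V2, U V2, SOpm V2 r f f', Upm V2} (hat1 t (Upm V1)) (SOpm V2 r f f')"
    "\<not> 4 dvd ddim V2 \<Longrightarrow> only_commutes_with (Sppm_hat S) (hat2 t)
      {SO V2, U V2, SOpm V2 r f f', Upm V2} (hat1 t (Upm V1)) (SO V2)"
    "only_commutes_with (Sppm_hat S) (hat1 t) {U V1, Upm V1} (hat2 t (Upm V2)) (U V1)"
proof -
  interpret Q2: quadratic_space V2 by (rule quadratic_space_V2)
  interpret Y: hyperbolic V2 r f f' by unfold_locales (rule hyp)
  have UU: "U V2 \<subseteq> Upm V2" using Q2.U_Upm by blast
  obtain g where g: "g \<in> U V2" "endo_det V2 g = -1" by (rule Q2.reflection_exists)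
  have neg: "\<exists>g\<in>U V2. endo_det V2 g < 0" "\<exists>g\<in>Upm V2. endo_det V2 g < 0"
    using g UU by (auto intro!: bexI[of _ g])
  have r: "4 dvd ddim V2 \<longleftrightarrow> even r" unfolding Y.hyp_dim by presburger
  show "only_commutes_with (Sppm_hat S) (hat2 t)
      {SO V2, U V2, SOpm V2 r f f', Upm V2} (hat1 t (Upm V1)) (SOpm V2 r f f')" if d4: "4 dvd ddim V2"
  proof (rule only_commutes_Upm1[OF n4 Y.SOpm_incl(3)])
    show "endo_det V2 g > 0" if "g \<in> SOpm V2 r f f'" for g
      using Y.SOpm_det_pos[OF _ that] d4 r by blast
    fix H assume "H \<in> {SO V2, U V2, SOpm V2 r f f', Upm V2}" "SOpm V2 r f f' \<subset> H"
    then have "H = U V2 \<or> H = Upm V2" using Y.SOpm_incl(1) by blast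
    then show "H \<subseteq> Upm V2 \<and> (\<exists>g\<in>H. endo_det V2 g < 0)" using UU neg by blast
  qed
  show "only_commutes_with (Sppm_hat S) (hat2 t)
      {SO V2, U V2, SOpm V2 r f f', Upm V2} (hat1 t (Upm V1)) (SO V2)" if d4: "\<not> 4 dvd ddim V2"
  proof (rule only_commutes_Upm1[OF n4])
    show "SO V2 \<subseteq> Upm V2" using Y.SOpm_incl by blast
    show "endo_det V2 g > 0" if "g \<in> SO V2" for g using that by (simp add: SO_def)
    fix H assume "H \<in> {SO V2, U V2, SOpm V2 r f f', Upm V2}" "SO V2 \<subset> H"
    then have H: "H = U V2 \<or> H = Upm V2 \<or> H = SOpm V2 r f f'" by blast
    have "endo_det V2 Y.flip < 0" using d4 r by (simp add: Y.endo_det_flip)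
    then show "H \<subseteq> Upm V2 \<and> (\<exists>g\<in>H. endo_det V2 g < 0)"
      using H UU neg Y.SOpm_incl(2,3) by blast
  qed
  show "only_commutes_with (Sppm_hat S) (hat1 t) {U V1, Upm V1} (hat2 t (Upm V2)) (U V1)"
    by (rule only_commutes_U1[OF n4 UU subset_refl])
qed

lemma hyperbolic_pair_commutes:
  "4 dvd ddim V1 \<Longrightarrow> commutes_with (Sppm_hat S) (hat1 t (Upm V1)) (hat2 t (Upm V2))"
  using commutes_real(1)[OF subset_refl] by blast

end

theorem proposition1p4:
  shows
    \<comment> \<open>(1) for D the complex numbers\<close>
    "(\<forall>eps1 eps2 (V1 :: (complex, 'a::ab_group_add) form_space)
        (V2 :: (complex, 'b::ab_group_add) form_space) (t :: 'a \<Rightarrow> 'b \<Rightarrow> 'w::real_vector) S.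
        dual_pair eps1 eps2 V1 V2 t \<and>
        sform S = tensor_form V1 V2 t \<and> symplectic_frame S \<longrightarrow>
        commutes_with (Sppm_hat S) (hat1 t (Upm V1)) (hat2 t (Upm V2)))
     \<and>
     (\<forall>eps1 eps2 (V1 :: (quat, 'a) form_space) (V2 :: (quat, 'b) form_space)
        (t :: 'a \<Rightarrow> 'b \<Rightarrow> 'w) S.
        dual_pair eps1 eps2 V1 V2 t \<and>
        \<not> (eps1 = -1 \<and> ddim V1 = 1) \<and> \<not> (eps2 = -1 \<and> ddim V2 = 1) \<and>
        sform S = tensor_form V1 V2 t \<and> symplectic_frame S \<longrightarrow>
        commutes_with (Sppm_hat S) (hat1 t (Upm V1)) (hat2 t (Upm V2)))
     \<and>
     (\<forall>(V1 :: (real, 'a) form_space) (V2 :: (real, 'b) form_space)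
        (t :: 'a \<Rightarrow> 'b \<Rightarrow> 'w) S.
        dual_pair (-1) 1 V1 V2 t \<and>
        sform S = tensor_form V1 V2 t \<and> symplectic_frame S \<longrightarrow>
        \<comment> \<open>(2)(a)\<close>
        (2 dvd ddim V2 \<and> \<not> hyperbolic_space V2 \<longrightarrow>
           Upm V2 = U V2 \<and>
           (4 dvd ddim V1 \<longrightarrow>
              commutes_with (Sppm_hat S) (hat1 t (Upm V1)) (hat2 t (U V2))) \<and>
           (\<not> 4 dvd ddim V1 \<longrightarrow>
              only_commutes_with (Sppm_hat S) (hat2 t) {SO V2, U V2}
                (hat1 t (Upm V1)) (SO V2) \<and>
              only_commutes_with (Sppm_hat S) (hat1 t) {U V1, Upm V1}
                (hat2 t (U V2)) (U V1)))
        \<and>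
        \<comment> \<open>(2)(b)\<close>
        (2 dvd ddim V2 \<and> hyperbolic_space V2 \<longrightarrow>
           hat2_splits S t V2 \<and>
           (4 dvd ddim V1 \<longrightarrow>
              commutes_with (Sppm_hat S) (hat1 t (Upm V1)) (hat2 t (Upm V2))) \<and>
           (\<forall>n f f'. hyperbolic_basis V2 n f f' \<longrightarrow>
              (\<not> 4 dvd ddim V1 \<and> 4 dvd ddim V2 \<longrightarrow>
                 only_commutes_with (Sppm_hat S) (hat2 t)
                   {SO V2, U V2, SOpm V2 n f f', Upm V2}
                   (hat1 t (Upm V1)) (SOpm V2 n f f') \<and>
                 only_commutes_with (Sppm_hat S) (hat1 t) {U V1, Upm V1}
                   (hat2 t (Upm V2)) (U V1)) \<and>
              (\<not> 4 dvd ddim V1 \<and> \<not> 4 dvd ddim V2 \<longrightarrow>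
                 only_commutes_with (Sppm_hat S) (hat2 t)
                   {SO V2, U V2, SOpm V2 n f f', Upm V2}
                   (hat1 t (Upm V1)) (SO V2) \<and>
                 only_commutes_with (Sppm_hat S) (hat1 t) {U V1, Upm V1}
                   (hat2 t (Upm V2)) (U V1))))
        \<and>
        \<comment> \<open>(2)(c)\<close>
        (\<not> 2 dvd ddim V2 \<longrightarrow>
           Upm V2 = U V2 \<and>
           (4 dvd ddim V1 \<longrightarrow>
              commutes_with (Sppm_hat S) (hat1 t (Upm V1)) (hat2 t (U V2))) \<and>
           (\<not> 4 dvd ddim V1 \<longrightarrow>
              only_commutes_with (Sppm_hat S) (hat2 t) {SO V2, U V2}
                (hat1 t (Upm V1)) (SO V2) \<and>
              only_commutes_with (Sppm_hat S) (hat1 t) {U V1, Upm V1}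
                (hat2 t (U V2)) (U V1))))"
proof (intro conjI, goal_cases)
  case 1
  show ?case
  proof (intro allI impI, goal_cases)
    case (1 eps1 eps2 V1 V2 t S)
    then have "tensor_datum eps1 eps2 V1 V2 t S" by (simp add: tensor_datum_def)
    then show ?case by (rule complex_pair_commutes)
  qed
next
  case 2
  show ?case
  proof (intro allI impI, goal_cases)
    case (1 eps1 eps2 V1 V2 t S)
    then have "tensor_datum eps1 eps2 V1 V2 t S" by (simp add: tensor_datum_def)
    then show ?case by (rule quaternionic_pair_commutes)
  qed
next
  case 3
  show ?case
  proof (intro allI impI, goal_cases)
    case (1 V1 V2 t S)
    then interpret RP: real_pair V1 V2 t S by (simp add: real_pair_def tensor_datum_def)
    show ?case
    proof (intro conjI, goal_cases)
      case 1
      show ?case using RP.nonhyperbolic_pair by blast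
    next
      case 2
      show ?case
        unfolding hyperbolic_space_def
        using RP.hat2_splits_hyperbolic RP.hyperbolic_pair RP.hyperbolic_pair_commutes by blast
    next
      case 3
      show ?case using RP.nonhyperbolic_pair by blast
    qed
  qed
qed

end
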